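(* Let $R$ be regular and essentially of finite type over an $F$-finite field of characteristic $p>0$. Let $(M,\kappa)$ be an $F$-regular Cartier module over $R$ and $f\in R$ an $M$-regular element. Then for all $e\gg0$ the roots of the Bernstein-Sato polynomial $b^e_{M,f}(s)$ are given by $\frac{\lceil\lambda p^e\rceil-1}{p^e}$, where $\lambda$ varies over the $F$-jumping numbers in $(0,1]$ of the test module filtration $\tau(M,f^\mu)_{\mu\ge0}$.
   Context: All rings are commutative Noetherian of prime characteristic $p$; $F$ is the Frobenius, and $F^e_*M$ is $M$ with $R$ acting through $p^e$-th powers. $R$ is $F$-finite if $F_*R$ is a finitely generated $R$-module. A Cartier module $(M,\kappa)$ is a finitely generated $R$-module $M$ with an $R$-linear map $\kappa\colon F_*M\to M$; $\kappa^e\colon F^e_*M\to M$ is its iterate, and for $g\in R$, $\kappa^e g$ denotes $m\mapsto\kappa^e(gm)$. $f\in R$ is $M$-regular if it is a non-zero-divisor on $M$. A Cartier algebra is an $\mathbb N$-graded ring $\mathcal C=\bigoplus_{e\ge0}\mathcal C_e$ with $\mathcal C_0=R$ and $r\varphi=\varphi r^{p^e}$ for $\varphi\in\mathcal C_e$, $r\in R$; $\mathcal C_+=\bigoplus_{e\ge1}\mathcal C_e$. A $\mathcal C$-module is a left $\mathcal C$-module finitely generated over $R$; it is nilpotent if $\mathcal C_+^aM=0$ for some $a$; a morphism is a nil-isomorphism if its kernel and cokernel are nilpotent. Test modules: for $f\in R$ and rational $\lambda\ge0$ let $\mathcal C$ be the Cartier algebra with $\mathcal C_0=R$, $\mathcal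 C_e=\kappa^ef^{\lceil\lambda p^e\rceil}R$ ($e\ge1$), acting on $M$. $\tau(M,f^\lambda)$ is the smallest $\mathcal C$-submodule $N\subseteq M$ such that $H^0_\eta(N)_\eta\subseteq H^0_\eta(M)_\eta$ is a nil-isomorphism for every associated prime $\eta$ of the $R$-module $M$ ($H^0_\eta$ = elements killed by a power of $\eta$; the outer subscript is localization). If $R$ is essentially of finite type over an $F$-finite field, $\tau(M,f^\lambda)$ exists for all $\lambda$ and is a non-increasing, right-continuous, discrete filtration. $(M,\kappa)$ is $F$-regular if $\tau(M,f^0)=M$. A number $\lambda>0$ is an $F$-jumping number if $\tau(M,f^\lambda)\ne\tau(M,f^{\lambda-\varepsilon})$ for all $0<\varepsilon\le\lambda$. $\mathcal D$-modules: for an $\mathbb F_p$-algebra $A$, $\mathcal D^e_A=\operatorname{End}_A(F^e_*A)$, and modules over it are right modules. For an $A$-module $P$, ${F^e}^!P=\operatorname{Hom}_A(F^e_*A,P)$, a right $\mathcal D^e_A$-module by precomposition. In $\mathcal D^e_{R[t]}$ there are, for $a<p^e$, the Euler operators $\theta_a=t^a\partial_t^{[a]}$ acting by $\theta_a(rt^m)=\binom ma rt^m$ ($r\in R$), and $\mathcal D^e_R\subseteq\mathcal D^e_{R[t]}$ acts on coefficients. Every $\mathcal D^e_R[\theta_1,\theta_p,\dots,\theta_{p^{e-1}}]$-module $A$ decomposes uniquely as $A=\bigoplus_{i\in\mathbb F_p^e}E_i$ with $\theta_{p^{j-1}}$ acting on $E_i$ as multiplication by $i_j$ ($j=1,\dots,e$);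 $E_i$ is the generalized $i$-eigenspace. Let $\gamma\colon\operatorname{Spec}R\to\operatorname{Spec}R[t]$ be the graph embedding given by $\gamma^\#\colon R[t]\to R$, $t\mapsto f$. For a submodule $A\subseteq M$, $\gamma_*C^e(A)\subseteq{F^e}^!\gamma_*M=\operatorname{Hom}_{R[t]}(F^e_*R[t],\gamma_*M)$ denotes the set of maps $s\mapsto\kappa^e(\gamma^\#(s)m)$, $m\in A$. Put \[N_e=\big(\gamma_*C^e(M)\big)\mathcal D^e_R[\theta_1,\theta_p,\dots,\theta_{p^{e-1}}]\big/\big(\gamma_*C^e(fM)\big)\mathcal D^e_R[\theta_1,\theta_p,\dots,\theta_{p^{e-1}}].\] Let $\Gamma\subseteq\{0,\dots,p-1\}^e$ be the set of those $i=(i_1,\dots,i_e)$ (identified with elements of $\mathbb F_p^e$) for which the generalized $i$-eigenspace of $N_e$ is non-zero. The $e$th Bernstein-Sato polynomial is \[b^e_{M,f}(s)=\prod_{i\in\Gamma}\Big(s-\Big(\frac{i_e}{p}+\dots+\frac{i_1}{p^e}\Big)\Big)\in\mathbb Q[s].\] *)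

theory Defs
  imports
    "HOL-Algebra.UnivPoly"
    "HOL-Algebra.Generated_Groups"
    "HOL-Algebra.Generated_Rings"
    "HOL-Algebra.Ideal_Product"
    "HOL-Algebra.Ring_Divisibility"
    "HOL-Library.Extended_Nat"
    "HOL-Computational_Algebra.Polynomial"
begin

section \<open>Modules\<close>

text \<open>A module record extends a ring record; its ring multiplication and its one are irrelevant,
  except for the endomorphism rings below, where they are composition and the identity.\<close>

definition self_module :: "('a, 'm) ring_scheme \<Rightarrow> ('a, 'a) module" where
  "self_module R =
     \<lparr>carrier = carrier R, monoid.mult = monoid.mult R, one = one R, zero = zero R, add = add R,
      module.smult = monoid.mult R\<rparr>"

definition restrict_scalars ::
    "('c \<Rightarrow> 'a) \<Rightarrow> ('a, 'b, 'm) module_scheme \<Rightarrow> ('c, 'b) module" where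
  "restrict_scalars \<phi> M =
     \<lparr>carrier = carrier M, monoid.mult = monoid.mult M, one = one M, zero = zero M, add = add M,
      module.smult = (\<lambda>r x. \<phi> r \<odot>\<^bsub>M\<^esub> x)\<rparr>"

definition finitely_generated ::
    "('a, 'm) ring_scheme \<Rightarrow> ('a, 'b, 'n) module_scheme \<Rightarrow> bool" where
  "finitely_generated R M \<longleftrightarrow>
     (\<exists>A \<subseteq> carrier M. finite A \<and> (\<forall>N. submodule N R M \<and> A \<subseteq> N \<longrightarrow> N = carrier M))"

definition linear_map ::
    "('a, 'm) ring_scheme \<Rightarrow> ('a, 'v, 'n) module_scheme \<Rightarrow> ('a, 'w, 'k) module_scheme
       \<Rightarrow> ('v \<Rightarrow> 'w) \<Rightarrow> bool" where
  "linear_map R V W h \<longleftrightarrow>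
     h \<in> carrier V \<rightarrow> carrier W \<and>
     (\<forall>x \<in> carrier V. \<forall>y \<in> carrier V. h (x \<oplus>\<^bsub>V\<^esub> y) = h x \<oplus>\<^bsub>W\<^esub> h y) \<and>
     (\<forall>r \<in> carrier R. \<forall>x \<in> carrier V. h (r \<odot>\<^bsub>V\<^esub> x) = r \<odot>\<^bsub>W\<^esub> h x)"

text \<open>Elements of Hom are taken extensional, so that they are equal as soon as they agree on
  the carrier of the source.\<close>

definition hom_module ::
    "('a, 'm) ring_scheme \<Rightarrow> ('a, 'v, 'n) module_scheme \<Rightarrow> ('a, 'w, 'k) module_scheme
       \<Rightarrow> ('a, 'v \<Rightarrow> 'w) module" where
  "hom_module R V W =
     \<lparr>carrier = {h \<in> extensional (carrier V). linear_map R V W h},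
      monoid.mult = undefined, one = undefined,
      zero = (\<lambda>x \<in> carrier V. \<zero>\<^bsub>W\<^esub>),
      add = (\<lambda>g h. \<lambda>x \<in> carrier V. g x \<oplus>\<^bsub>W\<^esub> h x),
      module.smult = (\<lambda>r h. \<lambda>x \<in> carrier V. r \<odot>\<^bsub>W\<^esub> h x)\<rparr>"

definition end_ring ::
    "('a, 'm) ring_scheme \<Rightarrow> ('a, 'v, 'n) module_scheme \<Rightarrow> ('a, 'v \<Rightarrow> 'v) module" where
  "end_ring R V =
     (hom_module R V V)\<lparr>monoid.mult := compose (carrier V), one := (\<lambda>x \<in> carrier V. x)\<rparr>"

text \<open>The map induced on cosets of \<open>N\<close> by a map \<open>h\<close> preserving \<open>N\<close>; all cosets
  in the union coincide for additive \<open>h\<close>.\<close>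

definition induced_on_cosets ::
    "('a, 'm) monoid_scheme \<Rightarrow> 'a set \<Rightarrow> ('a \<Rightarrow> 'a) \<Rightarrow> 'a set \<Rightarrow> 'a set" where
  "induced_on_cosets G N h X = (\<Union>x \<in> X. N #>\<^bsub>G\<^esub> h x)"


section \<open>Localization\<close>

text \<open>The fraction \<open>m / s\<close>, as an equivalence class of pairs.\<close>

definition fraction ::
    "('a, 'm) ring_scheme \<Rightarrow> 'a set \<Rightarrow> ('a, 'b, 'n) module_scheme \<Rightarrow> 'b \<Rightarrow> 'a \<Rightarrow> ('b \<times> 'a) set"
  where
  "fraction R S M m s =
     {(m', s'). m' \<in> carrier M \<and> s' \<in> S \<and>
        (\<exists>u \<in> S. u \<odot>\<^bsub>M\<^esub> (s' \<odot>\<^bsub>M\<^esub> m) = u \<odot>\<^bsub>M\<^esub> (s \<odot>\<^bsub>M\<^esub> m'))}"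

abbreviation rfrac ::
    "('a, 'm) ring_scheme \<Rightarrow> 'a set \<Rightarrow> 'a \<Rightarrow> 'a \<Rightarrow> ('a \<times> 'a) set" where
  "rfrac R S \<equiv> fraction R S (self_module R)"

text \<open>The operations are defined on representatives; the unions below are over equal classes.\<close>

definition localize_ring :: "('a, 'm) ring_scheme \<Rightarrow> 'a set \<Rightarrow> ('a \<times> 'a) set ring" where
  "localize_ring R S =
     \<lparr>carrier = {rfrac R S r s | r s. r \<in> carrier R \<and> s \<in> S},
      monoid.mult = (\<lambda>X Y. \<Union>(r, s) \<in> X. \<Union>(r', s') \<in> Y. rfrac R S (r \<otimes>\<^bsub>R\<^esub> r') (s \<otimes>\<^bsub>R\<^esub> s')),
      one = rfrac R S \<one>\<^bsub>R\<^esub> \<one>\<^bsub>R\<^esub>,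
      zero = rfrac R S \<zero>\<^bsub>R\<^esub> \<one>\<^bsub>R\<^esub>,
      add = (\<lambda>X Y. \<Union>(r, s) \<in> X. \<Union>(r', s') \<in> Y.
               rfrac R S (s' \<otimes>\<^bsub>R\<^esub> r \<oplus>\<^bsub>R\<^esub> s \<otimes>\<^bsub>R\<^esub> r') (s \<otimes>\<^bsub>R\<^esub> s'))\<rparr>"

definition localize_module ::
    "('a, 'm) ring_scheme \<Rightarrow> 'a set \<Rightarrow> ('a, 'b, 'n) module_scheme
       \<Rightarrow> (('a \<times> 'a) set, ('b \<times> 'a) set) module" where
  "localize_module R S M =
     \<lparr>carrier = {fraction R S M m s | m s. m \<in> carrier M \<and> s \<in> S},
      monoid.mult = undefined, one = undefined,
      zero = fraction R S M \<zero>\<^bsub>M\<^esub> \<one>\<^bsub>R\<^esub>,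
      add = (\<lambda>X Y. \<Union>(m, s) \<in> X. \<Union>(m', s') \<in> Y.
               fraction R S M (s' \<odot>\<^bsub>M\<^esub> m \<oplus>\<^bsub>M\<^esub> s \<odot>\<^bsub>M\<^esub> m') (s \<otimes>\<^bsub>R\<^esub> s')),
      module.smult = (\<lambda>\<rho> X. \<Union>(r, t) \<in> \<rho>. \<Union>(m, s) \<in> X. fraction R S M (r \<odot>\<^bsub>M\<^esub> m) (t \<otimes>\<^bsub>R\<^esub> s))\<rparr>"

text \<open>For a submodule \<open>N\<close> of \<open>M\<close>, the localization of \<open>N\<close> is regarded as a submodule of the
  localization of \<open>M\<close>.\<close>

definition localize_submodule ::
    "('a, 'm) ring_scheme \<Rightarrow> 'a set \<Rightarrow> ('a, 'b, 'n) module_scheme \<Rightarrow> 'b set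
       \<Rightarrow> (('a \<times> 'a) set, ('b \<times> 'a) set) module" where
  "localize_submodule R S M N =
     (localize_module R S M)\<lparr>carrier := {fraction R S M n s | n s. n \<in> N \<and> s \<in> S}\<rparr>"


section \<open>Assumptions on the base ring\<close>

definition has_char :: "('a, 'm) ring_scheme \<Rightarrow> nat \<Rightarrow> bool" where
  "has_char R p \<longleftrightarrow> (\<forall>n::nat. [n] \<cdot>\<^bsub>R\<^esub> \<one>\<^bsub>R\<^esub> = \<zero>\<^bsub>R\<^esub> \<longleftrightarrow> p dvd n)"

definition krull_dim :: "('a, 'm) ring_scheme \<Rightarrow> enat" where
  "krull_dim R = Sup {enat n | n. \<exists>P :: nat \<Rightarrow> 'a set.
     (\<forall>i \<le> n. primeideal (P i) R) \<and> (\<forall>i < n. P i \<subset> P (Suc i))}"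

definition regular_local_ring :: "('a, 'm) ring_scheme \<Rightarrow> bool" where
  "regular_local_ring R \<longleftrightarrow>
     cring R \<and> noetherian_ring R \<and>
     (\<exists>\<mm>. maximalideal \<mm> R \<and> (\<forall>\<nn>. maximalideal \<nn> R \<longrightarrow> \<nn> = \<mm>) \<and>
        (\<exists>A \<subseteq> carrier R. finite A \<and> \<mm> = Idl\<^bsub>R\<^esub> A \<and> enat (card A) = krull_dim R))"

definition regular_ring :: "('a, 'm) ring_scheme \<Rightarrow> bool" where
  "regular_ring R \<longleftrightarrow>
     cring R \<and> noetherian_ring R \<and>
     (\<forall>P. primeideal P R \<longrightarrow> regular_local_ring (localize_ring R (carrier R - P)))"

definition finite_type ::
    "('k, 'm) ring_scheme \<Rightarrow> ('a, 'n) ring_scheme \<Rightarrow> ('k \<Rightarrow> 'a) \<Rightarrow> bool" where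
  "finite_type K B \<psi> \<longleftrightarrow>
     cring B \<and> \<psi> \<in> ring_hom K B \<and>
     (\<exists>X \<subseteq> carrier B. finite X \<and> generate_ring B (\<psi> ` carrier K \<union> X) = carrier B)"

text \<open>\<open>R\<close> is, as a \<open>K\<close>-algebra, a localization of a \<open>K\<close>-algebra \<open>B\<close> of finite type. It is no
  restriction that \<open>B\<close> lives on the same type as \<open>R\<close>: a localization of \<open>B\<close> is also a
  localization of the image of \<open>B\<close> in it.\<close>

definition essentially_finite_type ::
    "('k, 'm) ring_scheme \<Rightarrow> ('a, 'n) ring_scheme \<Rightarrow> ('k \<Rightarrow> 'a) \<Rightarrow> bool" where
  "essentially_finite_type K R \<phi> \<longleftrightarrow>
     \<phi> \<in> ring_hom K R \<and>
     (\<exists>(B :: 'a ring) \<psi> S h. finite_type K B \<psi> \<and> submonoid S B \<and>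
        h \<in> ring_iso (localize_ring B S) R \<and>
        (\<forall>k \<in> carrier K. h (rfrac B S (\<psi> k) \<one>\<^bsub>B\<^esub>) = \<phi> k))"


section \<open>Cartier modules and test modules\<close>

definition frobenius :: "nat \<Rightarrow> nat \<Rightarrow> ('a, 'm) ring_scheme \<Rightarrow> 'a \<Rightarrow> 'a" where
  "frobenius p e R r = r [^]\<^bsub>R\<^esub> (p ^ e)"

definition frobenius_push ::
    "nat \<Rightarrow> nat \<Rightarrow> ('a, 'm) ring_scheme \<Rightarrow> ('a, 'b, 'n) module_scheme \<Rightarrow> ('a, 'b) module" where
  "frobenius_push p e R M = restrict_scalars (frobenius p e R) M"

definition F_finite :: "nat \<Rightarrow> ('a, 'm) ring_scheme \<Rightarrow> bool" where
  "F_finite p R \<longleftrightarrow> finitely_generated R (frobenius_push p 1 R (self_module R))"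

definition cartier_module ::
    "nat \<Rightarrow> ('a, 'm) ring_scheme \<Rightarrow> ('a, 'b, 'n) module_scheme \<Rightarrow> ('b \<Rightarrow> 'b) \<Rightarrow> bool" where
  "cartier_module p R M \<kappa> \<longleftrightarrow>
     module R M \<and> finitely_generated R M \<and> linear_map R (frobenius_push p 1 R M) M \<kappa>"

definition regular_element ::
    "('a, 'm) ring_scheme \<Rightarrow> ('a, 'b, 'n) module_scheme \<Rightarrow> 'a \<Rightarrow> bool" where
  "regular_element R M f \<longleftrightarrow>
     f \<in> carrier R \<and> (\<forall>m \<in> carrier M. f \<odot>\<^bsub>M\<^esub> m = \<zero>\<^bsub>M\<^esub> \<longrightarrow> m = \<zero>\<^bsub>M\<^esub>)"

text \<open>A Cartier algebra is given by the operators on \<open>M\<close> through which its homogeneous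
  parts act: \<open>test_algebra p R M \<kappa> f \<lambda> e\<close> is \<open>\<kappa>\<^sup>e f\<^bsup>\<lceil>\<lambda>p\<^sup>e\<rceil>\<^esup> R\<close> for \<open>e \<ge> 1\<close>, and \<open>R\<close> for \<open>e = 0\<close>.\<close>

definition test_algebra ::
    "nat \<Rightarrow> ('a, 'm) ring_scheme \<Rightarrow> ('a, 'b, 'n) module_scheme \<Rightarrow> ('b \<Rightarrow> 'b) \<Rightarrow> 'a \<Rightarrow> rat
       \<Rightarrow> nat \<Rightarrow> ('b \<Rightarrow> 'b) set" where
  "test_algebra p R M \<kappa> f l e =
     (if e = 0 then {\<lambda>m. r \<odot>\<^bsub>M\<^esub> m | r. r \<in> carrier R}
      else {\<lambda>m. (\<kappa> ^^ e) ((f [^]\<^bsub>R\<^esub> nat \<lceil>l * of_nat p ^ e\<rceil> \<otimes>\<^bsub>R\<^esub> r) \<odot>\<^bsub>M\<^esub> m) | r. r \<in> carrier R})"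

definition cartier_submodule ::
    "('a, 'm) ring_scheme \<Rightarrow> ('a, 'b, 'n) module_scheme \<Rightarrow> (nat \<Rightarrow> ('b \<Rightarrow> 'b) set)
       \<Rightarrow> 'b set \<Rightarrow> bool" where
  "cartier_submodule R M C N \<longleftrightarrow>
     submodule N R M \<and> (\<forall>e. \<forall>\<phi> \<in> C e. \<phi> ` N \<subseteq> N)"

text \<open>Below, \<open>G\<close> is the additive group, written multiplicatively, of a module on which the
  operators in \<open>C e\<close> act. \<open>cartier_plus G C W\<close> is \<open>C\<^sub>+ W\<close>, so that its \<open>a\<close>-fold iterate
  is \<open>C\<^sub>+\<^sup>a W\<close>.\<close>

definition cartier_plus ::
    "('b, 'n) monoid_scheme \<Rightarrow> (nat \<Rightarrow> ('b \<Rightarrow> 'b) set) \<Rightarrow> 'b set \<Rightarrow> 'b set" where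
  "cartier_plus G C W = generate G {\<phi> x | e \<phi> x. e \<ge> 1 \<and> \<phi> \<in> C e \<and> x \<in> W}"

definition cartier_nilpotent ::
    "('b, 'n) monoid_scheme \<Rightarrow> (nat \<Rightarrow> ('b \<Rightarrow> 'b) set) \<Rightarrow> bool" where
  "cartier_nilpotent G C \<longleftrightarrow> (\<exists>a. (cartier_plus G C ^^ a) (carrier G) = {\<one>\<^bsub>G\<^esub>})"

definition nil_isomorphism ::
    "('b, 'm) monoid_scheme \<Rightarrow> (nat \<Rightarrow> ('b \<Rightarrow> 'b) set)
       \<Rightarrow> ('c, 'n) monoid_scheme \<Rightarrow> (nat \<Rightarrow> ('c \<Rightarrow> 'c) set) \<Rightarrow> ('b \<Rightarrow> 'c) \<Rightarrow> bool" where
  "nil_isomorphism G C H D h \<longleftrightarrow>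
     cartier_nilpotent (G\<lparr>carrier := kernel G H h\<rparr>) C \<and>
     cartier_nilpotent (H Mod (h ` carrier G))
       (\<lambda>e. induced_on_cosets H (h ` carrier G) ` D e)"

text \<open>The action of \<open>\<phi>\<close> of degree \<open>e\<close> on fractions: \<open>\<phi>(m/s) = \<phi>(s\<^bsup>p\<^sup>e - 1\<^esup> m) / s\<close>.\<close>

definition localize_operator ::
    "nat \<Rightarrow> ('a, 'm) ring_scheme \<Rightarrow> 'a set \<Rightarrow> ('a, 'b, 'n) module_scheme \<Rightarrow> nat \<Rightarrow> ('b \<Rightarrow> 'b)
       \<Rightarrow> ('b \<times> 'a) set \<Rightarrow> ('b \<times> 'a) set" where
  "localize_operator p R S M e \<phi> X =
     (\<Union>(m, s) \<in> X. fraction R S M (\<phi> ((s [^]\<^bsub>R\<^esub> (p ^ e - 1)) \<odot>\<^bsub>M\<^esub> m)) s)"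

definition associated_prime ::
    "('a, 'm) ring_scheme \<Rightarrow> ('a, 'b, 'n) module_scheme \<Rightarrow> 'a set \<Rightarrow> bool" where
  "associated_prime R M \<eta> \<longleftrightarrow>
     primeideal \<eta> R \<and> (\<exists>m \<in> carrier M. \<eta> = {r \<in> carrier R. r \<odot>\<^bsub>M\<^esub> m = \<zero>\<^bsub>M\<^esub>})"

definition ideal_power :: "('a, 'm) ring_scheme \<Rightarrow> 'a set \<Rightarrow> nat \<Rightarrow> 'a set" where
  "ideal_power R I k = (ideal_prod R I ^^ k) (carrier R)"

text \<open>\<open>H\<^sup>0\<^sub>\<eta>(N)\<close> for a submodule \<open>N\<close> of \<open>M\<close>.\<close>

definition local_sections ::
    "('a, 'm) ring_scheme \<Rightarrow> ('a, 'b, 'n) module_scheme \<Rightarrow> 'a set \<Rightarrow> 'b set \<Rightarrow> 'b set" where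
  "local_sections R M \<eta> N =
     {x \<in> N. \<exists>k. \<forall>r \<in> ideal_power R \<eta> k. r \<odot>\<^bsub>M\<^esub> x = \<zero>\<^bsub>M\<^esub>}"

definition generically_nil_isomorphic ::
    "nat \<Rightarrow> ('a, 'm) ring_scheme \<Rightarrow> ('a, 'b, 'n) module_scheme \<Rightarrow> (nat \<Rightarrow> ('b \<Rightarrow> 'b) set)
       \<Rightarrow> 'b set \<Rightarrow> bool" where
  "generically_nil_isomorphic p R M C N \<longleftrightarrow>
     (\<forall>\<eta>. associated_prime R M \<eta> \<longrightarrow>
        (let S = carrier R - \<eta>;
             V = localize_submodule R S M (local_sections R M \<eta> N);
             W = localize_submodule R S M (local_sections R M \<eta> (carrier M));
             C\<^sub>\<eta> = (\<lambda>e. localize_operator p R S M e ` C e)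
         in nil_isomorphism (add_monoid V) C\<^sub>\<eta> (add_monoid W) C\<^sub>\<eta> (\<lambda>X. X)))"

definition test_module ::
    "nat \<Rightarrow> ('a, 'm) ring_scheme \<Rightarrow> ('a, 'b, 'n) module_scheme \<Rightarrow> ('b \<Rightarrow> 'b) \<Rightarrow> 'a \<Rightarrow> rat
       \<Rightarrow> 'b set" where
  "test_module p R M \<kappa> f l =
     (LEAST N. cartier_submodule R M (test_algebra p R M \<kappa> f l) N \<and>
               generically_nil_isomorphic p R M (test_algebra p R M \<kappa> f l) N)"

text \<open>Since \<open>f\<^sup>0 = 1\<close>, the choice of \<open>f\<close> is irrelevant for F-regularity.\<close>

definition F_regular ::
    "nat \<Rightarrow> ('a, 'm) ring_scheme \<Rightarrow> ('a, 'b, 'n) module_scheme \<Rightarrow> ('b \<Rightarrow> 'b) \<Rightarrow> bool" where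
  "F_regular p R M \<kappa> \<longleftrightarrow> test_module p R M \<kappa> \<one>\<^bsub>R\<^esub> 0 = carrier M"

definition F_jumping_number ::
    "nat \<Rightarrow> ('a, 'm) ring_scheme \<Rightarrow> ('a, 'b, 'n) module_scheme \<Rightarrow> ('b \<Rightarrow> 'b) \<Rightarrow> 'a \<Rightarrow> rat
       \<Rightarrow> bool" where
  "F_jumping_number p R M \<kappa> f l \<longleftrightarrow>
     0 < l \<and>
     (\<forall>\<epsilon>. 0 < \<epsilon> \<and> \<epsilon> \<le> l \<longrightarrow> test_module p R M \<kappa> f l \<noteq> test_module p R M \<kappa> f (l - \<epsilon>))"


section \<open>Differential operators and Bernstein-Sato polynomials\<close>

definition diff_ops :: "nat \<Rightarrow> nat \<Rightarrow> ('a, 'm) ring_scheme \<Rightarrow> ('a, 'a \<Rightarrow> 'a) module" where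
  "diff_ops p e A = end_ring A (frobenius_push p e A (self_module A))"

definition frobenius_shriek ::
    "nat \<Rightarrow> nat \<Rightarrow> ('a, 'm) ring_scheme \<Rightarrow> ('a, 'b, 'n) module_scheme \<Rightarrow> ('a, 'a \<Rightarrow> 'b) module"
  where
  "frobenius_shriek p e A P = hom_module A (frobenius_push p e A (self_module A)) P"

text \<open>Elements of \<^term>\<open>UP R\<close>, i.e. of \<open>R[t]\<close>, are functions from exponents to coefficients.\<close>

definition euler_op :: "('a, 'm) ring_scheme \<Rightarrow> nat \<Rightarrow> (nat \<Rightarrow> 'a) \<Rightarrow> (nat \<Rightarrow> 'a)" where
  "euler_op R a =
     (\<lambda>q \<in> carrier (UP R). \<lambda>m. [(m choose a)] \<cdot>\<^bsub>R\<^esub> up_ring.coeff (UP R) q m)"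

definition coefficientwise ::
    "('a, 'm) ring_scheme \<Rightarrow> ('a \<Rightarrow> 'a) \<Rightarrow> (nat \<Rightarrow> 'a) \<Rightarrow> (nat \<Rightarrow> 'a)" where
  "coefficientwise R P = (\<lambda>q \<in> carrier (UP R). \<lambda>m. P (up_ring.coeff (UP R) q m))"

text \<open>\<open>D\<^sup>e\<^sub>R[\<theta>\<^sub>1, \<theta>\<^sub>p, \<dots>]\<close>, with Euler operators indexed by \<open>p\<^sup>j\<close> for \<open>j < e\<close>.\<close>

definition euler_algebra ::
    "nat \<Rightarrow> nat \<Rightarrow> ('a, 'm) ring_scheme \<Rightarrow> ((nat \<Rightarrow> 'a) \<Rightarrow> (nat \<Rightarrow> 'a)) set" where
  "euler_algebra p e R =
     generate_ring (diff_ops p e (UP R))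
       (coefficientwise R ` carrier (diff_ops p e R) \<union> {euler_op R (p ^ j) | j. j < e})"

definition graph_map :: "('a, 'm) ring_scheme \<Rightarrow> 'a \<Rightarrow> (nat \<Rightarrow> 'a) \<Rightarrow> 'a" where
  "graph_map R f = UnivPoly.eval R R (\<lambda>r. r) f"

definition graph_push ::
    "('a, 'm) ring_scheme \<Rightarrow> 'a \<Rightarrow> ('a, 'b, 'n) module_scheme \<Rightarrow> (nat \<Rightarrow> 'a, 'b) module" where
  "graph_push R f M = restrict_scalars (graph_map R f) M"

definition graph_shriek ::
    "nat \<Rightarrow> nat \<Rightarrow> ('a, 'm) ring_scheme \<Rightarrow> 'a \<Rightarrow> ('a, 'b, 'n) module_scheme
       \<Rightarrow> (nat \<Rightarrow> 'a, (nat \<Rightarrow> 'a) \<Rightarrow> 'b) module" where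
  "graph_shriek p e R f M = frobenius_shriek p e (UP R) (graph_push R f M)"

text \<open>The set \<open>\<gamma>\<^sub>*C\<^sup>e(A)\<close> of maps \<open>s \<mapsto> \<kappa>\<^sup>e(\<gamma>(s) m)\<close>, \<open>m \<in> A\<close>.\<close>

definition graph_cartier ::
    "nat \<Rightarrow> ('a, 'm) ring_scheme \<Rightarrow> ('a, 'b, 'n) module_scheme \<Rightarrow> ('b \<Rightarrow> 'b) \<Rightarrow> 'a
       \<Rightarrow> 'b set \<Rightarrow> ((nat \<Rightarrow> 'a) \<Rightarrow> 'b) set" where
  "graph_cartier e R M \<kappa> f A =
     {\<lambda>s \<in> carrier (UP R). (\<kappa> ^^ e) (graph_map R f s \<odot>\<^bsub>M\<^esub> m) | m. m \<in> A}"

text \<open>The right submodule generated by \<open>\<gamma>\<^sub>*C\<^sup>e(A)\<close>; operators act by precomposition.\<close>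

definition euler_submodule ::
    "nat \<Rightarrow> nat \<Rightarrow> ('a, 'm) ring_scheme \<Rightarrow> ('a, 'b, 'n) module_scheme \<Rightarrow> ('b \<Rightarrow> 'b) \<Rightarrow> 'a
       \<Rightarrow> 'b set \<Rightarrow> ((nat \<Rightarrow> 'a) \<Rightarrow> 'b) set" where
  "euler_submodule p e R M \<kappa> f A =
     generate (add_monoid (graph_shriek p e R f M))
       {compose (carrier (UP R)) \<phi> P | \<phi> P.
          \<phi> \<in> graph_cartier e R M \<kappa> f A \<and> P \<in> euler_algebra p e R}"

text \<open>The additive group of \<open>N\<^sub>e\<close>, written multiplicatively as a library quotient group.\<close>

definition bernstein_quotient ::
    "nat \<Rightarrow> nat \<Rightarrow> ('a, 'm) ring_scheme \<Rightarrow> ('a, 'b, 'n) module_scheme \<Rightarrow> ('b \<Rightarrow> 'b) \<Rightarrow> 'a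
       \<Rightarrow> ((nat \<Rightarrow> 'a) \<Rightarrow> 'b) set monoid" where
  "bernstein_quotient p e R M \<kappa> f =
     (add_monoid (graph_shriek p e R f M))
         \<lparr>carrier := euler_submodule p e R M \<kappa> f (carrier M)\<rparr>
       Mod euler_submodule p e R M \<kappa> f ((\<lambda>m. f \<odot>\<^bsub>M\<^esub> m) ` carrier M)"

definition bernstein_action ::
    "nat \<Rightarrow> nat \<Rightarrow> ('a, 'm) ring_scheme \<Rightarrow> ('a, 'b, 'n) module_scheme \<Rightarrow> ('b \<Rightarrow> 'b) \<Rightarrow> 'a
       \<Rightarrow> ((nat \<Rightarrow> 'a) \<Rightarrow> (nat \<Rightarrow> 'a))
       \<Rightarrow> ((nat \<Rightarrow> 'a) \<Rightarrow> 'b) set \<Rightarrow> ((nat \<Rightarrow> 'a) \<Rightarrow> 'b) set" where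
  "bernstein_action p e R M \<kappa> f P =
     induced_on_cosets (add_monoid (graph_shriek p e R f M))
       (euler_submodule p e R M \<kappa> f ((\<lambda>m. f \<odot>\<^bsub>M\<^esub> m) ` carrier M))
       (\<lambda>\<phi>. compose (carrier (UP R)) \<phi> P)"

text \<open>An index \<open>i\<close> is a function on \<open>{1..e}\<close> with values in \<open>{0..p-1}\<close>. The summand \<open>E\<^sub>i\<close> in the
  decomposition of \<open>N\<^sub>e\<close> is the joint eigenspace of the Euler operators for the eigenvalues \<open>i\<^sub>j\<close>;
  multiplication by \<open>i\<^sub>j\<close> appears as a power in the multiplicatively written group.\<close>

definition bernstein_eigenspace ::
    "nat \<Rightarrow> nat \<Rightarrow> ('a, 'm) ring_scheme \<Rightarrow> ('a, 'b, 'n) module_scheme \<Rightarrow> ('b \<Rightarrow> 'b) \<Rightarrow> 'a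
       \<Rightarrow> (nat \<Rightarrow> nat) \<Rightarrow> ((nat \<Rightarrow> 'a) \<Rightarrow> 'b) set set" where
  "bernstein_eigenspace p e R M \<kappa> f i =
     {Y \<in> carrier (bernstein_quotient p e R M \<kappa> f).
        \<forall>j \<in> {1..e}. bernstein_action p e R M \<kappa> f (euler_op R (p ^ (j - 1))) Y
                     = Y [^]\<^bsub>bernstein_quotient p e R M \<kappa> f\<^esub> i j}"

definition bernstein_indices ::
    "nat \<Rightarrow> nat \<Rightarrow> ('a, 'm) ring_scheme \<Rightarrow> ('a, 'b, 'n) module_scheme \<Rightarrow> ('b \<Rightarrow> 'b) \<Rightarrow> 'a
       \<Rightarrow> (nat \<Rightarrow> nat) set" where
  "bernstein_indices p e R M \<kappa> f =
     {i \<in> {1..e} \<rightarrow>\<^sub>E {..<p}.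
        bernstein_eigenspace p e R M \<kappa> f i \<noteq> {\<one>\<^bsub>bernstein_quotient p e R M \<kappa> f\<^esub>}}"

definition bernstein_sato ::
    "nat \<Rightarrow> nat \<Rightarrow> ('a, 'm) ring_scheme \<Rightarrow> ('a, 'b, 'n) module_scheme \<Rightarrow> ('b \<Rightarrow> 'b) \<Rightarrow> 'a
       \<Rightarrow> rat poly" where
  "bernstein_sato p e R M \<kappa> f =
     (\<Prod>i \<in> bernstein_indices p e R M \<kappa> f.
        [: - (\<Sum>j = 1..e. of_nat (i j) / of_nat p ^ (e + 1 - j)), 1 :])"

end

theory Submission
  imports Defs "HOL-Number_Theory.Residues"
begin

text \<open>With \<open>I(e, n) = \<kappa>\<^sup>e(f\<^sup>n M)\<close>, F-regularity gives \<open>\<tau>(M, f\<^bsup>n/p^e\<^esup>) = I(e, n)\<close>, so that there is a jumping number in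
\<open>(n/p\<^sup>e, (n+1)/p\<^sup>e]\<close> if and only if \<open>I(e, n) \<noteq> I(e, n+1)\<close>. The Euler operators are diagonal on monomials \<open>t\<^sup>m\<close>, and
the eigenspace of the digits of \<open>n\<close> is cut out by the projector to \<open>m \<equiv> n\<close> modulo \<open>p\<^sup>e\<close>. If \<open>I(e, n) = I(e, n+1)\<close>,
it vanishes in \<open>N\<^sub>e\<close> because \<open>F\<^sup>e\<^sub>*R\<close> is projective over the regular ring \<open>R\<close> (Kunz); otherwise evaluation at \<open>t\<^sup>n\<close> shows
that it does not. Existence of the smallest module in the definition of F-regularity and finiteness of the set of
\<open>\<tau>(M, f\<^sup>\<lambda>)\<close>, \<open>\<lambda> \<le> 1\<close>, follow from a filtration of \<open>M\<close> by degree that \<open>\<kappa>\<close> contracts. Jumping numbers are rational since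
they are stable under multiplication by \<open>p\<close> and subtraction of \<open>1\<close>.\<close>

text \<open>An equality \<open>img e n = img e (Suc n)\<close> compares values, whereas
  \<open>N\<^sub>e\<close> is built from maps r |-> \<kappa>^e(r f^n m), and a general r does not
  pass through \<kappa>^e; only p^e-th powers do. Writing r as a finite sum of terms \<xi>(r)^(p^e)
  x, with x independent of r, separates the two. Kunz's theorem is therefore proved in exactly this
  form (\<open>frob_rank\<close>): explicit bases over the regular local rings, then descent to
  \<open>R\<close>.

  F-regularity is stated through LEAST, which determines nothing before a least module is known to
  exist. Its working form is that each \<kappa>-stable, generically nil submodule is
  \<open>M\<close>. Applied to \<kappa>(M) it gives \<kappa>(M) = M, so that \<open>img e n\<close>
  depends on n/p^e only and the comparison with \<tau> is exact at every level e.

  A jumping number arises as an infimum, hence as a real number, while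
  \<open>F_jumping_number\<close> is about rational ones; this is why \<tau> is extended to real
  exponents.

  Degrees exist only up to denominators, since \<open>R\<close> is a localization of an algebra of
  finite type; the generators of \<open>M\<close> have to be rescaled before \<kappa> contracts
  degrees.\<close>

abbreviation module_smult ("_ *[_] _" [70, 0, 71] 70) where "a *[M] x \<equiv> a \<odot>\<^bsub>M\<^esub> x"
abbreviation module_add ("_ +[_] _" [65, 0, 66] 65) where "x +[M] y \<equiv> x \<oplus>\<^bsub>M\<^esub> y"
abbreviation group_mult ("_ **[_] _" [70, 0, 71] 70) where "x **[G] y \<equiv> x \<otimes>\<^bsub>G\<^esub> y"

section \<open>Spans and Noetherian modules\<close>

text \<open>Linear combinations are built one summand at a time, so that statements about them are
  proved by induction instead of with indexed sums. The coefficients form a set of their own: the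
  whole ring for submodules, a subfield for the finite-dimensional pieces of a degree
  filtration.\<close>

inductive_set span_over :: "('a, 'b, 'n) module_scheme \<Rightarrow> 'a set \<Rightarrow> 'b set \<Rightarrow> 'b set"
 for M and A and X where
  zero: "\<zero>\<^bsub>M\<^esub> \<in> span_over M A X"
 | step: "a \<in> A ==> x \<in> X ==> y \<in> span_over M A X ==> a *[M] x +[M] y \<in> span_over M A X"

lemma span_over_mono: "A \<subseteq> B ==> X \<subseteq> Y ==> span_over M A X \<subseteq> span_over M B Y"
proof
 fix v assume "A \<subseteq> B" "X \<subseteq> Y" "v \<in> span_over M A X"
 from this(3,1,2) show "v \<in> span_over M B Y"
  by (induction) (auto intro: span_over.intros)
qed

context module begin

lemma span_over_closed:
 assumes "A \<subseteq> carrier R" "X \<subseteq> carrier M"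
 shows "span_over M A X \<subseteq> carrier M"
proof
 fix v assume "v \<in> span_over M A X"
 then show "v \<in> carrier M" using assms by induction auto
qed

lemma span_over_add:
 assumes AX: "A \<subseteq> carrier R" "X \<subseteq> carrier M"
  and "v \<in> span_over M A X" "w \<in> span_over M A X"
 shows "v +[M] w \<in> span_over M A X"
 using assms(3,4)
proof induction
 case zero
 then show ?case using span_over_closed[OF AX] by auto
next
 case (step a x y)
 have "(a *[M] x +[M] y) +[M] w = a *[M] x +[M] (y +[M] w)"
  using step AX span_over_closed[OF AX] by (intro M.a_assoc) auto
 then show ?case using step by (auto intro: span_over.step)
qed

lemma span_over_base:
 assumes "a \<in> A" "x \<in> X" "A \<subseteq> carrier R" "X \<subseteq> carrier M"
 shows "a *[M] x \<in> span_over M A X"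
proof -
 have "a \<in> carrier R" "x \<in> carrier M" using assms by auto
 then show ?thesis using span_over.step[OF assms(1,2) span_over.zero, of M] by simp
qed

lemma span_over_incl:
 assumes "\<one> \<in> A" "A \<subseteq> carrier R" "X \<subseteq> carrier M"
 shows "X \<subseteq> span_over M A X"
 using span_over_base[OF assms(1) _ assms(2,3)] assms(3) by force

lemma span_over_smult:
 assumes AX: "A \<subseteq> carrier R" "X \<subseteq> carrier M"
  and "v \<in> span_over M A X" "c \<in> carrier R" "\<And>a. a \<in> A ==> c \<otimes> a \<in> B" "B \<subseteq> carrier R"
 shows "c *[M] v \<in> span_over M B X"
 using assms(3)
proof induction
 case zero
 then show ?case using assms(4) by (auto intro: span_over.zero)
next
 case (step a x y)
 have "c *[M] (a *[M] x +[M] y) = (c \<otimes> a) *[M] x +[M] c *[M] y"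
 proof -
  have "a \<in> carrier R" "x \<in> carrier M" "y \<in> carrier M"
   using step AX span_over_closed[OF AX] by auto
  then show ?thesis using assms(4) by (simp add: smult_r_distr smult_assoc1)
 qed
 then show ?case using step assms by (auto intro: span_over.step)
qed

lemma span_over_least:
 assumes "\<zero>\<^bsub>M\<^esub> \<in> N" "\<And>x y. x \<in> N ==> y \<in> N ==> x +[M] y \<in> N"
  and "\<And>a x. a \<in> A ==> x \<in> X ==> a *[M] x \<in> N"
 shows "span_over M A X \<subseteq> N"
proof
 fix v assume "v \<in> span_over M A X"
 then show "v \<in> N" by induction (use assms in auto)
qed

text \<open>Splits off the coefficient of one generator. Both the Noetherian property of modules and
  the dimension function for subspaces are proved by induction on the generators through this
  splitting.\<close>

lemma span_over_insert:
 assumes A: "subring A R" and X: "v \<in> carrier M" "X \<subseteq> carrier M"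
 shows "span_over M A (insert v X) = {a *[M] v +[M] y | a y. a \<in> A \<and> y \<in> span_over M A X}"
  (is "_ = ?S")
proof -
 note AE = subringE[OF A]
 note cl = span_over_closed[OF AE(1) X(2)]
 show ?thesis
 proof
  show "span_over M A (insert v X) \<subseteq> ?S"
  proof
   fix w assume "w \<in> span_over M A (insert v X)"
   then show "w \<in> ?S"
   proof induction
    case zero
    have "\<zero>\<^bsub>M\<^esub> = \<zero> *[M] v +[M] \<zero>\<^bsub>M\<^esub>" using X by simp
    then show ?case using AE(2) span_over.zero by fastforce
   next
    case (step a x w)
    then obtain b y where w: "w = b *[M] v +[M] y" "b \<in> A" "y \<in> span_over M A X" by auto
    have abc: "a \<in> carrier R" "b \<in> carrier R" "y \<in> carrier M" "x \<in> carrier M"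
     using step AE(1) w cl X by auto
    show ?case
    proof (cases "x = v")
     case True
     have "a *[M] x +[M] w = (a \<oplus> b) *[M] v +[M] y"
      using True abc X w by (simp add: smult_l_distr M.a_assoc)
     then show ?thesis using w AE(7)[OF step(1) w(2)] by blast
    next
     case False
     then have "x \<in> X" using step by auto
     have "a *[M] x +[M] w = b *[M] v +[M] (a *[M] x +[M] y)"
      using abc X w by (simp add: M.a_lcomm)
     then show ?thesis using w span_over.step[OF step(1) \<open>x \<in> X\<close> w(3)] by blast
    qed
   qed
  qed
  show "?S \<subseteq> span_over M A (insert v X)"
   using span_over_mono[of A A X "insert v X" M]
   by (auto intro!: span_over.step)
 qed
qed

lemma span_over_submodule:
 assumes "X \<subseteq> carrier M"
 shows "submodule (span_over M (carrier R) X) R M"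
proof (rule submoduleI)
 note sm = span_over_smult[OF subset_refl assms]
 show "span_over M (carrier R) X \<subseteq> carrier M" using span_over_closed assms by auto
 show "\<zero>\<^bsub>M\<^esub> \<in> span_over M (carrier R) X" by (rule span_over.zero)
 show "a +[M] b \<in> span_over M (carrier R) X"
  if "a \<in> span_over M (carrier R) X" "b \<in> span_over M (carrier R) X" for a b
  using span_over_add[OF subset_refl assms] that by auto
 show c: "a *[M] x \<in> span_over M (carrier R) X"
  if "a \<in> carrier R" "x \<in> span_over M (carrier R) X" for a x
  using sm[OF that(2,1), of "carrier R"] that by auto
 fix a assume a: "a \<in> span_over M (carrier R) X"
 then have "a \<in> carrier M" using span_over_closed[OF subset_refl assms] by auto
 then have "\<ominus>\<^bsub>M\<^esub> a = (\<ominus> \<one>) *[M] a" by (simp add: smult_l_minus)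
 then show "\<ominus>\<^bsub>M\<^esub> a \<in> span_over M (carrier R) X" using c[OF _ a, of "\<ominus> \<one>"] by simp
qed

lemma submodule_props:
 assumes "submodule N R M"
 shows "N \<subseteq> carrier M" "\<zero>\<^bsub>M\<^esub> \<in> N" "\<And>x y. x \<in> N ==> y \<in> N ==> x +[M] y \<in> N"
  "\<And>a x. a \<in> carrier R ==> x \<in> N ==> a *[M] x \<in> N" "\<And>x. x \<in> N ==> \<ominus>\<^bsub>M\<^esub> x \<in> N"
  "\<And>x y. x \<in> N ==> y \<in> N ==> x \<ominus>\<^bsub>M\<^esub> y \<in> N"
 using submoduleE[OF assms] subgroup.one_closed[OF submodule.axioms(1)[OF assms]]
 by (auto simp: a_minus_def)

lemma finitely_generated_iff:
 "finitely_generated R M \<longleftrightarrow>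
   (\<exists>X \<subseteq> carrier M. finite X \<and> span_over M (carrier R) X = carrier M)"
proof
 assume "finitely_generated R M"
 then obtain X where X: "X \<subseteq> carrier M" "finite X"
   "\<And>N. submodule N R M ==> X \<subseteq> N ==> N = carrier M"
  unfolding finitely_generated_def by auto
 have "span_over M (carrier R) X = carrier M"
  using X(3)[OF span_over_submodule[OF X(1)]] span_over_incl[of "carrier R" X] X(1) by simp
 then show "\<exists>X \<subseteq> carrier M. finite X \<and> span_over M (carrier R) X = carrier M"
  using X(1,2) by auto
next
 assume "\<exists>X \<subseteq> carrier M. finite X \<and> span_over M (carrier R) X = carrier M"
 then obtain X where X: "X \<subseteq> carrier M" "finite X" "span_over M (carrier R) X = carrier M" by auto
 moreover have "N = carrier M" if "submodule N R M" "X \<subseteq> N" for N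
 proof
  note NS = submodule_props[OF that(1)]
  show "N \<subseteq> carrier M" by (rule NS(1))
  show "carrier M \<subseteq> N"
   unfolding X(3)[symmetric] by (rule span_over_least) (use NS(2,3,4) that(2) in auto)
 qed
 ultimately show "finitely_generated R M"
  unfolding finitely_generated_def by metis
qed

text \<open>This plays the part of an ideal of leading coefficients: the coefficients with which
  \<open>v\<close> occurs in elements of \<open>N\<close>, disregarding \<open>E\<close>.\<close>

lemma coefficient_ideal:
 assumes E: "submodule E R M" and N: "submodule N R M" and v: "v \<in> carrier M"
 shows "ideal {r \<in> carrier R. \<exists>y \<in> E. r *[M] v +[M] y \<in> N} R" (is "ideal ?I R")
proof -
 note NS = submodule_props[OF N] and ES = submodule_props[OF E]
 define I where "I = ?I"
 have "ideal I R"
 proof (rule idealI[OF R.ring_axioms])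
  show "subgroup I (add_monoid R)"
  proof
   show "I \<subseteq> carrier (add_monoid R)" by (auto simp: I_def)
   show "\<one>\<^bsub>add_monoid R\<^esub> \<in> I" using v ES NS by (auto simp: I_def intro!: bexI[of _ "\<zero>\<^bsub>M\<^esub>"])
   fix a b assume "a \<in> I" "b \<in> I"
   then obtain y z where yz: "a \<in> carrier R" "b \<in> carrier R" "y \<in> E" "z \<in> E"
    "a *[M] v +[M] y \<in> N" "b *[M] v +[M] z \<in> N" by (auto simp: I_def)
   have "(a \<oplus> b) *[M] v +[M] (y +[M] z) = (a *[M] v +[M] y) +[M] (b *[M] v +[M] z)"
    using yz v ES(1) by (simp add: smult_l_distr M.a_ac subset_iff)
   then have "(a \<oplus> b) *[M] v +[M] (y +[M] z) \<in> N" using NS(3)[OF yz(5,6)] by simp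
   then show "a \<otimes>\<^bsub>add_monoid R\<^esub> b \<in> I" using yz(1,2) ES(3)[OF yz(3,4)] by (auto simp: I_def)
  next
   fix a assume "a \<in> I"
   then obtain y where y: "a \<in> carrier R" "y \<in> E" "a *[M] v +[M] y \<in> N" by (auto simp: I_def)
   have "(\<ominus> a) *[M] v +[M] (\<ominus>\<^bsub>M\<^esub> y) = \<ominus>\<^bsub>M\<^esub> (a *[M] v +[M] y)"
    using y v ES(1) by (simp add: smult_l_minus M.minus_add subset_iff)
   then have "(\<ominus> a) *[M] v +[M] (\<ominus>\<^bsub>M\<^esub> y) \<in> N" using NS(5)[OF y(3)] by simp
   then show "inv\<^bsub>add_monoid R\<^esub> a \<in> I"
    using y(1) ES(5)[OF y(2)] by (auto simp: I_def simp flip: a_inv_def)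
  qed
  have *: "x \<otimes> a \<in> I" if ax: "a \<in> I" "x \<in> carrier R" for a x
  proof -
   obtain y where y: "a \<in> carrier R" "y \<in> E" "a *[M] v +[M] y \<in> N" using ax by (auto simp: I_def)
   have "(x \<otimes> a) *[M] v +[M] (x *[M] y) = x *[M] (a *[M] v +[M] y)"
    using y v ES(1) ax by (simp add: smult_assoc1 smult_r_distr subset_iff)
   then have "(x \<otimes> a) *[M] v +[M] (x *[M] y) \<in> N" using NS(4)[OF ax(2) y(3)] by simp
   then show ?thesis using y(1) ES(4)[OF ax(2) y(2)] ax by (auto simp: I_def)
  qed
  then show "\<And>a x. a \<in> I ==> x \<in> carrier R ==> x \<otimes> a \<in> I" .
  show "\<And>a x. a \<in> I ==> x \<in> carrier R ==> a \<otimes> x \<in> I"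
   using * R.m_comm by (simp add: I_def)
 qed
 then show ?thesis by (simp only: I_def)
qed

text \<open>Induction on the generators: finitely many elements of \<open>N\<close> whose
  \<open>v\<close>-coefficients generate the coefficient ideal reduce any element of
  \<open>N\<close> to one without \<open>v\<close>, and the induction hypothesis deals with the part
  of \<open>N\<close> in the span of the other generators.\<close>

lemma noetherian_span:
 assumes noeth: "noetherian_ring R" and "finite X" "X \<subseteq> carrier M"
  and "submodule N R M" "N \<subseteq> span_over M (carrier R) X"
 shows "\<exists>Y \<subseteq> N. finite Y \<and> N = span_over M (carrier R) Y"
 using assms(2-5)
proof (induction X arbitrary: N)
 case empty
 have "span_over M (carrier R) {} = {\<zero>\<^bsub>M\<^esub>}"
  by (auto elim: span_over.cases intro: span_over.zero)
 then show ?case using empty submodule_props[OF empty.prems(2)] by (intro exI[of _ "{}"]) auto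
next
 case (insert v X N)
 note NS = submodule_props[OF insert.prems(2)]
 have v: "v \<in> carrier M" and X: "X \<subseteq> carrier M" using insert by auto
 let ?E = "span_over M (carrier R) X"
 note ES = submodule_props[OF span_over_submodule[OF X]]
 have "submodule (N \<inter> ?E) R M" using NS ES by (intro submoduleI) auto
 from insert.IH[OF X this] obtain Y where
  Y: "Y \<subseteq> N \<inter> ?E" "finite Y" "N \<inter> ?E = span_over M (carrier R) Y" by auto
 have ins: "span_over M (carrier R) (insert v X)
  = {a *[M] v +[M] y | a y. a \<in> carrier R \<and> y \<in> ?E}"
  using span_over_insert[OF R.carrier_is_subring v X] .
 define I where "I = {r \<in> carrier R. \<exists>y \<in> ?E. r *[M] v +[M] y \<in> N}"
 have I: "ideal I R"
  unfolding I_def using coefficient_ideal[OF span_over_submodule[OF X] insert.prems(2) v] .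
 obtain G where G: "G \<subseteq> carrier R" "finite G" "I = Idl G"
  using noetherian_ring.finetely_gen[OF noeth I] by auto
 have "\<forall>g \<in> G. \<exists>y. y \<in> ?E \<and> g *[M] v +[M] y \<in> N"
  using R.genideal_self[OF G(1)] G(3) unfolding I_def by blast
 then obtain h where h: "\<And>g. g \<in> G ==> h g \<in> ?E \<and> g *[M] v +[M] h g \<in> N" by metis
 define Z where "Z = (\<lambda>g. g *[M] v +[M] h g) ` G"
 have Z: "Z \<subseteq> N" "finite Z" using h G by (auto simp: Z_def)
 have YZ: "Y \<union> Z \<subseteq> carrier M" using Y Z NS(1) by auto
 let ?W = "span_over M (carrier R) (Y \<union> Z)"
 note WS = submodule_props[OF span_over_submodule[OF YZ]]
 have sub: "Y \<union> Z \<subseteq> ?W" using span_over_incl[of "carrier R" "Y \<union> Z"] YZ by auto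
 have WN: "?W \<subseteq> N"
  by (rule span_over_least) (use NS(2,3,4) Y(1) Z(1) in auto)
 \<comment> \<open>Comparing the coefficient ideals of \<open>N\<close> and of the candidate span
   avoids expanding an element of \<open>I\<close> in terms of \<open>G\<close>: it suffices that
   \<open>G\<close> lies in the ideal \<open>J\<close>.\<close>
 define J where "J = {r \<in> carrier R. \<exists>y \<in> ?E. r *[M] v +[M] y \<in> ?W}"
 have J: "ideal J R"
  unfolding J_def using coefficient_ideal[OF span_over_submodule[OF X] span_over_submodule[OF YZ] v] .
 have "G \<subseteq> J" using h G(1) sub unfolding J_def Z_def by blast
 then have IJ: "I \<subseteq> J" using R.genideal_minimal[OF J] G(3) by auto
 have "N \<subseteq> ?W"
 proof
  fix n assume n: "n \<in> N"
  then obtain a y where ay: "n = a *[M] v +[M] y" "a \<in> carrier R" "y \<in> ?E"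
   using insert.prems(3) ins by auto
  then have "a \<in> J" using n IJ unfolding I_def by auto
  then obtain z where z: "z \<in> ?E" "a *[M] v +[M] z \<in> ?W" by (auto simp: J_def)
  have c: "y \<in> carrier M" "z \<in> carrier M" "a *[M] v \<in> carrier M" using ay z ES(1) v by auto
  have "n \<ominus>\<^bsub>M\<^esub> (a *[M] v +[M] z) = y \<ominus>\<^bsub>M\<^esub> z"
   using c ay(1) by (simp add: a_minus_def M.minus_add M.a_ac M.r_neg)
  then have "n \<ominus>\<^bsub>M\<^esub> (a *[M] v +[M] z) \<in> N \<inter> ?E"
   using NS(6)[OF n subsetD[OF WN z(2)]] ES(6)[OF ay(3) z(1)] by simp
  then have d: "n \<ominus>\<^bsub>M\<^esub> (a *[M] v +[M] z) \<in> ?W"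
   using Y(3) span_over_mono[of "carrier R" "carrier R" Y "Y \<union> Z" M] by auto
  have "n = (n \<ominus>\<^bsub>M\<^esub> (a *[M] v +[M] z)) +[M] (a *[M] v +[M] z)"
   using c subsetD[OF NS(1) n] by (simp add: a_minus_def M.a_assoc M.l_neg)
  then show "n \<in> ?W" using WS(3)[OF d z(2)] by simp
 qed
 then have "N = ?W" using WN by (rule equalityI)
 moreover have "Y \<union> Z \<subseteq> N" "finite (Y \<union> Z)" using Y(1,2) Z by auto
 ultimately show ?case by (intro exI[of _ "Y \<union> Z"]) simp
qed

text \<open>Zorn's lemma applies because the union of a chain of submodules is finitely generated
  and therefore equals a member of the chain. Stationarity of ascending chains is later taken from
  this lemma as well.\<close>

lemma submodule_maximal:
 assumes noeth: "noetherian_ring R" and fg: "finitely_generated R M"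
  and ne: "\<F> \<noteq> {}" and sub: "\<And>N. N \<in> \<F> ==> submodule N R M"
 shows "\<exists>N \<in> \<F>. \<forall>N' \<in> \<F>. N \<subseteq> N' \<longrightarrow> N' = N"
proof (rule subset_Zorn_nonempty[OF ne])
 fix C assume C: "C \<noteq> {}" "subset.chain \<F> C"
 have CF: "C \<subseteq> \<F>" using C unfolding pred_on.chain_def by auto
 note CS = submodule_props[OF sub[OF subsetD[OF CF]]]
 have "submodule (\<Union>C) R M"
 proof (rule submoduleI)
  show "\<Union>C \<subseteq> carrier M" using CS(1) by blast
  show "\<zero>\<^bsub>M\<^esub> \<in> \<Union>C" using C(1) CS(2) by blast
  show "\<ominus>\<^bsub>M\<^esub> a \<in> \<Union>C" if "a \<in> \<Union>C" for a using that CS(5) by blast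
  show "a *[M] x \<in> \<Union>C" if "a \<in> carrier R" "x \<in> \<Union>C" for a x using that CS(4) by blast
  fix a b assume "a \<in> \<Union>C" "b \<in> \<Union>C"
  then obtain A B where AB: "A \<in> C" "B \<in> C" "a \<in> A" "b \<in> B" by auto
  then have "A \<subseteq> B \<or> B \<subseteq> A" using C(2) unfolding pred_on.chain_def by blast
  then show "a +[M] b \<in> \<Union>C" using AB CS(3)[of A a b] CS(3)[of B a b] by blast
 qed
 moreover obtain X where "X \<subseteq> carrier M" "finite X" "span_over M (carrier R) X = carrier M"
  using fg finitely_generated_iff by auto
 ultimately obtain Y where Y: "Y \<subseteq> \<Union>C" "finite Y" "\<Union>C = span_over M (carrier R) Y"
  using noetherian_span[OF noeth, of X "\<Union>C"] submodule_props(1) by metis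
 then obtain B where B: "B \<in> C" "Y \<subseteq> B" using finite_subset_Union_chain C by metis
 have "\<Union>C \<subseteq> B"
  unfolding Y(3) by (rule span_over_least) (use CS(2,3,4)[OF B(1)] B(2) in auto)
 then have "\<Union>C = B" using B(1) by auto
 then show "\<Union>C \<in> \<F>" using B(1) CF by auto
qed

text \<open>Take \<open>H'\<close> maximal among the submodules containing \<open>H\<close> but not, locally at \<open>T\<close>, all of \<open>J\<close>.
 Any \<open>y \<in> J\<close> outside of \<open>H'\<close> generates \<open>J\<close> modulo \<open>H'\<close>, so that no generating sets have to be
 manipulated.\<close>

lemma local_nakayama:
 assumes noeth: "noetherian_ring R" and fg: "finitely_generated R M"
  and T: "primeideal T R" and x: "x \<in> T"
  and H: "submodule H R M" and J: "submodule J R M"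
  and step: "\<And>j. j \<in> J ==> \<exists>s \<in> carrier R - T. \<exists>h \<in> H. \<exists>j' \<in> J. s *[M] j = h +[M] x *[M] j'"
  and j: "j \<in> J"
 shows "\<exists>s \<in> carrier R - T. s *[M] j \<in> H"
proof (rule ccontr)
 interpret T: primeideal T R by (rule T)
 have xR: "x \<in> carrier R" using x T.Icarr by auto
 have oneT: "\<one> \<notin> T" using T.one_imp_carrier T.I_notcarr by auto
 note JS = submodule_props[OF J]
 assume contra: "\<not> ?thesis"
 define \<F> where "\<F> = {H'. submodule H' R M \<and> H \<subseteq> H' \<and> (\<exists>j \<in> J. \<forall>s \<in> carrier R - T. s *[M] j \<notin> H')}"
 have "H \<in> \<F>" using H j contra by (auto simp: \<F>_def)
 then have "\<exists>N \<in> \<F>. \<forall>N' \<in> \<F>. N \<subseteq> N' \<longrightarrow> N' = N"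
  by (intro submodule_maximal[OF noeth fg]) (auto simp: \<F>_def)
 then obtain H' where H': "H' \<in> \<F>" "\<forall>N \<in> \<F>. H' \<subseteq> N \<longrightarrow> N = H'" by (rule bexE)
 then obtain y where y: "y \<in> J" "\<And>s. s \<in> carrier R - T ==> s *[M] y \<notin> H'"
  and H'sub: "submodule H' R M" and HH': "H \<subseteq> H'" by (auto simp: \<F>_def)
 note HS = submodule_props[OF H'sub]
 have yM: "y \<in> carrier M" using y JS by auto
 define H'' where "H'' = {r *[M] y +[M] h | r h. r \<in> carrier R \<and> h \<in> H'}"
 have sm: "submodule H'' R M"
 proof (rule submoduleI)
  show "H'' \<subseteq> carrier M" using HS(1) yM by (auto simp: H''_def)
  have "\<zero>\<^bsub>M\<^esub> = \<zero> *[M] y +[M] \<zero>\<^bsub>M\<^esub>" using yM by simp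
  then show "\<zero>\<^bsub>M\<^esub> \<in> H''" using HS(2) unfolding H''_def by blast
  fix a assume "a \<in> H''"
  then obtain r h where a: "a = r *[M] y +[M] h" "r \<in> carrier R" "h \<in> H'" by (auto simp: H''_def)
  then have h: "h \<in> carrier M" using HS(1) by auto
  have "\<ominus>\<^bsub>M\<^esub> a = (\<ominus> r) *[M] y +[M] (\<ominus>\<^bsub>M\<^esub> h)"
   using a h yM by (simp add: smult_l_minus M.minus_add)
  then show "\<ominus>\<^bsub>M\<^esub> a \<in> H''" using a(2) HS(5)[OF a(3)] unfolding H''_def by blast
  show "c *[M] a \<in> H''" if c: "c \<in> carrier R" for c
  proof -
   have "c *[M] a = (c \<otimes> r) *[M] y +[M] c *[M] h"
    using a h yM c by (simp add: smult_r_distr smult_assoc1)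
   then show ?thesis using a(2) c HS(4)[OF c a(3)] unfolding H''_def by blast
  qed
  fix b assume "b \<in> H''"
  then obtain r' h' where b: "b = r' *[M] y +[M] h'" "r' \<in> carrier R" "h' \<in> H'" by (auto simp: H''_def)
  then have h': "h' \<in> carrier M" using HS(1) by auto
  have "a +[M] b = (r \<oplus> r') *[M] y +[M] (h +[M] h')"
   using a(1,2) b(1,2) h h' yM by (simp add: smult_l_distr M.a_ac)
  then show "a +[M] b \<in> H''" using a(2) b(2) HS(3)[OF a(3) b(3)] unfolding H''_def by blast
 qed
 have sub: "H' \<subseteq> H''"
 proof
  fix h assume h: "h \<in> H'"
  then have "h = \<zero> *[M] y +[M] h" using yM HS(1) by auto
  then show "h \<in> H''" using h unfolding H''_def by blast
 qed
 have ne: "H'' \<noteq> H'"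
 proof -
  have "y = \<one> *[M] y +[M] \<zero>\<^bsub>M\<^esub>" using yM by simp
  then have "y \<in> H''" using HS(2) unfolding H''_def by blast
  moreover have "y \<notin> H'" using y(2)[of \<one>] oneT yM by auto
  ultimately show ?thesis by auto
 qed
 have all: "\<exists>s \<in> carrier R - T. s *[M] i \<in> H''" if i: "i \<in> J" for i
 proof (rule ccontr)
  assume "\<not> ?thesis"
  then have "H'' \<in> \<F>" using i sm subset_trans[OF HH' sub] unfolding \<F>_def by auto
  then show False using H'(2) sub ne by auto
 qed
 obtain s h j' where s: "s \<in> carrier R" "s \<notin> T" "h \<in> H" "j' \<in> J" "s *[M] y = h +[M] x *[M] j'"
  using step[OF y(1)] by auto
 obtain s' where s': "s' \<in> carrier R" "s' \<notin> T" "s' *[M] j' \<in> H''" using all[OF s(4)] by auto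
 then obtain r h' where r: "s' *[M] j' = r *[M] y +[M] h'" "r \<in> carrier R" "h' \<in> H'"
  by (auto simp: H''_def)
 have hM: "h \<in> carrier M" "h' \<in> carrier M" "j' \<in> carrier M"
  using HS(1) HH' s(3,4) r(3) JS(1) by auto
 have e: "(s' \<otimes> s) *[M] y = (x \<otimes> r) *[M] y +[M] (s' *[M] h +[M] x *[M] h')"
 proof -
  have "(s' \<otimes> s) *[M] y = s' *[M] h +[M] (s' \<otimes> x) *[M] j'"
   using s s' hM yM xR by (simp add: smult_assoc1 smult_r_distr)
  also have "(s' \<otimes> x) *[M] j' = x *[M] (s' *[M] j')"
   using s'(1) hM xR by (simp add: R.m_comm[of s' x] smult_assoc1)
  also have "\<dots> = (x \<otimes> r) *[M] y +[M] x *[M] h'"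
   using r(2) hM xR yM by (simp add: r(1) smult_r_distr smult_assoc1)
  finally show ?thesis using s'(1) hM r(2) xR yM by (simp add: M.a_lcomm)
 qed
 have w: "s' *[M] h +[M] x *[M] h' \<in> H'"
  using HS(3)[OF HS(4)[OF s'(1) subsetD[OF HH' s(3)]] HS(4)[OF xR r(3)]] .
 \<comment> \<open>Both sides of \<open>e\<close> contain a multiple of \<open>y\<close>. Their
   difference has the coefficient s' s - x r, which is outside \<open>T\<close> since s' s is
   outside and x r inside; so a forbidden multiple of \<open>y\<close> falls into
   \<open>H'\<close>.\<close>
 have "(s' \<otimes> s \<ominus> x \<otimes> r) *[M] y = s' *[M] h +[M] x *[M] h'"
 proof -
  have "(s' \<otimes> s \<ominus> x \<otimes> r) *[M] y = (s' \<otimes> s) *[M] y \<ominus>\<^bsub>M\<^esub> (x \<otimes> r) *[M] y"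
   using s(1) s'(1) xR r(2) yM by (simp add: a_minus_def smult_l_distr smult_l_minus)
  also have "\<dots> = s' *[M] h +[M] x *[M] h'"
   unfolding e using s'(1) hM r(2) xR yM
   by (simp add: a_minus_def M.a_ac M.r_neg M.r_neg1)
  finally show ?thesis .
 qed
 moreover have "s' \<otimes> s \<ominus> x \<otimes> r \<in> carrier R - T"
 proof -
  have "s' \<otimes> s \<notin> T" using T.I_prime s s' by blast
  moreover have "x \<otimes> r \<in> T" using T.I_r_closed x r by auto
  moreover have "s' \<otimes> s = (s' \<otimes> s \<ominus> x \<otimes> r) \<oplus> x \<otimes> r"
   using s(1) s'(1) xR r(2) by (simp add: a_minus_def R.a_assoc R.l_neg)
  ultimately show ?thesis using T.a_closed s(1) s'(1) xR r(2) by (metis DiffI R.m_closed R.minus_closed)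
 qed
 ultimately show False using y(2) w by metis
qed

end

section \<open>Finite-dimensional subspaces\<close>

definition scalar_closed :: "('a, 'b, 'n) module_scheme \<Rightarrow> 'a set \<Rightarrow> 'b set \<Rightarrow> bool" where
 "scalar_closed M F U \<longleftrightarrow> U \<subseteq> carrier M \<and> \<zero>\<^bsub>M\<^esub> \<in> U \<and> (\<forall>x \<in> U. \<forall>y \<in> U. x +[M] y \<in> U) \<and>
   (\<forall>a \<in> F. \<forall>x \<in> U. a *[M] x \<in> U)"

lemma scalar_closed_Int: "scalar_closed M F U ==> scalar_closed M F V ==> scalar_closed M F (U \<inter> V)"
 by (auto simp: scalar_closed_def)

context module begin

lemma scalar_closed_span:
 assumes F: "subring F R" and X: "X \<subseteq> carrier M"
 shows "scalar_closed M F (span_over M F X)"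
 using span_over_closed[OF subringE(1)[OF F] X] span_over_add[OF subringE(1)[OF F] X]
  span_over_smult[OF subringE(1)[OF F] X, where B = F] subringE(1,6)[OF F]
 unfolding scalar_closed_def by (auto intro: span_over.zero)

text \<open>A substitute for dimension: only boundedness and strict growth along proper inclusions
  are needed. The function counts the steps in the flag of spans of the generators at which the
  intersection with \<open>U\<close> grows.\<close>

lemma subspace_dimension:
 assumes F: "subring F R" and inv: "\<And>a. a \<in> F ==> a \<noteq> \<zero> ==> \<exists>b \<in> F. b \<otimes> a = \<one>"
  and "finite X" "X \<subseteq> carrier M"
 shows "\<exists>\<delta> :: 'c set \<Rightarrow> nat.
  (\<forall>U. scalar_closed M F U \<and> U \<subseteq> span_over M F X \<longrightarrow> \<delta> U \<le> card X) \<and>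
  (\<forall>U V. scalar_closed M F U \<and> scalar_closed M F V \<and> U \<subset> V \<and> V \<subseteq> span_over M F X \<longrightarrow> \<delta> U < \<delta> V)"
 using assms(3,4)
proof (induction X)
 case empty
 have "span_over M F {} = {\<zero>\<^bsub>M\<^esub>}"
  by (auto elim: span_over.cases intro: span_over.zero)
 then show ?case by (intro exI[of _ "\<lambda>_. 0"]) (auto simp: scalar_closed_def)
next
 case (insert v X)
 have v: "v \<in> carrier M" and X: "X \<subseteq> carrier M" using insert by auto
 note FE = subringE[OF F]
 let ?E = "span_over M F X"
 have E: "scalar_closed M F ?E" by (rule scalar_closed_span[OF F X])
 have EM: "?E \<subseteq> carrier M" using E by (auto simp: scalar_closed_def)
 have ins: "span_over M F (insert v X) = {a *[M] v +[M] y | a y. a \<in> F \<and> y \<in> ?E}"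
  using span_over_insert[OF F v X] .
 obtain \<delta> :: "'c set \<Rightarrow> nat" where \<delta>:
  "(\<forall>U. scalar_closed M F U \<and> U \<subseteq> ?E \<longrightarrow> \<delta> U \<le> card X) \<and>
   (\<forall>U V. scalar_closed M F U \<and> scalar_closed M F V \<and> U \<subset> V \<and> V \<subseteq> ?E \<longrightarrow> \<delta> U < \<delta> V)"
  using insert.IH[OF X] by (rule exE)
 have \<delta>1: "\<delta> U \<le> card X" if "scalar_closed M F U" "U \<subseteq> ?E" for U
  using \<delta> that by simp
 have \<delta>2: "\<delta> U < \<delta> V" if "scalar_closed M F U" "scalar_closed M F V" "U \<subset> V" "V \<subseteq> ?E" for U V
  using \<delta> that by simp
 define \<delta>' where "\<delta>' U = \<delta> (U \<inter> ?E) + (if U \<subseteq> ?E then 0 else 1 :: nat)" for U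
 have b: "\<delta>' U \<le> card (insert v X)" if "scalar_closed M F U" for U
  using \<delta>1[OF scalar_closed_Int[OF that E]] insert(1,2) by (auto simp: \<delta>'_def)
 have s: "\<delta>' U < \<delta>' V"
  if U: "scalar_closed M F U" and V: "scalar_closed M F V" and UV: "U \<subset> V"
   and VE: "V \<subseteq> span_over M F (insert v X)" for U V
 proof (cases "U \<inter> ?E = V \<inter> ?E")
  case False
  then have "\<delta> (U \<inter> ?E) < \<delta> (V \<inter> ?E)"
   using \<delta>2[OF scalar_closed_Int[OF U E] scalar_closed_Int[OF V E]] UV by blast
  then show ?thesis using UV by (auto simp: \<delta>'_def)
 next
  case True
  \<comment> \<open>If some w in \<open>U\<close> had a nonzero coefficient at \<open>v\<close>,
    subtracting multiples of w would bring each element of \<open>V\<close> into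
    \<open>V \<inter> ?E\<close>, which equals \<open>U \<inter> ?E\<close>; then \<open>V\<close>
    would be contained in \<open>U\<close>.\<close>
  have "U \<subseteq> ?E"
  proof (rule ccontr)
   assume "\<not> U \<subseteq> ?E"
   then obtain w where w: "w \<in> U" "w \<notin> ?E" by auto
   then obtain k h where k: "w = k *[M] v +[M] h" "k \<in> F" "h \<in> ?E" using UV VE ins by blast
   then have h: "h \<in> carrier M" and kR: "k \<in> carrier R" using EM FE(1) by auto
   have "k \<noteq> \<zero>" using k w(2) v h by auto
   then obtain b where b: "b \<in> F" "b \<otimes> k = \<one>" using inv k by auto
   have bR: "b \<in> carrier R" using b FE by auto
   have "V \<subseteq> U"
   proof
    fix y assume y: "y \<in> V"
    then obtain k' h' where k': "y = k' *[M] v +[M] h'" "k' \<in> F" "h' \<in> ?E" using VE ins by blast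
    then have h': "h' \<in> carrier M" "k' \<in> carrier R" using EM FE(1) by auto
    let ?c = "k' \<otimes> b"
    have c: "?c \<in> F" "\<ominus> ?c \<in> F" using k'(2) b(1) FE(5,6) by auto
    have cR: "?c \<in> carrier R" using h' bR by simp
    have wM: "w \<in> carrier M" and yM: "y \<in> carrier M" using k k' h h' v kR by auto
    have ck: "?c \<otimes> k = k'" using h' bR kR b(2) by (simp add: R.m_assoc)
    have cw: "?c *[M] w = k' *[M] v +[M] ?c *[M] h"
    proof -
     have "?c *[M] w = (?c \<otimes> k) *[M] v +[M] ?c *[M] h"
      unfolding k(1) using cR kR v h by (simp only: smult_r_distr smult_assoc1 smult_closed)
     then show ?thesis by (simp only: ck)
    qed
    have e: "(\<ominus> ?c) *[M] w +[M] y = (\<ominus> ?c) *[M] h +[M] h'"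
    proof -
     have "(\<ominus> ?c) *[M] w +[M] y = \<ominus>\<^bsub>M\<^esub> (k' *[M] v +[M] ?c *[M] h) +[M] (k' *[M] v +[M] h')"
      using smult_l_minus[OF cR wM] cw k'(1) by simp
     also have "\<dots> = \<ominus>\<^bsub>M\<^esub> (?c *[M] h) +[M] h'"
     proof -
      have A: "k' *[M] v \<in> carrier M" "?c *[M] h \<in> carrier M" using h' v cR h by auto
      show ?thesis using A h'(1)
       by (simp add: M.minus_add M.a_ac M.r_neg1 M.r_neg2)
     qed
     finally show ?thesis using smult_l_minus[OF cR h] by simp
    qed
    have "(\<ominus> ?c) *[M] w +[M] y \<in> V"
     using V c(2) w(1) UV y unfolding scalar_closed_def by blast
    moreover have "(\<ominus> ?c) *[M] h +[M] h' \<in> ?E"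
     using E c(2) k(3) k'(3) unfolding scalar_closed_def by blast
    ultimately have "(\<ominus> ?c) *[M] w +[M] y \<in> V \<inter> ?E" unfolding e by (rule IntI)
    then have d: "(\<ominus> ?c) *[M] w +[M] y \<in> U" unfolding True[symmetric] by (rule IntD1)
    have "?c *[M] w +[M] ((\<ominus> ?c) *[M] w +[M] y) \<in> U"
     using U c(1) w(1) d unfolding scalar_closed_def by blast
    moreover have "?c *[M] w +[M] ((\<ominus> ?c) *[M] w +[M] y) = y"
     using smult_l_minus[OF cR wM] cR wM yM by (simp add: M.r_neg2)
    ultimately show "y \<in> U" by simp
   qed
   then show False using UV by auto
  qed
  moreover have "\<not> V \<subseteq> ?E" using True UV calculation by blast
  ultimately show ?thesis using True by (simp add: \<delta>'_def)
 qed
 show ?case using b s by (intro exI[of _ \<delta>']) auto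
qed

end

section \<open>Fractions\<close>

lemma self_module_simps [simp]:
 "carrier (self_module R) = carrier R" "\<zero>\<^bsub>self_module R\<^esub> = \<zero>\<^bsub>R\<^esub>" "\<one>\<^bsub>self_module R\<^esub> = \<one>\<^bsub>R\<^esub>"
 "x \<oplus>\<^bsub>self_module R\<^esub> y = x +[R] y" "x \<otimes>\<^bsub>self_module R\<^esub> y = x **[R] y"
 "x \<odot>\<^bsub>self_module R\<^esub> y = x **[R] y"
 by (simp_all add: self_module_def)

lemma (in cring) self_module: "module R (self_module R)"
proof (intro moduleI abelian_groupI is_cring)
 show "\<exists>y \<in> carrier (self_module R). y \<oplus>\<^bsub>self_module R\<^esub> x = \<zero>\<^bsub>self_module R\<^esub>"
  if "x \<in> carrier (self_module R)" for x
  using that by (auto intro!: bexI[of _ "\<ominus> x"] simp: l_neg)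
qed (auto simp: a_ac m_assoc l_distr r_distr)

lemma a_inv_self_module [simp]: "\<ominus>\<^bsub>self_module R\<^esub> x = \<ominus>\<^bsub>R\<^esub> x"
 by (simp add: a_inv_def m_inv_def self_module_def)

lemma (in cring) submodule_self_iff: "submodule I R (self_module R) \<longleftrightarrow> ideal I R"
proof
 interpret S: module R "self_module R" by (rule self_module)
 {
  assume "submodule I R (self_module R)"
  note IS = S.submodule_props[OF this]
  show "ideal I R"
  proof (rule idealI[OF ring_axioms])
   show "subgroup I (add_monoid R)"
   proof
    show "inv\<^bsub>add_monoid R\<^esub> a \<in> I" if "a \<in> I" for a
     using IS(5)[OF that] by (simp flip: a_inv_def)
   qed (use IS in auto)
   show *: "\<And>a x. a \<in> I ==> x \<in> carrier R ==> x \<otimes> a \<in> I" using IS(4) by simp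
   show "\<And>a x. a \<in> I ==> x \<in> carrier R ==> a \<otimes> x \<in> I"
    using * IS(1) m_comm by (metis self_module_simps(1) subsetD)
  qed
 }
 assume "ideal I R"
 then interpret I: ideal I R .
 show "submodule I R (self_module R)"
  by (rule S.submoduleI) (auto simp: I.I_l_closed I.Icarr)
qed

lemma (in cring) self_module_fg: "finitely_generated R (self_module R)"
proof -
 interpret S: module R "self_module R" by (rule self_module)
 have "N = carrier R" if "submodule N R (self_module R)" "{\<one>} \<subseteq> N" for N
  using that ideal.one_imp_carrier submodule_self_iff by blast
 then show ?thesis unfolding finitely_generated_def
  by (intro exI[of _ "{\<one>}"]) auto
qed

lemma (in cring) ideal_maximal:
 assumes "noetherian_ring R" "\<F> \<noteq> {}" "\<And>I. I \<in> \<F> ==> ideal I R"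
 shows "\<exists>I \<in> \<F>. \<forall>J \<in> \<F>. I \<subseteq> J \<longrightarrow> J = I"
 using module.submodule_maximal[OF self_module assms(1) self_module_fg assms(2)] assms(3)
 by (simp add: submodule_self_iff)

locale fractions = module R M + submonoid S R for R (structure) and M (structure) and S
begin

lemma S_carrier: "s \<in> S ==> s \<in> carrier R"
 using subset by auto

abbreviation "mfrac \<equiv> fraction R S M"

text \<open>The relation on pairs is an equivalence; for transitivity the two witnesses are
  multiplied with the middle denominator. Well-definedness of the operations on fractions rests on
  this criterion.\<close>

lemma frac_eq_iff:
 assumes "m \<in> carrier M" "m' \<in> carrier M" "s \<in> S" "s' \<in> S"
 shows "mfrac m s = mfrac m' s' \<longleftrightarrow> (\<exists>u \<in> S. (u \<otimes> s') *[M] m = (u \<otimes> s) *[M] m')"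
proof -
 have sym: "(\<exists>u \<in> S. (u \<otimes> s') *[M] m = (u \<otimes> s) *[M] m') \<longleftrightarrow>
  (\<exists>u \<in> S. (u \<otimes> s) *[M] m' = (u \<otimes> s') *[M] m)" for m m' s s' by metis
 have trans: "\<exists>u \<in> S. (u \<otimes> s'') *[M] m = (u \<otimes> s) *[M] m''"
  if "u \<in> S" "(u \<otimes> s') *[M] m = (u \<otimes> s) *[M] m'" "v \<in> S" "(v \<otimes> s'') *[M] m' = (v \<otimes> s') *[M] m''"
   "m \<in> carrier M" "m' \<in> carrier M" "m'' \<in> carrier M" "s \<in> S" "s' \<in> S" "s'' \<in> S" for u v s s' s'' m m' m''
 proof -
  have c: "u \<in> carrier R" "v \<in> carrier R" "s \<in> carrier R" "s' \<in> carrier R" "s'' \<in> carrier R"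
   using that S_carrier by auto
  have "(u \<otimes> v \<otimes> s' \<otimes> s'') *[M] m = (v \<otimes> s'') *[M] ((u \<otimes> s') *[M] m)"
   using c that(5) by (simp add: m_ac flip: smult_assoc1)
  also have "\<dots> = (u \<otimes> s) *[M] ((v \<otimes> s'') *[M] m')"
   unfolding that(2) using c that(6) by (simp add: m_ac flip: smult_assoc1)
  also have "\<dots> = (u \<otimes> v \<otimes> s' \<otimes> s) *[M] m''"
   unfolding that(4) using c that(7) by (simp add: m_ac flip: smult_assoc1)
  finally show ?thesis using that by (intro bexI[of _ "u \<otimes> v \<otimes> s'"]) auto
 qed
 have mem: "(m', s') \<in> mfrac m s \<longleftrightarrow>
   m' \<in> carrier M \<and> s' \<in> S \<and> (\<exists>u \<in> S. (u \<otimes> s') *[M] m = (u \<otimes> s) *[M] m')"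
  if "m \<in> carrier M" "s \<in> S" for m m' s s'
  using that S_carrier by (auto simp: fraction_def smult_assoc1)
 show ?thesis
 proof
  assume "mfrac m s = mfrac m' s'"
  moreover have "(m', s') \<in> mfrac m' s'" using assms mem by auto
  ultimately have "(m', s') \<in> mfrac m s" by simp
  then show "\<exists>u \<in> S. (u \<otimes> s') *[M] m = (u \<otimes> s) *[M] m'" using mem[OF assms(1,3)] by simp
 next
  assume u: "\<exists>u \<in> S. (u \<otimes> s') *[M] m = (u \<otimes> s) *[M] m'"
  have "(n, t) \<in> mfrac m s \<longleftrightarrow> (n, t) \<in> mfrac m' s'" for n t
  proof
   assume "(n, t) \<in> mfrac m s"
   then obtain v where v: "n \<in> carrier M" "t \<in> S" "v \<in> S" "(v \<otimes> t) *[M] m = (v \<otimes> s) *[M] n"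
    using mem assms by auto
   obtain w where "w \<in> S" "(w \<otimes> s) *[M] m' = (w \<otimes> s') *[M] m" using u by metis
   from trans[OF this v(3,4) assms(2,1) v(1) assms(4,3) v(2)]
   show "(n, t) \<in> mfrac m' s'" using mem[OF assms(2,4)] v by auto
  next
   assume "(n, t) \<in> mfrac m' s'"
   then obtain v where v: "n \<in> carrier M" "t \<in> S" "v \<in> S" "(v \<otimes> t) *[M] m' = (v \<otimes> s') *[M] n"
    using mem assms by auto
   obtain w where "w \<in> S" "(w \<otimes> s') *[M] m = (w \<otimes> s) *[M] m'" using u by metis
   from trans[OF this v(3,4) assms(1,2) v(1) assms(3,4) v(2)]
   show "(n, t) \<in> mfrac m s" using mem[OF assms(1,3)] v by auto
  qed
  then show "mfrac m s = mfrac m' s'" by auto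
 qed
qed

lemma mem_frac_iff:
 assumes "m \<in> carrier M" "s \<in> S"
 shows "(m', s') \<in> mfrac m s \<longleftrightarrow> m' \<in> carrier M \<and> s' \<in> S \<and> mfrac m' s' = mfrac m s"
proof -
 have "(m', s') \<in> mfrac m s \<longleftrightarrow>
   m' \<in> carrier M \<and> s' \<in> S \<and> (\<exists>u \<in> S. (u \<otimes> s') *[M] m = (u \<otimes> s) *[M] m')"
  using assms S_carrier by (auto simp: fraction_def smult_assoc1)
 then show ?thesis using frac_eq_iff assms by metis
qed

lemma frac_self: "m \<in> carrier M ==> s \<in> S ==> (m, s) \<in> mfrac m s"
 by (simp add: mem_frac_iff)

lemma frac_eqI:
 assumes "m \<in> carrier M" "m' \<in> carrier M" "s \<in> S" "s' \<in> S" "s' *[M] m = s *[M] m'"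
 shows "mfrac m s = mfrac m' s'"
 using assms S_carrier by (subst frac_eq_iff) (auto intro!: bexI[of _ \<one>])

text \<open>Operations on fractions are unions over all representatives. A value independent of the
  representative is equal to that union, so that a computation with one representative is
  enough.\<close>

lemma union_frac:
 assumes "m \<in> carrier M" "s \<in> S"
  and "\<And>m' s'. m' \<in> carrier M ==> s' \<in> S ==> mfrac m' s' = mfrac m s ==> g m' s' = g m s"
 shows "(\<Union>(m', s') \<in> mfrac m s. g m' s') = g m s"
proof -
 have "(\<Union>(m', s') \<in> mfrac m s. g m' s') = (\<Union>x \<in> mfrac m s. g m s)"
 proof (rule SUP_cong[OF refl])
  fix x assume x: "x \<in> mfrac m s"
  obtain m' s' where ms: "x = (m', s')" by (cases x)
  have "m' \<in> carrier M \<and> s' \<in> S \<and> mfrac m' s' = mfrac m s"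
   using mem_frac_iff[OF assms(1,2)] x ms by simp
  then show "(case x of (m', s') \<Rightarrow> g m' s') = g m s" using assms(3) ms by simp
 qed
 moreover have "mfrac m s \<noteq> {}" using frac_self[OF assms(1,2)] by auto
 ultimately show ?thesis by simp
qed

lemma frac_add_cong:
 assumes "m \<in> carrier M" "m' \<in> carrier M" "s \<in> S" "s' \<in> S" "mfrac m s = mfrac m' s'"
  and "n \<in> carrier M" "t \<in> S"
 shows "mfrac (t *[M] m +[M] s *[M] n) (s \<otimes> t) = mfrac (t *[M] m' +[M] s' *[M] n) (s' \<otimes> t)"
proof -
 obtain u where u: "u \<in> S" "(u \<otimes> s') *[M] m = (u \<otimes> s) *[M] m'" using frac_eq_iff assms by auto
 have c: "u \<in> carrier R" "s \<in> carrier R" "s' \<in> carrier R" "t \<in> carrier R" using u assms S_carrier by auto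
 have "(u \<otimes> (s' \<otimes> t)) *[M] (t *[M] m +[M] s *[M] n)
  = (t \<otimes> t) *[M] ((u \<otimes> s') *[M] m) +[M] (u \<otimes> s \<otimes> s' \<otimes> t) *[M] n"
  using c assms by (simp add: smult_r_distr m_ac flip: smult_assoc1)
 also have "\<dots> = (u \<otimes> (s \<otimes> t)) *[M] (t *[M] m' +[M] s' *[M] n)"
  unfolding u(2) using c assms by (simp add: smult_r_distr m_ac flip: smult_assoc1)
 finally show ?thesis using assms c u(1) by (subst frac_eq_iff) auto
qed

lemma localize_add:
 assumes "m \<in> carrier M" "m' \<in> carrier M" "s \<in> S" "s' \<in> S"
 shows "mfrac m s \<oplus>\<^bsub>localize_module R S M\<^esub> mfrac m' s' = mfrac (s' *[M] m +[M] s *[M] m') (s \<otimes> s')"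
proof -
 define g where "g n t = (\<Union>(n', t') \<in> mfrac m' s'. mfrac (t' *[M] n +[M] t *[M] n') (t \<otimes> t'))" for n t
 have g: "g n t = mfrac (s' *[M] n +[M] t *[M] m') (t \<otimes> s')" if nt: "n \<in> carrier M" "t \<in> S" for n t
  unfolding g_def
 proof (rule union_frac[OF assms(2,4)])
  fix n' t' assume *: "n' \<in> carrier M" "t' \<in> S" "mfrac n' t' = mfrac m' s'"
  from frac_add_cong[OF *(1) assms(2) *(2) assms(4) *(3) nt]
  show "mfrac (t' *[M] n +[M] t *[M] n') (t \<otimes> t') = mfrac (s' *[M] n +[M] t *[M] m') (t \<otimes> s')"
   using nt * assms S_carrier by (simp add: M.a_comm m_comm)
 qed
 have "mfrac m s \<oplus>\<^bsub>localize_module R S M\<^esub> mfrac m' s' = (\<Union>(n, t) \<in> mfrac m s. g n t)"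
  by (simp add: localize_module_def g_def)
 also have "\<dots> = g m s"
 proof (rule union_frac[OF assms(1,3)])
  fix n t assume *: "n \<in> carrier M" "t \<in> S" "mfrac n t = mfrac m s"
  show "g n t = g m s"
   unfolding g[OF *(1,2)] g[OF assms(1,3)]
   by (rule frac_add_cong[OF *(1) assms(1) *(2) assms(3) *(3) assms(2,4)])
 qed
 finally show ?thesis unfolding g[OF assms(1,3)] .
qed

lemma localize_zero: "\<zero>\<^bsub>localize_module R S M\<^esub> = mfrac \<zero>\<^bsub>M\<^esub> \<one>"
 by (simp add: localize_module_def)

lemma frac_zero: "s \<in> S ==> mfrac \<zero>\<^bsub>M\<^esub> s = mfrac \<zero>\<^bsub>M\<^esub> \<one>"
 using S_carrier by (intro frac_eqI) auto

text \<open>This covers \<^const>\<open>localize_submodule\<close>, which only replaces the carrier.\<close>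

lemma localize_submodule_group:
 assumes N: "submodule N R M"
 shows "comm_group (add_monoid (localize_submodule R S M N))"
proof -
 let ?L = "localize_submodule R S M N"
 note NS = submodule_props[OF N]
 have NM: "n \<in> carrier M" if "n \<in> N" for n using that NS(1) by auto
 have car: "carrier ?L = {mfrac n s | n s. n \<in> N \<and> s \<in> S}"
  by (simp add: localize_submodule_def)
 have add: "mfrac m s \<oplus>\<^bsub>?L\<^esub> mfrac m' s' = mfrac (s' *[M] m +[M] s *[M] m') (s \<otimes> s')"
  if "m \<in> N" "m' \<in> N" "s \<in> S" "s' \<in> S" for m m' s s'
  using localize_add[OF NM NM] that by (simp add: localize_submodule_def)
 have zero: "\<zero>\<^bsub>?L\<^esub> = mfrac \<zero>\<^bsub>M\<^esub> \<one>" by (simp add: localize_submodule_def localize_zero)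
 have cl: "s' *[M] m +[M] s *[M] m' \<in> N" if "m \<in> N" "m' \<in> N" "s \<in> S" "s' \<in> S" for m m' s s'
  using NS(3)[OF NS(4) NS(4)] that S_carrier by auto
 show ?thesis
 proof (rule comm_groupI, simp_all)
  fix x y assume "x \<in> carrier ?L" "y \<in> carrier ?L"
  then obtain m s m' s' where xy: "x = mfrac m s" "y = mfrac m' s'" "m \<in> N" "m' \<in> N" "s \<in> S" "s' \<in> S"
   unfolding car by blast
  show "x \<oplus>\<^bsub>?L\<^esub> y \<in> carrier ?L"
   unfolding xy(1,2) add[OF xy(3-6)] car using cl[OF xy(3-6)] xy by blast
  show "x \<oplus>\<^bsub>?L\<^esub> y = y \<oplus>\<^bsub>?L\<^esub> x"
   unfolding xy(1,2) add[OF xy(3-6)] add[OF xy(4,3,6,5)]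
   using xy NM S_carrier by (simp add: m_comm M.a_comm)
  fix z assume "z \<in> carrier ?L"
  then obtain m'' s'' where z: "z = mfrac m'' s''" "m'' \<in> N" "s'' \<in> S"
   unfolding car by blast
  have c: "m \<in> carrier M" "m' \<in> carrier M" "m'' \<in> carrier M" "s \<in> carrier R" "s' \<in> carrier R" "s'' \<in> carrier R"
   using xy z NM S_carrier by auto
  have ss: "s \<otimes> s' \<in> S" "s' \<otimes> s'' \<in> S" using xy z by auto
  have "x \<oplus>\<^bsub>?L\<^esub> y \<oplus>\<^bsub>?L\<^esub> z = mfrac (s'' *[M] (s' *[M] m +[M] s *[M] m') +[M] (s \<otimes> s') *[M] m'') (s \<otimes> s' \<otimes> s'')"
   unfolding xy(1,2) z(1) add[OF xy(3-6)] by (rule add[OF cl[OF xy(3-6)] z(2) ss(1) z(3)])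
  also have "\<dots> = mfrac ((s' \<otimes> s'') *[M] m +[M] s *[M] (s'' *[M] m' +[M] s' *[M] m'')) (s \<otimes> (s' \<otimes> s''))"
   using c by (simp add: smult_r_distr m_assoc M.a_assoc m_comm[of s' s''] m_comm[of s s''] flip: smult_assoc1)
  also have "\<dots> = x \<oplus>\<^bsub>?L\<^esub> (y \<oplus>\<^bsub>?L\<^esub> z)"
   unfolding xy(1,2) z(1) add[OF xy(4) z(2) xy(6) z(3)]
   by (rule add[OF xy(3) cl[OF xy(4) z(2) xy(6) z(3)] xy(5) ss(2), symmetric])
  finally show "x \<oplus>\<^bsub>?L\<^esub> y \<oplus>\<^bsub>?L\<^esub> z = x \<oplus>\<^bsub>?L\<^esub> (y \<oplus>\<^bsub>?L\<^esub> z)" .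
 next
  show "\<zero>\<^bsub>?L\<^esub> \<in> carrier ?L" unfolding zero car using NS(2) one_closed by blast
  fix x assume "x \<in> carrier ?L"
  then obtain m s where x: "x = mfrac m s" "m \<in> N" "s \<in> S" unfolding car by blast
  have c: "m \<in> carrier M" "s \<in> carrier R" using x NM S_carrier by auto
  show "\<zero>\<^bsub>?L\<^esub> \<oplus>\<^bsub>?L\<^esub> x = x"
   unfolding x(1) zero add[OF NS(2) x(2) one_closed x(3)] using c by simp
  have "mfrac (\<ominus>\<^bsub>M\<^esub> m) s \<oplus>\<^bsub>?L\<^esub> x = \<zero>\<^bsub>?L\<^esub>"
   unfolding x(1) zero add[OF NS(5)[OF x(2)] x(2) x(3) x(3)]
   using c by (simp add: M.l_neg smult_r_minus frac_zero[OF m_closed[OF x(3) x(3)]])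
  then show "\<exists>y \<in> carrier ?L. y \<oplus>\<^bsub>?L\<^esub> x = \<zero>\<^bsub>?L\<^esub>"
   unfolding car using NS(5)[OF x(2)] x(3) by blast
 qed
qed

end

lemma (in cring) prime_fractions:
 assumes "module R M" "primeideal P R"
 shows "fractions R M (carrier R - P)"
proof -
 interpret P: primeideal P R by fact
 have "\<one> \<notin> P" using P.one_imp_carrier P.I_notcarr by auto
 moreover have "x \<otimes> y \<notin> P" if "x \<in> carrier R - P" "y \<in> carrier R - P" for x y
  using P.I_prime that by auto
 ultimately have "submonoid (carrier R - P) R" by (intro submonoid.intro) auto
 then show ?thesis using assms(1) by (simp add: fractions_def)
qed

section \<open>Commutative rings of prime characteristic\<close>

lemma (in cring) idealI_cring:
 assumes "I \<subseteq> carrier R" "\<zero> \<in> I" "\<And>a b. a \<in> I ==> b \<in> I ==> a \<oplus> b \<in> I"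
  "\<And>a x. a \<in> I ==> x \<in> carrier R ==> x \<otimes> a \<in> I"
 shows "ideal I R"
proof (rule idealI[OF ring_axioms])
 show "subgroup I (add_monoid R)"
 proof
  fix a assume a: "a \<in> I"
  then have "\<ominus> a = (\<ominus> \<one>) \<otimes> a" using assms(1) by (simp add: l_minus subset_iff)
  then have "\<ominus> a \<in> I" using assms(4)[OF a, of "\<ominus> \<one>"] by simp
  then show "inv\<^bsub>add_monoid R\<^esub> a \<in> I" by (simp add: a_inv_def)
 qed (use assms in auto)
 show "a \<otimes> x \<in> I" if "a \<in> I" "x \<in> carrier R" for a x
 proof -
  have "a \<in> carrier R" using that assms(1) by auto
  then show ?thesis using assms(4)[OF that] that(2) by (simp add: m_comm)
 qed
qed (use assms(4) in simp)

context cring begin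

lemma binomial_cring:
 assumes a: "a \<in> carrier R" and b: "b \<in> carrier R"
 shows "(a \<oplus> b) [^] n = (\<Oplus>k\<in>{..n::nat}. [(n choose k)] \<cdot> (a [^] k \<otimes> b [^] (n - k)))"
proof (induction n)
 case 0
 then show ?case using assms by (simp add: Pi_def)
next
 case (Suc n)
 let ?t = "\<lambda>k. [(n choose k)] \<cdot> (a [^] k \<otimes> b [^] (n - k))"
 let ?g = "\<lambda>k. [(Suc n choose k)] \<cdot> (a [^] k \<otimes> b [^] (Suc n - k))"
 let ?h = "\<lambda>k. [(n choose k)] \<cdot> (a [^] k \<otimes> b [^] (Suc n - k))"
 have [simp]: "?t \<in> {..n} \<rightarrow> carrier R" "?g \<in> {..Suc n} \<rightarrow> carrier R" "?h \<in> {..Suc n} \<rightarrow> carrier R"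
  using assms by auto
 have 1: "a \<otimes> (\<Oplus>k\<in>{..n}. ?t k) = (\<Oplus>k\<in>{..n}. [(n choose k)] \<cdot> (a [^] Suc k \<otimes> b [^] (n - k)))"
 proof -
  have "a \<otimes> (\<Oplus>k\<in>{..n}. ?t k) = (\<Oplus>k\<in>{..n}. a \<otimes> ?t k)"
   using assms by (simp add: finsum_rdistr)
  also have "\<dots> = (\<Oplus>k\<in>{..n}. [(n choose k)] \<cdot> (a [^] Suc k \<otimes> b [^] (n - k)))"
   using assms by (intro finsum_cong') (auto simp: add_pow_rdistr m_ac)
  finally show ?thesis .
 qed
 have 2: "b \<otimes> (\<Oplus>k\<in>{..n}. ?t k) = (\<Oplus>k\<in>{..n}. ?h k)"
 proof -
  have "b \<otimes> (\<Oplus>k\<in>{..n}. ?t k) = (\<Oplus>k\<in>{..n}. b \<otimes> ?t k)"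
   using assms by (simp add: finsum_rdistr)
  also have "\<dots> = (\<Oplus>k\<in>{..n}. ?h k)"
   using assms by (intro finsum_cong') (auto simp: add_pow_rdistr m_ac Suc_diff_le)
  finally show ?thesis .
 qed
 have 3: "(\<Oplus>k\<in>{..n}. ?h k) = (\<Oplus>k\<in>{..n}. ?h (Suc k)) \<oplus> ?h 0"
 proof -
  have "(\<Oplus>k\<in>{..Suc n}. ?h k) = (\<Oplus>k\<in>{..n}. ?h k)" using assms by (simp add: binomial_eq_0)
  then show ?thesis using finsum_Suc2[of ?h n] by simp
 qed
 have "(\<Oplus>k\<in>{..Suc n}. ?g k) = (\<Oplus>k\<in>{..n}. ?g (Suc k)) \<oplus> ?g 0"
  by (rule finsum_Suc2) simp
 also have "(\<Oplus>k\<in>{..n}. ?g (Suc k)) =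
   (\<Oplus>k\<in>{..n}. [(n choose k)] \<cdot> (a [^] Suc k \<otimes> b [^] (n - k)) \<oplus> ?h (Suc k))"
  using assms by (intro finsum_cong') (auto simp: add.nat_pow_mult[symmetric])
 also have "\<dots> = (\<Oplus>k\<in>{..n}. [(n choose k)] \<cdot> (a [^] Suc k \<otimes> b [^] (n - k))) \<oplus> (\<Oplus>k\<in>{..n}. ?h (Suc k))"
  using assms by (intro finsum_addf) auto
 finally have g: "(\<Oplus>k\<in>{..Suc n}. ?g k) = a \<otimes> (\<Oplus>k\<in>{..n}. ?t k) \<oplus> b \<otimes> (\<Oplus>k\<in>{..n}. ?t k)"
  unfolding 1 2 3 using assms by (simp add: a_assoc)
 have "(a \<oplus> b) [^] Suc n = (\<Oplus>k\<in>{..n}. ?t k) \<otimes> (a \<oplus> b)" using Suc by simp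
 also have "\<dots> = a \<otimes> (\<Oplus>k\<in>{..n}. ?t k) \<oplus> b \<otimes> (\<Oplus>k\<in>{..n}. ?t k)"
 proof -
  have "(\<Oplus>k\<in>{..n}. ?t k) \<in> carrier R" using assms by (intro finsum_closed) auto
  then show ?thesis using assms by (simp only: r_distr m_comm[of _ a] m_comm[of _ b])
 qed
 finally show ?case using g by simp
qed

end

locale cring_char = cring R for R (structure) +
 fixes p :: nat
 assumes prime_p: "Factorial_Ring.prime p" and p_zero: "[p] \<cdot> \<one> = \<zero>"
begin

lemma p_pos [simp]: "p > 0" using prime_p prime_gt_0_nat by auto

lemma p_gt_1: "p > 1" using prime_p prime_gt_1_nat by auto

lemma add_pow_p_dvd:
 assumes "x \<in> carrier R" "p dvd n"
 shows "[n] \<cdot> x = \<zero>"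
proof -
 obtain k where k: "n = p * k" using assms by auto
 have "[p] \<cdot> x = \<zero>" using add_pow_ldistr[of \<one> x p] p_zero assms by simp
 then have "[k] \<cdot> ([p] \<cdot> x) = \<zero>" by simp
 then show ?thesis using add.nat_pow_pow[OF assms(1), of k p] k by (simp add: mult.commute)
qed

lemma frobenius_add_1:
 assumes a: "a \<in> carrier R" and b: "b \<in> carrier R"
 shows "(a \<oplus> b) [^] p = a [^] p \<oplus> b [^] p"
proof -
 have "(\<Oplus>k\<in>{..p}. [(p choose k)] \<cdot> (a [^] k \<otimes> b [^] (p - k)))
   = (\<Oplus>k\<in>{0, p}. [(p choose k)] \<cdot> (a [^] k \<otimes> b [^] (p - k)))"
 proof (rule add.finprod_mono_neutral_cong_right)
  fix k assume "k \<in> {..p} - {0, p}"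
  then have "p dvd (p choose k)" using prime_p by (intro dvd_choose_prime) auto
  then show "[(p choose k)] \<cdot> (a [^] k \<otimes> b [^] (p - k)) = \<zero>" using assms by (intro add_pow_p_dvd) auto
 qed (use assms in auto)
 also have "\<dots> = a [^] p \<oplus> b [^] p"
  using assms p_pos by (subst finsum_insert) (auto simp: a_comm)
 finally show ?thesis using binomial_cring[OF assms, of p] by simp
qed

lemma frobenius_add:
 assumes "a \<in> carrier R" "b \<in> carrier R"
 shows "(a \<oplus> b) [^] (p ^ e) = a [^] (p ^ e) \<oplus> b [^] (p ^ e)"
proof (induction e)
 case (Suc e)
 have "(a \<oplus> b) [^] (p ^ Suc e) = ((a \<oplus> b) [^] (p ^ e)) [^] p"
  using assms by (simp add: nat_pow_pow mult.commute)
 then show ?case using assms Suc by (simp add: frobenius_add_1 nat_pow_pow mult.commute)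
qed (use assms in simp)

lemma frobenius_zero: "\<zero> [^] (p ^ e) = \<zero>"
 by (simp add: nat_pow_zero)

lemma frobenius_minus:
 assumes a: "a \<in> carrier R"
 shows "(\<ominus> a) [^] (p ^ e) = \<ominus> (a [^] (p ^ e))"
proof -
 have "(\<ominus> a) [^] (p ^ e) \<oplus> a [^] (p ^ e) = \<zero>"
  using frobenius_add[of "\<ominus> a" a e] a frobenius_zero by (simp add: l_neg)
 then show ?thesis using a by (simp add: minus_equality)
qed


lemma frobenius_push_module:
 assumes "module R M"
 shows "module R (frobenius_push p e R M)"
proof -
 interpret M: module R M by fact
 have [simp]: "carrier (frobenius_push p e R M) = carrier M"
  "\<zero>\<^bsub>frobenius_push p e R M\<^esub> = \<zero>\<^bsub>M\<^esub>"
  "x \<oplus>\<^bsub>frobenius_push p e R M\<^esub> y = x +[M] y"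
  "a \<odot>\<^bsub>frobenius_push p e R M\<^esub> x = (a [^] (p ^ e)) *[M] x" for x y a
  by (auto simp: frobenius_push_def restrict_scalars_def frobenius_def)
 show ?thesis
 proof (intro moduleI abelian_groupI is_cring)
  show "\<exists>y \<in> carrier (frobenius_push p e R M). y \<oplus>\<^bsub>frobenius_push p e R M\<^esub> x = \<zero>\<^bsub>frobenius_push p e R M\<^esub>"
   if "x \<in> carrier (frobenius_push p e R M)" for x
   using that by (auto intro!: bexI[of _ "\<ominus>\<^bsub>M\<^esub> x"] simp: M.M.l_neg)
 qed (auto simp: M.M.a_ac M.smult_l_distr M.smult_r_distr frobenius_add nat_pow_distrib M.smult_assoc1)
qed

end

lemma frobenius_push_simps [simp]:
 "carrier (frobenius_push p e R M) = carrier M"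
 "\<zero>\<^bsub>frobenius_push p e R M\<^esub> = \<zero>\<^bsub>M\<^esub>"
 "x \<oplus>\<^bsub>frobenius_push p e R M\<^esub> y = x +[M] y"
 "a \<odot>\<^bsub>frobenius_push p e R M\<^esub> x = (a [^]\<^bsub>R\<^esub> (p ^ e)) *[M] x"
 by (auto simp: frobenius_push_def restrict_scalars_def frobenius_def)

section \<open>Krull's principal ideal theorem\<close>

locale noetherian_cring = cring R + noetherian_ring R for R (structure)

definition adjoin :: "('a, 'm) ring_scheme \<Rightarrow> 'a set \<Rightarrow> 'a \<Rightarrow> 'a set" where
 "adjoin R I g = {h +[R] r **[R] g | h r. h \<in> I \<and> r \<in> carrier R}"

context cring begin

lemma ideal_carrier: "ideal I R ==> x \<in> I ==> x \<in> carrier R"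
 by (rule ideal.Icarr)

lemma ideal_zero: "ideal I R ==> \<zero> \<in> I"
 by (simp add: additive_subgroup.zero_closed ideal.axioms(1))

lemma ideal_add: "ideal I R ==> a \<in> I ==> b \<in> I ==> a \<oplus> b \<in> I"
 by (simp add: additive_subgroup.a_closed ideal.axioms(1))

lemma ideal_mult: "ideal I R ==> a \<in> I ==> x \<in> carrier R ==> x \<otimes> a \<in> I"
 by (simp add: ideal.I_l_closed)

lemma ideal_mult': "ideal I R ==> a \<in> I ==> x \<in> carrier R ==> a \<otimes> x \<in> I"
 by (simp add: ideal.I_r_closed)

lemma ideal_minus: "ideal I R ==> a \<in> I ==> b \<in> I ==> a \<ominus> b \<in> I"
 by (simp add: a_minus_def additive_subgroup.a_closed additive_subgroup.a_inv_closed ideal.axioms(1))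

lemma adjoin_ideal:
 assumes I: "ideal I R" and g: "g \<in> carrier R"
 shows "ideal (adjoin R I g) R"
proof (rule idealI_cring)
 show "adjoin R I g \<subseteq> carrier R" using ideal_carrier[OF I] g by (auto simp: adjoin_def)
 have "\<zero> = \<zero> \<oplus> \<zero> \<otimes> g" using g by simp
 then show "\<zero> \<in> adjoin R I g" unfolding adjoin_def using ideal_zero[OF I] by blast
 fix a assume "a \<in> adjoin R I g"
 then obtain h r where a: "a = h \<oplus> r \<otimes> g" "h \<in> I" "r \<in> carrier R" by (auto simp: adjoin_def)
 have h: "h \<in> carrier R" using ideal_carrier[OF I a(2)] .
 show "x \<otimes> a \<in> adjoin R I g" if x: "x \<in> carrier R" for x
 proof -
  have "x \<otimes> a = x \<otimes> h \<oplus> (x \<otimes> r) \<otimes> g" using a h g x by (simp add: r_distr m_assoc)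
  moreover have "x \<otimes> r \<in> carrier R" using x a by simp
  ultimately show ?thesis unfolding adjoin_def using ideal_mult[OF I a(2) x] by blast
 qed
 fix b assume "b \<in> adjoin R I g"
 then obtain h' r' where b: "b = h' \<oplus> r' \<otimes> g" "h' \<in> I" "r' \<in> carrier R" by (auto simp: adjoin_def)
 have h': "h' \<in> carrier R" using ideal_carrier[OF I b(2)] .
 have "a \<oplus> b = (h \<oplus> h') \<oplus> (r \<oplus> r') \<otimes> g" using a b h h' g by (simp add: l_distr a_ac)
 moreover have "r \<oplus> r' \<in> carrier R" using a b by simp
 ultimately show "a \<oplus> b \<in> adjoin R I g" unfolding adjoin_def using ideal_add[OF I a(2) b(2)] by blast
qed

lemma adjoin_incl:
 assumes I: "ideal I R" and g: "g \<in> carrier R"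
 shows "I \<subseteq> adjoin R I g" "g \<in> adjoin R I g"
proof -
 show "I \<subseteq> adjoin R I g"
 proof
  fix h assume h: "h \<in> I"
  then have "h = h \<oplus> \<zero> \<otimes> g" using ideal_carrier[OF I] g by simp
  then show "h \<in> adjoin R I g" unfolding adjoin_def using h by blast
 qed
 have "g = \<zero> \<oplus> \<one> \<otimes> g" using g by simp
 then show "g \<in> adjoin R I g" unfolding adjoin_def using ideal_zero[OF I] one_closed by blast
qed

lemma adjoin_least:
 assumes J: "ideal J R" and "I \<subseteq> J" "g \<in> J"
 shows "adjoin R I g \<subseteq> J"
proof
 fix a assume "a \<in> adjoin R I g"
 then obtain h r where a: "a = h \<oplus> r \<otimes> g" "h \<in> I" "r \<in> carrier R" by (auto simp: adjoin_def)
 show "a \<in> J" unfolding a(1)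
  using ideal_add[OF J subsetD[OF assms(2) a(2)] ideal_mult[OF J assms(3) a(3)]] .
qed

lemma prime_one: "primeideal P R ==> \<one> \<notin> P"
 using ideal.one_imp_carrier primeideal.I_notcarr primeideal.axioms(1) by metis

lemma prime_ideal: "primeideal P R ==> ideal P R"
 by (rule primeideal.axioms(1))

lemma prime_mult_notin:
 "primeideal P R ==> a \<in> carrier R - P ==> b \<in> carrier R - P ==> a \<otimes> b \<in> carrier R - P"
 using primeideal.I_prime by fastforce

end

context noetherian_cring begin

lemma noetherian_ring: "noetherian_ring R" ..

lemma ideal_local_nakayama:
 assumes T: "primeideal T R" and x: "x \<in> T"
  and H: "ideal H R" and J: "ideal J R"
  and step: "\<And>j. j \<in> J ==> \<exists>s \<in> carrier R - T. \<exists>h \<in> H. \<exists>j' \<in> J. s \<otimes> j = h \<oplus> x \<otimes> j'"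
  and j: "j \<in> J"
 shows "\<exists>s \<in> carrier R - T. s \<otimes> j \<in> H"
 using module.local_nakayama[OF self_module noetherian_ring self_module_fg T x, of H J j] assms
 by (simp add: submodule_self_iff)

text \<open>Encodes that the module G_T/D_T over R_T is Artinian. Multipliers outside
  \<open>T\<close> take the place of denominators, so that all chains consist of ideals of
  \<open>R\<close>.\<close>

definition locally_artinian :: "'a set \<Rightarrow> 'a set \<Rightarrow> 'a set \<Rightarrow> bool" where
 "locally_artinian T D G \<longleftrightarrow>
   (\<forall>J :: nat \<Rightarrow> 'a set. (\<forall>n. ideal (J n) R \<and> D \<subseteq> J n \<and> J n \<subseteq> G \<and> J (Suc n) \<subseteq> J n) \<longrightarrow>
    (\<exists>n. \<forall>m \<ge> n. \<forall>y \<in> J n. \<exists>s \<in> carrier R - T. s \<otimes> y \<in> J m))"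

text \<open>Since \<open>T\<close> kills \<open>g\<close> modulo \<open>G\<close>, the new ideal
  exceeds \<open>G\<close> locally by at most one copy of the residue field at \<open>T\<close>. A
  chain either falls into \<open>G\<close>, or each of its members contains an element whose
  \<open>g\<close>-coefficient is outside \<open>T\<close>; with these the chain is controlled by
  its intersection with \<open>G\<close>.\<close>

lemma locally_artinian_adjoin:
 assumes T: "primeideal T R" and G: "ideal G R" "D \<subseteq> G" and art: "locally_artinian T D G"
  and g: "g \<in> carrier R" and Tg: "\<And>t. t \<in> T ==> t \<otimes> g \<in> G"
 shows "locally_artinian T D (adjoin R G g)"
 unfolding locally_artinian_def
proof (intro allI impI)
 fix J :: "nat \<Rightarrow> 'a set"
 assume J: "\<forall>n. ideal (J n) R \<and> D \<subseteq> J n \<and> J n \<subseteq> adjoin R G g \<and> J (Suc n) \<subseteq> J n"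
 have Ji: "ideal (J n) R" and DJ: "D \<subseteq> J n" and JG: "J n \<subseteq> adjoin R G g" for n using J by auto
 have dec: "J m \<subseteq> J n" if "n \<le> m" for n m
  using that J lift_Suc_antimono_le[of J] by (auto simp: antimono_def)
 note GC = ideal_carrier[OF G(1)]
 show "\<exists>n. \<forall>m \<ge> n. \<forall>y \<in> J n. \<exists>s \<in> carrier R - T. s \<otimes> y \<in> J m"
 proof (cases "\<exists>k. J k \<subseteq> G")
  case True
  then obtain k where k: "J k \<subseteq> G" by auto
  have "\<forall>n. ideal (J (k + n)) R \<and> D \<subseteq> J (k + n) \<and> J (k + n) \<subseteq> G \<and> J (k + Suc n) \<subseteq> J (k + n)"
   using Ji DJ subset_trans[OF dec k] dec by auto
  then have "\<exists>n. \<forall>m \<ge> n. \<forall>y \<in> J (k + n). \<exists>s \<in> carrier R - T. s \<otimes> y \<in> J (k + m)"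
   using art[unfolded locally_artinian_def, rule_format, of "\<lambda>n. J (k + n)"] by simp
  then obtain n where n: "\<And>m. m \<ge> n ==> \<forall>y \<in> J (k + n). \<exists>s \<in> carrier R - T. s \<otimes> y \<in> J (k + m)" by auto
  have "\<forall>y \<in> J (k + n). \<exists>s \<in> carrier R - T. s \<otimes> y \<in> J m" if "m \<ge> k + n" for m
   using n[of "m - k"] that by simp
  then show ?thesis by (intro exI[of _ "k + n"]) simp
 next
  case False
  have "\<forall>n. ideal (J n \<inter> G) R \<and> D \<subseteq> J n \<inter> G \<and> J n \<inter> G \<subseteq> G \<and> J (Suc n) \<inter> G \<subseteq> J n \<inter> G"
   using i_intersect[OF Ji G(1)] DJ G(2) Int_mono[OF dec subset_refl] by auto
  then have "\<exists>n. \<forall>m \<ge> n. \<forall>y \<in> J n \<inter> G. \<exists>s \<in> carrier R - T. s \<otimes> y \<in> J m \<inter> G"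
   using art[unfolded locally_artinian_def, rule_format, of "\<lambda>n. J n \<inter> G"] by simp
  then obtain n where n: "\<And>m. m \<ge> n ==> \<forall>y \<in> J n \<inter> G. \<exists>s \<in> carrier R - T. s \<otimes> y \<in> J m \<inter> G" by auto
  have "\<exists>s \<in> carrier R - T. s \<otimes> y \<in> J m" if m: "m \<ge> n" and y: "y \<in> J n" for m y
  proof -
   obtain z where z: "z \<in> J m" "z \<notin> G" using False by auto
   then obtain h u where u: "z = h \<oplus> u \<otimes> g" "h \<in> G" "u \<in> carrier R"
    using subsetD[OF JG z(1)] by (auto simp: adjoin_def)
   have uT: "u \<in> carrier R - T" using z(2) u Tg ideal_add[OF G(1)] by auto
   obtain h' u' where u': "y = h' \<oplus> u' \<otimes> g" "h' \<in> G" "u' \<in> carrier R"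
    using subsetD[OF JG y] by (auto simp: adjoin_def)
   have c: "h \<in> carrier R" "h' \<in> carrier R" using u u' GC by auto
   \<comment> \<open>Cross-multiplication cancels the \<open>g\<close>-parts of \<open>y\<close> and
     \<open>z\<close> and leaves an element of \<open>J n \<inter> G\<close>, where the chain is
     already locally stationary.\<close>
   have "u \<otimes> y \<ominus> u' \<otimes> z = u \<otimes> h' \<ominus> u' \<otimes> h"
    using u(1,3) u'(1,3) c g by (simp add: a_minus_def r_distr l_distr minus_add m_ac a_ac r_neg r_neg1 r_neg2)
   moreover have "u \<otimes> h' \<ominus> u' \<otimes> h \<in> G"
    using ideal_minus[OF G(1) ideal_mult[OF G(1) u'(2) u(3)] ideal_mult[OF G(1) u(2) u'(3)]] .
   moreover have "u \<otimes> y \<ominus> u' \<otimes> z \<in> J n"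
    using ideal_minus[OF Ji ideal_mult[OF Ji y u(3)] ideal_mult[OF Ji subsetD[OF dec[OF m] z(1)] u'(3)]] .
   ultimately obtain s where s: "s \<in> carrier R - T" "s \<otimes> (u \<otimes> y \<ominus> u' \<otimes> z) \<in> J m" using n[OF m] by auto
   have zy: "z \<in> carrier R" "y \<in> carrier R" using ideal_carrier[OF Ji] z y by auto
   have "(s \<otimes> u) \<otimes> y = s \<otimes> (u \<otimes> y \<ominus> u' \<otimes> z) \<oplus> (s \<otimes> u') \<otimes> z"
    using s(1) u(3) u'(3) zy by (simp add: a_minus_def r_distr r_minus m_assoc a_assoc l_neg)
   then have "(s \<otimes> u) \<otimes> y \<in> J m"
    using ideal_add[OF Ji s(2) ideal_mult[OF Ji z(1)], of "s \<otimes> u'"] s(1) u'(3) by simp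
   then show ?thesis using prime_mult_notin[OF T s(1) uT] by blast
  qed
  then show ?thesis by (intro exI[of _ n]) simp
 qed
qed

text \<open>Take \<open>G\<close> maximal with G_T/D_T Artinian. Were \<open>G\<close> inside
  \<open>T\<close>, the nonzero module R_T/G_T would have an associated prime; as \<open>T\<close>
  is minimal over \<open>D\<close>, this prime is \<open>T\<close>, and one more copy of the residue
  field could be adjoined to \<open>G\<close>. That \<open>G\<close> is not inside \<open>T\<close>
  means that R_T/D_T is Artinian.\<close>

lemma locally_artinian_minimal_prime:
 assumes T: "primeideal T R" and D: "ideal D R"
  and min: "\<And>Q. primeideal Q R ==> D \<subseteq> Q ==> Q \<subseteq> T ==> Q = T"
 shows "\<exists>G. ideal G R \<and> D \<subseteq> G \<and> locally_artinian T D G \<and> \<not> G \<subseteq> T"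
proof -
 define \<F> where "\<F> = {G. ideal G R \<and> D \<subseteq> G \<and> locally_artinian T D G}"
 have oneT: "\<one> \<in> carrier R - T" using prime_one[OF T] by simp
 have "locally_artinian T D D"
  unfolding locally_artinian_def
 proof (intro allI impI exI[of _ 0] ballI)
  fix J :: "nat \<Rightarrow> 'a set" and m y
  assume J: "\<forall>n. ideal (J n) R \<and> D \<subseteq> J n \<and> J n \<subseteq> D \<and> J (Suc n) \<subseteq> J n" and y: "y \<in> J 0"
  then have "y \<in> J m" by blast
  moreover have "y \<in> carrier R" using J y ideal_carrier by blast
  ultimately show "\<exists>s \<in> carrier R - T. s \<otimes> y \<in> J m" using oneT by (intro bexI[of _ \<one>]) auto
 qed
 then have "D \<in> \<F>" using D by (simp add: \<F>_def)
 then have "\<exists>G \<in> \<F>. \<forall>G' \<in> \<F>. G \<subseteq> G' \<longrightarrow> G' = G"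
  by (intro ideal_maximal[OF noetherian_ring]) (auto simp: \<F>_def)
 then obtain G where "G \<in> \<F>" and max: "\<And>G'. G' \<in> \<F> ==> G \<subseteq> G' ==> G' = G" by auto
 then have G: "ideal G R" "D \<subseteq> G" "locally_artinian T D G" by (auto simp: \<F>_def)
 note GC = ideal_carrier[OF G(1)]
 have "\<not> G \<subseteq> T"
 proof
  assume GT: "G \<subseteq> T"
  \<comment> \<open>The annihilator of \<open>y\<close> in R_T/G_T, contracted to \<open>R\<close>.
    Among the \<open>y\<close> that are nonzero there, collected in \<open>Y\<close>, one with a
    maximal annihilator has a prime annihilator.\<close>
  define q where "q y = {r \<in> carrier R. \<exists>s \<in> carrier R - T. s \<otimes> (r \<otimes> y) \<in> G}" for y
  define Y where "Y = {y \<in> carrier R. \<forall>s \<in> carrier R - T. s \<otimes> y \<notin> G}"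
  have q: "ideal (q y) R" if y: "y \<in> carrier R" for y
  proof (rule idealI_cring)
   show "q y \<subseteq> carrier R" by (auto simp: q_def)
   show "\<zero> \<in> q y" using oneT y ideal_zero[OF G(1)] by (auto simp: q_def intro!: bexI[of _ \<one>])
   fix a assume "a \<in> q y"
   then obtain s where s: "a \<in> carrier R" "s \<in> carrier R - T" "s \<otimes> (a \<otimes> y) \<in> G" by (auto simp: q_def)
   show "x \<otimes> a \<in> q y" if x: "x \<in> carrier R" for x
   proof -
    have "s \<otimes> ((x \<otimes> a) \<otimes> y) = x \<otimes> (s \<otimes> (a \<otimes> y))" using s y x by (simp add: m_ac)
    then show ?thesis using ideal_mult[OF G(1) s(3) x] s x by (auto simp: q_def intro!: bexI[of _ s])
   qed
   fix b assume "b \<in> q y"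
   then obtain t where t: "b \<in> carrier R" "t \<in> carrier R - T" "t \<otimes> (b \<otimes> y) \<in> G" by (auto simp: q_def)
   have "(s \<otimes> t) \<otimes> ((a \<oplus> b) \<otimes> y) = t \<otimes> (s \<otimes> (a \<otimes> y)) \<oplus> s \<otimes> (t \<otimes> (b \<otimes> y))"
    using s t y by (simp add: r_distr l_distr m_ac)
   moreover have "t \<otimes> (s \<otimes> (a \<otimes> y)) \<oplus> s \<otimes> (t \<otimes> (b \<otimes> y)) \<in> G"
    using ideal_add[OF G(1) ideal_mult[OF G(1) s(3)] ideal_mult[OF G(1) t(3)]] s(2) t(2) by simp
   ultimately show "a \<oplus> b \<in> q y"
    using prime_mult_notin[OF T s(2) t(2)] s(1) t(1) by (auto simp: q_def intro!: bexI[of _ "s \<otimes> t"])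
  qed
  have "\<one> \<in> Y" using GT by (auto simp: Y_def)
  then have "q ` Y \<noteq> {}" by auto
  then have "\<exists>Q \<in> q ` Y. \<forall>Q' \<in> q ` Y. Q \<subseteq> Q' \<longrightarrow> Q' = Q"
   by (intro ideal_maximal[OF noetherian_ring]) (auto simp: Y_def q)
  then obtain y where y: "y \<in> Y" and ymax: "\<And>z. z \<in> Y ==> q y \<subseteq> q z ==> q z = q y" by auto
  have yR: "y \<in> carrier R" using y by (simp add: Y_def)
  have yG: "s \<otimes> y \<notin> G" if "s \<in> carrier R - T" for s using y that unfolding Y_def by blast
  have qT: "q y \<subseteq> T"
  proof
   fix r assume "r \<in> q y"
   then obtain s where s: "r \<in> carrier R" "s \<in> carrier R - T" "s \<otimes> (r \<otimes> y) \<in> G" by (auto simp: q_def)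
   show "r \<in> T"
   proof (rule ccontr)
    assume "r \<notin> T"
    then have "s \<otimes> r \<in> carrier R - T" using prime_mult_notin[OF T s(2)] s(1) by blast
    then show False using yG[of "s \<otimes> r"] s yR by (simp add: m_assoc)
   qed
  qed
  have "primeideal (q y) R"
  proof (rule primeidealI[OF q[OF yR] is_cring])
   show "carrier R \<noteq> q y" using qT oneT by auto
   fix a b assume ab: "a \<in> carrier R" "b \<in> carrier R" "a \<otimes> b \<in> q y"
   show "a \<in> q y \<or> b \<in> q y"
   proof (rule disjCI)
    assume "b \<notin> q y"
    then have bY: "b \<otimes> y \<in> Y" using ab yR by (auto simp: Y_def q_def)
    have "q y \<subseteq> q (b \<otimes> y)"
    proof
     fix r assume "r \<in> q y"
     then obtain s where s: "r \<in> carrier R" "s \<in> carrier R - T" "s \<otimes> (r \<otimes> y) \<in> G" by (auto simp: q_def)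
     have "s \<otimes> (r \<otimes> (b \<otimes> y)) = b \<otimes> (s \<otimes> (r \<otimes> y))" using s ab yR by (simp add: m_ac)
     then have "s \<otimes> (r \<otimes> (b \<otimes> y)) \<in> G" using ideal_mult[OF G(1) s(3) ab(2)] by simp
     then show "r \<in> q (b \<otimes> y)" using s unfolding q_def by blast
    qed
    then have "q (b \<otimes> y) = q y" using ymax bY by auto
    moreover have "a \<in> q (b \<otimes> y)" using ab yR by (auto simp: q_def m_assoc)
    ultimately show "a \<in> q y" by simp
   qed
  qed
  moreover have "D \<subseteq> q y"
  proof
   fix r assume r: "r \<in> D"
   then have "r \<in> G" "r \<in> carrier R" using G(2) ideal_carrier[OF D] by auto
   then show "r \<in> q y" using ideal_mult'[OF G(1) _ yR] oneT yR by (auto simp: q_def intro!: bexI[of _ \<one>])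
  qed
  ultimately have Tq: "T = q y" using min qT by auto
  obtain A where A: "A \<subseteq> carrier R" "finite A" "T = Idl A" using finetely_gen[OF prime_ideal[OF T]] by auto
  have Aq: "A \<subseteq> q y" using genideal_self[OF A(1)] A(3) Tq by simp
  \<comment> \<open>One multiplier for all generators of \<open>T\<close>: after replacing
    \<open>y\<close> by s y, the ideal \<open>T\<close> multiplies it into \<open>G\<close> without
    further localization, as \<open>locally_artinian_adjoin\<close> demands.\<close>
  have "\<exists>s \<in> carrier R - T. \<forall>a \<in> A. s \<otimes> (a \<otimes> y) \<in> G"
   using A(2) Aq
  proof (induction A rule: finite_induct)
   case empty
   then show ?case using oneT by auto
  next
   case (insert b C)
   then obtain s where s: "s \<in> carrier R - T" "\<forall>b \<in> C. s \<otimes> (b \<otimes> y) \<in> G" by auto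
   obtain t where t: "b \<in> carrier R" "t \<in> carrier R - T" "t \<otimes> (b \<otimes> y) \<in> G" using insert.prems by (auto simp: q_def)
   have C: "C \<subseteq> carrier R" using insert.prems by (auto simp: q_def)
   have "(t \<otimes> s) \<otimes> (c \<otimes> y) \<in> G" if c: "c \<in> C" for c
   proof -
    have "c \<in> carrier R" using c C by auto
    then show ?thesis using ideal_mult[OF G(1), of "s \<otimes> (c \<otimes> y)" t] s c t(2) yR by (simp add: m_assoc)
   qed
   moreover have "(t \<otimes> s) \<otimes> (b \<otimes> y) = s \<otimes> (t \<otimes> (b \<otimes> y))" using s t yR by (simp add: m_ac)
   then have "(t \<otimes> s) \<otimes> (b \<otimes> y) \<in> G" using ideal_mult[OF G(1) t(3)] s(1) by simp
   ultimately show ?case using prime_mult_notin[OF T t(2) s(1)] by (intro bexI[of _ "t \<otimes> s"]) auto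
  qed
  then obtain s where s: "s \<in> carrier R - T" "\<And>a. a \<in> A ==> s \<otimes> (a \<otimes> y) \<in> G" by auto
  have sR: "s \<in> carrier R" using s by simp
  define C where "C = {r \<in> carrier R. r \<otimes> (s \<otimes> y) \<in> G}"
  have "ideal C R"
  proof (rule idealI_cring)
   show "C \<subseteq> carrier R" "\<zero> \<in> C" using ideal_zero[OF G(1)] sR yR by (auto simp: C_def)
   show "a \<oplus> b \<in> C" if "a \<in> C" "b \<in> C" for a b
    using that sR yR ideal_add[OF G(1)] by (auto simp: C_def l_distr)
   show "x \<otimes> a \<in> C" if "a \<in> C" "x \<in> carrier R" for a x
    using that sR yR ideal_mult[OF G(1)] by (auto simp: C_def m_assoc)
  qed
  moreover have "A \<subseteq> C"
  proof
   fix a assume a: "a \<in> A"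
   then have "a \<in> carrier R" using A(1) by auto
   then show "a \<in> C" using s(2)[OF a] sR yR by (simp add: C_def m_lcomm)
  qed
  ultimately have "T \<subseteq> C" unfolding A(3) by (rule genideal_minimal)
  then have Ts: "t \<otimes> (s \<otimes> y) \<in> G" if "t \<in> T" for t using that by (auto simp: C_def)
  have syR: "s \<otimes> y \<in> carrier R" using sR yR by simp
  have "locally_artinian T D (adjoin R G (s \<otimes> y))"
   by (rule locally_artinian_adjoin[OF T G(1,2,3) syR Ts])
  then have "adjoin R G (s \<otimes> y) \<in> \<F>"
   using adjoin_ideal[OF G(1) syR] adjoin_incl[OF G(1) syR] G(2) by (auto simp: \<F>_def)
  then have "adjoin R G (s \<otimes> y) = G" using max adjoin_incl[OF G(1) syR] by auto
  then show False using adjoin_incl[OF G(1) syR] yG[OF s(1)] by auto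
 qed
 then show ?thesis using G by auto
qed

text \<open>Krull's principal ideal theorem: if there were no such \<open>Q\<close>, then \<open>R/(O + xR)\<close> would be
 Artinian locally at \<open>T\<close>, so that for \<open>y \<in> P - O\<close> the chain of the ideals \<open>S n\<close>, the
 contractions of \<open>O + y\<^sup>nR\<^sub>P\<close>, would become stationary.\<close>

lemma prime_between:
 assumes O: "primeideal O' R" and P: "primeideal P R" and T: "primeideal T R"
  and OP: "O' \<subset> P" and PT: "P \<subset> T" and x: "x \<in> T"
 shows "\<exists>Q. primeideal Q R \<and> O' \<subset> Q \<and> Q \<subset> T \<and> x \<in> Q"
proof (rule ccontr)
 assume none: "\<not> ?thesis"
 have xP: "x \<notin> P" using none P OP PT by blast
 note Oi = prime_ideal[OF O] and Pi = prime_ideal[OF P] and Ti = prime_ideal[OF T]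
 have xR: "x \<in> carrier R" using ideal_carrier[OF Ti x] .
 define D where "D = adjoin R O' x"
 have Di: "ideal D R" and OD: "O' \<subseteq> D" and xD: "x \<in> D"
  using adjoin_ideal[OF Oi xR] adjoin_incl[OF Oi xR] by (auto simp: D_def)
 have "\<exists>G. ideal G R \<and> D \<subseteq> G \<and> locally_artinian T D G \<and> \<not> G \<subseteq> T"
 proof (rule locally_artinian_minimal_prime[OF T Di])
  fix Q assume Q: "primeideal Q R" "D \<subseteq> Q" "Q \<subseteq> T"
  then have "O' \<subset> Q" "x \<in> Q" using OD xD xP OP by auto
  then show "Q = T" using none Q by auto
 qed
 then obtain G where G: "ideal G R" "D \<subseteq> G" "locally_artinian T D G" "\<not> G \<subseteq> T" by auto
 then obtain g where g: "g \<in> G" "g \<in> carrier R - T" using ideal_carrier[OF G(1)] by auto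
 obtain y where y: "y \<in> P" "y \<notin> O'" using OP by auto
 have yR: "y \<in> carrier R" using ideal_carrier[OF Pi y(1)] .
 define S where "S n = {r \<in> carrier R. \<exists>u \<in> carrier R - P. \<exists>b \<in> carrier R. \<exists>h \<in> O'. u \<otimes> r = y [^] n \<otimes> b \<oplus> h}"
  for n :: nat
 have oneP: "\<one> \<in> carrier R - P" using prime_one[OF P] by simp
 have S: "ideal (S n) R" for n
 proof (rule idealI_cring)
  show "S n \<subseteq> carrier R" by (auto simp: S_def)
  have "\<one> \<otimes> \<zero> = y [^] n \<otimes> \<zero> \<oplus> \<zero>" using yR by simp
  then show "\<zero> \<in> S n" using oneP ideal_zero[OF Oi] unfolding S_def by blast
  fix a assume "a \<in> S n"
  then obtain u b h where a: "a \<in> carrier R" "u \<in> carrier R - P" "b \<in> carrier R" "h \<in> O'" "u \<otimes> a = y [^] n \<otimes> b \<oplus> h"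
   unfolding S_def by blast
  have hR: "h \<in> carrier R" using ideal_carrier[OF Oi a(4)] .
  show "c \<otimes> a \<in> S n" if c: "c \<in> carrier R" for c
  proof -
   have "u \<otimes> (c \<otimes> a) = c \<otimes> (u \<otimes> a)" using a(1,2) c by (simp add: m_ac)
   also have "\<dots> = y [^] n \<otimes> (c \<otimes> b) \<oplus> c \<otimes> h"
    unfolding a(5) using a c hR yR by (simp add: r_distr m_ac)
   finally show ?thesis unfolding S_def using a(1,2,3) c ideal_mult[OF Oi a(4) c] by blast
  qed
  fix a' assume "a' \<in> S n"
  then obtain u' b' h' where a': "a' \<in> carrier R" "u' \<in> carrier R - P" "b' \<in> carrier R" "h' \<in> O'"
    "u' \<otimes> a' = y [^] n \<otimes> b' \<oplus> h'"
   unfolding S_def by blast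
  have hR': "h' \<in> carrier R" using ideal_carrier[OF Oi a'(4)] .
  have "(u \<otimes> u') \<otimes> (a \<oplus> a') = u' \<otimes> (u \<otimes> a) \<oplus> u \<otimes> (u' \<otimes> a')"
   using a(1,2) a'(1,2) by (simp add: r_distr m_ac)
  also have "\<dots> = y [^] n \<otimes> (u' \<otimes> b \<oplus> u \<otimes> b') \<oplus> (u' \<otimes> h \<oplus> u \<otimes> h')"
   unfolding a(5) a'(5) using a(2,3) a'(2,3) hR hR' yR by (simp add: r_distr m_ac a_ac)
  finally have eq: "(u \<otimes> u') \<otimes> (a \<oplus> a') = y [^] n \<otimes> (u' \<otimes> b \<oplus> u \<otimes> b') \<oplus> (u' \<otimes> h \<oplus> u \<otimes> h')" .
  have "u' \<otimes> h \<oplus> u \<otimes> h' \<in> O'"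
   using ideal_add[OF Oi ideal_mult[OF Oi a(4)] ideal_mult[OF Oi a'(4)]] a(2) a'(2) by simp
  moreover have "a \<oplus> a' \<in> carrier R" "u' \<otimes> b \<oplus> u \<otimes> b' \<in> carrier R" using a a' by auto
  ultimately show "a \<oplus> a' \<in> S n"
   unfolding S_def using eq prime_mult_notin[OF P a(2) a'(2)] by blast
 qed
 have OS: "O' \<subseteq> S n" for n
 proof
  fix h assume h: "h \<in> O'"
  then have "\<one> \<otimes> h = y [^] n \<otimes> \<zero> \<oplus> h" using ideal_carrier[OF Oi] yR by simp
  then show "h \<in> S n" using oneP h ideal_carrier[OF Oi h] unfolding S_def by blast
 qed
 have sat: "r \<in> S n" if vP: "v \<in> carrier R - P" and vr: "v \<otimes> r \<in> S n" and rR: "r \<in> carrier R" for v r n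
 proof -
  obtain u b h where a: "u \<in> carrier R - P" "b \<in> carrier R" "h \<in> O'" "u \<otimes> (v \<otimes> r) = y [^] n \<otimes> b \<oplus> h"
   using vr unfolding S_def by blast
  then have "(u \<otimes> v) \<otimes> r = y [^] n \<otimes> b \<oplus> h" using vP rR by (simp add: m_assoc)
  then show ?thesis unfolding S_def using prime_mult_notin[OF P a(1) vP] a rR by blast
 qed
 have Sdec: "S (Suc n) \<subseteq> S n" for n
 proof
  fix r assume "r \<in> S (Suc n)"
  then obtain u b h where a: "r \<in> carrier R" "u \<in> carrier R - P" "b \<in> carrier R" "h \<in> O'"
    "u \<otimes> r = y [^] Suc n \<otimes> b \<oplus> h" unfolding S_def by blast
  then have "u \<otimes> r = y [^] n \<otimes> (y \<otimes> b) \<oplus> h" using yR by (simp add: m_assoc)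
  moreover have "y \<otimes> b \<in> carrier R" using a yR by simp
  ultimately show "r \<in> S n" unfolding S_def using a by blast
 qed
 \<comment> \<open>Intersecting with \<open>G\<close> places the chain where local stationarity is
   known. The element \<open>g\<close>, which is in \<open>G\<close> but outside \<open>T\<close>,
   will move \<open>S n\<close> into this range.\<close>
 define J where "J n = adjoin R (S n) x \<inter> G" for n
 note AS = adjoin_ideal[OF S xR] and AI = adjoin_incl[OF S xR]
 have "\<forall>n. ideal (J n) R \<and> D \<subseteq> J n \<and> J n \<subseteq> G \<and> J (Suc n) \<subseteq> J n"
 proof (intro allI conjI)
  fix n
  show "ideal (J n) R" unfolding J_def by (rule i_intersect[OF AS G(1)])
  show "J n \<subseteq> G" by (auto simp: J_def)
  have "D \<subseteq> adjoin R (S n) x"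
   unfolding D_def using adjoin_least[OF AS] OS AI by (meson subset_trans)
  then show "D \<subseteq> J n" using G(2) by (auto simp: J_def)
  have "adjoin R (S (Suc n)) x \<subseteq> adjoin R (S n) x" using Sdec by (auto simp: adjoin_def)
  then show "J (Suc n) \<subseteq> J n" by (auto simp: J_def)
 qed
 then have "\<exists>n. \<forall>m \<ge> n. \<forall>y \<in> J n. \<exists>s \<in> carrier R - T. s \<otimes> y \<in> J m"
  using G(3)[unfolded locally_artinian_def, rule_format, of J] by simp
 then obtain n where n: "\<And>z. z \<in> J n ==> \<exists>s \<in> carrier R - T. s \<otimes> z \<in> J (Suc n)" by (meson le_SucI order_refl)
 \<comment> \<open>Modulo x the chain is stationary, so locally r = h + x b with h in
   \<open>S (Suc n)\<close>. Since x is outside P and \<open>S n\<close> is saturated with respect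
   to P, also b is in \<open>S n\<close>; Nakayama then removes the term x b.\<close>
 have step: "\<exists>s \<in> carrier R - T. \<exists>h \<in> S (Suc n). \<exists>b \<in> S n. s \<otimes> r = h \<oplus> x \<otimes> b" if r: "r \<in> S n" for r
 proof -
  have rR: "r \<in> carrier R" using ideal_carrier[OF S r] .
  have gR: "g \<in> carrier R" using g by simp
  have "g \<otimes> r \<in> J n"
   using ideal_mult[OF AS subsetD[OF AI(1) r] gR] ideal_mult'[OF G(1) g(1) rR] by (simp add: J_def)
  then obtain s where s: "s \<in> carrier R - T" "s \<otimes> (g \<otimes> r) \<in> adjoin R (S (Suc n)) x" using n by (auto simp: J_def)
  then obtain z b where z: "s \<otimes> (g \<otimes> r) = z \<oplus> b \<otimes> x" "z \<in> S (Suc n)" "b \<in> carrier R"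
   by (auto simp: adjoin_def)
  have zR: "z \<in> carrier R" using ideal_carrier[OF S z(2)] .
  have sR: "s \<in> carrier R" using s by simp
  have "x \<otimes> b = s \<otimes> (g \<otimes> r) \<ominus> z"
   unfolding z(1) using zR z(3) xR by (simp add: a_minus_def m_comm a_ac r_neg r_neg1 r_neg2)
  moreover have "\<dots> \<in> S n"
   using ideal_minus[OF S ideal_mult[OF S ideal_mult[OF S r gR] sR] subsetD[OF Sdec z(2)]] .
  ultimately have "b \<in> S n" using sat[of x b n] xP xR z(3) by simp
  moreover have "(s \<otimes> g) \<otimes> r = z \<oplus> x \<otimes> b" using z(1,3) sR gR rR xR by (simp add: m_assoc m_comm[of x b])
  ultimately show ?thesis using prime_mult_notin[OF T s(1) g(2)] z(2) by blast
 qed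
 have "y [^] n \<in> S n"
 proof -
  have "\<one> \<otimes> y [^] n = y [^] n \<otimes> \<one> \<oplus> \<zero>" using yR by simp
  moreover have "y [^] n \<in> carrier R" using yR by simp
  ultimately show ?thesis using oneP ideal_zero[OF Oi] one_closed unfolding S_def by blast
 qed
 then obtain s where s: "s \<in> carrier R - T" "s \<otimes> y [^] n \<in> S (Suc n)"
  using ideal_local_nakayama[OF T x S S step] by blast
 then have "y [^] n \<in> S (Suc n)" using sat[of s "y [^] n" "Suc n"] PT yR by auto
 then obtain u b h where u: "u \<in> carrier R - P" "b \<in> carrier R" "h \<in> O'" "u \<otimes> y [^] n = y [^] Suc n \<otimes> b \<oplus> h"
  unfolding S_def by blast
 have uR: "u \<in> carrier R" and hR: "h \<in> carrier R" using u(1) ideal_carrier[OF Oi u(3)] by auto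
 have "y [^] n \<otimes> (u \<ominus> y \<otimes> b) = u \<otimes> y [^] n \<ominus> y [^] Suc n \<otimes> b"
  using uR yR u(2) by (simp add: a_minus_def r_distr r_minus m_ac)
 also have "\<dots> = h" unfolding u(4) using yR u(2) hR by (simp add: a_minus_def a_ac r_neg r_neg1 r_neg2)
 finally have "y [^] n \<otimes> (u \<ominus> y \<otimes> b) \<in> O'" using u(3) by simp
 moreover have ynO: "y [^] k \<notin> O'" for k :: nat
 proof (induction k)
  case 0
  then show ?case using prime_one[OF O] by simp
 next
  case (Suc k)
  then show ?case using primeideal.I_prime[OF O, of "y [^] k" y] y(2) yR by auto
 qed
 ultimately have "u \<ominus> y \<otimes> b \<in> O'" using primeideal.I_prime[OF O, of "y [^] n" "u \<ominus> y \<otimes> b"] yR uR u(2) by auto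
 then have "u \<ominus> y \<otimes> b \<in> P" using OP by auto
 moreover have "u = (u \<ominus> y \<otimes> b) \<oplus> y \<otimes> b" using uR yR u(2) by (simp add: a_minus_def a_assoc l_neg)
 ultimately have "u \<in> P" using ideal_add[OF Pi _ ideal_mult'[OF Pi y(1) u(2)]] by metis
 then show False using u(1) by simp
qed

section \<open>Chains of primes and systems of parameters\<close>

definition prime_chain :: "nat \<Rightarrow> (nat \<Rightarrow> 'a set) \<Rightarrow> bool" where
 "prime_chain d Q \<longleftrightarrow> (\<forall>i \<le> d. primeideal (Q i) R) \<and> (\<forall>i < d. Q i \<subset> Q (Suc i))"

text \<open>\<open>prime_between\<close> is applied from the top of the chain downwards; each
  application replaces one intermediate prime and moves \<open>x\<close> one place down. The primes
  up to index \<open>k\<close> and the top prime remain, so that earlier adjustments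
  survive.\<close>

lemma prime_chain_through:
 assumes Q: "prime_chain d Q" and x: "x \<in> Q d" and k: "k < d"
 shows "\<exists>Q'. prime_chain d Q' \<and> (\<forall>i \<le> k. Q' i = Q i) \<and> Q' d = Q d \<and> x \<in> Q' (Suc k)"
proof -
 have "\<exists>Q'. prime_chain d Q' \<and> (\<forall>i \<le> k. Q' i = Q i) \<and> Q' d = Q d \<and> x \<in> Q' (d - n)" if "n \<le> d - Suc k" for n
  using that
 proof (induction n)
  case 0
  then show ?case using Q x by auto
 next
  case (Suc n)
  then obtain Q' where Q': "prime_chain d Q'" "\<forall>i \<le> k. Q' i = Q i" "Q' d = Q d" "x \<in> Q' (d - n)" by auto
  define j where "j = d - n - 2"
  have j: "d - n = Suc (Suc j)" "d - Suc n = Suc j" "Suc (Suc j) \<le> d" "k < Suc j" using Suc.prems k by (auto simp: j_def)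
  have "\<exists>P. primeideal P R \<and> Q' j \<subset> P \<and> P \<subset> Q' (Suc (Suc j)) \<and> x \<in> P"
   using Q'(1,4) j by (intro prime_between[of _ "Q' (Suc j)"]) (auto simp: prime_chain_def)
  then obtain P where P: "primeideal P R" "Q' j \<subset> P" "P \<subset> Q' (Suc (Suc j))" "x \<in> P" by auto
  have "prime_chain d (Q'(Suc j := P))"
   using Q'(1) P j unfolding prime_chain_def by (auto simp: less_Suc_eq)
  then show ?case using Q'(2,3) P(4) j by (intro exI[of _ "Q'(Suc j := P)"]) (simp del: fun_upd_apply, simp)
 qed
 from this[of "d - Suc k"] k show ?thesis by auto
qed

lemma prime_chain_mono:
 assumes "prime_chain d Q" "i \<le> j" "j \<le> d"
 shows "Q i \<subseteq> Q j"
 using assms(2,3)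
proof (induction j)
 case (Suc j)
 show ?case
 proof (cases "i = Suc j")
  case False
  then have "Q i \<subseteq> Q j" using Suc by simp
  moreover have "Q j \<subset> Q (Suc j)" using assms(1) Suc.prems unfolding prime_chain_def by simp
  ultimately show ?thesis by blast
 qed simp
qed auto

fun adjoin_seq :: "(nat \<Rightarrow> 'a) \<Rightarrow> nat \<Rightarrow> 'a set" where
 "adjoin_seq x 0 = {\<zero>}"
| "adjoin_seq x (Suc k) = adjoin R (adjoin_seq x k) (x k)"

lemma adjoin_seq_ideal:
 assumes "\<And>i. i < k ==> x i \<in> carrier R"
 shows "ideal (adjoin_seq x k) R"
 using assms by (induction k) (auto simp: zeroideal adjoin_ideal)

lemma adjoin_seq_mem:
 assumes "\<And>i. i < k ==> x i \<in> carrier R" "i < k"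
 shows "x i \<in> adjoin_seq x k"
 using assms
proof (induction k)
 case (Suc k)
 have I: "ideal (adjoin_seq x k) R" using Suc.prems by (intro adjoin_seq_ideal) auto
 note AI = adjoin_incl[OF I, of "x k"]
 show ?case
 proof (cases "i = k")
  case True
  then show ?thesis using AI(2) Suc.prems by simp
 next
  case False
  then have "x i \<in> adjoin_seq x k" using Suc by simp
  then show ?thesis using AI(1) Suc.prems by auto
 qed
qed simp

lemma adjoin_seq_least:
 assumes "ideal J R" "\<And>i. i < k ==> x i \<in> J"
 shows "adjoin_seq x k \<subseteq> J"
 using assms(2)
proof (induction k)
 case (Suc k)
 then show ?case using adjoin_least[OF assms(1), of "adjoin_seq x k" "x k"] by simp
qed (simp add: ideal_zero[OF assms(1)])

text \<open>Pushing the parameters down the chain, one after the other, gives a chain with x_i in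
  \<open>Q' (Suc i)\<close>, hence with \<open>adjoin_seq x i\<close> inside \<open>Q' i\<close>.
  Both agree at the top, and a descending induction with Nakayama makes them agree everywhere.
  Primality of the parameter ideals thus comes from the chain itself.\<close>

lemma regular_parameters_prime:
 assumes Q: "prime_chain d Q" and m: "Q d = adjoin_seq x d"
  and xR: "\<And>i. i < d ==> x i \<in> carrier R" and unit: "\<And>s. s \<in> carrier R - Q d ==> s \<in> Units R"
  and k: "k \<le> d"
 shows "primeideal (adjoin_seq x k) R" "k < d ==> x k \<notin> adjoin_seq x k"
proof -
 have "\<exists>Q'. prime_chain d Q' \<and> Q' d = Q d \<and> (\<forall>i < k. x i \<in> Q' (Suc i))" if "k \<le> d" for k
  using that
 proof (induction k)
  case 0
  then show ?case using Q by auto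
 next
  case (Suc k)
  then obtain Q' where Q': "prime_chain d Q'" "Q' d = Q d" "\<forall>i < k. x i \<in> Q' (Suc i)" by auto
  have "x k \<in> Q' d" unfolding Q'(2) m using adjoin_seq_mem[of d x k] xR Suc.prems by auto
  then obtain Q'' where Q'': "prime_chain d Q''" "\<forall>i \<le> k. Q'' i = Q' i" "Q'' d = Q' d" "x k \<in> Q'' (Suc k)"
   using prime_chain_through[OF Q'(1), of "x k" k] Suc.prems by auto
  then show ?case using Q' by (intro exI[of _ Q'']) (auto simp: less_Suc_eq)
 qed
 from this[of d] obtain Q' where Q': "prime_chain d Q'" "Q' d = Q d" "\<And>i. i < d ==> x i \<in> Q' (Suc i)" by auto
 have prime: "primeideal (Q' i) R" if "i \<le> d" for i using Q'(1) that by (auto simp: prime_chain_def)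
 have I: "ideal (adjoin_seq x i) R" if "i \<le> d" for i using xR that by (intro adjoin_seq_ideal) auto
 have IQ: "adjoin_seq x i \<subseteq> Q' i" if "i \<le> d" for i
 proof (rule adjoin_seq_least[OF prime_ideal[OF prime[OF that]]])
  fix j assume "j < i"
  then show "x j \<in> Q' i" using Q'(3)[of j] prime_chain_mono[OF Q'(1), of "Suc j" i] that by auto
 qed
 \<comment> \<open>Equality one place higher shows that x_i is outside \<open>Q' i\<close>, since
   otherwise the inclusion would not be strict. By primality, \<open>Q' i\<close> is then
   \<open>adjoin_seq x i\<close> plus x_i times \<open>Q' i\<close>, which is the situation of
   Nakayama.\<close>
 have eq_step: "adjoin_seq x i = Q' i \<and> x i \<notin> Q' i" if i: "i < d" and IH: "adjoin_seq x (Suc i) = Q' (Suc i)" for i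
 proof -
  have strict: "Q' i \<subset> Q' (Suc i)" using Q'(1) i by (auto simp: prime_chain_def)
  have Qi: "primeideal (Q' i) R" using prime i by simp
  note Qii = prime_ideal[OF Qi]
  have xi: "x i \<notin> Q' i"
  proof
   assume "x i \<in> Q' i"
   then have "adjoin_seq x (Suc i) \<subseteq> Q' i" using adjoin_least[OF Qii] IQ[of i] i by simp
   then show False using strict IH by auto
  qed
  have "Q' i \<subseteq> adjoin_seq x i"
  proof
   fix y assume y: "y \<in> Q' i"
   have step: "\<exists>s \<in> carrier R - Q' d. \<exists>h \<in> adjoin_seq x i. \<exists>b \<in> Q' i. s \<otimes> j = h \<oplus> x i \<otimes> b" if j: "j \<in> Q' i" for j
   proof -
    have jR: "j \<in> carrier R" using ideal_carrier[OF Qii j] .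
    have "j \<in> adjoin R (adjoin_seq x i) (x i)" using strict IH j by auto
    then obtain h b where h: "j = h \<oplus> b \<otimes> x i" "h \<in> adjoin_seq x i" "b \<in> carrier R" by (auto simp: adjoin_def)
    have hR: "h \<in> carrier R" and hQ: "h \<in> Q' i" using h(2) IQ[of i] i ideal_carrier[OF Qii] by auto
    have "x i \<otimes> b = j \<ominus> h" unfolding h(1) using hR h(3) xR[OF i] by (simp add: a_minus_def m_comm a_ac r_neg r_neg1 r_neg2)
    then have "x i \<otimes> b \<in> Q' i" using ideal_minus[OF Qii j hQ] by simp
    then have "b \<in> Q' i" using primeideal.I_prime[OF Qi xR[OF i] h(3)] xi by auto
    moreover have "\<one> \<otimes> j = h \<oplus> x i \<otimes> b" using jR h xR[OF i] by (simp add: m_comm)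
    moreover have "\<one> \<in> carrier R - Q' d" using prime_one[OF prime[of d]] by simp
    ultimately show ?thesis using h(2) by blast
   qed
   have xd: "x i \<in> Q' d" using Q'(2) m adjoin_seq_mem[OF xR i] by simp
   obtain s where s: "s \<in> carrier R - Q' d" "s \<otimes> y \<in> adjoin_seq x i"
    using ideal_local_nakayama[OF prime[OF order_refl] xd I[of i] Qii step y] i by auto
   have su: "s \<in> Units R" using unit s(1) Q'(2) by simp
   have yR: "y \<in> carrier R" using ideal_carrier[OF Qii y] .
   have "inv s \<otimes> (s \<otimes> y) = y" using su s(1) yR by (simp flip: m_assoc)
   then show "y \<in> adjoin_seq x i" using ideal_mult[OF I[of i] s(2), of "inv s"] su i by auto
  qed
  then show ?thesis using IQ[of i] i xi by auto
 qed
 have eq: "adjoin_seq x i = Q' i" if "i \<le> d" for i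
  using that
 proof (induction rule: inc_induct)
  case base
  then show ?case using m Q'(2) by simp
 next
  case (step i)
  then show ?case using eq_step by blast
 qed
 show "primeideal (adjoin_seq x k) R" using eq[OF k] prime[OF k] by simp
 show "x k \<notin> adjoin_seq x k" if "k < d" using eq_step[OF that eq] that eq[OF k] by simp
qed

end

section \<open>Frobenius bases of regular local rings\<close>

locale noetherian_char = noetherian_cring R + cring_char R p for R (structure) and p

context cring_char begin

text \<open>An R-linear combination in F_*R, where scalars act through their p-th powers. The lemmas
  about it ask for values in the ring at all indices, which avoids restricting coefficient functions
  to \<open>U\<close>.\<close>

definition fcomb :: "'i set \<Rightarrow> ('i \<Rightarrow> 'a) \<Rightarrow> ('i \<Rightarrow> 'a) \<Rightarrow> 'a" where
 "fcomb U b c = (\<Oplus>u\<in>U. c u [^] p \<otimes> b u)"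

lemma frob_add: "a \<in> carrier R ==> b \<in> carrier R ==> (a \<oplus> b) [^] p = a [^] p \<oplus> b [^] p"
 using frobenius_add[of a b 1] by simp

lemma frob_zero [simp]: "\<zero> [^] p = \<zero>"
 using frobenius_zero[of 1] by simp

lemma fcomb_closed:
 assumes "\<forall>u. b u \<in> carrier R" "\<forall>u. c u \<in> carrier R"
 shows "fcomb U b c \<in> carrier R"
 unfolding fcomb_def using assms by (intro finsum_closed) auto

lemma fcomb_cong:
 assumes "\<And>u. u \<in> U ==> c u = c' u" "\<forall>u. b u \<in> carrier R" "\<forall>u. c' u \<in> carrier R"
 shows "fcomb U b c = fcomb U b c'"
 unfolding fcomb_def using assms by (intro finsum_cong') auto

lemma fcomb_add:
 assumes "\<forall>u. b u \<in> carrier R" "\<forall>u. c u \<in> carrier R" "\<forall>u. c' u \<in> carrier R"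
 shows "fcomb U b (\<lambda>u. c u \<oplus> c' u) = fcomb U b c \<oplus> fcomb U b c'"
proof -
 have "fcomb U b (\<lambda>u. c u \<oplus> c' u) = (\<Oplus>u\<in>U. c u [^] p \<otimes> b u \<oplus> c' u [^] p \<otimes> b u)"
  unfolding fcomb_def using assms by (intro finsum_cong') (auto simp: frob_add l_distr)
 also have "\<dots> = fcomb U b c \<oplus> fcomb U b c'"
  unfolding fcomb_def using assms by (intro finsum_addf) auto
 finally show ?thesis .
qed

lemma fcomb_smult:
 assumes "finite U" "\<forall>u. b u \<in> carrier R" "\<forall>u. c u \<in> carrier R" "a \<in> carrier R"
 shows "fcomb U b (\<lambda>u. a \<otimes> c u) = a [^] p \<otimes> fcomb U b c"
proof -
 have "a [^] p \<otimes> fcomb U b c = (\<Oplus>u\<in>U. a [^] p \<otimes> (c u [^] p \<otimes> b u))"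
  unfolding fcomb_def using assms by (intro finsum_rdistr) auto
 also have "\<dots> = fcomb U b (\<lambda>u. a \<otimes> c u)"
  unfolding fcomb_def using assms by (intro finsum_cong') (auto simp: nat_pow_distrib m_assoc)
 finally show ?thesis by simp
qed

lemma fcomb_zero: "\<lbrakk>\<And>u. u \<in> U ==> c u = \<zero>; \<And>u. b u \<in> carrier R\<rbrakk> \<Longrightarrow> fcomb U b c = \<zero>"
 unfolding fcomb_def by (rule add.finprod_one_eqI) simp

lemma fcomb_single:
 assumes "finite U" "u \<in> U" "\<forall>u. b u \<in> carrier R" "a \<in> carrier R"
 shows "fcomb U b (\<lambda>v. if v = u then a else \<zero>) = a [^] p \<otimes> b u"
proof -
 have "fcomb U b (\<lambda>v. if v = u then a else \<zero>) = (\<Oplus>v\<in>U. if v = u then a [^] p \<otimes> b v else \<zero>)"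
  unfolding fcomb_def using assms by (intro finsum_cong') auto
 also have "\<dots> = a [^] p \<otimes> b u"
  using assms by (intro add.finprod_singleton_swap) auto
 finally show ?thesis .
qed

lemma ideal_frob: "ideal I R ==> a \<in> I ==> a [^] p \<in> I"
proof -
 assume I: "ideal I R" and a: "a \<in> I"
 obtain q where "p = Suc q" using p_pos gr0_implies_Suc by blast
 then show ?thesis using ideal_mult[OF I a, of "a [^] q"] ideal_carrier[OF I a] by simp
qed

lemma ideal_finsum:
 assumes I: "ideal I R" and "finite U" "\<And>u. u \<in> U ==> g u \<in> I"
 shows "(\<Oplus>u\<in>U. g u) \<in> I"
 using assms(2,3)
proof (induction U rule: finite_induct)
 case (insert u U)
 then have "g \<in> U \<rightarrow> carrier R" "g u \<in> carrier R" using ideal_carrier[OF I] by auto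
 then show ?case using insert ideal_add[OF I] by simp
qed (simp add: ideal_zero[OF I])

lemma fcomb_ideal:
 assumes I: "ideal I R" and "finite U" "\<forall>u. b u \<in> carrier R" "\<forall>u \<in> U. c u \<in> I"
 shows "fcomb U b c \<in> I"
 unfolding fcomb_def using assms by (intro ideal_finsum[OF I] ideal_mult'[OF I] ideal_frob[OF I]) auto

text \<open>\<open>fbasis I U b\<close> says that the \<open>b u\<close> form a basis of \<open>F\<^sub>*(R/I)\<close> over \<open>R/I\<close>.\<close>

definition fbasis :: "'a set \<Rightarrow> 'i set \<Rightarrow> ('i \<Rightarrow> 'a) \<Rightarrow> bool" where
 "fbasis I U b \<longleftrightarrow> finite U \<and> (\<forall>u. b u \<in> carrier R) \<and>
   (\<forall>r \<in> carrier R. \<exists>c i. (\<forall>u. c u \<in> carrier R) \<and> i \<in> I \<and> r = fcomb U b c \<oplus> i) \<and>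
   (\<forall>c. (\<forall>u. c u \<in> carrier R) \<and> fcomb U b c \<in> I \<longrightarrow> (\<forall>u \<in> U. c u \<in> I))"

text \<open>Combinations of the elements b u x^j with j < n, arranged by powers of \<open>x\<close>:
  expansion along \<open>x\<close> and cyclic shifts of relations act on this outer index
  only.\<close>

fun gcomb :: "'i list set \<Rightarrow> ('i list \<Rightarrow> 'a) \<Rightarrow> 'a \<Rightarrow> (nat \<Rightarrow> 'i list \<Rightarrow> 'a) \<Rightarrow> nat \<Rightarrow> 'a" where
 "gcomb U b x c 0 = \<zero>"
| "gcomb U b x c (Suc n) = gcomb U b x c n \<oplus> x [^] n \<otimes> fcomb U b (c n)"

lemma gcomb_closed:
 assumes "\<forall>u. b u \<in> carrier R" "\<forall>j u. c j u \<in> carrier R" "x \<in> carrier R"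
 shows "gcomb U b x c n \<in> carrier R"
proof (induction n)
 case (Suc n)
 then show ?case using fcomb_closed[OF assms(1), of "c n"] assms by simp
qed simp

lemma gcomb_cong:
 assumes "\<And>j u. j < n ==> c j u = c' j u"
 shows "gcomb U b x c n = gcomb U b x c' n"
 using assms
proof (induction n)
 case (Suc n)
 have "c n = c' n" using Suc.prems by auto
 then show ?case using Suc by simp
qed simp

lemma gcomb_add:
 assumes "\<forall>u. b u \<in> carrier R" "\<forall>j u. c j u \<in> carrier R" "\<forall>j u. c' j u \<in> carrier R" "x \<in> carrier R"
 shows "gcomb U b x (\<lambda>j u. c j u \<oplus> c' j u) n = gcomb U b x c n \<oplus> gcomb U b x c' n"
proof (induction n)
 case (Suc n)
 have "gcomb U b x c n \<in> carrier R" "gcomb U b x c' n \<in> carrier R"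
  "fcomb U b (c n) \<in> carrier R" "fcomb U b (c' n) \<in> carrier R"
  using gcomb_closed[OF assms(1,2,4)] gcomb_closed[OF assms(1,3,4)]
   fcomb_closed[OF assms(1), of "c n"] fcomb_closed[OF assms(1), of "c' n"] assms by auto
 then show ?case using Suc assms(4) fcomb_add[OF assms(1), of "c n" "c' n" U] assms(2,3) by (simp add: r_distr a_ac)
qed simp

lemma gcomb_smult:
 assumes "finite U" "\<forall>u. b u \<in> carrier R" "\<forall>j u. c j u \<in> carrier R" "x \<in> carrier R" "a \<in> carrier R"
 shows "gcomb U b x (\<lambda>j u. a \<otimes> c j u) n = a [^] p \<otimes> gcomb U b x c n"
proof (induction n)
 case (Suc n)
 have "gcomb U b x c n \<in> carrier R" "fcomb U b (c n) \<in> carrier R"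
  using gcomb_closed[OF assms(2,3,4)] fcomb_closed[OF assms(2), of "c n"] assms by auto
 then show ?case using Suc assms(4,5) fcomb_smult[OF assms(1,2), of "c n" a] assms(3)
  by (simp add: r_distr m_lcomm)
qed (use assms in simp)

lemma gcomb_front:
 assumes "\<forall>u. b u \<in> carrier R" "\<forall>j u. c j u \<in> carrier R" "x \<in> carrier R"
 shows "gcomb U b x c (Suc n) = fcomb U b (c 0) \<oplus> x \<otimes> gcomb U b x (\<lambda>j. c (Suc j)) n"
proof (induction n)
 case 0
 then show ?case using fcomb_closed[OF assms(1), of "c 0"] assms(2,3) by simp
next
 case (Suc n)
 have cl: "fcomb U b (c j) \<in> carrier R" "gcomb U b x (\<lambda>j. c (Suc j)) n \<in> carrier R" for j
  using gcomb_closed[OF assms(1) _ assms(3), of "\<lambda>j. c (Suc j)"] fcomb_closed[OF assms(1), of "c j"] assms(2) by auto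
 have "gcomb U b x c (Suc (Suc n)) = gcomb U b x c (Suc n) \<oplus> x [^] Suc n \<otimes> fcomb U b (c (Suc n))" by simp
 also have "\<dots> = fcomb U b (c 0) \<oplus> x \<otimes> (gcomb U b x (\<lambda>j. c (Suc j)) n \<oplus> x [^] n \<otimes> fcomb U b (c (Suc n)))"
  unfolding Suc using cl assms(3) by (simp add: r_distr a_assoc m_ac)
 finally show ?case by simp
qed

lemma gcomb_ideal:
 assumes I: "ideal I R" and "finite U" "\<forall>u. b u \<in> carrier R" "x \<in> carrier R"
  "\<forall>j < n. \<forall>u \<in> U. c j u \<in> I"
 shows "gcomb U b x c n \<in> I"
 using assms(5)
proof (induction n)
 case (Suc n)
 have "fcomb U b (c n) \<in> I" using fcomb_ideal[OF I assms(2,3), of "c n"] Suc.prems by simp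
 then have "x [^] n \<otimes> fcomb U b (c n) \<in> I" using ideal_mult[OF I] assms(4) by simp
 then show ?case using Suc ideal_add[OF I] by simp
qed (simp add: ideal_zero[OF I])

text \<open>An index is a list whose head is the exponent of \<open>x\<close>. Passing to one more
  parameter prepends an exponent, so the type of indices stays the same in the induction over the
  parameters.\<close>

lemma gcomb_fcomb:
 assumes U: "finite U" and b: "\<forall>u. b u \<in> carrier R" and c: "\<forall>w. c w \<in> carrier R" and x: "x \<in> carrier R"
 shows "fcomb {j # u | j u. j < n \<and> u \<in> U} (\<lambda>w. b (tl w) \<otimes> x [^] (hd w :: nat)) c
  = gcomb U b x (\<lambda>j u. c (j # u)) n"
proof (induction n)
 case 0
 have "{j # u | j u. j < (0::nat) \<and> u \<in> U} = {}" by auto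
 then show ?case by (simp add: fcomb_def)
next
 case (Suc n)
 let ?V = "\<lambda>n. {j # u | j u. j < (n::nat) \<and> u \<in> U}"
 let ?b = "\<lambda>w. b (tl w) \<otimes> x [^] (hd w :: nat)"
 have V: "?V (Suc n) = ?V n \<union> (#) n ` U" by (auto simp: less_Suc_eq)
 have fin: "finite (?V n)" for n
 proof -
  have "?V n = (\<lambda>(j, u). j # u) ` ({..<n} \<times> U)" by auto
  then show ?thesis using U by simp
 qed
 have "fcomb (?V (Suc n)) ?b c = fcomb (?V n) ?b c \<oplus> fcomb ((#) n ` U) ?b c"
  unfolding V fcomb_def by (rule finsum_Un_disjoint) (use fin U b c x in auto)
 moreover have "fcomb ((#) n ` U) ?b c = x [^] n \<otimes> fcomb U b (\<lambda>u. c (n # u))"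
 proof -
  have "fcomb ((#) n ` U) ?b c = (\<Oplus>u\<in>U. c (n # u) [^] p \<otimes> (b u \<otimes> x [^] n))"
   unfolding fcomb_def using b c x by (subst finsum_reindex) (auto simp: inj_on_def)
  also have "\<dots> = (\<Oplus>u\<in>U. x [^] n \<otimes> (c (n # u) [^] p \<otimes> b u))"
   using b c x by (intro finsum_cong') (auto simp: m_ac)
  also have "\<dots> = x [^] n \<otimes> fcomb U b (\<lambda>u. c (n # u))"
   unfolding fcomb_def using b c x U by (intro finsum_rdistr[symmetric]) auto
  finally show ?thesis .
 qed
 ultimately show ?case using Suc by simp
qed

end

section \<open>Lifting a Frobenius basis along a parameter\<close>

context noetherian_char begin

definition F_fin :: bool where
 "F_fin \<longleftrightarrow> finitely_generated R (frobenius_push p 1 R (self_module R))"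

abbreviation "FR \<equiv> frobenius_push p 1 R (self_module R)"

lemma FR_module: "module R FR"
 by (rule frobenius_push_module[OF self_module])

text \<open>Repeated expansion modulo I + xR writes \<open>r\<close>, up to an element of
  \<open>I\<close>, as a combination of the b u x^j with j < n plus x^n y. For n = p the remainder
  x^p y is the scalar x acting on y in F_*R, so that Nakayama over the local ring disposes of
  it.\<close>

lemma fbasis_step_span:
 assumes T: "primeideal T R" and unit: "\<And>s. s \<in> carrier R - T ==> s \<in> Units R"
  and I: "ideal I R" and x: "x \<in> T" and fin: F_fin and B: "fbasis (adjoin R I x) U b"
  and r: "r \<in> carrier R"
 shows "\<exists>c i. (\<forall>j u. c j u \<in> carrier R) \<and> i \<in> I \<and> r = gcomb U b x c p \<oplus> i"
proof -
 note Ti = prime_ideal[OF T]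
 have xR: "x \<in> carrier R" using ideal_carrier[OF Ti x] .
 have U: "finite U" and b: "\<forall>u. b u \<in> carrier R"
  and sp: "\<And>r. r \<in> carrier R ==> \<exists>c i. (\<forall>u. c u \<in> carrier R) \<and> i \<in> adjoin R I x \<and> r = fcomb U b c \<oplus> i"
  using B by (auto simp: fbasis_def)
 have ex: "\<exists>c i y. (\<forall>j u. c j u \<in> carrier R) \<and> i \<in> I \<and> y \<in> carrier R \<and> r = (gcomb U b x c n \<oplus> i) \<oplus> x [^] n \<otimes> y"
  if r: "r \<in> carrier R" for r n
 proof (induction n)
  case 0
  have "r = (gcomb U b x (\<lambda>_ _. \<zero>) 0 \<oplus> \<zero>) \<oplus> x [^] (0::nat) \<otimes> r" using r by simp
  then show ?case using ideal_zero[OF I] r by (intro exI[of _ "\<lambda>_ _. \<zero>"]) blast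
 next
  case (Suc n)
  then obtain c i y where c: "\<forall>j u. c j u \<in> carrier R" "i \<in> I" "y \<in> carrier R"
   "r = (gcomb U b x c n \<oplus> i) \<oplus> x [^] n \<otimes> y" by blast
  obtain c0 i0 where c0: "\<forall>u. c0 u \<in> carrier R" "i0 \<in> adjoin R I x" "y = fcomb U b c0 \<oplus> i0"
   using sp[OF c(3)] by blast
  obtain h z where h: "i0 = h \<oplus> z \<otimes> x" "h \<in> I" "z \<in> carrier R" using c0(2) by (auto simp: adjoin_def)
  define c' where "c' j = (if j = n then c0 else c j)" for j
  have c'R: "\<forall>j u. c' j u \<in> carrier R" using c(1) c0(1) by (auto simp: c'_def)
  have g': "gcomb U b x c' n = gcomb U b x c n" by (rule gcomb_cong) (simp add: c'_def)
  have cl: "gcomb U b x c n \<in> carrier R" "fcomb U b c0 \<in> carrier R" "i \<in> carrier R" "h \<in> carrier R"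
   using gcomb_closed[OF b c(1) xR] fcomb_closed[OF b c0(1)] ideal_carrier[OF I] c(2) h(2) by auto
  have "r = (gcomb U b x c' (Suc n) \<oplus> (i \<oplus> x [^] n \<otimes> h)) \<oplus> x [^] Suc n \<otimes> z"
   unfolding c(4) c0(3) h(1) using g' cl h(3) xR by (simp add: c'_def r_distr a_ac m_ac)
  moreover have "i \<oplus> x [^] n \<otimes> h \<in> I" using ideal_add[OF I c(2) ideal_mult[OF I h(2)]] xR by simp
  ultimately show ?case using c'R h(3) by blast
 qed
 define H where "H = {gcomb U b x c p \<oplus> i | c i. (\<forall>j u. c j u \<in> carrier R) \<and> i \<in> I}"
 interpret F: module R FR by (rule FR_module)
 have H: "submodule H R FR"
 proof (rule F.submoduleI)
  show "H \<subseteq> carrier FR" using gcomb_closed[OF b _ xR] ideal_carrier[OF I] by (auto simp: H_def)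
  have "\<zero> = gcomb U b x (\<lambda>_ _. \<zero>) p \<oplus> \<zero>"
   using gcomb_ideal[OF zeroideal U b xR, of p "\<lambda>_ _. \<zero>"] by simp
  then show "\<zero>\<^bsub>FR\<^esub> \<in> H" unfolding H_def using ideal_zero[OF I] by auto
  show sm: "a *[FR] h \<in> H" if a: "a \<in> carrier R" and "h \<in> H" for a h
  proof -
   obtain c i where c: "\<forall>j u. c j u \<in> carrier R" "i \<in> I" "h = gcomb U b x c p \<oplus> i"
    using \<open>h \<in> H\<close> unfolding H_def by blast
   have cl: "gcomb U b x c p \<in> carrier R" "i \<in> carrier R" using gcomb_closed[OF b c(1) xR] ideal_carrier[OF I c(2)] by auto
   have "a *[FR] h = gcomb U b x (\<lambda>j u. a \<otimes> c j u) p \<oplus> a [^] p \<otimes> i"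
    unfolding c(3) using cl a gcomb_smult[OF U b c(1) xR a, where n = p] by (simp add: r_distr)
   moreover have "\<forall>j u. a \<otimes> c j u \<in> carrier R" using a c(1) by auto
   moreover have "a [^] p \<otimes> i \<in> I" using ideal_mult[OF I c(2)] a by simp
   ultimately show ?thesis unfolding H_def by (intro CollectI exI conjI) auto
  qed
  show "\<ominus>\<^bsub>FR\<^esub> a \<in> H" if a: "a \<in> H" for a
  proof -
   have "a \<in> carrier FR" using gcomb_closed[OF b _ xR] ideal_carrier[OF I] a by (auto simp: H_def)
   then have "\<ominus>\<^bsub>FR\<^esub> a = (\<ominus> \<one>) *[FR] a" using F.smult_l_minus[OF one_closed] F.smult_one by simp
   then show ?thesis using sm[OF _ a, of "\<ominus> \<one>"] by simp
  qed
  fix h h' assume "h \<in> H" "h' \<in> H"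
  then obtain c i c' i' where c: "\<forall>j u. c j u \<in> carrier R" "i \<in> I" "h = gcomb U b x c p \<oplus> i"
   and c': "\<forall>j u. c' j u \<in> carrier R" "i' \<in> I" "h' = gcomb U b x c' p \<oplus> i'"
   unfolding H_def by blast
  have cl: "gcomb U b x c p \<in> carrier R" "i \<in> carrier R" "gcomb U b x c' p \<in> carrier R" "i' \<in> carrier R"
   using gcomb_closed[OF b c(1) xR] gcomb_closed[OF b c'(1) xR] ideal_carrier[OF I] c(2) c'(2) by auto
  have "h +[FR] h' = gcomb U b x (\<lambda>j u. c j u \<oplus> c' j u) p \<oplus> (i \<oplus> i')"
   unfolding c(3) c'(3) using cl gcomb_add[OF b c(1) c'(1) xR, where n = p] by (simp add: a_ac)
  moreover have "\<forall>j u. c j u \<oplus> c' j u \<in> carrier R" using c c' by auto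
  ultimately show "h +[FR] h' \<in> H" unfolding H_def using ideal_add[OF I c(2) c'(2)]
   by (intro CollectI exI conjI) auto
 qed
 have step: "\<exists>s \<in> carrier R - T. \<exists>h \<in> H. \<exists>j' \<in> carrier FR. s *[FR] j = h +[FR] x *[FR] j'"
  if j: "j \<in> carrier FR" for j
 proof -
  obtain c i y where c: "\<forall>j u. c j u \<in> carrier R" "i \<in> I" "y \<in> carrier R"
   "j = (gcomb U b x c p \<oplus> i) \<oplus> x [^] p \<otimes> y" using ex[of j p] j by auto
  have "gcomb U b x c p \<oplus> i \<in> H" using c unfolding H_def by blast
  moreover have "\<one> *[FR] j = (gcomb U b x c p \<oplus> i) +[FR] x *[FR] y"
   using c(4) j by simp
  moreover have "\<one> \<in> carrier R - T" using prime_one[OF T] by simp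
  moreover have "y \<in> carrier FR" using c(3) by simp
  ultimately show ?thesis by blast
 qed
 have "r \<in> carrier FR" using r by simp
 from F.local_nakayama[OF noetherian_ring fin[unfolded F_fin_def] T x H F.carrier_is_submodule step this]
 obtain s where s: "s \<in> carrier R - T" "s *[FR] r \<in> H" by blast
 have su: "s \<in> Units R" using unit s(1) by auto
 have "inv s *[FR] (s *[FR] r) = (inv s \<otimes> s) *[FR] r"
  using su s(1) r by (intro F.smult_assoc1[symmetric]) auto
 also have "\<dots> = r" using su r by simp
 finally have "r \<in> H" using F.submodule_props(4)[OF H _ s(2), of "inv s"] su by simp
 then show ?thesis by (auto simp: H_def)
qed

text \<open>A relation modulo \<open>I\<close> among the \<open>p |U|\<close> elements \<open>b u x\<^sup>j\<close> can be divided by \<open>x\<close>, which shifts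
 its coefficients cyclically in \<open>j\<close>; after \<open>p\<close> such divisions every coefficient has been divided by \<open>x\<close>.\<close>

lemma relation_shift:
 assumes I: "primeideal I R" and xR: "x \<in> carrier R" and xI: "x \<notin> I" and B: "fbasis (adjoin R I x) U b"
  and c: "\<forall>j u. c j u \<in> carrier R" and rel: "gcomb U b x c p \<in> I"
 shows "\<exists>c'. (\<forall>j u. c' j u \<in> carrier R) \<and> gcomb U b x c' p \<in> I \<and>
  (\<forall>u \<in> U. (\<forall>j. Suc j < p \<longrightarrow> c' j u = c (Suc j) u) \<and> (\<exists>h \<in> I. c 0 u = h \<oplus> x \<otimes> c' (p - 1) u))"
proof -
 note Ii = prime_ideal[OF I]
 have U: "finite U" and b: "\<forall>u. b u \<in> carrier R"
  and ind: "\<And>c. (\<forall>u. c u \<in> carrier R) ==> fcomb U b c \<in> adjoin R I x ==> (\<forall>u \<in> U. c u \<in> adjoin R I x)"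
  using B by (auto simp: fbasis_def)
 note AI = adjoin_ideal[OF Ii xR] and incl = adjoin_incl[OF Ii xR]
 obtain q where q: "p = Suc q" using p_pos gr0_implies_Suc by blast
 let ?s = "gcomb U b x (\<lambda>j. c (Suc j)) q"
 have cl: "fcomb U b (c 0) \<in> carrier R" "?s \<in> carrier R" "gcomb U b x c p \<in> carrier R"
  using gcomb_closed[OF b c xR] gcomb_closed[OF b _ xR, of "\<lambda>j. c (Suc j)"] fcomb_closed[OF b, of "c 0"] c by auto
 have front: "gcomb U b x c p = fcomb U b (c 0) \<oplus> x \<otimes> ?s"
  using gcomb_front[OF b c xR, of U q] by (simp only: q[symmetric])
 have "fcomb U b (c 0) = gcomb U b x c p \<ominus> x \<otimes> ?s"
  unfolding front using cl xR by (simp add: a_minus_def a_assoc r_neg)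
 moreover have "gcomb U b x c p \<ominus> x \<otimes> ?s \<in> adjoin R I x"
  using ideal_minus[OF AI subsetD[OF incl(1) rel] ideal_mult'[OF AI incl(2) cl(2)]] .
 ultimately have "\<forall>u \<in> U. c 0 u \<in> adjoin R I x" using ind[of "c 0"] c by simp
 then have "\<forall>u \<in> U. \<exists>h r. c 0 u = h \<oplus> r \<otimes> x \<and> h \<in> I \<and> r \<in> carrier R" by (auto simp: adjoin_def)
 then obtain h0 r0 where hr: "\<And>u. u \<in> U ==> c 0 u = h0 u \<oplus> r0 u \<otimes> x \<and> h0 u \<in> I \<and> r0 u \<in> carrier R" by metis
 define h where "h u = (if u \<in> U then h0 u else \<zero>)" for u
 define r where "r u = (if u \<in> U then r0 u else \<zero>)" for u
 have h: "\<forall>u. h u \<in> I" "\<forall>u. h u \<in> carrier R" "\<forall>u. r u \<in> carrier R" "\<And>u. u \<in> U ==> c 0 u = h u \<oplus> x \<otimes> r u"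
  using hr xR ideal_zero[OF Ii] ideal_carrier[OF Ii] by (auto simp: h_def r_def m_comm)
 have "fcomb U b (c 0) = fcomb U b (\<lambda>u. h u \<oplus> x \<otimes> r u)"
  by (rule fcomb_cong) (use h b xR in auto)
 also have "\<dots> = fcomb U b h \<oplus> x [^] p \<otimes> fcomb U b r"
  using fcomb_add[OF b h(2), of "\<lambda>u. x \<otimes> r u" U] fcomb_smult[OF U b h(3) xR] h(3) xR by simp
 finally have S0: "fcomb U b (c 0) = fcomb U b h \<oplus> x [^] p \<otimes> fcomb U b r" .
 define c' where "c' j = (if j = q then r else c (Suc j))" for j
 have c'R: "\<forall>j u. c' j u \<in> carrier R" using c h(3) by (auto simp: c'_def)
 have "gcomb U b x c' q = ?s" by (rule gcomb_cong) (simp add: c'_def)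
 then have "gcomb U b x c' (Suc q) = ?s \<oplus> x [^] q \<otimes> fcomb U b r" by (simp add: c'_def)
 then have g': "gcomb U b x c' p = ?s \<oplus> x [^] q \<otimes> fcomb U b r" by (simp only: q[symmetric])
 have "x [^] Suc q = x \<otimes> x [^] q" using xR by (simp add: m_comm)
 then have xp: "x [^] p = x \<otimes> x [^] q" by (simp only: q[symmetric])
 have fcl: "fcomb U b h \<in> carrier R" "fcomb U b r \<in> carrier R" using fcomb_closed[OF b h(2)] fcomb_closed[OF b h(3)] by auto
 have "x \<otimes> gcomb U b x c' p = gcomb U b x c p \<ominus> fcomb U b h"
  unfolding front S0 g' xp using fcl cl xR
  by (simp add: a_minus_def r_distr a_ac m_ac r_neg r_neg1 r_neg2)
 moreover have "\<dots> \<in> I" using ideal_minus[OF Ii rel fcomb_ideal[OF Ii U b, of h]] h(1) by simp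
 ultimately have "gcomb U b x c' p \<in> I"
  using primeideal.I_prime[OF I xR gcomb_closed[OF b c'R xR]] xI by metis
 then show ?thesis using c'R h q by (intro exI[of _ c']) (auto simp: c'_def)
qed

text \<open>After n shifts position j holds the coefficient that started at j + n, and those that
  have wrapped around have been divided by \<open>x\<close> once, modulo \<open>I\<close>. After p
  shifts every coefficient is back at its place and has wrapped around exactly once.\<close>

lemma relation_divide:
 assumes I: "primeideal I R" and xR: "x \<in> carrier R" and xI: "x \<notin> I" and B: "fbasis (adjoin R I x) U b"
  and c: "\<forall>j u. c j u \<in> carrier R" and rel: "gcomb U b x c p \<in> I"
 shows "\<exists>c'. (\<forall>j u. c' j u \<in> carrier R) \<and> gcomb U b x c' p \<in> I \<and>
  (\<forall>u \<in> U. \<forall>j < p. \<exists>h \<in> I. c j u = h \<oplus> x \<otimes> c' j u)"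
proof -
 have "\<exists>c'. (\<forall>j u. c' j u \<in> carrier R) \<and> gcomb U b x c' p \<in> I \<and>
  (\<forall>u \<in> U. \<forall>j < p. (j + n < p \<longrightarrow> c' j u = c (j + n) u) \<and>
   (p \<le> j + n \<longrightarrow> (\<exists>h \<in> I. c (j + n - p) u = h \<oplus> x \<otimes> c' j u)))" if "n \<le> p" for n
  using that
 proof (induction n)
  case 0
  then show ?case using c rel by (intro exI[of _ c]) auto
 next
  case (Suc n)
  then obtain c' where cc: "\<forall>j u. c' j u \<in> carrier R" "gcomb U b x c' p \<in> I"
   "\<forall>u \<in> U. \<forall>j < p. (j + n < p \<longrightarrow> c' j u = c (j + n) u) \<and>
    (p \<le> j + n \<longrightarrow> (\<exists>h \<in> I. c (j + n - p) u = h \<oplus> x \<otimes> c' j u))"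
   by auto
  then have c': "\<forall>j u. c' j u \<in> carrier R" "gcomb U b x c' p \<in> I"
   "\<And>u j. u \<in> U ==> j < p ==> j + n < p ==> c' j u = c (j + n) u"
   "\<And>u j. u \<in> U ==> j < p ==> p \<le> j + n ==> \<exists>h \<in> I. c (j + n - p) u = h \<oplus> x \<otimes> c' j u"
   by auto
  obtain c'' where c'': "\<forall>j u. c'' j u \<in> carrier R" "gcomb U b x c'' p \<in> I"
   "\<And>u j. u \<in> U ==> Suc j < p ==> c'' j u = c' (Suc j) u"
   "\<And>u. u \<in> U ==> \<exists>h \<in> I. c' 0 u = h \<oplus> x \<otimes> c'' (p - 1) u"
   using relation_shift[OF I xR xI B c'(1,2)] by auto
  have "(j + Suc n < p \<longrightarrow> c'' j u = c (j + Suc n) u) \<and>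
   (p \<le> j + Suc n \<longrightarrow> (\<exists>h \<in> I. c (j + Suc n - p) u = h \<oplus> x \<otimes> c'' j u))" if u: "u \<in> U" and j: "j < p" for u j
  proof (cases "Suc j < p")
   case True
   then show ?thesis using c''(3)[OF u True] c'(3)[OF u True] c'(4)[OF u True] by auto
  next
   case False
   then have "j = p - 1" "j + Suc n - p = n" using j by auto
   then show ?thesis using c''(4)[OF u] c'(3)[OF u, of 0] Suc.prems p_pos by auto
  qed
  then show ?case using c''(1,2) by (intro exI[of _ c'']) auto
 qed
 from this[of p] show ?thesis by auto
qed

text \<open>For a fixed position, the coefficients occurring there in relations modulo
  \<open>I\<close> form an ideal \<open>Z\<close>. Division of relations by \<open>x\<close> shows
  that \<open>Z\<close> is contained in I + xZ, and Nakayama gives that it is contained in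
  \<open>I\<close>.\<close>

lemma fbasis_step_indep:
 assumes T: "primeideal T R" and unit: "\<And>s. s \<in> carrier R - T ==> s \<in> Units R"
  and I: "primeideal I R" and x: "x \<in> T" and xI: "x \<notin> I" and B: "fbasis (adjoin R I x) U b"
  and c: "\<forall>j u. c j u \<in> carrier R" and rel: "gcomb U b x c p \<in> I" and u: "u \<in> U" and j: "j < p"
 shows "c j u \<in> I"
proof -
 note Ii = prime_ideal[OF I]
 have xR: "x \<in> carrier R" using ideal_carrier[OF prime_ideal[OF T] x] .
 have U: "finite U" and b: "\<forall>u. b u \<in> carrier R" using B by (auto simp: fbasis_def)
 define Z where "Z = {c j u | c. (\<forall>j u. c j u \<in> carrier R) \<and> gcomb U b x c p \<in> I}"
 have Zi: "ideal Z R"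
 proof (rule idealI_cring)
  show "Z \<subseteq> carrier R" by (auto simp: Z_def)
  have "gcomb U b x (\<lambda>_ _. \<zero>) p \<in> I" by (rule gcomb_ideal[OF Ii U b xR]) (simp add: ideal_zero[OF Ii])
  then show "\<zero> \<in> Z" unfolding Z_def by (intro CollectI exI[of _ "\<lambda>_ _. \<zero>"]) auto
  fix z assume "z \<in> Z"
  then obtain c where c: "z = c j u" "\<forall>j u. c j u \<in> carrier R" "gcomb U b x c p \<in> I" unfolding Z_def by blast
  show "a \<otimes> z \<in> Z" if a: "a \<in> carrier R" for a
  proof -
   have "gcomb U b x (\<lambda>j u. a \<otimes> c j u) p \<in> I"
    using gcomb_smult[OF U b c(2) xR a, where n = p] ideal_mult[OF Ii c(3)] a by simp
   then show ?thesis unfolding Z_def using c a by (intro CollectI exI[of _ "\<lambda>j u. a \<otimes> c j u"]) auto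
  qed
  fix z' assume "z' \<in> Z"
  then obtain c' where c': "z' = c' j u" "\<forall>j u. c' j u \<in> carrier R" "gcomb U b x c' p \<in> I" unfolding Z_def by blast
  have "gcomb U b x (\<lambda>j u. c j u \<oplus> c' j u) p \<in> I"
   using gcomb_add[OF b c(2) c'(2) xR, where n = p] ideal_add[OF Ii c(3) c'(3)] by simp
  then show "z \<oplus> z' \<in> Z" unfolding Z_def using c c' by (intro CollectI exI[of _ "\<lambda>j u. c j u \<oplus> c' j u"]) auto
 qed
 have step: "\<exists>s \<in> carrier R - T. \<exists>h \<in> I. \<exists>z' \<in> Z. s \<otimes> z = h \<oplus> x \<otimes> z'" if zZ: "z \<in> Z" for z
 proof -
  obtain c where c: "z = c j u" "\<forall>j u. c j u \<in> carrier R" "gcomb U b x c p \<in> I" using zZ unfolding Z_def by blast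
  obtain c' where c': "\<forall>j u. c' j u \<in> carrier R" "gcomb U b x c' p \<in> I"
   "\<forall>u \<in> U. \<forall>j < p. \<exists>h \<in> I. c j u = h \<oplus> x \<otimes> c' j u"
   using relation_divide[OF I xR xI B c(2,3)] by blast
  then obtain h where h: "h \<in> I" "c j u = h \<oplus> x \<otimes> c' j u" using u j by blast
  have "c' j u \<in> Z" unfolding Z_def using c' by blast
  moreover have "\<one> \<otimes> z = h \<oplus> x \<otimes> c' j u" using c(1,2) h(2) by (metis l_one)
  moreover have "\<one> \<in> carrier R - T" using prime_one[OF T] by simp
  ultimately show ?thesis using h(1) by blast
 qed
 have cZ: "c j u \<in> Z" unfolding Z_def using c rel by blast
 obtain s where s: "s \<in> carrier R - T" "s \<otimes> c j u \<in> I" using ideal_local_nakayama[OF T x Ii Zi step cZ] by blast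
 have su: "s \<in> Units R" using unit s(1) by auto
 have "inv s \<otimes> (s \<otimes> c j u) = c j u" using su s(1) c by (simp flip: m_assoc)
 then show ?thesis using ideal_mult[OF Ii s(2), of "inv s"] su by simp
qed

lemma fbasis_step:
 fixes U :: "nat list set"
 assumes T: "primeideal T R" and unit: "\<And>s. s \<in> carrier R - T ==> s \<in> Units R"
  and I: "primeideal I R" and x: "x \<in> T" and xI: "x \<notin> I" and fin: F_fin and B: "fbasis (adjoin R I x) U b"
 shows "fbasis I {j # u | j u. j < p \<and> u \<in> U} (\<lambda>w. b (tl w) \<otimes> x [^] (hd w))" (is "fbasis I ?U ?b")
proof -
 have xR: "x \<in> carrier R" using ideal_carrier[OF prime_ideal[OF T] x] .
 have U: "finite U" and b: "\<forall>u. b u \<in> carrier R" using B by (auto simp: fbasis_def)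
 note gf = gcomb_fcomb[OF U b _ xR, where n = p]
 show ?thesis
  unfolding fbasis_def
 proof (intro conjI allI ballI impI)
  have "?U = (\<lambda>(j, u). j # u) ` ({..<p} \<times> U)" by auto
  then show "finite ?U" using U by simp
  show "?b w \<in> carrier R" for w using b xR by simp
  fix r assume "r \<in> carrier R"
  then obtain c i where c: "\<forall>j u. c j u \<in> carrier R" "i \<in> I" "r = gcomb U b x c p \<oplus> i"
   using fbasis_step_span[OF T unit prime_ideal[OF I] x fin B] by blast
  have "fcomb ?U ?b (\<lambda>w. c (hd w) (tl w)) = gcomb U b x c p"
   using gf[of "\<lambda>w. c (hd w) (tl w)"] c(1) by simp
  then show "\<exists>c i. (\<forall>u. c u \<in> carrier R) \<and> i \<in> I \<and> r = fcomb ?U ?b c \<oplus> i"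
   using c by (intro exI[of _ "\<lambda>w. c (hd w) (tl w)"] exI[of _ i]) auto
 next
  fix c w assume c: "(\<forall>w. c w \<in> carrier R) \<and> fcomb ?U ?b c \<in> I" and "w \<in> ?U"
  then obtain j u where w: "w = j # u" "j < p" "u \<in> U" by auto
  have "gcomb U b x (\<lambda>j u. c (j # u)) p \<in> I" using gf[of c] c by simp
  then show "c w \<in> I"
   using fbasis_step_indep[OF T unit I x xI B, of "\<lambda>j u. c (j # u)" u j] c w by simp
 qed
qed

text \<open>Everything outside \<open>T\<close> is invertible, so a generating family modulo
  \<open>T\<close> with the least number of elements is independent: a relation with a coefficient
  outside \<open>T\<close> would express one member by the others.\<close>

lemma fbasis_residue:
 assumes T: "primeideal T R" and unit: "\<And>s. s \<in> carrier R - T ==> s \<in> Units R" and fin: F_fin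
 shows "\<exists>(U :: nat list set) b. fbasis T U b"
proof -
 note Ti = prime_ideal[OF T]
 interpret F: module R FR by (rule FR_module)
 define P where "P n = (\<exists>(U :: nat list set) b. finite U \<and> card U = n \<and> (\<forall>u. b u \<in> carrier R) \<and>
  (\<forall>r \<in> carrier R. \<exists>c i. (\<forall>u. c u \<in> carrier R) \<and> i \<in> T \<and> r = fcomb U b c \<oplus> i))" for n
 have "\<exists>n. P n"
 proof -
  obtain X where X: "X \<subseteq> carrier R" "finite X" "span_over FR (carrier R) X = carrier R"
   using fin F.finitely_generated_iff by (auto simp: F_fin_def)
  obtain g where g: "bij_betw g {..<card X} X" using ex_bij_betw_nat_finite[OF X(2)] atLeast0LessThan by metis
  define U where "U = (\<lambda>i. [i]) ` {..<card X}"
  define b where "b w = (if w \<in> U then g (hd w) else \<zero>)" for w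
  have U: "finite U" by (simp add: U_def)
  have b: "\<forall>w. b w \<in> carrier R" using g X(1) by (auto simp: b_def U_def bij_betw_def)
  have bX: "\<exists>u \<in> U. b u = x" if "x \<in> X" for x
  proof -
   have "x \<in> g ` {..<card X}" using g that by (simp add: bij_betw_def)
   then obtain i where "i < card X" "g i = x" by auto
   then show ?thesis by (intro bexI[of _ "[i]"]) (auto simp: b_def U_def)
  qed
  have "\<exists>c. (\<forall>u. c u \<in> carrier R) \<and> r = fcomb U b c" if "r \<in> span_over FR (carrier R) X" for r
   using that
  proof induction
   case zero
   have "fcomb U b (\<lambda>_. \<zero>) = \<zero>" by (rule fcomb_zero) (use b in auto)
   then show ?case by (intro exI[of _ "\<lambda>_. \<zero>"]) simp
  next
   case (step a x y)
   then obtain c u where c: "\<forall>u. c u \<in> carrier R" "y = fcomb U b c" and u: "u \<in> U" "b u = x"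
    using bX by blast
   let ?d = "\<lambda>v. if v = u then a else \<zero>"
   have d: "\<forall>v. ?d v \<in> carrier R" using step(1) by simp
   have "a *[FR] x +[FR] y = fcomb U b (\<lambda>v. ?d v \<oplus> c v)"
    using fcomb_add[OF b d c(1), of U] fcomb_single[OF U u(1) b step(1)] c(2) u(2) by simp
   then show ?case using d c(1) by (intro exI[of _ "\<lambda>v. ?d v \<oplus> c v"]) simp
  qed
  then have "\<exists>c i. (\<forall>u. c u \<in> carrier R) \<and> i \<in> T \<and> r = fcomb U b c \<oplus> i" if "r \<in> carrier R" for r
   using that X(3) ideal_zero[OF Ti] by (metis r_zero)
  then have "P (card U)" unfolding P_def using U b by blast
  then show ?thesis ..
 qed
 then have "P (LEAST n. P n)" by (rule LeastI_ex)
 then obtain U :: "nat list set" and b where U: "finite U" "card U = (LEAST n. P n)" and b: "\<forall>u. b u \<in> carrier R"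
  and sp: "\<And>r. r \<in> carrier R ==> \<exists>c i. (\<forall>u. c u \<in> carrier R) \<and> i \<in> T \<and> r = fcomb U b c \<oplus> i"
  unfolding P_def by blast
 have "c u \<in> T" if c: "\<forall>u. c u \<in> carrier R" and rel: "fcomb U b c \<in> T" and u: "u \<in> U" for c u
 proof (rule ccontr)
  assume "c u \<notin> T"
  then have cu: "c u \<in> Units R" using unit c by auto
  have "\<exists>d i. (\<forall>u. d u \<in> carrier R) \<and> i \<in> T \<and> r = fcomb (U - {u}) b d \<oplus> i" if r: "r \<in> carrier R" for r
  proof -
   obtain d i where d: "\<forall>u. d u \<in> carrier R" "i \<in> T" "r = fcomb U b d \<oplus> i" using sp[OF r] by blast
   define a where "a = \<ominus> (d u \<otimes> inv (c u))"
   have aR: "a \<in> carrier R" using d(1) cu by (simp add: a_def)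
   let ?d = "\<lambda>v. d v \<oplus> a \<otimes> c v"
   have dR: "\<forall>v. ?d v \<in> carrier R" using d(1) aR c by simp
   have "d u \<in> carrier R" "c u \<in> carrier R" using d(1) c by auto
   then have "?d u = \<zero>" using cu by (simp add: a_def l_minus m_assoc r_neg)
   then have e1: "fcomb U b ?d = fcomb (U - {u}) b ?d"
    unfolding fcomb_def using U(1) u b dR
    by (intro add.finprod_mono_neutral_cong_right) auto
   have e2: "fcomb U b ?d = fcomb U b d \<oplus> a [^] p \<otimes> fcomb U b c"
    using fcomb_add[OF b d(1), of "\<lambda>v. a \<otimes> c v" U] fcomb_smult[OF U(1) b c aR] aR c by simp
   have cl: "fcomb U b d \<in> carrier R" "fcomb U b c \<in> carrier R" "i \<in> carrier R"
    using fcomb_closed[OF b d(1)] fcomb_closed[OF b c] ideal_carrier[OF Ti d(2)] by auto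
   have re: "r = fcomb (U - {u}) b ?d \<oplus> (i \<ominus> a [^] p \<otimes> fcomb U b c)"
    unfolding e1[symmetric] e2 d(3) using cl aR by (simp add: a_minus_def a_ac r_neg r_neg1 r_neg2)
   have iT: "i \<ominus> a [^] p \<otimes> fcomb U b c \<in> T"
    using ideal_minus[OF Ti d(2) ideal_mult[OF Ti rel, of "a [^] p"]] aR by simp
   show ?thesis
    by (intro exI[of _ ?d] exI[of _ "i \<ominus> a [^] p \<otimes> fcomb U b c"] conjI) (rule dR iT re)+
  qed
  then have "P (card (U - {u}))" unfolding P_def using U(1) b by blast
  then have "(LEAST n. P n) \<le> card (U - {u})" by (rule Least_le)
  then show False using U u by (metis card_Diff1_less not_less)
 qed
 then have "fbasis T U b" unfolding fbasis_def using U(1) b sp by blast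
 then show ?thesis by blast
qed

text \<open>Descends from the residue field, where the ideal is the maximal one, to \<open>R\<close>
  itself, where it is zero, dropping the last remaining parameter each time. Independence in each
  step relies on the parameter ideal being prime and not containing the parameter that is
  dropped.\<close>

lemma frobenius_basis:
 assumes Q: "prime_chain d Q" and m: "Q d = adjoin_seq x d"
  and xR: "\<And>i. i < d ==> x i \<in> carrier R" and unit: "\<And>s. s \<in> carrier R - Q d ==> s \<in> Units R"
  and fin: F_fin
 shows "\<exists>(U :: nat list set) b. fbasis {\<zero>} U b"
proof -
 have T: "primeideal (Q d) R" using Q by (simp add: prime_chain_def)
 have "\<exists>(U :: nat list set) b. fbasis (adjoin_seq x k) U b" if "k \<le> d" for k
  using that
 proof (induction rule: inc_induct)
  case base
  then show ?case using fbasis_residue[OF T unit fin] m by simp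
 next
  case (step k)
  then obtain U :: "nat list set" and b where B: "fbasis (adjoin R (adjoin_seq x k) (x k)) U b" by auto
  have "x k \<in> Q d" unfolding m using adjoin_seq_mem[of d x k] xR step(2) by simp
  then show ?case
   using fbasis_step[OF T unit regular_parameters_prime(1)[OF Q m xR unit, of k] _
     regular_parameters_prime(2)[OF Q m xR unit, of k] fin B] step(2) by auto
 qed
 from this[of 0] show ?thesis by simp
qed

end

section \<open>The Frobenius of a regular ring\<close>

lemma (in noetherian_cring) proper_ideal_maximal:
 assumes I: "ideal I R" "\<one> \<notin> I"
 shows "\<exists>J. maximalideal J R \<and> I \<subseteq> J"
proof -
 define \<F> where "\<F> = {J. ideal J R \<and> I \<subseteq> J \<and> \<one> \<notin> J}"
 have "\<exists>J \<in> \<F>. \<forall>J' \<in> \<F>. J \<subseteq> J' \<longrightarrow> J' = J"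
  by (rule ideal_maximal[OF noetherian_ring]) (use I in \<open>auto simp: \<F>_def\<close>)
 then obtain J where J: "J \<in> \<F>" "\<And>J'. J' \<in> \<F> ==> J \<subseteq> J' ==> J' = J" by auto
 have "maximalideal J R"
 proof (rule maximalidealI)
  show "ideal J R" "carrier R \<noteq> J" using J(1) one_closed by (auto simp: \<F>_def)
  fix J' assume J': "ideal J' R" "J \<subseteq> J'" "J' \<subseteq> carrier R"
  show "J' = J \<or> J' = carrier R"
  proof (cases "\<one> \<in> J'")
   case True
   then show ?thesis using ideal.one_imp_carrier[OF J'(1)] by simp
  next
   case False
   then have "J' \<in> \<F>" using J' J(1) by (auto simp: \<F>_def)
   then show ?thesis using J(2) J'(2) by simp
  qed
 qed
 then show ?thesis using J(1) by (auto simp: \<F>_def)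
qed

lemma (in noetherian_cring) unit_outside_maximal:
 assumes m: "\<And>n. maximalideal n R ==> n = m" and s: "s \<in> carrier R - m"
 shows "s \<in> Units R"
proof (rule ccontr)
 assume ns: "s \<notin> Units R"
 have P: "ideal (PIdl s) R" using cgenideal_ideal s by simp
 have "\<one> \<notin> PIdl s"
 proof
  assume "\<one> \<in> PIdl s"
  then obtain r where "r \<in> carrier R" "r \<otimes> s = \<one>" by (auto simp: cgenideal_def)
  then show False using ns s m_comm unfolding Units_def by fastforce
 qed
 then obtain J where J: "maximalideal J R" "PIdl s \<subseteq> J" using proper_ideal_maximal[OF P] by auto
 then show False using m[OF J(1)] cgenideal_self[of s] s by auto
qed

section \<open>Maps of finite Frobenius rank\<close>

context cring_char begin

text \<open>These are the R-linear maps from F^e_*R to \<open>R\<close>.\<close>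

definition frob_linear :: "nat \<Rightarrow> ('a \<Rightarrow> 'a) \<Rightarrow> bool" where
 "frob_linear e \<xi> \<longleftrightarrow> \<xi> \<in> carrier R \<rightarrow> carrier R \<and>
   (\<forall>r \<in> carrier R. \<forall>s \<in> carrier R. \<xi> (r \<oplus> s) = \<xi> r \<oplus> \<xi> s) \<and>
   (\<forall>a \<in> carrier R. \<forall>r \<in> carrier R. \<xi> (a [^] (p ^ e) \<otimes> r) = a \<otimes> \<xi> r)"

text \<open>The endomorphisms of \<open>F\<^sup>e\<^sub>*R\<close> that factor through a finitely generated free module. That the
 identity is one of them means that \<open>F\<^sup>e\<^sub>*R\<close> is finitely generated projective.\<close>

inductive frob_rank :: "nat \<Rightarrow> ('a \<Rightarrow> 'a) \<Rightarrow> bool" for e where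
 zero: "(\<And>r. r \<in> carrier R ==> g r = \<zero>) ==> frob_rank e g"
| step: "frob_linear e \<xi> ==> x \<in> carrier R ==> frob_rank e g ==>
  (\<And>r. r \<in> carrier R ==> g' r = \<xi> r [^] (p ^ e) \<otimes> x \<oplus> g r) ==> frob_rank e g'"

lemma frob_linear_closed: "frob_linear e \<xi> ==> r \<in> carrier R ==> \<xi> r \<in> carrier R"
 by (auto simp: frob_linear_def)

lemma frob_rank_closed: "frob_rank e g ==> r \<in> carrier R ==> g r \<in> carrier R"
proof (induction rule: frob_rank.induct)
 case (step \<xi> x g g')
 have "\<xi> r \<in> carrier R" using frob_linear_closed[OF step(1,6)] .
 then show ?case using step(2,4,5,6) by simp
qed simp

lemma frob_rank_cong:
 assumes "frob_rank e g" "\<And>r. r \<in> carrier R ==> g' r = g r"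
 shows "frob_rank e g'"
 using assms
proof (induction arbitrary: g' rule: frob_rank.induct)
 case (zero g)
 then show ?case by (intro frob_rank.zero) simp
next
 case (step \<xi> x g h)
 show ?case by (rule frob_rank.step[OF step(1,2,3)]) (simp add: step(4,6))
qed

lemma frob_rank_add:
 assumes "frob_rank e g" "frob_rank e h"
 shows "frob_rank e (\<lambda>r. g r \<oplus> h r)"
 using assms(1)
proof induction
 case (zero g)
 then show ?case using frob_rank_closed[OF assms(2)] by (intro frob_rank_cong[OF assms(2)]) simp
next
 case (step \<xi> x g g')
 show ?case
 proof (rule frob_rank.step[OF step(1,2,5)])
  fix r assume "r \<in> carrier R"
  then show "g' r \<oplus> h r = \<xi> r [^] (p ^ e) \<otimes> x \<oplus> (g r \<oplus> h r)"
   using step(2,4) frob_rank_closed[OF assms(2)] frob_rank_closed[OF step(3)] frob_linear_closed[OF step(1)]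
   by (simp add: a_assoc)
 qed
qed

lemma frob_linear_smult: "frob_linear e \<xi> ==> a \<in> carrier R ==> frob_linear e (\<lambda>r. a \<otimes> \<xi> r)"
 unfolding frob_linear_def by (auto simp: r_distr m_lcomm Pi_iff)

lemma frob_rank_smult:
 assumes "frob_rank e g" "a \<in> carrier R"
 shows "frob_rank e (\<lambda>r. a [^] (p ^ e) \<otimes> g r)"
 using assms(1)
proof induction
 case (zero g)
 then show ?case using assms(2) by (intro frob_rank.zero) simp
next
 case (step \<xi> x g g')
 show ?case
 proof (rule frob_rank.step[OF frob_linear_smult[OF step(1) assms(2)] step(2,5)])
  fix r assume "r \<in> carrier R"
  then show "a [^] (p ^ e) \<otimes> g' r = (a \<otimes> \<xi> r) [^] (p ^ e) \<otimes> x \<oplus> a [^] (p ^ e) \<otimes> g r"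
   using step(2,4) assms(2) frob_rank_closed[OF step(3)] frob_linear_closed[OF step(1)]
   by (simp add: r_distr nat_pow_distrib m_assoc)
 qed
qed

text \<open>The decompositions are composed: if r is the sum of the \<xi>(r)^p x, and s the sum of
  the \<eta>(s)^(p^e) y for each s, then r is the sum of the \<eta>(\<xi>(r))^(p^(e+1)) y^p
  x.\<close>

lemma frob_rank_Suc:
 assumes 1: "frob_rank 1 (\<lambda>r. r)" and e: "frob_rank e (\<lambda>r. r)"
 shows "frob_rank (Suc e) (\<lambda>r. r)"
proof -
 have comp: "frob_rank (Suc e) (\<lambda>r. h (\<xi> r) [^] p \<otimes> x)"
  if \<xi>: "frob_linear 1 \<xi>" and x: "x \<in> carrier R" and h: "frob_rank e h" for \<xi> x h
  using h
 proof induction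
  case (zero h)
  then show ?case using x frob_linear_closed[OF \<xi>] by (intro frob_rank.zero) simp
 next
  case (step \<eta> y h h')
  have lin: "frob_linear (Suc e) (\<lambda>r. \<eta> (\<xi> r))"
   unfolding frob_linear_def
  proof (intro conjI ballI)
   show "(\<lambda>r. \<eta> (\<xi> r)) \<in> carrier R \<rightarrow> carrier R"
    using frob_linear_closed[OF step(1)] frob_linear_closed[OF \<xi>] by auto
   fix a b assume ab: "a \<in> carrier R" "b \<in> carrier R"
   show "\<eta> (\<xi> (a \<oplus> b)) = \<eta> (\<xi> a) \<oplus> \<eta> (\<xi> b)"
    using ab \<xi> step(1) by (auto simp: frob_linear_def Pi_iff)
   have "\<xi> (a [^] (p ^ Suc e) \<otimes> b) = \<xi> ((a [^] (p ^ e)) [^] (p ^ 1) \<otimes> b)"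
    using ab by (simp add: nat_pow_pow mult.commute)
   also have "\<dots> = a [^] (p ^ e) \<otimes> \<xi> b" using ab \<xi> unfolding frob_linear_def by blast
   finally show "\<eta> (\<xi> (a [^] (p ^ Suc e) \<otimes> b)) = a \<otimes> \<eta> (\<xi> b)"
    using ab step(1) frob_linear_closed[OF \<xi>] unfolding frob_linear_def by simp
  qed
  show ?case
  proof (rule frob_rank.step[OF lin _ step(5), of "y [^] p \<otimes> x"])
   show "y [^] p \<otimes> x \<in> carrier R" using step(2) x by simp
   fix r assume r: "r \<in> carrier R"
   have c: "\<eta> (\<xi> r) \<in> carrier R" "h (\<xi> r) \<in> carrier R" "\<xi> r \<in> carrier R"
    using frob_linear_closed[OF step(1)] frob_linear_closed[OF \<xi> r] frob_rank_closed[OF step(3)] by auto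
   have "h' (\<xi> r) [^] p = \<eta> (\<xi> r) [^] (p ^ Suc e) \<otimes> y [^] p \<oplus> h (\<xi> r) [^] p"
    using c step(2,4) by (simp add: frob_add nat_pow_distrib nat_pow_pow mult.commute)
   then show "h' (\<xi> r) [^] p \<otimes> x = \<eta> (\<xi> r) [^] (p ^ Suc e) \<otimes> (y [^] p \<otimes> x) \<oplus> h (\<xi> r) [^] p \<otimes> x"
    using c step(2) x by (simp add: l_distr m_assoc)
  qed
 qed
 have "frob_rank (Suc e) g" if "frob_rank 1 g" for g
  using that
 proof induction
  case (zero g)
  then show ?case by (intro frob_rank.zero) simp
 next
  case (step \<xi> x g g')
  show ?case
   by (rule frob_rank_cong[OF frob_rank_add[OF comp[OF step(1,2) e] step(5)]]) (simp add: step(4))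
 qed
 then show ?thesis using 1 by simp
qed

lemma frob_rank_id:
 assumes "frob_rank 1 (\<lambda>r. r)"
 shows "frob_rank e (\<lambda>r. r)"
proof (induction e)
 case 0
 have lin: "frob_linear 0 (\<lambda>r. r)" by (auto simp: frob_linear_def)
 show ?case by (rule frob_rank.step[OF lin one_closed frob_rank.zero[of "\<lambda>_. \<zero>"]]) auto
next
 case (Suc e)
 then show ?case using frob_rank_Suc assms by simp
qed

text \<open>Uniqueness of coordinates makes the coordinate functions of a basis additive and
  compatible with p-th powers; the expansion of \<open>r\<close> in the basis is then the required
  sum.\<close>

lemma fbasis_frob_rank:
 assumes B: "fbasis {\<zero>} U b"
 shows "frob_rank 1 (\<lambda>r. r)"
proof -
 have U: "finite U" and b: "\<forall>u. b u \<in> carrier R"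
  and ind: "\<And>c u. (\<forall>u. c u \<in> carrier R) ==> fcomb U b c = \<zero> ==> u \<in> U ==> c u = \<zero>"
  using B by (auto simp: fbasis_def)
 have sp: "\<exists>c. (\<forall>u. c u \<in> carrier R) \<and> r = fcomb U b c" if "r \<in> carrier R" for r
 proof -
  obtain c where c: "\<forall>u. c u \<in> carrier R" "r = fcomb U b c \<oplus> \<zero>"
   using B \<open>r \<in> carrier R\<close> unfolding fbasis_def by blast
  then show ?thesis using fcomb_closed[OF b c(1)] by auto
 qed
 obtain \<xi> where \<xi>: "\<And>r. r \<in> carrier R ==> (\<forall>u. \<xi> r u \<in> carrier R) \<and> r = fcomb U b (\<xi> r)"
  using sp by metis
 have uniq: "c u = c' u" if c: "\<forall>u. c u \<in> carrier R" and c': "\<forall>u. c' u \<in> carrier R"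
  and eq: "fcomb U b c = fcomb U b c'" and u: "u \<in> U" for c c' u
 proof -
  have c'': "\<forall>u. (\<ominus> \<one>) \<otimes> c' u \<in> carrier R" using c' by simp
  have "fcomb U b (\<lambda>u. c u \<oplus> (\<ominus> \<one>) \<otimes> c' u) = fcomb U b c \<oplus> (\<ominus> \<one>) [^] p \<otimes> fcomb U b c'"
   using fcomb_add[OF b c c''] fcomb_smult[OF U b c', of "\<ominus> \<one>"] by simp
  also have "\<dots> = \<zero>"
   using frobenius_minus[of \<one> 1] eq fcomb_closed[OF b c'] by (simp add: l_minus r_neg)
  finally have "c u \<oplus> (\<ominus> \<one>) \<otimes> c' u = \<zero>" using ind[of "\<lambda>u. c u \<oplus> (\<ominus> \<one>) \<otimes> c' u" u] c c'' u by simp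
  then have "c u \<ominus> c' u = \<zero>" using c c' by (simp add: a_minus_def l_minus)
  then show ?thesis using c c' r_right_minus_eq by simp
 qed
 have lin: "frob_linear 1 (\<lambda>r. \<xi> r u)" if u: "u \<in> U" for u
  unfolding frob_linear_def
 proof (intro conjI ballI)
  show "(\<lambda>r. \<xi> r u) \<in> carrier R \<rightarrow> carrier R" using \<xi> by auto
  fix r s assume rs: "r \<in> carrier R" "s \<in> carrier R"
  have r: "\<forall>u. \<xi> r u \<in> carrier R" "r = fcomb U b (\<xi> r)"
   and s: "\<forall>u. \<xi> s u \<in> carrier R" "s = fcomb U b (\<xi> s)" using \<xi> rs by auto
  have x1: "\<forall>u. \<xi> (r \<oplus> s) u \<in> carrier R" "r \<oplus> s = fcomb U b (\<xi> (r \<oplus> s))"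
   using \<xi>[of "r \<oplus> s"] rs by auto
  have "fcomb U b (\<xi> (r \<oplus> s)) = fcomb U b (\<lambda>u. \<xi> r u \<oplus> \<xi> s u)"
   unfolding fcomb_add[OF b r(1) s(1)] by (simp only: x1(2)[symmetric] r(2)[symmetric] s(2)[symmetric])
  from uniq[OF x1(1) _ this u] show "\<xi> (r \<oplus> s) u = \<xi> r u \<oplus> \<xi> s u" using r(1) s(1) by simp
  have x2: "\<forall>u. \<xi> (r [^] p \<otimes> s) u \<in> carrier R" "r [^] p \<otimes> s = fcomb U b (\<xi> (r [^] p \<otimes> s))"
   using \<xi>[of "r [^] p \<otimes> s"] rs by auto
  have "fcomb U b (\<xi> (r [^] p \<otimes> s)) = fcomb U b (\<lambda>u. r \<otimes> \<xi> s u)"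
   unfolding fcomb_smult[OF U b s(1) rs(1)] by (simp only: x2(2)[symmetric] s(2)[symmetric])
  from uniq[OF x2(1) _ this u] show "\<xi> (r [^] (p ^ 1) \<otimes> s) u = r \<otimes> \<xi> s u"
   using s(1) rs by simp
 qed
 have "frob_rank 1 (\<lambda>r. fcomb V b (\<xi> r))" if "V \<subseteq> U" for V
  using finite_subset[OF that U] that
 proof (induction V rule: finite_induct)
  case empty
  then show ?case by (intro frob_rank.zero) (simp add: fcomb_def)
 next
  case (insert u V)
  show ?case
  proof (rule frob_rank.step)
   show "frob_linear 1 (\<lambda>r. \<xi> r u)" "b u \<in> carrier R" "frob_rank 1 (\<lambda>r. fcomb V b (\<xi> r))"
    using lin insert b by auto
   fix r assume "r \<in> carrier R"
   then show "fcomb (insert u V) b (\<xi> r) = \<xi> r u [^] (p ^ 1) \<otimes> b u \<oplus> fcomb V b (\<xi> r)"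
    unfolding fcomb_def using insert \<xi> b by (subst finsum_insert) auto
  qed
 qed
 from this[of U] show ?thesis
  by (rule frob_rank_cong) (use \<xi> in auto)
qed

end

section \<open>Descent of finite Frobenius rank from a localization\<close>

locale ring_localization = L: cring L + R: cring R for R (structure) and L :: "('c, 'd) ring_scheme" +
 fixes S :: "'a set" and \<iota> :: "'a \<Rightarrow> 'c"
 assumes S: "submonoid S R" and hom: "\<iota> \<in> ring_hom R L"
  and ker: "\<And>r. r \<in> carrier R ==> \<iota> r = \<zero>\<^bsub>L\<^esub> ==> \<exists>u \<in> S. u \<otimes> r = \<zero>"
  and unit: "\<And>s. s \<in> S ==> \<iota> s \<in> Units L"
  and frac: "\<And>y. y \<in> carrier L ==> \<exists>s \<in> S. \<exists>r \<in> carrier R. \<iota> s **[L] y = \<iota> r"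
begin

lemma S_closed: "s \<in> S ==> s \<in> carrier R" "\<one> \<in> S" "s \<in> S ==> t \<in> S ==> s \<otimes> t \<in> S"
 using submonoid.subset[OF S] submonoid.one_closed[OF S] submonoid.m_closed[OF S] by auto

lemma \<iota>_closed [simp]: "r \<in> carrier R ==> \<iota> r \<in> carrier L"
 using ring_hom_closed[OF hom] by auto

lemma \<iota>_mult: "r \<in> carrier R ==> s \<in> carrier R ==> \<iota> (r \<otimes> s) = \<iota> r **[L] \<iota> s"
 using ring_hom_mult[OF hom] by auto

lemma \<iota>_add: "r \<in> carrier R ==> s \<in> carrier R ==> \<iota> (r \<oplus> s) = \<iota> r +[L] \<iota> s"
 using ring_hom_add[OF hom] by auto

lemma \<iota>_one: "\<iota> \<one> = \<one>\<^bsub>L\<^esub>"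
 using ring_hom_one[OF hom] by auto

lemma \<iota>_zero: "\<iota> \<zero> = \<zero>\<^bsub>L\<^esub>"
 using ring_hom_zero[OF hom R.ring_axioms L.ring_axioms] .

lemma \<iota>_pow: "r \<in> carrier R ==> \<iota> (r [^] (n::nat)) = \<iota> r [^]\<^bsub>L\<^esub> n"
 by (induction n) (auto simp: \<iota>_one \<iota>_mult)

lemma \<iota>_neg: "r \<in> carrier R ==> \<iota> (\<ominus> r) = \<ominus>\<^bsub>L\<^esub> \<iota> r"
proof -
 assume r: "r \<in> carrier R"
 have "\<iota> (\<ominus> r) +[L] \<iota> r = \<zero>\<^bsub>L\<^esub>" using \<iota>_add[of "\<ominus> r" r] r \<iota>_zero by (simp add: R.l_neg)
 then show ?thesis using r by (intro L.minus_equality[symmetric]) auto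
qed

lemma common_denominator:
 assumes "finite X" "\<And>x. x \<in> X ==> \<exists>s \<in> S. P s x"
  and "\<And>s t x. x \<in> X ==> s \<in> S ==> t \<in> S ==> P s x ==> P (t \<otimes> s) x"
 shows "\<exists>s \<in> S. \<forall>x \<in> X. P s x"
 using assms
proof (induction X rule: finite_induct)
 case empty
 then show ?case using S_closed(2) by auto
next
 case (insert x X)
 then obtain s where s: "s \<in> S" "\<forall>x \<in> X. P s x" by auto
 obtain t where t: "t \<in> S" "P t x" using insert.prems(1)[of x] by auto
 have "P (t \<otimes> s) y" if "y \<in> X" for y using insert.prems(2)[of y s t] s t that by auto
 moreover have "P (s \<otimes> t) x" using insert.prems(2)[of x t s] s t by auto
 ultimately show ?case
  using s t S_closed R.m_comm[of s t] by (intro bexI[of _ "t \<otimes> s"]) auto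
qed

end

locale char_localization = ring_localization R L S \<iota> + R: noetherian_char R p + L: noetherian_char L p
 for R (structure) and L :: "('c, 'd) ring_scheme" and S \<iota> p
begin

text \<open>The kernel is a finitely generated ideal, so one multiplier works for all its elements.
  Such a uniform multiplier later makes a choice of lifts additive.\<close>

lemma kernel_annihilator: "\<exists>u \<in> S. \<forall>r \<in> carrier R. \<iota> r = \<zero>\<^bsub>L\<^esub> \<longrightarrow> u \<otimes> r = \<zero>"
proof -
 define N where "N = {r \<in> carrier R. \<iota> r = \<zero>\<^bsub>L\<^esub>}"
 have N: "ideal N R"
  by (rule R.idealI_cring) (auto simp: N_def \<iota>_zero \<iota>_add \<iota>_mult)
 obtain A where A: "A \<subseteq> carrier R" "finite A" "N = genideal R A" using R.finetely_gen[OF N] by auto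
 have AN: "A \<subseteq> N" using R.genideal_self[OF A(1)] A(3) by simp
 have "\<exists>s \<in> S. \<forall>x \<in> A. s \<otimes> x = \<zero>"
 proof (rule common_denominator[OF A(2)])
  show "\<exists>s \<in> S. s \<otimes> x = \<zero>" if "x \<in> A" for x using ker that AN by (auto simp: N_def)
  show "t \<otimes> s \<otimes> x = \<zero>" if "x \<in> A" "s \<in> S" "t \<in> S" "s \<otimes> x = \<zero>" for s t x
   using that A(1) S_closed(1) by (auto simp: R.m_assoc subset_iff)
 qed
 then obtain s where s: "s \<in> S" "\<And>x. x \<in> A ==> s \<otimes> x = \<zero>" by auto
 have sR: "s \<in> carrier R" using S_closed s by simp
 have "ideal {r \<in> carrier R. s \<otimes> r = \<zero>} R"
  by (rule R.idealI_cring) (auto simp: R.r_distr R.m_lcomm sR)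
 then have "N \<subseteq> {r \<in> carrier R. s \<otimes> r = \<zero>}"
  unfolding A(3) by (rule R.genideal_minimal) (use A(1) s(2) in auto)
 then show ?thesis using s(1) by (auto simp: N_def)
qed

text \<open>A fraction r/s is (1/s)^p s^(p-1) r, that is, the scalar 1/s acting on an element of the
  image of \<open>R\<close>; so generators of F_*R also generate after localization.\<close>

lemma localized_F_fin:
 assumes "R.F_fin"
 shows "L.F_fin"
proof -
 interpret FR: module R R.FR by (rule R.FR_module)
 interpret FL: module L L.FR by (rule L.FR_module)
 obtain X where X: "X \<subseteq> carrier R" "finite X" "span_over R.FR (carrier R) X = carrier R"
  using assms FR.finitely_generated_iff by (auto simp: R.F_fin_def)
 have XL: "\<iota> ` X \<subseteq> carrier L.FR" using X(1) by auto
 note sub = FL.submodule_props[OF FL.span_over_submodule[OF XL]]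
 have \<iota>X: "\<iota> r \<in> span_over L.FR (carrier L) (\<iota> ` X)" if "r \<in> span_over R.FR (carrier R) X" for r
  using that
 proof induction
  case zero
  then show ?case using sub(2) by (simp add: \<iota>_zero)
 next
  case (step a x y)
  have "y \<in> carrier R" using step(3) X(3) by simp
  moreover have "x \<in> carrier R" using step(2) X(1) by auto
  ultimately have "\<iota> (a \<odot>\<^bsub>R.FR\<^esub> x \<oplus>\<^bsub>R.FR\<^esub> y) = \<iota> a \<odot>\<^bsub>L.FR\<^esub> \<iota> x \<oplus>\<^bsub>L.FR\<^esub> \<iota> y"
   using step(1) by (simp add: \<iota>_add \<iota>_mult \<iota>_pow)
  moreover have "\<iota> a \<odot>\<^bsub>L.FR\<^esub> \<iota> x \<oplus>\<^bsub>L.FR\<^esub> \<iota> y \<in> span_over L.FR (carrier L) (\<iota> ` X)"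
   by (rule span_over.step[OF _ _ step(4)]) (use step(1,2) in auto)
  ultimately show ?case by (simp only:)
 qed
 have "y \<in> span_over L.FR (carrier L) (\<iota> ` X)" if y: "y \<in> carrier L" for y
 proof -
  obtain s r where s: "s \<in> S" "r \<in> carrier R" "\<iota> s **[L] y = \<iota> r" using frac[OF y] by blast
  have sR: "s \<in> carrier R" and su: "\<iota> s \<in> Units L" using S_closed s(1) unit by auto
  obtain q where q: "p = Suc q" using R.p_pos gr0_implies_Suc by blast
  let ?i = "inv\<^bsub>L\<^esub> (\<iota> s)"
  have iL: "?i \<in> carrier L" using su by simp
  have is1: "?i **[L] \<iota> s = \<one>\<^bsub>L\<^esub>" using su by simp
  have "?i \<odot>\<^bsub>L.FR\<^esub> \<iota> (s [^] q \<otimes> r) = (?i [^]\<^bsub>L\<^esub> p **[L] \<iota> s [^]\<^bsub>L\<^esub> p) **[L] y"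
   using sR s(2,3) iL y unfolding q by (simp add: \<iota>_mult \<iota>_pow L.m_assoc flip: s(3))
  also have "\<dots> = y" using is1 iL sR y by (simp flip: L.nat_pow_distrib)
  finally have y': "?i \<odot>\<^bsub>L.FR\<^esub> \<iota> (s [^] q \<otimes> r) = y" .
  have "\<iota> (s [^] q \<otimes> r) \<in> span_over L.FR (carrier L) (\<iota> ` X)" using \<iota>X X(3) sR s(2) by simp
  then show ?thesis using sub(4)[OF iL] y' by metis
 qed
 then have "span_over L.FR (carrier L) (\<iota> ` X) = carrier L.FR" using sub(1) by auto
 then show ?thesis unfolding L.F_fin_def FL.finitely_generated_iff using XL X(2) by blast
qed

text \<open>On finitely many generators of F_*R the values of \<xi> have a common denominator, so a
  multiple of \<xi> takes values in the image of \<open>R\<close>. Lifts of these values are unique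
  up to the kernel, and a factor that kills the kernel makes the lift well defined and linear. The
  denominator occurs as a p-th power because that is how scalars act on F_*R.\<close>

lemma frob_rank_descend:
 assumes fin: "R.F_fin" and g: "L.frob_rank 1 g"
 shows "\<exists>c \<in> S. \<exists>g'. R.frob_rank 1 g' \<and> (\<forall>r \<in> carrier R. \<iota> (g' r) = \<iota> c [^]\<^bsub>L\<^esub> p **[L] g (\<iota> r))"
 using g
proof induction
 case (zero g)
 have "R.frob_rank 1 (\<lambda>_. \<zero>)" by (rule R.frob_rank.zero) simp
 then show ?case using zero S_closed(2) by (intro bexI[of _ \<one>] exI[of _ "\<lambda>_. \<zero>"]) (auto simp: \<iota>_zero \<iota>_one)
next
 case (step \<xi> x g h)
 then obtain c0 g0 where c0: "c0 \<in> S" "R.frob_rank 1 g0"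
  "\<And>r. r \<in> carrier R ==> \<iota> (g0 r) = \<iota> c0 [^]\<^bsub>L\<^esub> p **[L] g (\<iota> r)" by blast
 obtain n0 where n0: "n0 \<in> S" "\<And>r. r \<in> carrier R ==> \<iota> r = \<zero>\<^bsub>L\<^esub> ==> n0 \<otimes> r = \<zero>"
  using kernel_annihilator by auto
 interpret FR: module R R.FR by (rule R.FR_module)
 obtain X where X: "X \<subseteq> carrier R" "finite X" "span_over R.FR (carrier R) X = carrier R"
  using fin FR.finitely_generated_iff by (auto simp: R.F_fin_def)
 have \<xi>L: "\<xi> y \<in> carrier L" if "y \<in> carrier L" for y using L.frob_linear_closed[OF step(1) that] .
 have "\<exists>s \<in> S. \<forall>z \<in> X. \<iota> s **[L] \<xi> (\<iota> z) \<in> \<iota> ` carrier R"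
 proof (rule common_denominator[OF X(2)])
  show "\<exists>s \<in> S. \<iota> s **[L] \<xi> (\<iota> z) \<in> \<iota> ` carrier R" if "z \<in> X" for z
   using frac[OF \<xi>L[of "\<iota> z"]] that X(1) by fastforce
  fix s t z assume *: "z \<in> X" "s \<in> S" "t \<in> S" "\<iota> s **[L] \<xi> (\<iota> z) \<in> \<iota> ` carrier R"
  then obtain w where w: "w \<in> carrier R" "\<iota> s **[L] \<xi> (\<iota> z) = \<iota> w" by auto
  have c: "\<xi> (\<iota> z) \<in> carrier L" "s \<in> carrier R" "t \<in> carrier R" using * \<xi>L X(1) S_closed(1) by auto
  have "\<iota> (t \<otimes> s) **[L] \<xi> (\<iota> z) = \<iota> (t \<otimes> w)" using c w by (simp add: \<iota>_mult L.m_assoc)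
  then show "\<iota> (t \<otimes> s) **[L] \<xi> (\<iota> z) \<in> \<iota> ` carrier R" using c w by simp
 qed
 then obtain c1 where c1: "c1 \<in> S" "\<And>z. z \<in> X ==> \<iota> c1 **[L] \<xi> (\<iota> z) \<in> \<iota> ` carrier R" by auto
 have c1R: "c1 \<in> carrier R" and n0R: "n0 \<in> carrier R" and c0R: "c0 \<in> carrier R"
  using S_closed c1 n0 c0 by auto
 have \<xi>add: "\<xi> (y +[L] z) = \<xi> y +[L] \<xi> z" if "y \<in> carrier L" "z \<in> carrier L" for y z
  using step(1) that by (simp add: L.frob_linear_def)
 have \<xi>smult: "\<xi> (a [^]\<^bsub>L\<^esub> p **[L] z) = a **[L] \<xi> z" if "a \<in> carrier L" "z \<in> carrier L" for a z
  using step(1) that by (simp add: L.frob_linear_def)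
 have lift: "\<exists>w. w \<in> carrier R \<and> \<iota> w = \<iota> c1 **[L] \<xi> (\<iota> r)" if "r \<in> carrier R" for r
 proof -
  have "r \<in> span_over R.FR (carrier R) X" using that X(3) by simp
  then show ?thesis
  proof induction
   case zero
   have "\<xi> (\<zero>\<^bsub>L\<^esub>) = \<zero>\<^bsub>L\<^esub>" using \<xi>smult[of "\<zero>\<^bsub>L\<^esub>" "\<zero>\<^bsub>L\<^esub>"] \<xi>L[of "\<zero>\<^bsub>L\<^esub>"] by simp
   then show ?case using c1R by (intro exI[of _ \<zero>]) (simp add: \<iota>_zero)
  next
   case (step a v y)
   then obtain w where w: "w \<in> carrier R" "\<iota> w = \<iota> c1 **[L] \<xi> (\<iota> y)" by auto
   obtain u where u: "u \<in> carrier R" "\<iota> u = \<iota> c1 **[L] \<xi> (\<iota> v)" using c1(2)[OF step(2)] by auto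
   have vR: "v \<in> carrier R" "y \<in> carrier R" using step X by auto
   have "\<xi> (\<iota> (a [^] p \<otimes> v \<oplus> y)) = \<iota> a **[L] \<xi> (\<iota> v) +[L] \<xi> (\<iota> y)"
    using step(1) vR by (simp add: \<iota>_add \<iota>_mult \<iota>_pow \<xi>add \<xi>smult)
   then have "\<iota> c1 **[L] \<xi> (\<iota> (a [^] p \<otimes> v \<oplus> y)) = \<iota> (a \<otimes> u \<oplus> w)"
    using step(1) vR u w c1R \<xi>L by (simp add: \<iota>_add \<iota>_mult L.r_distr L.m_lcomm)
   then show ?case using step(1) u(1) w(1) by (intro exI[of _ "a \<otimes> u \<oplus> w"]) simp
  qed
 qed
 define \<eta> where "\<eta> r = n0 \<otimes> (SOME w. w \<in> carrier R \<and> \<iota> w = \<iota> c1 **[L] \<xi> (\<iota> r))" for r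
 have \<eta>: "\<eta> r = n0 \<otimes> w" if r: "r \<in> carrier R" and w: "w \<in> carrier R" "\<iota> w = \<iota> c1 **[L] \<xi> (\<iota> r)" for r w
 proof -
  define v where "v = (SOME w. w \<in> carrier R \<and> \<iota> w = \<iota> c1 **[L] \<xi> (\<iota> r))"
  have v: "v \<in> carrier R" "\<iota> v = \<iota> c1 **[L] \<xi> (\<iota> r)" using someI_ex[OF lift[OF r]] by (auto simp: v_def)
  have "\<iota> c1 **[L] \<xi> (\<iota> r) \<in> carrier L" using c1R \<xi>L r by simp
  then have "\<iota> (v \<ominus> w) = \<zero>\<^bsub>L\<^esub>" using v w by (simp add: a_minus_def \<iota>_add \<iota>_neg L.r_neg)
  then have "n0 \<otimes> (v \<ominus> w) = \<zero>" using n0(2) v w by simp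
  then have "n0 \<otimes> v \<ominus> n0 \<otimes> w = \<zero>" using n0R v(1) w(1) by (simp add: a_minus_def R.r_distr R.r_minus)
  then have "n0 \<otimes> v = n0 \<otimes> w" using n0R v(1) w(1) R.r_right_minus_eq by simp
  then show ?thesis by (simp add: \<eta>_def v_def)
 qed
 have lin: "R.frob_linear 1 \<eta>"
  unfolding R.frob_linear_def
 proof (intro conjI ballI)
  show "\<eta> \<in> carrier R \<rightarrow> carrier R" using \<eta> lift n0R by fastforce
  fix a b assume ab: "a \<in> carrier R" "b \<in> carrier R"
  obtain v where v: "v \<in> carrier R" "\<iota> v = \<iota> c1 **[L] \<xi> (\<iota> a)" using lift[OF ab(1)] by auto
  obtain w where w: "w \<in> carrier R" "\<iota> w = \<iota> c1 **[L] \<xi> (\<iota> b)" using lift[OF ab(2)] by auto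
  have "\<iota> (v \<oplus> w) = \<iota> c1 **[L] \<xi> (\<iota> (a \<oplus> b))"
   using ab v w c1R \<xi>L by (simp add: \<iota>_add \<xi>add L.r_distr)
  then show "\<eta> (a \<oplus> b) = \<eta> a \<oplus> \<eta> b"
   using \<eta>[of "a \<oplus> b" "v \<oplus> w"] \<eta>[OF ab(1) v] \<eta>[OF ab(2) w] ab v(1) w(1) n0R by (simp add: R.r_distr)
  have "\<iota> (a \<otimes> w) = \<iota> c1 **[L] \<xi> (\<iota> (a [^] p \<otimes> b))"
   using ab w c1R \<xi>L by (simp add: \<iota>_mult \<iota>_pow \<xi>smult L.m_lcomm)
  then show "\<eta> (a [^] (p ^ 1) \<otimes> b) = a \<otimes> \<eta> b"
   using \<eta>[of "a [^] p \<otimes> b" "a \<otimes> w"] \<eta>[OF ab(2) w] ab w(1) n0R by (simp add: R.m_lcomm)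
 qed
 have \<iota>\<eta>: "\<iota> (\<eta> r) = \<iota> (n0 \<otimes> c1) **[L] \<xi> (\<iota> r)" if r: "r \<in> carrier R" for r
 proof -
  obtain w where w: "w \<in> carrier R" "\<iota> w = \<iota> c1 **[L] \<xi> (\<iota> r)" using lift[OF r] by auto
  show ?thesis using \<eta>[OF r w] w n0R c1R \<xi>L r by (simp add: \<iota>_mult L.m_assoc)
 qed
 obtain s a where sa: "s \<in> S" "a \<in> carrier R" "\<iota> s **[L] x = \<iota> a" using frac[OF step(2)] by blast
 have sR: "s \<in> carrier R" using S_closed sa by simp
 obtain q where q: "p = Suc q" using R.p_pos gr0_implies_Suc by blast
 \<comment> \<open>With s x = a, the element s^(p-1) a represents s^p x; so the denominator of x,
   too, enters as a p-th power.\<close>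
 have sp: "\<iota> (s [^] q \<otimes> a) = \<iota> s [^]\<^bsub>L\<^esub> p **[L] x"
  unfolding q using sR sa step(2) by (simp add: \<iota>_mult \<iota>_pow L.m_assoc flip: sa(3))
 define c where "c = c0 \<otimes> (n0 \<otimes> c1 \<otimes> s)"
 have cS: "c \<in> S" using c0 n0 c1 sa S_closed by (simp add: c_def)
 \<comment> \<open>Each summand is multiplied by the denominator of the other, so that both carry
   the same factor c^p.\<close>
 let ?g = "\<lambda>r. (c0 \<otimes> \<eta> r) [^] (p ^ 1) \<otimes> (s [^] q \<otimes> a) \<oplus> (n0 \<otimes> c1 \<otimes> s) [^] (p ^ 1) \<otimes> g0 r"
 have "R.frob_rank 1 ?g"
  by (rule R.frob_rank.step[OF R.frob_linear_smult[OF lin c0R] _ R.frob_rank_smult[OF c0(2)]])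
   (use sR sa n0R c1R in auto)
 moreover have "\<iota> (?g r) = \<iota> c [^]\<^bsub>L\<^esub> p **[L] h (\<iota> r)" if r: "r \<in> carrier R" for r
 proof -
  have cl: "\<eta> r \<in> carrier R" "g0 r \<in> carrier R" "\<xi> (\<iota> r) \<in> carrier L" "g (\<iota> r) \<in> carrier L"
   using R.frob_linear_closed[OF lin r] R.frob_rank_closed[OF c0(2) r] \<xi>L L.frob_rank_closed[OF step(3)] r by auto
  have "\<iota> ((c0 \<otimes> \<eta> r) [^] p \<otimes> (s [^] q \<otimes> a)) = \<iota> c [^]\<^bsub>L\<^esub> p **[L] (\<xi> (\<iota> r) [^]\<^bsub>L\<^esub> p **[L] x)"
  proof -
   have "\<iota> ((c0 \<otimes> \<eta> r) [^] p \<otimes> (s [^] q \<otimes> a)) = (\<iota> c0 **[L] \<iota> (\<eta> r)) [^]\<^bsub>L\<^esub> p **[L] \<iota> (s [^] q \<otimes> a)"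
    using cl c0R sR sa(2) by (simp add: \<iota>_mult \<iota>_pow)
   also have "\<dots> = \<iota> c [^]\<^bsub>L\<^esub> p **[L] (\<xi> (\<iota> r) [^]\<^bsub>L\<^esub> p **[L] x)"
    unfolding sp \<iota>\<eta>[OF r] c_def using cl c0R n0R c1R sR step(2)
    by (simp add: \<iota>_mult L.nat_pow_distrib L.m_ac)
   finally show ?thesis .
  qed
  moreover have "\<iota> ((n0 \<otimes> c1 \<otimes> s) [^] p \<otimes> g0 r) = \<iota> c [^]\<^bsub>L\<^esub> p **[L] g (\<iota> r)"
   using cl c0R n0R c1R sR c0(3)[OF r] by (simp add: c_def \<iota>_mult \<iota>_pow L.nat_pow_distrib L.m_ac)
  ultimately show ?thesis
   using cl step(2,4) r c0R n0R c1R sR sa(2) S_closed(1)[OF cS] by (simp add: \<iota>_add L.r_distr)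
 qed
 ultimately show ?case using cS by blast
qed

text \<open>The descended map agrees with multiplication by c^p up to the kernel only; the
  additional factor \<open>n0\<close> annihilates the difference.\<close>

lemma frob_rank_descend_id:
 assumes "R.F_fin" "L.frob_rank 1 (\<lambda>y. y)"
 shows "\<exists>c \<in> S. R.frob_rank 1 (\<lambda>r. c [^] p \<otimes> r)"
proof -
 obtain c g where c: "c \<in> S" "R.frob_rank 1 g" "\<And>r. r \<in> carrier R ==> \<iota> (g r) = \<iota> c [^]\<^bsub>L\<^esub> p **[L] \<iota> r"
  using frob_rank_descend[OF assms] by blast
 obtain n0 where n0: "n0 \<in> S" "\<And>r. r \<in> carrier R ==> \<iota> r = \<zero>\<^bsub>L\<^esub> ==> n0 \<otimes> r = \<zero>"
  using kernel_annihilator by auto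
 have cR: "c \<in> carrier R" "n0 \<in> carrier R" using S_closed c n0 by auto
 have "R.frob_rank 1 (\<lambda>r. (n0 \<otimes> c) [^] p \<otimes> r)"
 proof (rule R.frob_rank_cong[OF R.frob_rank_smult[OF c(2) cR(2)]])
  fix r assume r: "r \<in> carrier R"
  have gR: "g r \<in> carrier R" using R.frob_rank_closed[OF c(2) r] .
  have "\<iota> (g r \<ominus> c [^] p \<otimes> r) = \<zero>\<^bsub>L\<^esub>"
   using gR cR r c(3)[OF r] by (simp add: a_minus_def \<iota>_add \<iota>_neg \<iota>_mult \<iota>_pow L.r_neg)
  then have "n0 \<otimes> (g r \<ominus> c [^] p \<otimes> r) = \<zero>" using n0(2) gR cR r by simp
  then have "n0 \<otimes> g r \<ominus> n0 \<otimes> (c [^] p \<otimes> r) = \<zero>" using cR gR r by (simp add: a_minus_def R.r_distr R.r_minus)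
  then have eq: "n0 \<otimes> g r = n0 \<otimes> (c [^] p \<otimes> r)" using cR gR r R.r_right_minus_eq by simp
  obtain q where q: "p = Suc q" using R.p_pos gr0_implies_Suc by blast
  have np: "n0 [^] p = n0 [^] q \<otimes> n0" unfolding q by simp
  have "n0 [^] p \<otimes> g r = n0 [^] q \<otimes> (n0 \<otimes> g r)" unfolding np using cR gR by (simp add: R.m_assoc)
  also have "\<dots> = (n0 \<otimes> c) [^] p \<otimes> r"
   unfolding eq R.nat_pow_distrib[OF cR(2,1)] np using cR r by (simp add: R.m_assoc)
  finally show "(n0 \<otimes> c) [^] p \<otimes> r = n0 [^] (p ^ 1) \<otimes> g r" by simp
 qed
 then show ?thesis using S_closed(3)[OF n0(1) c(1)] by blast
qed

end
lemma (in cring) localize_ring_ops: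
 fixes S
 defines "L \<equiv> localize_ring R S"
 assumes sub: "submonoid S R"
 shows "carrier L = {rfrac R S r s | r s. r \<in> carrier R \<and> s \<in> S}"
  "\<zero>\<^bsub>L\<^esub> = rfrac R S \<zero> \<one>" "\<one>\<^bsub>L\<^esub> = rfrac R S \<one> \<one>"
  "\<And>r r' s s'. \<lbrakk>r \<in> carrier R; r' \<in> carrier R; s \<in> S; s' \<in> S\<rbrakk> \<Longrightarrow>
   rfrac R S r s +[L] rfrac R S r' s' = rfrac R S (s' \<otimes> r \<oplus> s \<otimes> r') (s \<otimes> s')"
  "\<And>r r' s s'. \<lbrakk>r \<in> carrier R; r' \<in> carrier R; s \<in> S; s' \<in> S\<rbrakk> \<Longrightarrow>
   rfrac R S r s **[L] rfrac R S r' s' = rfrac R S (r \<otimes> r') (s \<otimes> s')"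
  "\<And>r r' s s'. \<lbrakk>r \<in> carrier R; r' \<in> carrier R; s \<in> S; s' \<in> S; s' \<otimes> r = s \<otimes> r'\<rbrakk> \<Longrightarrow>
   rfrac R S r s = rfrac R S r' s'"
  "\<And>r r' s s'. \<lbrakk>rfrac R S r s = rfrac R S r' s'; r \<in> carrier R; r' \<in> carrier R; s \<in> S; s' \<in> S\<rbrakk> \<Longrightarrow>
   \<exists>u \<in> S. (u \<otimes> s') \<otimes> r = (u \<otimes> s) \<otimes> r'"
proof -
 interpret F: fractions R "self_module R" S
  using self_module sub by (simp add: fractions_def)
 let ?q = "rfrac R S"
 have car: "carrier L = {?q r s | r s. r \<in> carrier R \<and> s \<in> S}"
  and zero: "\<zero>\<^bsub>L\<^esub> = ?q \<zero> \<one>" and one: "\<one>\<^bsub>L\<^esub> = ?q \<one> \<one>"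
  by (simp_all add: L_def localize_ring_def)
 have eqI: "?q r s = ?q r' s'" if "r \<in> carrier R" "r' \<in> carrier R" "s \<in> S" "s' \<in> S" "s' \<otimes> r = s \<otimes> r'" for r r' s s'
  using F.frac_eqI[of r r' s s'] that by simp
 have eqD: "\<exists>u \<in> S. (u \<otimes> s') \<otimes> r = (u \<otimes> s) \<otimes> r'" if "?q r s = ?q r' s'" "r \<in> carrier R" "r' \<in> carrier R" "s \<in> S" "s' \<in> S" for r r' s s'
  using F.frac_eq_iff[of r r' s s'] that by simp
 have add: "?q r s +[L] ?q r' s' = ?q (s' \<otimes> r \<oplus> s \<otimes> r') (s \<otimes> s')"
  if "r \<in> carrier R" "r' \<in> carrier R" "s \<in> S" "s' \<in> S" for r r' s s'
 proof -
  have "X +[L] Y = X \<oplus>\<^bsub>localize_module R S (self_module R)\<^esub> Y" for X Y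
   by (simp add: L_def localize_ring_def localize_module_def)
  then show ?thesis using F.localize_add[of r r' s s'] that by simp
 qed
 have mult_cong: "?q (r \<otimes> t) (s \<otimes> v) = ?q (r' \<otimes> t) (s' \<otimes> v)"
  if h: "?q r s = ?q r' s'" "r \<in> carrier R" "r' \<in> carrier R" "s \<in> S" "s' \<in> S" "t \<in> carrier R" "v \<in> S" for r r' s s' t v
 proof -
  obtain u where u: "u \<in> S" "(u \<otimes> s') \<otimes> r = (u \<otimes> s) \<otimes> r'"
   using eqD[OF h(1-5)] by (rule bexE)
  have c: "u \<in> carrier R" "s \<in> carrier R" "s' \<in> carrier R" "v \<in> carrier R" using u h F.S_carrier by auto
  have "(u \<otimes> (s' \<otimes> v)) \<otimes> (r \<otimes> t) = (v \<otimes> t) \<otimes> ((u \<otimes> s') \<otimes> r)" using c h by (simp add: m_ac)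
  also have "\<dots> = (u \<otimes> (s \<otimes> v)) \<otimes> (r' \<otimes> t)" unfolding u(2) using c h by (simp add: m_ac)
  finally have "(u \<otimes> (s' \<otimes> v)) \<otimes> (r \<otimes> t) = (u \<otimes> (s \<otimes> v)) \<otimes> (r' \<otimes> t)" .
  then show ?thesis
   using F.frac_eq_iff[of "r \<otimes> t" "r' \<otimes> t" "s \<otimes> v" "s' \<otimes> v"] h u(1) F.m_closed by auto
 qed
 have mult: "?q r s **[L] ?q r' s' = ?q (r \<otimes> r') (s \<otimes> s')"
  if rs: "r \<in> carrier R" "r' \<in> carrier R" "s \<in> S" "s' \<in> S" for r r' s s'
 proof -
  define g where "g n t = (\<Union>(n', t') \<in> ?q r' s'. ?q (n \<otimes> n') (t \<otimes> t'))" for n t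
  have g: "g n t = ?q (n \<otimes> r') (t \<otimes> s')" if nt: "n \<in> carrier R" "t \<in> S" for n t
   unfolding g_def
  proof (rule F.union_frac)
   show "r' \<in> carrier (self_module R)" "s' \<in> S" using rs by auto
   fix n' t' assume *: "n' \<in> carrier (self_module R)" "t' \<in> S" "?q n' t' = ?q r' s'"
   have c: "n' \<in> carrier R" "t \<in> carrier R" "t' \<in> carrier R" "s' \<in> carrier R"
    using * nt rs F.S_carrier by auto
   have "?q (n' \<otimes> n) (t' \<otimes> t) = ?q (r' \<otimes> n) (s' \<otimes> t)"
    using mult_cong[of n' t' r' s' n t] * nt rs c by blast
   then show "?q (n \<otimes> n') (t \<otimes> t') = ?q (n \<otimes> r') (t \<otimes> s')"
    using c nt rs by (simp only: m_comm[of n n'] m_comm[of t t'] m_comm[of n r'] m_comm[of t s'])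
  qed
  have "?q r s **[L] ?q r' s' = (\<Union>(n, t) \<in> ?q r s. g n t)"
   by (simp add: L_def localize_ring_def g_def)
  also have "\<dots> = g r s"
  proof (rule F.union_frac)
   show "r \<in> carrier (self_module R)" "s \<in> S" using rs by auto
   fix n t assume *: "n \<in> carrier (self_module R)" "t \<in> S" "?q n t = ?q r s"
   have n: "n \<in> carrier R" using *(1) by simp
   show "g n t = g r s"
    unfolding g[OF n *(2)] g[OF rs(1,3)] by (rule mult_cong[OF *(3) n rs(1) *(2) rs(3,2,4)])
  qed
  finally show ?thesis using g rs by simp
 qed
 show "carrier L = {?q r s | r s. r \<in> carrier R \<and> s \<in> S}" "\<zero>\<^bsub>L\<^esub> = ?q \<zero> \<one>" "\<one>\<^bsub>L\<^esub> = ?q \<one> \<one>"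
  by (rule car zero one)+
 show "?q r s +[L] ?q r' s' = ?q (s' \<otimes> r \<oplus> s \<otimes> r') (s \<otimes> s')"
  if "r \<in> carrier R" "r' \<in> carrier R" "s \<in> S" "s' \<in> S" for r r' s s' by (rule add[OF that])
 show "?q r s **[L] ?q r' s' = ?q (r \<otimes> r') (s \<otimes> s')"
  if "r \<in> carrier R" "r' \<in> carrier R" "s \<in> S" "s' \<in> S" for r r' s s' by (rule mult[OF that])
 show "?q r s = ?q r' s'" if "r \<in> carrier R" "r' \<in> carrier R" "s \<in> S" "s' \<in> S" "s' \<otimes> r = s \<otimes> r'" for r r' s s'
  by (rule eqI[OF that])
 show "\<exists>u \<in> S. (u \<otimes> s') \<otimes> r = (u \<otimes> s) \<otimes> r'"
  if "?q r s = ?q r' s'" "r \<in> carrier R" "r' \<in> carrier R" "s \<in> S" "s' \<in> S" for r r' s s' by (rule eqD[OF that])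
qed

lemma (in cring) prime_localization:
 fixes P
 defines "S \<equiv> carrier R - P" and "L \<equiv> localize_ring R (carrier R - P)"
 assumes P: "primeideal P R" and L: "cring L"
 shows "ring_localization R L S (\<lambda>r. rfrac R S r \<one>)"
proof -
 have LS: "L = localize_ring R S" by (simp add: L_def S_def)
 interpret F: fractions R "self_module R" S
  unfolding S_def by (rule prime_fractions[OF self_module P])
 interpret L: cring L by (rule L)
 let ?q = "rfrac R S"
 have sub: "submonoid S R" by (rule F.submonoid_axioms)
 note ops = localize_ring_ops[OF sub, folded LS]
 note car = ops(1) and zero = ops(2) and one = ops(3) and add = ops(4) and mult = ops(5)
  and eqI = ops(6) and eqD = ops(7)
 have oneS: "\<one> \<in> S" using prime_one[OF P] by (simp add: S_def)
 have qcl: "?q r s \<in> carrier L" if "r \<in> carrier R" "s \<in> S" for r s using car that by blast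
 show ?thesis
 proof (intro ring_localization.intro ring_localization_axioms.intro L is_cring)
  show "submonoid S R" by (rule sub)
  show "(\<lambda>r. ?q r \<one>) \<in> ring_hom R L"
   by (rule ring_hom_memI) (use qcl add mult one oneS in auto)
  show "\<exists>u \<in> S. u \<otimes> r = \<zero>" if h: "r \<in> carrier R" "?q r \<one> = \<zero>\<^bsub>L\<^esub>" for r
  proof -
   obtain u where "u \<in> S" "(u \<otimes> \<one>) \<otimes> r = (u \<otimes> \<one>) \<otimes> \<zero>"
    using eqD[of r \<one> \<zero> \<one>] h oneS unfolding zero by auto
   then show ?thesis using F.S_carrier h by auto
  qed
  show "?q s \<one> \<in> Units L" if "s \<in> S" for s
  proof -
   have s: "s \<in> carrier R" using that F.S_carrier by simp
   have "?q \<one> s **[L] ?q s \<one> = \<one>\<^bsub>L\<^esub>"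
    using mult[of \<one> s s \<one>] that s oneS eqI[of s \<one> s \<one>] one by simp
   moreover have "?q s \<one> **[L] ?q \<one> s = \<one>\<^bsub>L\<^esub>"
    using mult[of s \<one> \<one> s] that s oneS eqI[of s \<one> s \<one>] one by simp
   ultimately show ?thesis unfolding Units_def using qcl[of s \<one>] qcl[of \<one> s] s that oneS by auto
  qed
  show "\<exists>s \<in> S. \<exists>r \<in> carrier R. ?q s \<one> **[L] y = ?q r \<one>" if y: "y \<in> carrier L" for y
  proof -
   obtain r s where rs: "y = ?q r s" "r \<in> carrier R" "s \<in> S" using y car by blast
   have s: "s \<in> carrier R" using rs F.S_carrier by simp
   have "?q s \<one> **[L] y = ?q r \<one>"
    using mult[of s r \<one> s] rs s oneS eqI[of "s \<otimes> r" r s \<one>] by simp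
   then show ?thesis using rs by blast
  qed
 qed
qed

section \<open>Finite Frobenius rank for regular rings\<close>

context noetherian_char begin

text \<open>The maximal ideal has as many generators as the Krull dimension d. A chain of primes of
  length d exists and, being longest, ends in the maximal ideal; with an enumeration of the
  generators it is the input of \<open>frobenius_basis\<close>.\<close>

lemma regular_local_frob_rank:
 assumes reg: "regular_local_ring R" and fin: F_fin
 shows "frob_rank 1 (\<lambda>r. r)"
proof -
 obtain m A where m: "maximalideal m R" "\<And>n. maximalideal n R ==> n = m"
  and A: "A \<subseteq> carrier R" "finite A" "m = Idl A" "enat (card A) = krull_dim R"
  using reg unfolding regular_local_ring_def by blast
 have mp: "primeideal m R" using maximalideal_prime[OF m(1)] .
 define d where "d = card A"
 define N where "N = {enat n | n. \<exists>P :: nat \<Rightarrow> 'a set. (\<forall>i \<le> n. primeideal (P i) R) \<and> (\<forall>i < n. P i \<subset> P (Suc i))}"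
 have chainN: "enat n \<in> N" if "prime_chain n P" for n P
  using that unfolding N_def prime_chain_def by blast
 have supN: "Sup N = enat d" using A(4) by (simp add: krull_dim_def N_def d_def)
 have N0: "enat 0 \<in> N" using chainN[of 0 "\<lambda>_. m"] mp by (simp add: prime_chain_def)
 \<comment> \<open>The Krull dimension is a supremum of extended naturals. It equals a number of
   generators, hence is finite, hence is attained by some chain.\<close>
 have "finite N" using supN N0 by (auto simp: Sup_enat_def split: if_splits)
 moreover have "N \<noteq> {}" using N0 by auto
 ultimately have "enat d \<in> N" using supN Max_in[of N] by (simp add: Sup_enat_def)
 then obtain Q where Q: "prime_chain d Q" unfolding N_def prime_chain_def by auto
 have Qd: "primeideal (Q d) R" using Q by (simp add: prime_chain_def)
 have "Q d \<subseteq> m"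
  using proper_ideal_maximal[OF prime_ideal[OF Qd] prime_one[OF Qd]] m(2) by auto
 have Qm: "Q d = m"
 proof (rule ccontr)
  assume "Q d \<noteq> m"
  then have "prime_chain (Suc d) (Q(Suc d := m))"
   using Q mp \<open>Q d \<subseteq> m\<close> by (auto simp: prime_chain_def less_Suc_eq le_Suc_eq)
  then have "enat (Suc d) \<le> Sup N" using chainN by (intro Sup_upper)
  then show False unfolding supN by simp
 qed
 obtain x where x: "bij_betw x {..<d} A"
  using ex_bij_betw_nat_finite[OF A(2)] atLeast0LessThan unfolding d_def by metis
 have xA: "x i \<in> A" if "i < d" for i using x that by (auto simp: bij_betw_def)
 have xR: "x i \<in> carrier R" if "i < d" for i using xA[OF that] A(1) by auto
 have "m = adjoin_seq x d"
 proof
  have "A \<subseteq> adjoin_seq x d"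
  proof
   fix a assume "a \<in> A"
   then have "a \<in> x ` {..<d}" using x by (simp add: bij_betw_def)
   then show "a \<in> adjoin_seq x d" using adjoin_seq_mem[of d x] xR by auto
  qed
  then show "m \<subseteq> adjoin_seq x d"
   unfolding A(3) using genideal_minimal[OF adjoin_seq_ideal] xR by blast
  show "adjoin_seq x d \<subseteq> m"
   using adjoin_seq_least[OF prime_ideal[OF mp], of d x] xA genideal_self[OF A(1)] A(3) by auto
 qed
 then have "\<exists>(U :: nat list set) b. fbasis {\<zero>} U b"
  using unit_outside_maximal[OF m(2)] Qm fin by (intro frobenius_basis[OF Q _ xR]) auto
 then show ?thesis using fbasis_frob_rank by blast
qed

text \<open>The c for which c^p times the identity has finite rank form an ideal, as p-th powers are
  additive. Descent from the local rings shows that it lies in no maximal ideal, so it contains 1;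
  this takes the place of patching local bases.\<close>

lemma regular_frob_rank:
 assumes reg: "regular_ring R" and fin: F_fin
 shows "frob_rank e (\<lambda>r. r)"
proof (rule frob_rank_id)
 define C where "C = {c \<in> carrier R. frob_rank 1 (\<lambda>r. c [^] p \<otimes> r)}"
 have C: "ideal C R"
 proof (rule idealI_cring)
  show "C \<subseteq> carrier R" by (auto simp: C_def)
  show "\<zero> \<in> C" by (auto simp: C_def intro!: frob_rank.zero)
  fix a assume a: "a \<in> C"
  show "b \<otimes> a \<in> C" if b: "b \<in> carrier R" for b
  proof -
   have "frob_rank 1 (\<lambda>r. (b \<otimes> a) [^] p \<otimes> r)"
    by (rule frob_rank_cong[OF frob_rank_smult[OF _ b]])
     (use a b in \<open>auto simp: C_def nat_pow_distrib m_assoc\<close>)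
   then show ?thesis using a b by (simp add: C_def)
  qed
  fix b assume b: "b \<in> C"
  have "frob_rank 1 (\<lambda>r. (a \<oplus> b) [^] p \<otimes> r)"
   by (rule frob_rank_cong[OF frob_rank_add])
    (use a b in \<open>auto simp: C_def frob_add l_distr\<close>)
  then show "a \<oplus> b \<in> C" using a b by (simp add: C_def)
 qed
 have "\<one> \<in> C"
 proof (rule ccontr)
  assume "\<one> \<notin> C"
  then obtain P where P: "maximalideal P R" "C \<subseteq> P" using proper_ideal_maximal[OF C] by auto
  have Pp: "primeideal P R" using maximalideal_prime[OF P(1)] .
  let ?S = "carrier R - P" and ?L = "localize_ring R (carrier R - P)"
  have rl: "regular_local_ring ?L" using reg Pp by (simp add: regular_ring_def)
  then have Lc: "cring ?L" and Ln: "noetherian_ring ?L" by (auto simp: regular_local_ring_def)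
  interpret loc: ring_localization R ?L ?S "\<lambda>r. rfrac R ?S r \<one>"
   by (rule prime_localization[OF Pp Lc])
  have nat: "rfrac R ?S ([n] \<cdot> \<one>) \<one> = [n] \<cdot>\<^bsub>?L\<^esub> \<one>\<^bsub>?L\<^esub>" for n :: nat
   by (induction n) (auto simp: loc.\<iota>_zero loc.\<iota>_add loc.\<iota>_one)
  have "[p] \<cdot>\<^bsub>?L\<^esub> \<one>\<^bsub>?L\<^esub> = \<zero>\<^bsub>?L\<^esub>" using nat[of p] p_zero loc.\<iota>_zero by simp
  then interpret L: noetherian_char ?L p
   using Lc Ln prime_p
   by (simp add: noetherian_char_def noetherian_cring_def cring_char_def cring_char_axioms_def)
  interpret loc: char_localization R ?L ?S "\<lambda>r. rfrac R ?S r \<one>" p ..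
  obtain c where "c \<in> ?S" "frob_rank 1 (\<lambda>r. c [^] p \<otimes> r)"
   using loc.frob_rank_descend_id[OF fin L.regular_local_frob_rank[OF rl loc.localized_F_fin[OF fin]]] by blast
  then show False using P(2) by (auto simp: C_def)
 qed
 then have "frob_rank 1 (\<lambda>r. \<one> [^] p \<otimes> r)" by (simp add: C_def)
 then show "frob_rank 1 (\<lambda>r. r)" by (rule frob_rank_cong) simp
qed

end

section \<open>Cartier modules\<close>

locale cartier = module R M + noetherian_char R p for R (structure) and M (structure) and p +
 fixes \<kappa>
 assumes fg: "finitely_generated R M"
  and \<kappa>_closed [simp]: "\<And>x. x \<in> carrier M ==> \<kappa> x \<in> carrier M"
  and \<kappa>_add: "\<And>x y. x \<in> carrier M ==> y \<in> carrier M ==> \<kappa> (x +[M] y) = \<kappa> x +[M] \<kappa> y"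
  and \<kappa>_smult: "\<And>r x. r \<in> carrier R ==> x \<in> carrier M ==> \<kappa> (r [^] p *[M] x) = r *[M] \<kappa> x"
begin

lemma kpow_closed [simp]: "x \<in> carrier M ==> (\<kappa> ^^ e) x \<in> carrier M"
 by (induction e) auto

lemma kpow_add: "x \<in> carrier M ==> y \<in> carrier M ==> (\<kappa> ^^ e) (x +[M] y) = (\<kappa> ^^ e) x +[M] (\<kappa> ^^ e) y"
 by (induction e) (auto simp: \<kappa>_add)

lemma kpow_smult:
 assumes "r \<in> carrier R" "x \<in> carrier M"
 shows "(\<kappa> ^^ e) (r [^] (p ^ e) *[M] x) = r *[M] (\<kappa> ^^ e) x"
 using assms
proof (induction e arbitrary: r)
 case (Suc e)
 have "(\<kappa> ^^ Suc e) (r [^] (p ^ Suc e) *[M] x) = \<kappa> ((\<kappa> ^^ e) ((r [^] p) [^] (p ^ e) *[M] x))"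
  using Suc.prems by (simp add: nat_pow_pow)
 also have "\<dots> = \<kappa> (r [^] p *[M] (\<kappa> ^^ e) x)" using Suc.IH[of "r [^] p"] Suc.prems by simp
 also have "\<dots> = r *[M] (\<kappa> ^^ Suc e) x" using Suc.prems by (simp add: \<kappa>_smult)
 finally show ?case .
qed simp

lemma kpow_zero [simp]: "(\<kappa> ^^ e) \<zero>\<^bsub>M\<^esub> = \<zero>\<^bsub>M\<^esub>"
 using kpow_smult[of \<zero> "\<zero>\<^bsub>M\<^esub>" e] by simp

lemma kpow_plus: "(\<kappa> ^^ (d + e)) x = (\<kappa> ^^ d) ((\<kappa> ^^ e) x)"
 by (simp add: funpow_add)

lemma kpow_minus: "x \<in> carrier M ==> (\<kappa> ^^ e) (\<ominus>\<^bsub>M\<^esub> x) = \<ominus>\<^bsub>M\<^esub> (\<kappa> ^^ e) x"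
proof -
 assume x: "x \<in> carrier M"
 have "(\<kappa> ^^ e) (\<ominus>\<^bsub>M\<^esub> x) +[M] (\<kappa> ^^ e) x = \<zero>\<^bsub>M\<^esub>"
  using kpow_add[of "\<ominus>\<^bsub>M\<^esub> x" x e] x by (simp add: M.l_neg)
 then show ?thesis using x by (intro M.minus_equality[symmetric]) auto
qed

lemma kpow_image_submodule:
 assumes "submodule N R M"
 shows "submodule ((\<kappa> ^^ e) ` N) R M"
proof (rule submoduleI)
 note NS = submodule_props[OF assms]
 have NM: "\<And>x. x \<in> N ==> x \<in> carrier M" using NS(1) by auto
 show "(\<kappa> ^^ e) ` N \<subseteq> carrier M" using NM by auto
 show "\<zero>\<^bsub>M\<^esub> \<in> (\<kappa> ^^ e) ` N" using NS(2) by (intro image_eqI[of _ _ "\<zero>\<^bsub>M\<^esub>"]) auto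
 show "\<ominus>\<^bsub>M\<^esub> a \<in> (\<kappa> ^^ e) ` N" if "a \<in> (\<kappa> ^^ e) ` N" for a
  using that NS(5) NM by (auto simp flip: kpow_minus)
 show "a +[M] b \<in> (\<kappa> ^^ e) ` N" if "a \<in> (\<kappa> ^^ e) ` N" "b \<in> (\<kappa> ^^ e) ` N" for a b
  using that NS(3) NM by (auto simp flip: kpow_add)
 show "a *[M] x \<in> (\<kappa> ^^ e) ` N" if "a \<in> carrier R" "x \<in> (\<kappa> ^^ e) ` N" for a x
  using that NS(4) NM by (auto simp flip: kpow_smult)
qed

lemma smult_image_submodule:
 assumes "submodule N R M" and f: "f \<in> carrier R"
 shows "submodule ((\<lambda>m. f *[M] m) ` N) R M"
proof (rule submoduleI)
 note NS = submodule_props[OF assms(1)]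
 have NM: "\<And>x. x \<in> N ==> x \<in> carrier M" using NS(1) by auto
 show "(\<lambda>m. f *[M] m) ` N \<subseteq> carrier M" using NM f by auto
 show "\<zero>\<^bsub>M\<^esub> \<in> (\<lambda>m. f *[M] m) ` N" using NS(2) f by (intro image_eqI[of _ _ "\<zero>\<^bsub>M\<^esub>"]) auto
 show "\<ominus>\<^bsub>M\<^esub> a \<in> (\<lambda>m. f *[M] m) ` N" if "a \<in> (\<lambda>m. f *[M] m) ` N" for a
  using that NS(5) NM f by (auto simp flip: smult_r_minus)
 show "a +[M] b \<in> (\<lambda>m. f *[M] m) ` N" if "a \<in> (\<lambda>m. f *[M] m) ` N" "b \<in> (\<lambda>m. f *[M] m) ` N" for a b
  using that NS(3) NM f by (auto simp flip: smult_r_distr)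
 fix a x assume a: "a \<in> carrier R" and "x \<in> (\<lambda>m. f *[M] m) ` N"
 then obtain n where n: "n \<in> N" "x = f *[M] n" by auto
 have "a *[M] x = f *[M] (a *[M] n)"
  unfolding n(2) using a f NM[OF n(1)] by (simp add: m_comm flip: smult_assoc1)
 then show "a *[M] x \<in> (\<lambda>m. f *[M] m) ` N" using NS(4)[OF a n(1)] by auto
qed

subsection \<open>Local sections\<close>

lemma ideal_power_ideal:
 assumes "ideal I R"
 shows "ideal (ideal_power R I k) R" "ideal_power R I (Suc k) \<subseteq> ideal_power R I k"
proof -
 show *: "ideal (ideal_power R I k) R" for k
  unfolding ideal_power_def by (induction k) (auto simp: oneideal ideal_prod_is_ideal[OF assms])
 show "ideal_power R I (Suc k) \<subseteq> ideal_power R I k"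
  using ideal_prod_inter[OF assms *[of k]] unfolding ideal_power_def by auto
qed

text \<open>If r lies in a power of \<eta>, so does r^(p^e), and r \<kappa>^e(x) =
  \<kappa>^e(r^(p^e) x); therefore \<kappa>^e preserves the sections killed by that power.\<close>

lemma local_sections_props:
 assumes "ideal \<eta> R"
 shows "submodule (local_sections R M \<eta> (carrier M)) R M"
  "\<And>x. x \<in> local_sections R M \<eta> (carrier M) ==> (\<kappa> ^^ e) x \<in> local_sections R M \<eta> (carrier M)"
  "\<And>N. N \<subseteq> carrier M ==> local_sections R M \<eta> N = N \<inter> local_sections R M \<eta> (carrier M)"
proof -
 let ?H = "local_sections R M \<eta> (carrier M)"
 have dec: "ideal_power R \<eta> l \<subseteq> ideal_power R \<eta> k" if "k \<le> l" for k l
  using that lift_Suc_antimono_le[of "ideal_power R \<eta>"] ideal_power_ideal(2)[OF assms] by blast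
 note car = ideal_carrier[OF ideal_power_ideal(1)[OF assms]]
 have sm: "a *[M] x \<in> ?H" if "a \<in> carrier R" "x \<in> ?H" for a x
 proof -
  obtain k where k: "x \<in> carrier M" "\<forall>r \<in> ideal_power R \<eta> k. r *[M] x = \<zero>\<^bsub>M\<^esub>"
   using \<open>x \<in> ?H\<close> by (auto simp: local_sections_def)
  have "r *[M] (a *[M] x) = \<zero>\<^bsub>M\<^esub>" if r: "r \<in> ideal_power R \<eta> k" for r
  proof -
   have "r *[M] (a *[M] x) = a *[M] (r *[M] x)"
    using car[OF r] \<open>a \<in> carrier R\<close> k(1) by (simp add: m_comm flip: smult_assoc1)
   then show ?thesis using k(2) r \<open>a \<in> carrier R\<close> by simp
  qed
  then show ?thesis using k(1) \<open>a \<in> carrier R\<close> by (auto simp: local_sections_def)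
 qed
 have HM: "?H \<subseteq> carrier M" by (auto simp: local_sections_def)
 show "submodule ?H R M"
 proof (rule submoduleI[OF HM])
  show "\<zero>\<^bsub>M\<^esub> \<in> ?H" using car by (auto simp: local_sections_def)
  show "a *[M] x \<in> ?H" if "a \<in> carrier R" "x \<in> ?H" for a x by (rule sm[OF that])
  show "\<ominus>\<^bsub>M\<^esub> a \<in> ?H" if "a \<in> ?H" for a
   using sm[of "\<ominus> \<one>" a] that HM by (auto simp: smult_l_minus)
  fix x y assume "x \<in> ?H" "y \<in> ?H"
  then obtain k l where k: "x \<in> carrier M" "\<forall>r \<in> ideal_power R \<eta> k. r *[M] x = \<zero>\<^bsub>M\<^esub>"
   and l: "y \<in> carrier M" "\<forall>r \<in> ideal_power R \<eta> l. r *[M] y = \<zero>\<^bsub>M\<^esub>"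
   by (auto simp: local_sections_def)
  have "r *[M] (x +[M] y) = \<zero>\<^bsub>M\<^esub>" if r: "r \<in> ideal_power R \<eta> (max k l)" for r
  proof -
   have "r \<in> ideal_power R \<eta> k" "r \<in> ideal_power R \<eta> l"
    using r dec[of k "max k l"] dec[of l "max k l"] by auto
   then show ?thesis using k l car[OF r] by (simp add: smult_r_distr)
  qed
  then show "x +[M] y \<in> ?H" using k l by (auto simp: local_sections_def)
 qed
 show "(\<kappa> ^^ e) x \<in> ?H" if "x \<in> ?H" for x
 proof -
  obtain k where k: "x \<in> carrier M" "\<forall>r \<in> ideal_power R \<eta> k. r *[M] x = \<zero>\<^bsub>M\<^esub>"
   using \<open>x \<in> ?H\<close> by (auto simp: local_sections_def)
  have "r *[M] (\<kappa> ^^ e) x = \<zero>\<^bsub>M\<^esub>" if r: "r \<in> ideal_power R \<eta> k" for r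
  proof -
   obtain q where q: "p ^ e = Suc q" using p_pos by (metis gr0_implies_Suc zero_less_power)
   have "r [^] q \<otimes> r \<in> ideal_power R \<eta> k"
    using ideal_mult[OF ideal_power_ideal(1)[OF assms] r] car[OF r] by simp
   then have "r [^] (p ^ e) *[M] x = \<zero>\<^bsub>M\<^esub>" using k(2) by (simp add: q)
   then show ?thesis using kpow_smult[OF car[OF r] k(1), of e] by simp
  qed
  then show ?thesis using k(1) by (auto simp: local_sections_def)
 qed
 show "\<And>N. N \<subseteq> carrier M ==> local_sections R M \<eta> N = N \<inter> ?H" by (auto simp: local_sections_def)
qed

abbreviation "HS \<eta> \<equiv> local_sections R M \<eta> (carrier M)"

section \<open>Nil-isomorphisms at associated primes in terms of elements\<close>

definition generically_full :: "'c set \<Rightarrow> bool" where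
 "generically_full N \<longleftrightarrow>
   (\<forall>\<eta>. associated_prime R M \<eta> \<longrightarrow> (\<forall>x \<in> HS \<eta>. \<exists>s \<in> carrier R - \<eta>. s *[M] x \<in> N))"

text \<open>Locally at \<eta>, a power of \<kappa> carries H^0 into \<open>N\<close>. The power may
  depend on the prime but not on the element, as nilpotency of the cokernel requires; the multiplier
  s may depend on both.\<close>

definition generically_nil :: "'c set \<Rightarrow> bool" where
 "generically_nil N \<longleftrightarrow>
   (\<forall>\<eta>. associated_prime R M \<eta> \<longrightarrow> (\<exists>a. \<forall>x \<in> HS \<eta>. \<exists>s \<in> carrier R - \<eta>. s *[M] (\<kappa> ^^ a) x \<in> N))"

context
 fixes \<eta> N
 assumes \<eta>: "primeideal \<eta> R" and N: "submodule N R M"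
begin

private definition "S = carrier R - \<eta>"
private definition "W = localize_submodule R S M (HS \<eta>)"
private definition "V = localize_submodule R S M (local_sections R M \<eta> N)"

private lemma frS: "fractions R M S"
 unfolding S_def by (rule prime_fractions[OF module_axioms \<eta>])

private lemma Hsub: "submodule (HS \<eta>) R M"
 by (rule local_sections_props(1)[OF prime_ideal[OF \<eta>]])

private lemma Hcl: "x \<in> HS \<eta> ==> x \<in> carrier M"
 by (auto simp: local_sections_def)

private lemma HN: "local_sections R M \<eta> N = N \<inter> HS \<eta>"
 by (rule local_sections_props(3)[OF prime_ideal[OF \<eta>] submodule_props(1)[OF N]])

private lemma HNsub: "submodule (N \<inter> HS \<eta>) R M"
 using submodule_props[OF N] submodule_props[OF Hsub] by (intro submoduleI) auto

private lemma Wgroup: "comm_group (add_monoid W)"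
 unfolding W_def by (rule fractions.localize_submodule_group[OF frS Hsub])

private lemma sub_localize:
 assumes P: "submodule P R M" "P \<subseteq> HS \<eta>"
 shows "subgroup {fraction R S M n s | n s. n \<in> P \<and> s \<in> S} (add_monoid W)"
proof -
 interpret W: comm_group "add_monoid W" by (rule Wgroup)
 have "comm_group (add_monoid (localize_submodule R S M P))"
  by (rule fractions.localize_submodule_group[OF frS P(1)])
 moreover have "add_monoid (localize_submodule R S M P) =
   (add_monoid W)\<lparr>carrier := {fraction R S M n s | n s. n \<in> P \<and> s \<in> S}\<rparr>"
  by (simp add: W_def localize_submodule_def)
 ultimately have "group ((add_monoid W)\<lparr>carrier := {fraction R S M n s | n s. n \<in> P \<and> s \<in> S}\<rparr>)"
  by (simp add: comm_group_def)
 then show ?thesis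
  by (rule W.group_incl_imp_subgroup[rotated]) (use P(2) in \<open>auto simp: W_def localize_submodule_def\<close>)
qed

private lemma Vcar: "carrier V = {fraction R S M n s | n s. n \<in> N \<inter> HS \<eta> \<and> s \<in> S}"
 by (simp add: V_def localize_submodule_def HN)

private lemma Wcar: "carrier W = {fraction R S M n s | n s. n \<in> HS \<eta> \<and> s \<in> S}"
 by (simp add: W_def localize_submodule_def)

private lemma Vsub: "subgroup (carrier V) (add_monoid W)"
 unfolding Vcar by (rule sub_localize[OF HNsub]) auto

private lemma frac_in_V:
 assumes x: "x \<in> HS \<eta>" and t: "t \<in> S"
 shows "fraction R S M x t \<in> carrier V \<longleftrightarrow> (\<exists>s \<in> S. s *[M] x \<in> N)"
proof -
 interpret F: fractions R M S by (rule frS)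
 have xM: "x \<in> carrier M" using Hcl x .
 show ?thesis
 proof
  assume "fraction R S M x t \<in> carrier V"
  then obtain n s where n: "n \<in> N" "n \<in> HS \<eta>" "s \<in> S" "fraction R S M x t = fraction R S M n s"
   unfolding Vcar by blast
  then obtain u where u: "u \<in> S" "(u \<otimes> s) *[M] x = (u \<otimes> t) *[M] n"
   using F.frac_eq_iff[of x n t s] xM Hcl t by auto
  have "(u \<otimes> t) *[M] n \<in> N" using submodule_props(4)[OF N _ n(1)] u(1) t F.S_carrier by simp
  then show "\<exists>s \<in> S. s *[M] x \<in> N" using u n(3) F.m_closed by (metis (no_types, lifting))
 next
  assume "\<exists>s \<in> S. s *[M] x \<in> N"
  then obtain s where s: "s \<in> S" "s *[M] x \<in> N" by auto
  have c: "s \<in> carrier R" "t \<in> carrier R" using s t F.S_carrier by auto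
  have "fraction R S M x t = fraction R S M (s *[M] x) (s \<otimes> t)"
  proof (rule F.frac_eqI[OF xM _ t])
   show "s *[M] x \<in> carrier M" "s \<otimes> t \<in> S" using c xM s t F.m_closed by auto
   show "(s \<otimes> t) *[M] x = t *[M] (s *[M] x)"
    using c xM m_comm[of s t] by (simp add: smult_assoc1)
  qed
  moreover have "s *[M] x \<in> HS \<eta>" using submodule_props(4)[OF Hsub c(1) x] .
  ultimately show "fraction R S M x t \<in> carrier V" unfolding Vcar using s t F.m_closed by blast
 qed
qed

private abbreviation "Q \<equiv> add_monoid W Mod carrier V"

text \<open>The map is an inclusion, so its kernel is zero and only the cokernel imposes a
  condition.\<close>

lemma nil_isomorphism_iff:
 "nil_isomorphism (add_monoid V) C (add_monoid W) C (\<lambda>X. X) \<longleftrightarrow>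
   cartier_nilpotent Q (\<lambda>e. induced_on_cosets (add_monoid W) (carrier V) ` C e)"
proof -
 have "\<one>\<^bsub>add_monoid W\<^esub> \<in> carrier V" using subgroup.one_closed[OF Vsub] .
 then have "kernel (add_monoid V) (add_monoid W) (\<lambda>X. X) = {\<one>\<^bsub>add_monoid W\<^esub>}"
  by (auto simp: kernel_def)
 moreover have "\<one>\<^bsub>add_monoid W\<^esub> = \<one>\<^bsub>add_monoid V\<^esub>" by (simp add: V_def W_def localize_submodule_def)
 ultimately have "cartier_nilpotent ((add_monoid V)\<lparr>carrier := kernel (add_monoid V) (add_monoid W) (\<lambda>X. X)\<rparr>) C"
  unfolding cartier_nilpotent_def by (intro exI[of _ 0]) auto
 then show ?thesis by (simp add: nil_isomorphism_def)
qed

lemma nilpotent_full: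
 assumes "\<And>x. x \<in> HS \<eta> ==> \<exists>s \<in> carrier R - \<eta>. s *[M] x \<in> N"
 shows "cartier_nilpotent Q D"
proof -
 interpret W: comm_group "add_monoid W" by (rule Wgroup)
 have "carrier W \<subseteq> carrier V"
 proof
  fix w assume "w \<in> carrier W"
  then obtain x t where "w = fraction R S M x t" "x \<in> HS \<eta>" "t \<in> S" unfolding Wcar by blast
  then show "w \<in> carrier V" using frac_in_V assms by (simp add: S_def)
 qed
 then have eq: "carrier V = carrier W" using subgroup.subset[OF Vsub] by auto
 have "carrier Q = {carrier V}"
  unfolding carrier_FactGroup
 proof -
  have "(#>\<^bsub>add_monoid W\<^esub>) (carrier V) w = carrier V" if "w \<in> carrier (add_monoid W)" for w
   using W.coset_join2[OF that Vsub] that eq by simp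
  moreover have "carrier (add_monoid W) \<noteq> {}" using W.one_closed by blast
  ultimately show "(#>\<^bsub>add_monoid W\<^esub>) (carrier V) ` carrier (add_monoid W) = {carrier V}"
   by (auto simp: image_iff)
 qed
 then show ?thesis unfolding cartier_nilpotent_def by (intro exI[of _ 0]) simp
qed

private definition "op e g = localize_operator p R S M e (\<lambda>m. (\<kappa> ^^ e) (g *[M] m))"

text \<open>Equal fractions m/s and x/t agree after multiplication by u t and u s. These factors
  enter \<kappa>^e as p^e-th powers: one factor of each power serves for the relation, and the
  remaining p^e - 1 match the powers of the denominators in the definition of the action.\<close>

private lemma op_frac:
 assumes x: "x \<in> carrier M" and t: "t \<in> S" and g: "g \<in> carrier R"
 shows "op e g (fraction R S M x t) = fraction R S M ((\<kappa> ^^ e) (g *[M] (t [^] (p ^ e - 1) *[M] x))) t"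
proof -
 interpret F: fractions R M S by (rule frS)
 obtain q where q: "p ^ e = Suc q" using p_pos by (metis gr0_implies_Suc zero_less_power)
 define h where "h m s = fraction R S M ((\<kappa> ^^ e) (g *[M] (s [^] q *[M] m))) s" for m s
 have "op e g (fraction R S M x t) = (\<Union>(m, s) \<in> fraction R S M x t. h m s)"
  by (simp add: op_def localize_operator_def h_def q)
 also have "\<dots> = h x t"
 proof (rule F.union_frac[OF x t])
  fix m s assume *: "m \<in> carrier M" "s \<in> S" "fraction R S M m s = fraction R S M x t"
  then obtain u where u: "u \<in> S" "(u \<otimes> t) *[M] m = (u \<otimes> s) *[M] x"
   using F.frac_eq_iff[of m x s t] x t by auto
  have c: "u \<in> carrier R" "s \<in> carrier R" "t \<in> carrier R" using u * t F.S_carrier by auto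
  let ?y = "g *[M] (s [^] q *[M] m)" and ?z = "g *[M] (t [^] q *[M] x)"
  have pq: "(a [^] (p ^ e)) = a [^] q \<otimes> a" for a by (simp add: q)
  have "(u \<otimes> t) [^] (p ^ e) *[M] ?y = (g \<otimes> s [^] q \<otimes> (u \<otimes> t) [^] q) *[M] ((u \<otimes> t) *[M] m)"
   using c g * unfolding pq by (simp add: m_ac flip: smult_assoc1)
  also have "\<dots> = (u \<otimes> s) [^] (p ^ e) *[M] ?z"
   unfolding u(2) pq using c g x by (simp add: m_ac nat_pow_distrib flip: smult_assoc1)
  finally have "(\<kappa> ^^ e) ((u \<otimes> t) [^] (p ^ e) *[M] ?y) = (\<kappa> ^^ e) ((u \<otimes> s) [^] (p ^ e) *[M] ?z)" by simp
  then have "(u \<otimes> t) *[M] (\<kappa> ^^ e) ?y = (u \<otimes> s) *[M] (\<kappa> ^^ e) ?z"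
   using kpow_smult[of "u \<otimes> t" ?y e] kpow_smult[of "u \<otimes> s" ?z e] c g x * by simp
  then show "h m s = h x t"
   unfolding h_def using u(1) c g x t * by (subst F.frac_eq_iff) auto
 qed
 finally show ?thesis by (simp add: h_def q)
qed

private lemma op_closed:
 assumes P: "submodule P R M" and sub: "P \<subseteq> HS \<eta>" and w: "w \<in> {fraction R S M n s | n s. n \<in> P \<and> s \<in> S}"
  and g: "g \<in> carrier R" and im: "\<And>m. m \<in> P ==> (\<kappa> ^^ e) (g *[M] m) \<in> P'"
 shows "op e g w \<in> {fraction R S M n s | n s. n \<in> P' \<and> s \<in> S}"
proof -
 interpret F: fractions R M S by (rule frS)
 obtain n s where n: "w = fraction R S M n s" "n \<in> P" "s \<in> S" using w by blast
 have nM: "n \<in> carrier M" using n(2) sub Hcl by auto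
 have "s [^] (p ^ e - 1) *[M] n \<in> P" using submodule_props(4)[OF P _ n(2)] F.S_carrier[OF n(3)] by simp
 from im[OF this] show ?thesis unfolding n(1) op_frac[OF nM n(3) g] using n(3) by blast
qed

private lemma op_add:
 assumes v: "v \<in> carrier W" and w: "w \<in> carrier W" and g: "g \<in> carrier R"
 shows "op e g (v +[W] w) = op e g v +[W] op e g w"
proof -
 interpret F: fractions R M S by (rule frS)
 obtain x s where x: "v = fraction R S M x s" "x \<in> HS \<eta>" "s \<in> S" using v unfolding Wcar by blast
 obtain y t where y: "w = fraction R S M y t" "y \<in> HS \<eta>" "t \<in> S" using w unfolding Wcar by blast
 have c: "x \<in> carrier M" "y \<in> carrier M" "s \<in> carrier R" "t \<in> carrier R" using x y Hcl F.S_carrier by auto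
 have add: "fraction R S M m r +[W] fraction R S M m' r' = fraction R S M (r' *[M] m +[M] r *[M] m') (r \<otimes> r')"
  if "m \<in> carrier M" "m' \<in> carrier M" "r \<in> S" "r' \<in> S" for m m' r r'
  using F.localize_add[OF that] by (simp add: W_def localize_submodule_def)
 obtain q where q: "p ^ e = Suc q" using p_pos by (metis gr0_implies_Suc zero_less_power)
 have pq: "(a [^] (p ^ e)) = a [^] q \<otimes> a" for a by (simp add: q)
 let ?x = "(\<kappa> ^^ e) (g *[M] (s [^] q *[M] x))" and ?y = "(\<kappa> ^^ e) (g *[M] (t [^] q *[M] y))"
 have "g *[M] ((s \<otimes> t) [^] q *[M] (t *[M] x +[M] s *[M] y)) =
   t [^] (p ^ e) *[M] (g *[M] (s [^] q *[M] x)) +[M] s [^] (p ^ e) *[M] (g *[M] (t [^] q *[M] y))"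
  using c g unfolding pq by (simp add: smult_r_distr nat_pow_distrib m_ac flip: smult_assoc1)
 then have "(\<kappa> ^^ e) (g *[M] ((s \<otimes> t) [^] q *[M] (t *[M] x +[M] s *[M] y))) = t *[M] ?x +[M] s *[M] ?y"
  using c g by (simp add: kpow_add kpow_smult)
 then have "op e g (v +[W] w) = fraction R S M (t *[M] ?x +[M] s *[M] ?y) (s \<otimes> t)"
  unfolding x(1) y(1) add[OF c(1,2) x(3) y(3)]
  using op_frac[of "t *[M] x +[M] s *[M] y" "s \<otimes> t" g e] c g x(3) y(3) F.m_closed by (simp add: q)
 also have "\<dots> = op e g v +[W] op e g w"
  unfolding x(1) y(1) op_frac[OF c(1) x(3) g] op_frac[OF c(2) y(3) g]
  using add[of ?x ?y s t] c g x(3) y(3) by (simp add: q)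
 finally show ?thesis .
qed

private lemma induced_op:
 assumes w: "w \<in> carrier W" and g: "g \<in> carrier R" and Ng: "\<And>m. m \<in> N ==> (\<kappa> ^^ e) (g *[M] m) \<in> N"
 shows "op e g w \<in> carrier W"
  "induced_on_cosets (add_monoid W) (carrier V) (op e g) (carrier V #>\<^bsub>add_monoid W\<^esub> w) = carrier V #>\<^bsub>add_monoid W\<^esub> op e g w"
proof -
 interpret W: comm_group "add_monoid W" by (rule Wgroup)
 have H: "(\<kappa> ^^ e) (g *[M] m) \<in> HS \<eta>" if "m \<in> HS \<eta>" for m
  using local_sections_props(2)[OF prime_ideal[OF \<eta>]] submodule_props(4)[OF Hsub g that] by blast
 have opW: "op e g w \<in> carrier W" if "w \<in> carrier W" for w
  using op_closed[OF Hsub subset_refl _ g H] that unfolding Wcar by blast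
 have opV: "op e g v \<in> carrier V" if "v \<in> carrier V" for v
  unfolding Vcar by (rule op_closed[OF HNsub _ _ g]) (use H Ng that Vcar in auto)
 show "op e g w \<in> carrier W" by (rule opW[OF w])
 have "carrier V #>\<^bsub>add_monoid W\<^esub> op e g x = carrier V #>\<^bsub>add_monoid W\<^esub> op e g w"
  if x: "x \<in> carrier V #>\<^bsub>add_monoid W\<^esub> w" for x
 proof -
  obtain v where v: "v \<in> carrier V" "x = v +[W] w" using x by (auto simp: r_coset_def)
  have vW: "v \<in> carrier W" using v(1) subgroup.subset[OF Vsub] by auto
  have "op e g x = op e g v +[W] op e g w" unfolding v(2) by (rule op_add[OF vW w g])
  then have "op e g x \<in> carrier V #>\<^bsub>add_monoid W\<^esub> op e g w" using opV[OF v(1)] by (auto simp: r_coset_def)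
  from W.repr_independence[OF this _ Vsub] show ?thesis using opW[OF w] by simp
 qed
 moreover have "w \<in> carrier V #>\<^bsub>add_monoid W\<^esub> w" using W.rcos_self[OF _ Vsub, of w] w by simp
 ultimately show "induced_on_cosets (add_monoid W) (carrier V) (op e g) (carrier V #>\<^bsub>add_monoid W\<^esub> w) = carrier V #>\<^bsub>add_monoid W\<^esub> op e g w"
  unfolding induced_on_cosets_def by blast
qed

private abbreviation "DD C \<equiv> (\<lambda>e. induced_on_cosets (add_monoid W) (carrier V) ` (localize_operator p R S M e ` C e))"

text \<open>Inductively, the k-th power of C_+ maps the quotient into the image of \<kappa>^k(H): an
  operator \<kappa>^e g with e \<ge> 1 sends \<kappa>^k(x) to \<kappa>^(e+k)(g^(p^k) x), and
  \<kappa>^(e-1) stays within H. For k = a this image is zero by assumption.\<close>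

lemma nilpotentI:
 assumes C: "\<And>e \<phi>. e \<ge> 1 ==> \<phi> \<in> C e ==> \<exists>g \<in> carrier R. \<phi> = (\<lambda>m. (\<kappa> ^^ e) (g *[M] m))"
  and CN: "\<And>e \<phi>. e \<ge> 1 ==> \<phi> \<in> C e ==> \<phi> ` N \<subseteq> N"
  and nil: "\<And>x. x \<in> HS \<eta> ==> \<exists>s \<in> carrier R - \<eta>. s *[M] (\<kappa> ^^ a) x \<in> N"
 shows "cartier_nilpotent Q (DD C)"
proof -
 interpret W: comm_group "add_monoid W" by (rule Wgroup)
 interpret VN: normal "carrier V" "add_monoid W" by (rule W.subgroup_imp_normal[OF Vsub])
 interpret Q: group Q by (rule VN.factorgroup_is_group)
 interpret hom: group_hom "add_monoid W" Q "\<lambda>w. carrier V #>\<^bsub>add_monoid W\<^esub> w"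
  by (intro group_hom.intro group_hom_axioms.intro W.group_axioms Q.group_axioms VN.r_coset_hom_Mod)
 define Z where "Z k = {fraction R S M n s | n s. n \<in> (\<kappa> ^^ k) ` HS \<eta> \<and> s \<in> S}" for k
 have kH: "(\<kappa> ^^ k) ` HS \<eta> \<subseteq> HS \<eta>" for k using local_sections_props(2)[OF prime_ideal[OF \<eta>]] by auto
 have Zsub: "subgroup (Z k) (add_monoid W)" for k
  unfolding Z_def by (rule sub_localize[OF kpow_image_submodule[OF Hsub] kH])
 have ZW: "Z k \<subseteq> carrier W" for k using subgroup.subset[OF Zsub] by simp
 have Zim: "subgroup ((\<lambda>w. carrier V #>\<^bsub>add_monoid W\<^esub> w) ` Z k) Q" for k
  by (rule hom.subgroup_img_is_subgroup[OF Zsub])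
 have sub: "(cartier_plus Q (DD C) ^^ k) (carrier Q) \<subseteq> (\<lambda>w. carrier V #>\<^bsub>add_monoid W\<^esub> w) ` Z k" for k
 proof (induction k)
  case 0
  have "Z 0 = carrier W" by (simp add: Z_def Wcar)
  then show ?case by (simp add: carrier_FactGroup)
 next
  case (Suc k)
  let ?G = "{\<phi> x | e \<phi> x. e \<ge> 1 \<and> \<phi> \<in> DD C e \<and> x \<in> (cartier_plus Q (DD C) ^^ k) (carrier Q)}"
  have "?G \<subseteq> (\<lambda>w. carrier V #>\<^bsub>add_monoid W\<^esub> w) ` Z (Suc k)"
  proof
   fix Y assume "Y \<in> ?G"
   then obtain e \<phi> X where e: "1 \<le> e" and \<phi>: "\<phi> \<in> C e"
    and X: "X \<in> (cartier_plus Q (DD C) ^^ k) (carrier Q)"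
    and Y: "Y = induced_on_cosets (add_monoid W) (carrier V) (localize_operator p R S M e \<phi>) X" by blast
   obtain w where w: "w \<in> Z k" "X = carrier V #>\<^bsub>add_monoid W\<^esub> w" using Suc.IH X by blast
   obtain g where g: "g \<in> carrier R" "\<phi> = (\<lambda>m. (\<kappa> ^^ e) (g *[M] m))" using C[OF e \<phi>] by auto
   have opg: "localize_operator p R S M e \<phi> = op e g" by (simp add: op_def g(2))
   have Ng: "(\<kappa> ^^ e) (g *[M] m) \<in> N" if "m \<in> N" for m using CN[OF e \<phi>] that g(2) by auto
   have "induced_on_cosets (add_monoid W) (carrier V) (localize_operator p R S M e \<phi>) X = carrier V #>\<^bsub>add_monoid W\<^esub> op e g w"
    unfolding opg w(2) using induced_op(2)[OF _ g(1) Ng, of w] ZW w(1) by auto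
   moreover have "op e g w \<in> Z (Suc k)"
    unfolding Z_def
   proof (rule op_closed[OF kpow_image_submodule[OF Hsub, of k] kH _ g(1)])
    show "w \<in> {fraction R S M n s | n s. n \<in> (\<kappa> ^^ k) ` HS \<eta> \<and> s \<in> S}" using w(1) by (simp add: Z_def)
    fix m assume "m \<in> (\<kappa> ^^ k) ` HS \<eta>"
    then obtain x where x: "x \<in> HS \<eta>" "m = (\<kappa> ^^ k) x" by auto
    obtain d where d: "e = Suc d" using e by (cases e) auto
    have "g *[M] m = (\<kappa> ^^ k) (g [^] (p ^ k) *[M] x)"
     unfolding x(2) using kpow_smult[OF g(1) Hcl[OF x(1)]] by simp
    then have "(\<kappa> ^^ e) (g *[M] m) = (\<kappa> ^^ (e + k)) (g [^] (p ^ k) *[M] x)" by (simp add: kpow_plus)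
    also have "\<dots> = (\<kappa> ^^ (Suc k + d)) (g [^] (p ^ k) *[M] x)" by (simp add: d add.commute)
    also have "\<dots> = (\<kappa> ^^ Suc k) ((\<kappa> ^^ d) (g [^] (p ^ k) *[M] x))" by (rule kpow_plus)
    finally show "(\<kappa> ^^ e) (g *[M] m) \<in> (\<kappa> ^^ Suc k) ` HS \<eta>"
     using local_sections_props(2)[OF prime_ideal[OF \<eta>], of "g [^] (p ^ k) *[M] x" d] submodule_props(4)[OF Hsub _ x(1), of "g [^] (p ^ k)"] g(1)
     by auto
   qed
   ultimately show "Y \<in> (\<lambda>w. carrier V #>\<^bsub>add_monoid W\<^esub> w) ` Z (Suc k)"
    unfolding Y by blast
  qed
  then have "generate Q ?G \<subseteq> (\<lambda>w. carrier V #>\<^bsub>add_monoid W\<^esub> w) ` Z (Suc k)"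
   by (rule Q.generate_subgroup_incl[OF _ Zim])
  then show ?case unfolding cartier_plus_def funpow.simps o_apply .
 qed
 have "Z a \<subseteq> carrier V"
 proof
  fix w assume "w \<in> Z a"
  then obtain x t where "w = fraction R S M ((\<kappa> ^^ a) x) t" "x \<in> HS \<eta>" "t \<in> S" unfolding Z_def by blast
  then show "w \<in> carrier V" using frac_in_V[of "(\<kappa> ^^ a) x" t] kH nil by (auto simp: S_def)
 qed
 then have "(\<lambda>w. carrier V #>\<^bsub>add_monoid W\<^esub> w) ` Z a \<subseteq> {carrier V}"
  using W.coset_join2[OF _ Vsub] ZW by auto
 then have "(cartier_plus Q (DD C) ^^ a) (carrier Q) \<subseteq> {carrier V}" using sub by blast
 moreover have "carrier V \<in> (cartier_plus Q (DD C) ^^ a) (carrier Q)"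
 proof (cases a)
  case 0
  then show ?thesis using Q.one_closed by simp
 next
  case (Suc b)
  then show ?thesis using generate.one[of Q] by (simp add: cartier_plus_def)
 qed
 ultimately show ?thesis unfolding cartier_nilpotent_def by (intro exI[of _ a]) auto
qed

text \<open>A single operator of degree 1 is iterated. The cosets of its k-fold iterates lie in the
  k-th power of C_+, so that nilpotency puts some iterate into \<open>N\<close> locally.\<close>

lemma nilpotentD:
 assumes g: "g \<in> carrier R" and gC: "(\<lambda>m. (\<kappa> ^^ 1) (g *[M] m)) \<in> C 1"
  and gN: "\<And>m. m \<in> N ==> (\<kappa> ^^ 1) (g *[M] m) \<in> N"
  and nil: "cartier_nilpotent Q (DD C)"
 shows "\<exists>a. \<forall>x \<in> HS \<eta>. \<exists>s \<in> carrier R - \<eta>. s *[M] ((\<lambda>m. \<kappa> (g *[M] m)) ^^ a) x \<in> N"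
proof -
 interpret F: fractions R M S by (rule frS)
 interpret W: comm_group "add_monoid W" by (rule Wgroup)
 let ?\<phi> = "\<lambda>m. \<kappa> (g *[M] m)"
 obtain a where a: "(cartier_plus Q (DD C) ^^ a) (carrier Q) = {carrier V}"
  using nil by (auto simp: cartier_nilpotent_def)
 have \<phi>H: "(?\<phi> ^^ k) x \<in> HS \<eta>" if "x \<in> HS \<eta>" for k x
 proof (induction k)
  case (Suc k)
  then show ?case using local_sections_props(2)[OF prime_ideal[OF \<eta>], of "g *[M] (?\<phi> ^^ k) x" 1] submodule_props(4)[OF Hsub g] by simp
 qed (use that in simp)
 have mem: "carrier V #>\<^bsub>add_monoid W\<^esub> fraction R S M ((?\<phi> ^^ k) x) \<one> \<in> (cartier_plus Q (DD C) ^^ k) (carrier Q)"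
  if x: "x \<in> HS \<eta>" for x k
 proof (induction k)
  case 0
  have "fraction R S M x \<one> \<in> carrier W" unfolding Wcar using x F.one_closed by blast
  then show ?case by (simp add: carrier_FactGroup)
 next
  case (Suc k)
  let ?w = "fraction R S M ((?\<phi> ^^ k) x) \<one>"
  have w: "?w \<in> carrier W" unfolding Wcar using \<phi>H[OF x] F.one_closed by blast
  have "op 1 g ?w = fraction R S M ((?\<phi> ^^ Suc k) x) \<one>"
   using op_frac[OF Hcl[OF \<phi>H[OF x, of k]] F.one_closed g, of 1] Hcl[OF \<phi>H[OF x, of k]] g by simp
  then have eq: "carrier V #>\<^bsub>add_monoid W\<^esub> fraction R S M ((?\<phi> ^^ Suc k) x) \<one> =
    induced_on_cosets (add_monoid W) (carrier V) (op 1 g) (carrier V #>\<^bsub>add_monoid W\<^esub> ?w)"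
   using induced_op(2)[OF w g gN] by simp
  have "induced_on_cosets (add_monoid W) (carrier V) (op 1 g) \<in> DD C 1" using gC by (auto simp: op_def)
  then have "induced_on_cosets (add_monoid W) (carrier V) (op 1 g) (carrier V #>\<^bsub>add_monoid W\<^esub> ?w) \<in>
    {\<phi> x | e \<phi> x. e \<ge> 1 \<and> \<phi> \<in> DD C e \<and> x \<in> (cartier_plus Q (DD C) ^^ k) (carrier Q)}"
   using Suc.IH by (intro CollectI exI[of _ "1::nat"] exI[of _ "induced_on_cosets (add_monoid W) (carrier V) (op 1 g)"]
    exI[of _ "carrier V #>\<^bsub>add_monoid W\<^esub> ?w"] conjI order_refl refl)
  then have "carrier V #>\<^bsub>add_monoid W\<^esub> fraction R S M ((?\<phi> ^^ Suc k) x) \<one> \<in>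
    cartier_plus Q (DD C) ((cartier_plus Q (DD C) ^^ k) (carrier Q))"
   unfolding cartier_plus_def eq by (rule generate.incl)
  then show ?case by simp
 qed
 have "\<exists>s \<in> S. s *[M] (?\<phi> ^^ a) x \<in> N" if x: "x \<in> HS \<eta>" for x
 proof -
  let ?w = "fraction R S M ((?\<phi> ^^ a) x) \<one>"
  have w: "?w \<in> carrier W" unfolding Wcar using \<phi>H[OF x] F.one_closed by blast
  have "carrier V #>\<^bsub>add_monoid W\<^esub> ?w = carrier V" using mem[OF x, of a] unfolding a by simp
  then have "?w \<in> carrier V" using W.rcos_self[OF _ Vsub, of ?w] w by simp
  then show ?thesis using frac_in_V[OF \<phi>H[OF x] F.one_closed] by simp
 qed
 then show ?thesis unfolding S_def by blast
qed

lemma generically_nil_isomorphic_at: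
 "(let S = carrier R - \<eta>;
    V = localize_submodule R S M (local_sections R M \<eta> N);
    W = localize_submodule R S M (local_sections R M \<eta> (carrier M));
    C\<^sub>\<eta> = (\<lambda>e. localize_operator p R S M e ` C e)
  in nil_isomorphism (add_monoid V) C\<^sub>\<eta> (add_monoid W) C\<^sub>\<eta> (\<lambda>X. X)) \<longleftrightarrow> cartier_nilpotent Q (DD C)"
 unfolding Let_def using nil_isomorphism_iff[of "\<lambda>e. localize_operator p R S M e ` C e"]
 by (simp only: S_def V_def W_def)

end

lemma associated_prime_regular:
 assumes \<eta>: "associated_prime R M \<eta>" and f: "regular_element R M f"
 shows "f [^] (k::nat) \<in> carrier R - \<eta>"
proof -
 have P: "primeideal \<eta> R" using \<eta> by (simp add: associated_prime_def)
 obtain m where m: "m \<in> carrier M" "\<eta> = {r \<in> carrier R. r *[M] m = \<zero>\<^bsub>M\<^esub>}"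
  using \<eta> by (auto simp: associated_prime_def)
 have "f \<notin> \<eta>"
 proof
  assume "f \<in> \<eta>"
  then have "m = \<zero>\<^bsub>M\<^esub>" using f m by (auto simp: regular_element_def)
  then show False using m prime_one[OF P] by auto
 qed
 then have "f \<in> carrier R - \<eta>" using f by (simp add: regular_element_def)
 then show ?thesis
  by (induction k) (use prime_one[OF P] prime_mult_notin[OF P] in auto)
qed

lemma test_algebra_op:
 assumes "f \<in> carrier R" "e \<ge> 1" "\<phi> \<in> test_algebra p R M \<kappa> f l e"
 shows "\<exists>g \<in> carrier R. \<phi> = (\<lambda>m. (\<kappa> ^^ e) (g *[M] m))"
proof -
 obtain r where "r \<in> carrier R"
  "\<phi> = (\<lambda>m. (\<kappa> ^^ e) ((f [^] nat \<lceil>l * of_nat p ^ e\<rceil> \<otimes> r) *[M] m))"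
  using assms(2,3) by (auto simp: test_algebra_def)
 then show ?thesis using assms(1) by (intro bexI[of _ "f [^] nat \<lceil>l * of_nat p ^ e\<rceil> \<otimes> r"]) auto
qed

lemma full_generically_nil_isomorphic:
 assumes N: "submodule N R M" and full: "generically_full N"
 shows "generically_nil_isomorphic p R M C N"
 unfolding generically_nil_isomorphic_def
proof (intro allI impI)
 fix \<eta> assume \<eta>: "associated_prime R M \<eta>"
 then have P: "primeideal \<eta> R" by (simp add: associated_prime_def)
 show "let S = carrier R - \<eta>; V = localize_submodule R S M (local_sections R M \<eta> N); W = localize_submodule R S M (HS \<eta>);
   C\<^sub>\<eta> = \<lambda>e. localize_operator p R S M e ` C e
  in nil_isomorphism (add_monoid V) C\<^sub>\<eta> (add_monoid W) C\<^sub>\<eta> (\<lambda>X. X)"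
  unfolding generically_nil_isomorphic_at[OF P N]
  by (rule nilpotent_full[OF P N]) (use full \<eta> in \<open>auto simp: generically_full_def\<close>)
qed

lemma nil_generically_nil_isomorphic:
 assumes f: "f \<in> carrier R" and N: "cartier_submodule R M (test_algebra p R M \<kappa> f l) N" and nil: "generically_nil N"
 shows "generically_nil_isomorphic p R M (test_algebra p R M \<kappa> f l) N"
 unfolding generically_nil_isomorphic_def
proof (intro allI impI)
 let ?C = "test_algebra p R M \<kappa> f l"
 fix \<eta> assume \<eta>: "associated_prime R M \<eta>"
 then have P: "primeideal \<eta> R" by (simp add: associated_prime_def)
 have Ns: "submodule N R M" and NC: "\<And>e \<phi>. \<phi> \<in> ?C e ==> \<phi> ` N \<subseteq> N"
  using N by (auto simp: cartier_submodule_def)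
 obtain a where a: "\<And>x. x \<in> HS \<eta> ==> \<exists>s \<in> carrier R - \<eta>. s *[M] (\<kappa> ^^ a) x \<in> N"
  using nil \<eta> unfolding generically_nil_def by blast
 show "let S = carrier R - \<eta>; V = localize_submodule R S M (local_sections R M \<eta> N); W = localize_submodule R S M (HS \<eta>);
   C\<^sub>\<eta> = \<lambda>e. localize_operator p R S M e ` ?C e
  in nil_isomorphism (add_monoid V) C\<^sub>\<eta> (add_monoid W) C\<^sub>\<eta> (\<lambda>X. X)"
  unfolding generically_nil_isomorphic_at[OF P Ns]
  by (rule nilpotentI[OF P Ns test_algebra_op[OF f] NC a])
qed

text \<open>Since \<open>f\<close> is invertible at the associated primes, the twist by powers of \<open>f\<close> does not matter.\<close>

lemma generically_nil_isomorphic_nil: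
 assumes f: "regular_element R M f" and N: "cartier_submodule R M (test_algebra p R M \<kappa> f l) N"
  and gni: "generically_nil_isomorphic p R M (test_algebra p R M \<kappa> f l) N"
 shows "generically_nil N"
 unfolding generically_nil_def
proof (intro allI impI)
 let ?C = "test_algebra p R M \<kappa> f l"
 fix \<eta> assume \<eta>: "associated_prime R M \<eta>"
 then have P: "primeideal \<eta> R" by (simp add: associated_prime_def)
 have fR: "f \<in> carrier R"
  using f by (auto simp: regular_element_def)
 have Ns: "submodule N R M" and NC: "\<And>e \<phi>. \<phi> \<in> ?C e ==> \<phi> ` N \<subseteq> N"
  using N by (auto simp: cartier_submodule_def)
 note NS = submodule_props[OF Ns]
 note Hs = submodule_props[OF local_sections_props(1)[OF prime_ideal[OF P]]]
 define n where "n = nat \<lceil>l * of_nat p ^ 1\<rceil>"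
 let ?\<phi> = "\<lambda>m. \<kappa> (f [^] n *[M] m)"
 have mem: "(\<lambda>m. (\<kappa> ^^ 1) (f [^] n *[M] m)) \<in> ?C 1"
  using fR by (auto simp: test_algebra_def n_def intro!: exI[of _ \<one>])
 have gN: "(\<kappa> ^^ 1) (f [^] n *[M] m) \<in> N" if "m \<in> N" for m
  using NC[OF mem] that by (rule image_subset_iff[THEN iffD1, THEN bspec])
 have fn: "f [^] n \<in> carrier R" using fR by simp
 note at = gni[unfolded generically_nil_isomorphic_def, rule_format, OF \<eta>, unfolded generically_nil_isomorphic_at[OF P Ns]]
 obtain a where a: "\<forall>x \<in> HS \<eta>. \<exists>s \<in> carrier R - \<eta>. s *[M] (?\<phi> ^^ a) x \<in> N"
  using nilpotentD[OF P Ns fn mem gN at] by (rule exE)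
 note f\<eta>n = associated_prime_regular[OF \<eta> f]
 have "\<exists>c. \<forall>x \<in> carrier M. (?\<phi> ^^ a) x = (\<kappa> ^^ a) (f [^] (c::nat) *[M] x)"
 proof (induction a)
  case 0
  then show ?case by (intro exI[of _ 0]) simp
 next
  case (Suc a)
  then obtain c where c: "\<forall>x \<in> carrier M. (?\<phi> ^^ a) x = (\<kappa> ^^ a) (f [^] (c::nat) *[M] x)" by auto
  have "(?\<phi> ^^ Suc a) x = (\<kappa> ^^ Suc a) (f [^] (n * p ^ a + c) *[M] x)" if x: "x \<in> carrier M" for x
  proof -
   have "(?\<phi> ^^ Suc a) x = \<kappa> (f [^] n *[M] (\<kappa> ^^ a) (f [^] c *[M] x))" using c x by simp
   also have "\<dots> = \<kappa> ((\<kappa> ^^ a) ((f [^] n) [^] (p ^ a) *[M] (f [^] c *[M] x)))"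
    using kpow_smult[of "f [^] n" "f [^] c *[M] x" a] fR x by simp
   also have "\<dots> = (\<kappa> ^^ Suc a) (f [^] (n * p ^ a + c) *[M] x)"
    using fR x by (simp add: nat_pow_pow nat_pow_mult flip: smult_assoc1)
   finally show ?thesis .
  qed
  then show ?case by blast
 qed
 then obtain c :: nat where c: "\<And>x. x \<in> carrier M ==> (?\<phi> ^^ a) x = (\<kappa> ^^ a) (f [^] c *[M] x)" by auto
 have "\<exists>s \<in> carrier R - \<eta>. s *[M] (\<kappa> ^^ a) x \<in> N" if x: "x \<in> HS \<eta>" for x
 proof -
  have xM: "x \<in> carrier M" using x Hs(1) by auto
  \<comment> \<open>The power of f is filled up to the exponent c p^a. Then f^c leaves \<kappa>^a as
    a factor, and it can be absorbed into the multiplier because it is outside \<eta>.\<close>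
  define y where "y = f [^] (p ^ a * c - c) *[M] x"
  have y: "y \<in> HS \<eta>" unfolding y_def using Hs(4)[OF _ x] fR by simp
  obtain s where s: "s \<in> carrier R - \<eta>" "s *[M] (?\<phi> ^^ a) y \<in> N" using a y by blast
  have "0 < p ^ a" by simp
  then have "1 * c \<le> p ^ a * c" by (intro mult_le_mono1) (simp only: Suc_le_eq One_nat_def)
  then have pc: "c \<le> p ^ a * c" by simp
  have "f [^] c *[M] y = (f [^] c \<otimes> f [^] (p ^ a * c - c)) *[M] x"
   unfolding y_def using fR xM by (simp add: smult_assoc1)
  also have "\<dots> = (f [^] c) [^] (p ^ a) *[M] x"
   using pc fR by (simp add: nat_pow_mult nat_pow_pow mult.commute)
  finally have "(?\<phi> ^^ a) y = f [^] c *[M] (\<kappa> ^^ a) x"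
   using c[of y] Hs(1) y kpow_smult[of "f [^] c" x a] fR xM by auto
  then have "(s \<otimes> f [^] c) *[M] (\<kappa> ^^ a) x \<in> N" using s fR xM by (simp add: smult_assoc1)
  then show ?thesis using prime_mult_notin[OF P s(1) f\<eta>n] by blast
 qed
 then show "\<exists>a. \<forall>x \<in> HS \<eta>. \<exists>s \<in> carrier R - \<eta>. s *[M] (\<kappa> ^^ a) x \<in> N" by blast
qed

section \<open>The test condition at exponent zero\<close>

definition kstable :: "'c set \<Rightarrow> bool" where
 "kstable N \<longleftrightarrow> submodule N R M \<and> \<kappa> ` N \<subseteq> N"

lemma kstable_kpow: "kstable N ==> x \<in> N ==> (\<kappa> ^^ e) x \<in> N"
 by (induction e) (auto simp: kstable_def)

lemma kstable_cartier_submodule: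
 "cartier_submodule R M (test_algebra p R M \<kappa> \<one> 0) N \<longleftrightarrow> kstable N"
proof
 assume N: "cartier_submodule R M (test_algebra p R M \<kappa> \<one> 0) N"
 then have Ns: "submodule N R M" by (simp add: cartier_submodule_def)
 have "(\<lambda>m. (\<kappa> ^^ 1) ((\<one> [^] nat \<lceil>(0::rat) * of_nat p ^ 1\<rceil> \<otimes> \<one>) *[M] m)) \<in> test_algebra p R M \<kappa> \<one> 0 1"
  by (auto simp: test_algebra_def intro!: exI[of _ \<one>])
 then have im: "(\<lambda>m. (\<kappa> ^^ 1) ((\<one> [^] nat \<lceil>(0::rat) * of_nat p ^ 1\<rceil> \<otimes> \<one>) *[M] m)) ` N \<subseteq> N"
  by (rule N[unfolded cartier_submodule_def, THEN conjunct2, rule_format])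
 have eq: "(\<kappa> ^^ 1) ((\<one> [^] nat \<lceil>(0::rat) * of_nat p ^ 1\<rceil> \<otimes> \<one>) *[M] m) = \<kappa> m" if "m \<in> N" for m
 proof -
  have "m \<in> carrier M" using submodule_props(1)[OF Ns] that by auto
  then show ?thesis by simp
 qed
 have "\<kappa> m \<in> N" if "m \<in> N" for m
  using im[unfolded image_subset_iff, rule_format, OF that] by (simp only: eq[OF that])
 then have "\<kappa> ` N \<subseteq> N" by auto
 then show "kstable N" using Ns by (simp add: kstable_def)
next
 assume N: "kstable N"
 then have Ns: "submodule N R M" by (simp add: kstable_def)
 have "\<phi> m \<in> N" if \<phi>: "\<phi> \<in> test_algebra p R M \<kappa> \<one> 0 e" and m: "m \<in> N" for e \<phi> m
 proof (cases "e = 0")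
  case True
  then show ?thesis using \<phi> submodule_props(4)[OF Ns _ m] by (auto simp: test_algebra_def)
 next
  case False
  then obtain g where "g \<in> carrier R" "\<phi> = (\<lambda>m. (\<kappa> ^^ e) (g *[M] m))"
   using test_algebra_op[OF one_closed _ \<phi>] by auto
  then show ?thesis using kstable_kpow[OF N submodule_props(4)[OF Ns _ m]] by simp
 qed
 then show "cartier_submodule R M (test_algebra p R M \<kappa> \<one> 0) N"
  using Ns by (auto simp: cartier_submodule_def)
qed

lemma test_condition_iff:
 "cartier_submodule R M (test_algebra p R M \<kappa> \<one> 0) N \<and>
   generically_nil_isomorphic p R M (test_algebra p R M \<kappa> \<one> 0) N \<longleftrightarrow> kstable N \<and> generically_nil N"
proof -
 have "regular_element R M \<one>" by (auto simp: regular_element_def)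
 then show ?thesis
  using generically_nil_isomorphic_nil[of \<one> 0 N] nil_generically_nil_isomorphic[of \<one> 0 N] kstable_cartier_submodule by auto
qed

end

section \<open>Test modules of F-regular Cartier modules\<close>

text \<open>The assumption \<open>minimal\<close> expresses F-regularity without LEAST. It follows
  from \<open>F_regular\<close> as soon as a least module with the two properties is known to
  exist.\<close>

locale F_regular_cartier = cartier +
 fixes f
 assumes minimal: "\<And>N. kstable N ==> generically_nil N ==> N = carrier M"
  and regular: "regular_element R M f"
begin

lemma fR [simp]: "f \<in> carrier R"
 using regular by (simp add: regular_element_def)

definition img :: "nat \<Rightarrow> nat \<Rightarrow> 'c set" where
 "img e n = (\<lambda>m. (\<kappa> ^^ e) (f [^] n *[M] m)) ` carrier M"

lemma img_submodule: "submodule (img e n) R M"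
proof -
 have "img e n = (\<kappa> ^^ e) ` ((\<lambda>m. f [^] n *[M] m) ` carrier M)" by (auto simp: img_def)
 then show ?thesis using kpow_image_submodule[OF smult_image_submodule[OF carrier_is_submodule]] by simp
qed

text \<open>The image \<kappa>(M) is \<kappa>-stable, and one application of \<kappa> already
  carries everything into it; minimality leaves only \<open>M\<close>.\<close>

lemma kpow_surj: "(\<kappa> ^^ e) ` carrier M = carrier M"
proof -
 have sub: "submodule (\<kappa> ` carrier M) R M" using kpow_image_submodule[OF carrier_is_submodule, of 1] by simp
 have "kstable (\<kappa> ` carrier M)" using sub by (auto simp: kstable_def)
 moreover have "generically_nil (\<kappa> ` carrier M)"
  unfolding generically_nil_def
 proof (intro allI impI exI[of _ 1] ballI)
  fix \<eta> x assume \<eta>: "associated_prime R M \<eta>" and x: "x \<in> HS \<eta>"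
  then have "\<one> \<in> carrier R - \<eta>" using prime_one by (auto simp: associated_prime_def)
  moreover have "x \<in> carrier M" using x by (auto simp: local_sections_def)
  ultimately show "\<exists>s \<in> carrier R - \<eta>. s *[M] (\<kappa> ^^ 1) x \<in> \<kappa> ` carrier M"
   by (intro bexI[of _ \<one>]) auto
 qed
 ultimately have "\<kappa> ` carrier M = carrier M" by (rule minimal)
 then show ?thesis
 proof (induction e)
  case (Suc e)
  have "(\<kappa> ^^ Suc e) ` carrier M = \<kappa> ` ((\<kappa> ^^ e) ` carrier M)" by (simp add: image_comp)
  then show ?case using Suc by simp
 qed simp
qed

text \<open>Surjectivity of \<kappa>^d, together with moving f^n through it. As a consequence
  \<open>img e n\<close> depends on the fraction n/p^e only.\<close>

lemma img_shift: "img (e + d) (n * p ^ d) = img e n"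
proof -
 have "(\<kappa> ^^ (e + d)) (f [^] (n * p ^ d) *[M] m) = (\<kappa> ^^ e) (f [^] n *[M] (\<kappa> ^^ d) m)" if "m \<in> carrier M" for m
  using kpow_smult[of "f [^] n" m d] that by (simp add: kpow_plus nat_pow_pow)
 then have "img (e + d) (n * p ^ d) = (\<lambda>m. (\<kappa> ^^ e) (f [^] n *[M] m)) ` ((\<kappa> ^^ d) ` carrier M)"
  by (auto simp: img_def image_image)
 then show ?thesis by (simp add: kpow_surj img_def)
qed

lemma img_antimono: "n \<le> m ==> img e m \<subseteq> img e n"
proof
 fix y assume nm: "n \<le> m" and "y \<in> img e m"
 then obtain x where x: "x \<in> carrier M" "y = (\<kappa> ^^ e) (f [^] m *[M] x)" by (auto simp: img_def)
 have "f [^] m *[M] x = f [^] n *[M] (f [^] (m - n) *[M] x)"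
  using nm x(1) by (simp add: nat_pow_mult flip: smult_assoc1)
 then show "y \<in> img e n" unfolding img_def x(2) using x(1) by (intro image_eqI[of _ _ "f [^] (m - n) *[M] x"]) auto
qed

lemma img_add_pow: "img e (k * p ^ e + n) = (\<lambda>m. f [^] k *[M] m) ` img e n"
proof -
 have "(\<kappa> ^^ e) (f [^] (k * p ^ e + n) *[M] m) = f [^] k *[M] (\<kappa> ^^ e) (f [^] n *[M] m)" if m: "m \<in> carrier M" for m
 proof -
  have "f [^] (k * p ^ e + n) *[M] m = (f [^] k) [^] (p ^ e) *[M] (f [^] n *[M] m)"
   using m by (simp add: nat_pow_pow nat_pow_mult flip: smult_assoc1)
  then show ?thesis using kpow_smult[of "f [^] k" "f [^] n *[M] m" e] m by simp
 qed
 then show ?thesis by (auto simp: img_def image_image)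
qed

text \<open>The ascending chain of the \<kappa>^e(f M) becomes stationary at a \<kappa>-stable
  module that contains f M. As f is outside every associated prime this module is generically nil,
  hence \<open>M\<close>. Right continuity of \<tau> comes from here.\<close>

lemma img_one_eventually: "\<exists>n. img n 1 = carrier M"
proof -
 have inc: "img e 1 \<subseteq> img (Suc e) 1" for e
  using img_shift[of e 1 1] img_antimono[of 1 p "Suc e"] p_gt_1 by simp
 have mono: "img e 1 \<subseteq> img d 1" if "e \<le> d" for e d
  using lift_Suc_mono_le[of "\<lambda>e. img e 1", OF inc that] .
 have "\<exists>N \<in> range (\<lambda>e. img e 1). \<forall>N' \<in> range (\<lambda>e. img e 1). N \<subseteq> N' \<longrightarrow> N' = N"
  by (rule submodule_maximal[OF noetherian_ring fg]) (auto simp: img_submodule)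
 then obtain n where n: "\<And>d. img n 1 \<subseteq> img d 1 ==> img d 1 = img n 1" by auto
 have "\<kappa> ` img n 1 \<subseteq> img (Suc n) 1" by (auto simp: img_def)
 then have "kstable (img n 1)" using n[of "Suc n"] inc[of n] by (simp add: kstable_def img_submodule)
 moreover have "generically_nil (img n 1)"
  unfolding generically_nil_def
 proof (intro allI impI exI[of _ 0] ballI)
  fix \<eta> x assume \<eta>: "associated_prime R M \<eta>" and x: "x \<in> HS \<eta>"
  then have "f \<in> carrier R - \<eta>" using associated_prime_regular[OF \<eta> regular, of 1] by simp
  moreover have "x \<in> carrier M" using x by (auto simp: local_sections_def)
  moreover have "img 0 1 \<subseteq> img n 1" by (rule mono) simp
  ultimately show "\<exists>s \<in> carrier R - \<eta>. s *[M] (\<kappa> ^^ 0) x \<in> img n 1"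
   by (intro bexI[of _ f]) (auto simp: img_def)
 qed
 ultimately show ?thesis using minimal by blast
qed

text \<open>The usual description of test modules of an F-regular module. Real exponents are allowed
  because a jump is first found as an infimum. For nonnegative exponents the union is increasing in
  \<open>e\<close> and thus attained at some level.\<close>

definition tau :: "real \<Rightarrow> 'c set" where
 "tau l = (\<Union>e. img e (nat \<lceil>l * real p ^ e\<rceil>))"

lemma ceiling_mult_le:
 assumes "0 \<le> (l::real)"
 shows "nat \<lceil>l * real p ^ (e + d)\<rceil> \<le> nat \<lceil>l * real p ^ e\<rceil> * p ^ d"
proof -
 have "l * real p ^ e \<le> real (nat \<lceil>l * real p ^ e\<rceil>)" by (rule real_nat_ceiling_ge)
 then have "l * real p ^ e * real p ^ d \<le> real (nat \<lceil>l * real p ^ e\<rceil>) * real p ^ d"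
  by (intro mult_right_mono) auto
 then have "l * real p ^ (e + d) \<le> real (nat \<lceil>l * real p ^ e\<rceil> * p ^ d)" by (simp add: power_add mult.assoc)
 then show ?thesis by (simp only: nat_ceiling_le_eq)
qed

lemma img_ceiling_mono:
 assumes "0 \<le> l" "e \<le> d"
 shows "img e (nat \<lceil>l * real p ^ e\<rceil>) \<subseteq> img d (nat \<lceil>l * real p ^ d\<rceil>)"
proof -
 have "img e (nat \<lceil>l * real p ^ e\<rceil>) = img d (nat \<lceil>l * real p ^ e\<rceil> * p ^ (d - e))"
  using img_shift[of e "d - e"] assms(2) by simp
 also have "\<dots> \<subseteq> img d (nat \<lceil>l * real p ^ d\<rceil>)"
  using img_antimono[OF ceiling_mult_le[OF assms(1), of e "d - e"]] assms(2) by simp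
 finally show ?thesis .
qed

lemma tau_eventually:
 assumes "0 \<le> l"
 shows "\<exists>e0. \<forall>e \<ge> e0. tau l = img e (nat \<lceil>l * real p ^ e\<rceil>)"
proof -
 let ?I = "\<lambda>e. img e (nat \<lceil>l * real p ^ e\<rceil>)"
 have "\<exists>N \<in> range ?I. \<forall>N' \<in> range ?I. N \<subseteq> N' \<longrightarrow> N' = N"
  by (rule submodule_maximal[OF noetherian_ring fg]) (auto simp: img_submodule)
 then obtain n where n: "\<And>d. ?I n \<subseteq> ?I d ==> ?I d = ?I n" by auto
 have eq: "?I e = ?I n" if "n \<le> e" for e using n img_ceiling_mono[OF assms that] by auto
 have "?I e \<subseteq> ?I n" for e
  using img_ceiling_mono[OF assms, of e "max e n"] eq[of "max e n"] by simp
 then have "tau l = ?I n" unfolding tau_def by blast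
 then show ?thesis using eq by blast
qed

lemma tau_submodule: "0 \<le> l ==> submodule (tau l) R M"
 using tau_eventually[of l] img_submodule by (metis order_refl)

lemma tau_antimono:
 assumes "0 \<le> l" "l \<le> m"
 shows "tau m \<subseteq> tau l"
proof -
 have "img e (nat \<lceil>m * real p ^ e\<rceil>) \<subseteq> img e (nat \<lceil>l * real p ^ e\<rceil>)" for e
  using img_antimono[OF nat_mono[OF ceiling_mono[OF mult_right_mono[OF assms(2)]]]] by simp
 then show ?thesis unfolding tau_def by blast
qed

lemma tau_img: "tau (real n / real p ^ e) = img e n"
proof -
 obtain e0 where e0: "\<And>d. d \<ge> e0 ==> tau (real n / real p ^ e) = img d (nat \<lceil>real n / real p ^ e * real p ^ d\<rceil>)"
  using tau_eventually[of "real n / real p ^ e"] by auto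
 have cancel: "x / P * (P * y) = x * y" if "P > 0" for x P y :: real using that by simp
 have "real p ^ e > 0" using p_pos by (intro zero_less_power) (simp only: of_nat_0_less_iff)
 from cancel[OF this, of "real n" "real p ^ e0"]
 have "real n / real p ^ e * real p ^ (e + e0) = real (n * p ^ e0)" by (simp only: power_add of_nat_mult of_nat_power)
 then have "nat \<lceil>real n / real p ^ e * real p ^ (e + e0)\<rceil> = n * p ^ e0" by (simp only: ceiling_of_nat nat_int)
 then show ?thesis using e0[of "e + e0"] img_shift[of e e0 n] by simp
qed

text \<open>Since \<kappa>^n(f M) = M, one more factor f costs nothing at level e + n:
  \<kappa>^(e+n) f^(a p^n + 1) and \<kappa>^e f^a have the same image. The exponent (a p^n +
  1)/p^(e+n) is strictly larger than \<open>l\<close>, and \<tau> is constant up to it by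
  monotonicity.\<close>

lemma tau_right_continuous:
 assumes l: "0 \<le> l"
 shows "\<exists>d > 0. \<forall>m. l \<le> m \<and> m \<le> l + d \<longrightarrow> tau m = tau l"
proof -
 obtain e where e: "tau l = img e (nat \<lceil>l * real p ^ e\<rceil>)" using tau_eventually[OF l] by auto
 obtain n where n: "img n 1 = carrier M" using img_one_eventually by auto
 define a where "a = nat \<lceil>l * real p ^ e\<rceil>"
 have al: "l * real p ^ e \<le> real a" unfolding a_def by (rule real_nat_ceiling_ge)
 have "img (e + n) (a * p ^ n + 1) = img e a"
 proof -
  have "(\<kappa> ^^ (e + n)) (f [^] (a * p ^ n + 1) *[M] m) = (\<kappa> ^^ e) (f [^] a *[M] (\<kappa> ^^ n) (f [^] (1::nat) *[M] m))"
   if m: "m \<in> carrier M" for m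
  proof -
   have "f [^] (a * p ^ n + 1) *[M] m = (f [^] a) [^] (p ^ n) *[M] (f [^] (1::nat) *[M] m)"
    using m nat_pow_mult[OF fR, of "a * p ^ n" 1] by (simp add: nat_pow_pow smult_assoc1[symmetric])
   then show ?thesis using kpow_smult[of "f [^] a" "f [^] (1::nat) *[M] m" n] m by (simp add: kpow_plus)
  qed
  then have "img (e + n) (a * p ^ n + 1) = (\<lambda>m. (\<kappa> ^^ e) (f [^] a *[M] m)) ` img n 1"
   unfolding img_def image_image by (intro image_cong) auto
  then show ?thesis unfolding n by (simp add: img_def)
 qed
 then have eq: "tau (real (a * p ^ n + 1) / real p ^ (e + n)) = tau l"
  using e unfolding a_def[symmetric] by (simp only: tau_img)
 define b where "b = real (a * p ^ n + 1) / real p ^ (e + n)"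
 have "l * real p ^ (e + n) < real (a * p ^ n + 1)"
 proof -
  have "l * real p ^ e * real p ^ n \<le> real a * real p ^ n" using al by (intro mult_right_mono) auto
  moreover have "l * real p ^ (e + n) = l * real p ^ e * real p ^ n" by (simp add: power_add mult.assoc)
  moreover have "real (a * p ^ n + 1) = real a * real p ^ n + 1" by simp
  ultimately show ?thesis by linarith
 qed
 moreover have "real p ^ (e + n) > 0" using p_pos by (intro zero_less_power) (simp only: of_nat_0_less_iff)
 ultimately have "l < b" unfolding b_def by (simp only: pos_less_divide_eq)
 moreover have "tau m = tau l" if "l \<le> m" "m \<le> l + (b - l)" for m
 proof -
  have "tau b \<subseteq> tau m" using that l by (intro tau_antimono) auto
  then show ?thesis using tau_antimono[OF l that(1)] eq unfolding b_def[symmetric] by blast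
 qed
 ultimately show ?thesis by (intro exI[of _ "b - l"] conjI allI impI) (simp, blast)
qed

lemma tau_scale:
 assumes "0 \<le> l"
 shows "\<kappa> ` tau (real p * l) = tau l"
proof -
 have pl: "0 \<le> real p * l" using assms by simp
 obtain e1 where e1: "\<And>e. e \<ge> e1 ==> tau l = img e (nat \<lceil>l * real p ^ e\<rceil>)" using tau_eventually[OF assms] by auto
 obtain e2 where e2: "\<And>e. e \<ge> e2 ==> tau (real p * l) = img e (nat \<lceil>real p * l * real p ^ e\<rceil>)" using tau_eventually[OF pl] by auto
 let ?e = "max e1 e2"
 have "\<kappa> ` img ?e k = img (Suc ?e) k" for k by (auto simp: img_def image_image)
 then have "\<kappa> ` tau (real p * l) = img (Suc ?e) (nat \<lceil>l * real p ^ Suc ?e\<rceil>)"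
  using e2[of ?e] by (simp add: mult_ac)
 then show ?thesis using e1[of "Suc ?e"] by simp
qed

lemma tau_skoda:
 assumes "0 \<le> l"
 shows "tau (l + 1) = (\<lambda>m. f *[M] m) ` tau l"
proof -
 have l1: "0 \<le> l + 1" using assms by simp
 obtain e1 where e1: "\<And>e. e \<ge> e1 ==> tau l = img e (nat \<lceil>l * real p ^ e\<rceil>)" using tau_eventually[OF assms] by auto
 obtain e2 where e2: "\<And>e. e \<ge> e2 ==> tau (l + 1) = img e (nat \<lceil>(l + 1) * real p ^ e\<rceil>)" using tau_eventually[OF l1] by auto
 let ?e = "max e1 e2"
 have "\<lceil>(l + 1) * real p ^ ?e\<rceil> = \<lceil>l * real p ^ ?e + of_int (int (p ^ ?e))\<rceil>" by (simp add: distrib_right)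
 also have "\<dots> = \<lceil>l * real p ^ ?e\<rceil> + int (p ^ ?e)" by (rule ceiling_add_of_int)
 finally have ceil: "\<lceil>(l + 1) * real p ^ ?e\<rceil> = \<lceil>l * real p ^ ?e\<rceil> + int (p ^ ?e)" .
 have "0 \<le> l * real p ^ ?e" using assms by simp
 then have "0 \<le> \<lceil>l * real p ^ ?e\<rceil>" by linarith
 then have "nat \<lceil>(l + 1) * real p ^ ?e\<rceil> = 1 * p ^ ?e + nat \<lceil>l * real p ^ ?e\<rceil>"
  unfolding ceil by (simp only: nat_add_distrib of_nat_0_le_iff nat_int mult_1 add.commute)
 then show ?thesis using e1[of ?e] e2[of ?e] img_add_pow[of ?e 1] by simp
qed

lemma ceiling_of_rat_mult: "nat \<lceil>l * of_nat p ^ e\<rceil> = nat \<lceil>real_of_rat l * real p ^ e\<rceil>"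
 using of_rat_ceiling[of "l * of_nat p ^ e", where 'a = real] by (simp add: of_rat_mult of_rat_power)

text \<open>An element of \<tau> is \<kappa>^e0(f^k m). Moving the factor f^n of an operator
  \<kappa>^e f^n r into it gives the exponent n p^e0 + k at level e + e0, where n p^e0 alone reaches
  the required ceiling.\<close>

lemma test_algebra_tau:
 assumes l: "0 \<le> (l::rat)"
 shows "cartier_submodule R M (test_algebra p R M \<kappa> f l) (tau (of_rat l))" (is "cartier_submodule R M ?C ?T")
proof -
 have l': "0 \<le> (of_rat l :: real)" using l by simp
 obtain e0 where e0: "\<And>e. e \<ge> e0 ==> ?T = img e (nat \<lceil>of_rat l * real p ^ e\<rceil>)" using tau_eventually[OF l'] by auto
 note TS = tau_submodule[OF l']
 have "\<phi> x \<in> ?T" if \<phi>: "\<phi> \<in> ?C e" and x: "x \<in> ?T" for e \<phi> x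
 proof (cases "e = 0")
  case True
  then show ?thesis using \<phi> submodule_props(4)[OF TS _ x] by (auto simp: test_algebra_def)
 next
  case False
  then obtain r where r: "r \<in> carrier R" "\<phi> = (\<lambda>m. (\<kappa> ^^ e) ((f [^] nat \<lceil>l * of_nat p ^ e\<rceil> \<otimes> r) *[M] m))"
   using \<phi> by (auto simp: test_algebra_def)
  define n where "n = nat \<lceil>l * of_nat p ^ e\<rceil>"
  have "r *[M] x \<in> img e0 (nat \<lceil>of_rat l * real p ^ e0\<rceil>)" using submodule_props(4)[OF TS r(1) x] e0[of e0] by simp
  then obtain m where m: "m \<in> carrier M" "r *[M] x = (\<kappa> ^^ e0) (f [^] nat \<lceil>of_rat l * real p ^ e0\<rceil> *[M] m)" by (auto simp: img_def)
  define k where "k = nat \<lceil>of_rat l * real p ^ e0\<rceil>"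
  have xM: "x \<in> carrier M" using submodule_props(1)[OF TS] x by auto
  have "\<phi> x = (\<kappa> ^^ e) (f [^] n *[M] (r *[M] x))" using r xM by (simp add: n_def smult_assoc1)
  also have "\<dots> = (\<kappa> ^^ e) ((\<kappa> ^^ e0) ((f [^] n) [^] (p ^ e0) *[M] (f [^] k *[M] m)))"
   unfolding m(2) k_def[symmetric] using kpow_smult[of "f [^] n" "f [^] k *[M] m" e0] m(1) by simp
  also have "\<dots> = (\<kappa> ^^ (e + e0)) (f [^] (n * p ^ e0 + k) *[M] m)"
   using m(1) by (simp add: kpow_plus nat_pow_pow nat_pow_mult flip: smult_assoc1)
  finally have "\<phi> x \<in> img (e + e0) (n * p ^ e0 + k)" using m(1) by (auto simp: img_def)
  moreover have "nat \<lceil>of_rat l * real p ^ (e + e0)\<rceil> \<le> n * p ^ e0 + k"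
   using ceiling_mult_le[OF l', of e e0] unfolding n_def ceiling_of_rat_mult by (rule trans_le_add1)
  from img_antimono[OF this] have "img (e + e0) (n * p ^ e0 + k) \<subseteq> ?T" using e0[of "e + e0"] by simp
  ultimately show ?thesis by blast
 qed
 then show ?thesis using TS by (auto simp: cartier_submodule_def)
qed

text \<open>Level 0 of the union already contains a multiple f^n M, and f^n is outside every
  associated prime.\<close>

lemma tau_full:
 assumes l: "0 \<le> l"
 shows "generically_full (tau l)"
 unfolding generically_full_def
proof (intro allI impI ballI)
 fix \<eta> x assume \<eta>: "associated_prime R M \<eta>" and x: "x \<in> HS \<eta>"
 have "f [^] (k::nat) \<in> carrier R - \<eta>" for k by (rule associated_prime_regular[OF \<eta> regular])
 moreover have "x \<in> carrier M" using x by (auto simp: local_sections_def)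
 moreover have "img 0 (nat \<lceil>l * real p ^ 0\<rceil>) \<subseteq> tau l" unfolding tau_def by blast
 ultimately show "\<exists>s \<in> carrier R - \<eta>. s *[M] x \<in> tau l"
  by (intro bexI[of _ "f [^] nat \<lceil>l * real p ^ 0\<rceil>"]) (auto simp: img_def)
qed

text \<open>For minimality, let N be stable under the test algebra; it need not be stable under
  \<kappa>. The span of all \<kappa>^e(N) is \<kappa>-stable and contains N, so it is
  \<open>M\<close>. Applying the operator \<kappa>^d f^n that produces \<tau> to \<kappa>^e(y) with
  y in N yields \<kappa>^(d+e) f^(n p^e) y, which is an operator of the test algebra applied to
  y.\<close>

lemma test_module_tau:
 assumes l: "0 \<le> (l::rat)"
 shows "test_module p R M \<kappa> f l = tau (of_rat l)"
 unfolding test_module_def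
proof (rule Least_equality)
 let ?C = "test_algebra p R M \<kappa> f l"
 have l': "0 \<le> (of_rat l :: real)" using l by simp
 show "cartier_submodule R M ?C (tau (of_rat l)) \<and> generically_nil_isomorphic p R M ?C (tau (of_rat l))"
  using test_algebra_tau[OF l] full_generically_nil_isomorphic[OF tau_submodule tau_full] l' by simp
 fix N assume N: "cartier_submodule R M ?C N \<and> generically_nil_isomorphic p R M ?C N"
 then have nil: "generically_nil N" and Ns: "submodule N R M"
  using generically_nil_isomorphic_nil[OF regular] by (auto simp: cartier_submodule_def)
 have NC: "\<phi> ` N \<subseteq> N" if "\<phi> \<in> ?C e" for \<phi> e
  using N that unfolding cartier_submodule_def by (elim conjE allE ballE) auto
 note NS = submodule_props[OF Ns]
 have NM: "x \<in> carrier M" if "x \<in> N" for x using that NS(1) by auto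
 define X where "X = (\<Union>e. (\<kappa> ^^ e) ` N)"
 let ?N = "span_over M (carrier R) X"
 have XM: "X \<subseteq> carrier M" using NM by (auto simp: X_def)
 note SS = span_over_submodule[OF XM]
 have "N \<subseteq> X" unfolding X_def by (auto intro: UN_I[of 0])
 then have NX: "N \<subseteq> ?N" using span_over_incl[of "carrier R" X] XM by auto
 have kX: "\<kappa> x \<in> X" if xX: "x \<in> X" for x
 proof -
  obtain e n where "n \<in> N" "x = (\<kappa> ^^ e) n" using xX by (auto simp: X_def)
  then have "\<kappa> x = (\<kappa> ^^ Suc e) n" by simp
  then show ?thesis using \<open>n \<in> N\<close> unfolding X_def by blast
 qed
 have span: "v \<in> ?N" if "v \<in> X" for v
  using that span_over_incl[of "carrier R" X] XM by auto
 have rX: "r *[M] x \<in> X" if r: "r \<in> carrier R" and xX: "x \<in> X" for r x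
 proof -
  obtain e n where n: "n \<in> N" "x = (\<kappa> ^^ e) n" using xX by (auto simp: X_def)
  have "r *[M] x = (\<kappa> ^^ e) (r [^] (p ^ e) *[M] n)" using n kpow_smult[OF r NM] by simp
  moreover have "r [^] (p ^ e) *[M] n \<in> N" using NS(4)[OF _ n(1)] r by simp
  ultimately show ?thesis unfolding X_def by blast
 qed
 have "kstable ?N"
  unfolding kstable_def
 proof (intro conjI SS subsetI)
  fix y assume "y \<in> \<kappa> ` ?N"
  then obtain v where v: "v \<in> ?N" "y = \<kappa> v" by auto
  from v(1) have "\<kappa> v \<in> ?N"
  proof induction
   case zero
   then show ?case using kpow_zero[of 1] by (auto intro: span_over.zero)
  next
   case (step a x w)
   have c: "a *[M] x \<in> carrier M" "w \<in> carrier M"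
    using step XM span_over_closed[OF subset_refl XM] by auto
   have "\<kappa> (a *[M] x) \<in> ?N" using kX[OF rX[OF step(1,2)]] span by auto
   then show ?case using \<kappa>_add[OF c] step(4) submodule_props(3)[OF SS] by simp
  qed
  then show "y \<in> ?N" using v by simp
 qed
 moreover have "generically_nil ?N" using nil NX unfolding generically_nil_def by blast
 ultimately have full: "?N = carrier M" by (rule minimal)
 show "tau (of_rat l) \<subseteq> N"
 proof -
  obtain e0 where e0: "\<And>e. e \<ge> e0 ==> tau (of_rat l) = img e (nat \<lceil>of_rat l * real p ^ e\<rceil>)"
   using tau_eventually[OF l'] by auto
  \<comment> \<open>The successor keeps d + e positive: in degree 0 the algebra contains only
    scalars, not powers of \<kappa>.\<close>
  define d where "d = Suc e0"
  define n where "n = nat \<lceil>of_rat l * real p ^ d\<rceil>"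
  have T: "tau (of_rat l) = img d n" using e0[of d] by (simp add: d_def n_def)
  have gen: "(\<kappa> ^^ d) (f [^] n *[M] v) \<in> N" if "v \<in> ?N" for v
   using that
  proof induction
   case zero
   then show ?case using NS(2) by simp
  next
   case (step a x w)
   have c: "a *[M] x \<in> carrier M" "w \<in> carrier M"
    using step XM span_over_closed[OF subset_refl XM] by auto
   obtain e y where y: "y \<in> N" "a *[M] x = (\<kappa> ^^ e) y" using rX[OF step(1,2)] by (auto simp: X_def)
   define k where "k = nat \<lceil>l * of_nat p ^ (d + e)\<rceil>"
   \<comment> \<open>Rounding up at level d and then multiplying by p^e gives at least the ceiling
     at level d + e. The surplus power of f becomes the ring element r of the operator.\<close>
   have k: "k \<le> n * p ^ e" unfolding k_def n_def ceiling_of_rat_mult using ceiling_mult_le[OF l', of d e] .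
   have "(\<kappa> ^^ d) (f [^] n *[M] (a *[M] x)) = (\<kappa> ^^ (d + e)) (f [^] (n * p ^ e) *[M] y)"
    unfolding y(2) using kpow_smult[of "f [^] n" y e] NM[OF y(1)] by (simp add: kpow_plus nat_pow_pow)
   also have "\<dots> = (\<kappa> ^^ (d + e)) ((f [^] k \<otimes> f [^] (n * p ^ e - k)) *[M] y)" using k by (simp add: nat_pow_mult)
   finally have eq: "(\<kappa> ^^ d) (f [^] n *[M] (a *[M] x)) = (\<kappa> ^^ (d + e)) ((f [^] k \<otimes> f [^] (n * p ^ e - k)) *[M] y)" .
   have "(\<lambda>m. (\<kappa> ^^ (d + e)) ((f [^] k \<otimes> f [^] (n * p ^ e - k)) *[M] m)) \<in> ?C (d + e)"
   proof -
    have "d + e \<noteq> 0" "f [^] (n * p ^ e - k) \<in> carrier R" by (simp_all add: d_def fR)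
    then show ?thesis unfolding test_algebra_def k_def[symmetric] by (simp only: if_False) blast
   qed
   from NC[OF this] have "(\<kappa> ^^ d) (f [^] n *[M] (a *[M] x)) \<in> N"
    unfolding eq using y(1) by (simp only: image_subset_iff)
   then show ?case using c step(4) NS(3) by (simp add: smult_r_distr kpow_add)
  qed
  show ?thesis unfolding T img_def using gen full by auto
 qed
qed

section \<open>Jumping numbers\<close>

definition jump :: "real \<Rightarrow> bool" where
 "jump l \<longleftrightarrow> 0 < l \<and> (\<forall>m. 0 \<le> m \<and> m < l \<longrightarrow> tau m \<noteq> tau l)"

lemma F_jumping_number_iff: "F_jumping_number p R M \<kappa> f l \<longleftrightarrow> 0 < l \<and>
  (\<forall>m. 0 \<le> m \<and> m < l \<longrightarrow> tau (of_rat m) \<noteq> tau (of_rat l))"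
proof (cases "0 < l")
 case True
 have "F_jumping_number p R M \<kappa> f l \<longleftrightarrow> (\<forall>\<epsilon>. 0 < \<epsilon> \<and> \<epsilon> \<le> l \<longrightarrow> tau (of_rat (l - \<epsilon>)) \<noteq> tau (of_rat l))"
  using True by (auto simp: F_jumping_number_def test_module_tau)
 also have "\<dots> \<longleftrightarrow> (\<forall>m. 0 \<le> m \<and> m < l \<longrightarrow> tau (of_rat m) \<noteq> tau (of_rat l))"
 proof (intro iffI allI impI)
  fix m assume "\<forall>\<epsilon>. 0 < \<epsilon> \<and> \<epsilon> \<le> l \<longrightarrow> tau (of_rat (l - \<epsilon>)) \<noteq> tau (of_rat l)" "0 \<le> m \<and> m < l"
  then show "tau (of_rat m) \<noteq> tau (of_rat l)" by (auto dest: spec[of _ "l - m"])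
 qed auto
 finally show ?thesis using True by simp
qed (simp add: F_jumping_number_def)

lemma jump_F_jumping_number: "jump (of_rat l) ==> F_jumping_number p R M \<kappa> f l"
 unfolding F_jumping_number_iff jump_def by (auto simp: of_rat_less)

text \<open>Consider the infimum of the exponents at which \<tau> differs from its value at
  \<open>a\<close>. By right continuity the change has already taken place at the infimum, and not
  before it; so the infimum is a jump, and it is larger than \<open>a\<close>.\<close>

lemma jump_exists:
 assumes a: "0 \<le> a" and ab: "a \<le> b" and ne: "tau a \<noteq> tau b"
 shows "\<exists>l. a < l \<and> l \<le> b \<and> jump l"
proof -
 define S where "S = {m. a \<le> m \<and> m \<le> b \<and> tau m \<noteq> tau a}"
 have bS: "b \<in> S" using ab ne by (auto simp: S_def)
 have bdd: "bdd_below S" by (rule bdd_belowI[of _ a]) (auto simp: S_def)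
 define l where "l = Inf S"
 have al: "a \<le> l" unfolding l_def using bS by (intro cInf_greatest) (auto simp: S_def)
 have lb: "l \<le> b" unfolding l_def using bS bdd by (rule cInf_lower)
 have lS: "l \<le> m" if "m \<in> S" for m unfolding l_def using that bdd by (rule cInf_lower)
 have neq: "tau l \<noteq> tau a"
 proof
  assume eq: "tau l = tau a"
  obtain d where d: "d > 0" "\<And>m. l \<le> m ==> m \<le> l + d ==> tau m = tau l"
   using tau_right_continuous[OF order_trans[OF a al]] by blast
  have "l + d \<le> m" if "m \<in> S" for m
  proof (rule ccontr)
   assume "\<not> l + d \<le> m"
   then have "tau m = tau a" using d(2)[OF lS[OF that]] eq by simp
   then show False using that by (simp add: S_def)
  qed
  then have "l + d \<le> l" unfolding l_def using bS by (intro cInf_greatest) auto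
  then show False using d(1) by simp
 qed
 then have "a < l" using al by (cases "a = l") auto
 moreover have "tau m \<noteq> tau l" if m: "0 \<le> m" "m < l" for m
 proof
  assume eq: "tau m = tau l"
  show False
  proof (cases "a \<le> m")
   case True
   then have "m \<notin> S" using lS m by fastforce
   then show False using True m lb eq neq by (auto simp: S_def)
  next
   case False
   then have "tau a \<subseteq> tau l" using tau_antimono[OF m(1), of a] eq by simp
   then show False using neq tau_antimono[OF a al] by auto
  qed
 qed
 ultimately show ?thesis using lb a by (auto simp: jump_def)
qed

text \<open>By \<open>tau_scale\<close> the map \<kappa> divides exponents by p, so it carries an
  equality between \<tau>(p l) and an earlier value to one for l.\<close>

lemma jump_scale: "jump l ==> jump (real p * l)"
 unfolding jump_def
proof (intro conjI allI impI)
 assume l: "0 < l \<and> (\<forall>m. 0 \<le> m \<and> m < l \<longrightarrow> tau m \<noteq> tau l)"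
 then show "0 < real p * l" by simp
 fix m assume m: "0 \<le> m \<and> m < real p * l"
 show "tau m \<noteq> tau (real p * l)"
 proof
  assume eq: "tau m = tau (real p * l)"
  have "tau (m / real p) = \<kappa> ` tau m" using tau_scale[of "m / real p"] m by simp
  also have "\<dots> = tau l" unfolding eq using tau_scale l by simp
  finally show False using l m by (auto simp: divide_less_eq mult.commute)
 qed
qed

text \<open>By \<open>tau_skoda\<close> multiplication by f adds 1 to the exponent, so it carries an
  equality between \<tau>(l - 1) and an earlier value to one for l.\<close>

lemma jump_minus_one: "jump l ==> 1 < l ==> jump (l - 1)"
 unfolding jump_def
proof (intro conjI allI impI)
 assume l: "0 < l \<and> (\<forall>m. 0 \<le> m \<and> m < l \<longrightarrow> tau m \<noteq> tau l)" and l1: "1 < l"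
 then show "0 < l - 1" by simp
 fix m assume m: "0 \<le> m \<and> m < l - 1"
 show "tau m \<noteq> tau (l - 1)"
 proof
  assume "tau m = tau (l - 1)"
  then have "tau (m + 1) = tau l" using tau_skoda[of m] tau_skoda[of "l - 1"] m l1 by simp
  then show False using l m by (auto dest: spec[of _ "m + 1"])
 qed
qed

lemma jump_minus_nat: "jump l ==> real n < l ==> jump (l - real n)"
proof (induction n)
 case (Suc n)
 then have "jump (l - real n - 1)" by (intro jump_minus_one) auto
 then show ?case by (simp add: algebra_simps)
qed simp

text \<open>The fractional parts of \<open>p\<^sup>n l\<close> are again jumps; as there are finitely many, two of them agree.\<close>

lemma jump_rational:
 assumes fin: "finite (tau ` {0..1})" and l: "jump l" "l \<le> 1"
 shows "l \<in> \<rat>"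
proof -
 \<comment> \<open>Subtracting the ceiling minus 1, instead of the floor, gives a representative in
   (0, 1]; a jump is positive, so 0 must not occur.\<close>
 define g where "g x = real p * x - real (nat \<lceil>real p * x\<rceil> - 1)" for x
 have g: "jump (g x) \<and> g x \<le> 1" if x: "jump x" for x
 proof -
  have px: "jump (real p * x)" by (rule jump_scale[OF x])
  then have pos: "0 < real p * x" by (simp add: jump_def)
  have lt: "real (nat \<lceil>real p * x\<rceil> - 1) < real p * x" using pos by linarith
  have "real p * x \<le> real (nat \<lceil>real p * x\<rceil> - 1) + 1" using pos by linarith
  then show ?thesis using jump_minus_nat[OF px lt] by (simp add: g_def)
 qed
 define y where "y n = (g ^^ n) l" for n
 have y: "jump (y n) \<and> y n \<le> 1" for n
  using l g by (induction n) (auto simp: y_def)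
 have yp: "\<exists>k :: int. y n = real p ^ n * l - of_int k" for n
 proof (induction n)
  case 0
  then show ?case by (intro exI[of _ 0]) (simp add: y_def)
 next
  case (Suc n)
  then obtain k :: int where k: "y n = real p ^ n * l - of_int k" by auto
  have "y (Suc n) = real p * y n - real (nat \<lceil>real p * y n\<rceil> - 1)" by (simp add: y_def g_def)
  also have "\<dots> = real p ^ Suc n * l - of_int (int p * k + int (nat \<lceil>real p * y n\<rceil> - 1))"
   by (simp add: k algebra_simps)
  finally show ?case by blast
 qed
 have "\<not> inj (\<lambda>n. tau (y n))"
 proof
  assume "inj (\<lambda>n. tau (y n))"
  moreover have "y n \<in> {0..1}" for n using y[of n] by (simp add: jump_def)
  then have "range (\<lambda>n. tau (y n)) \<subseteq> tau ` {0..1}" by blast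
  ultimately show False using fin finite_subset finite_imageD by blast
 qed
 then obtain m n where mn: "m \<noteq> n" "tau (y m) = tau (y n)" by (auto simp: inj_def)
 have neq: "tau (y i) \<noteq> tau (y j)" if "y i < y j" for i j
 proof -
  have "0 \<le> y i" using y[of i] by (simp add: jump_def)
  then show ?thesis using y[of j] that by (simp add: jump_def)
 qed
 have "y m = y n" using mn(2) neq[of m n] neq[of n m] by (cases "y m" "y n" rule: linorder_cases) auto
 obtain j k :: int where jk: "y m = real p ^ m * l - of_int j" "y n = real p ^ n * l - of_int k"
  using yp[of m] yp[of n] by auto
 have "l * (real p ^ m - real p ^ n) = of_int (j - k)" using \<open>y m = y n\<close> jk by (simp add: algebra_simps)
 moreover have "real p ^ m - real p ^ n \<noteq> 0" using mn(1) p_gt_1 by (simp add: power_inject_exp)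
 ultimately have "l = of_int (j - k) / (real p ^ m - real p ^ n)" by (intro eq_divide_imp)
 moreover have "of_int (j - k) / (real p ^ m - real p ^ n) \<in> \<rat>" by (intro Rats_divide Rats_diff Rats_power) auto
 ultimately show ?thesis by (simp only:)
qed

text \<open>The two images are the values of \<tau> at the end points. The left end point is
  excluded because \<tau> is right continuous, and the right one is included because the change is
  complete at the jump itself. Rationality of the jump is what allows the passage to
  \<open>F_jumping_number\<close>.\<close>

lemma img_neq_iff_jumping_number:
 assumes fin: "finite (tau ` {0..1})" and n: "n < p ^ e"
 shows "img e n \<noteq> img e (Suc n) \<longleftrightarrow>
  (\<exists>l :: rat. F_jumping_number p R M \<kappa> f l \<and> of_nat n / of_nat p ^ e < l \<and> l \<le> of_nat (Suc n) / of_nat p ^ e)"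
proof -
 define a :: rat where "a = of_nat n / of_nat p ^ e"
 define b :: rat where "b = of_nat (Suc n) / of_nat p ^ e"
 have a0: "0 \<le> a" by (simp add: a_def)
 have ab: "a < b" using p_pos by (simp add: a_def b_def divide_strict_right_mono)
 have ra: "real_of_rat a = real n / real p ^ e" and rb: "real_of_rat b = real (Suc n) / real p ^ e"
  by (simp_all add: a_def b_def of_rat_divide of_rat_power of_rat_add)
 have ia: "img e n = tau (of_rat a)" and ib: "img e (Suc n) = tau (of_rat b)"
  unfolding ra rb by (simp_all only: tau_img)
 have b1: "b \<le> 1" using n p_pos by (simp add: b_def divide_le_eq) (metis Suc_leI of_nat_Suc of_nat_le_iff of_nat_power)
 show ?thesis
  unfolding ia ib a_def[symmetric] b_def[symmetric]
 proof
  assume "tau (of_rat a) \<noteq> tau (of_rat b)"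
  then obtain l where l: "real_of_rat a < l" "l \<le> of_rat b" "jump l"
   using jump_exists[of "of_rat a" "of_rat b"] a0 ab by (auto simp: of_rat_less_eq)
  have "l \<le> 1" using l(2) b1 by (metis of_rat_1 of_rat_less_eq order_trans)
  then have "l \<in> \<rat>" using jump_rational[OF fin l(3)] by simp
  then obtain r where r: "l = of_rat r" by (auto elim: Rats_cases)
  then show "\<exists>l. F_jumping_number p R M \<kappa> f l \<and> a < l \<and> l \<le> b"
   using l jump_F_jumping_number by (auto simp: of_rat_less of_rat_less_eq)
 next
  assume "\<exists>l. F_jumping_number p R M \<kappa> f l \<and> a < l \<and> l \<le> b"
  then obtain l where l: "F_jumping_number p R M \<kappa> f l" "a < l" "l \<le> b" by auto
  have "tau (of_rat a) \<noteq> tau (of_rat l)" using l(1,2) a0 by (simp add: F_jumping_number_iff)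
  moreover have "tau (of_rat l) \<subseteq> tau (of_rat a)" using l a0 by (intro tau_antimono) (auto simp: of_rat_less_eq)
  moreover have "tau (of_rat b) \<subseteq> tau (of_rat l)" using l a0 by (intro tau_antimono) (auto simp: of_rat_less_eq)
  ultimately show "tau (of_rat a) \<noteq> tau (of_rat b)" by auto
 qed
qed

end

section \<open>Gauges\<close>

context cring begin

text \<open>Degree means the largest exponent, not the sum of the exponents. Division of all
  exponents by q with remainder then splits a monomial of degree d into a q-th power of degree d div
  q and a rest of degree at most q - 1, with bounds that do not depend on the number of
  variables.\<close>

primrec mon :: "nat \<Rightarrow> 'a list \<Rightarrow> 'a set" where
 "mon d [] = {\<one>}"
| "mon d (x # xs) = (\<lambda>(j, w). x [^] j \<otimes> w) ` ({..d} \<times> mon d xs)"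

lemma mon_closed: "set xs \<subseteq> carrier R ==> w \<in> mon d xs ==> w \<in> carrier R"
 by (induction xs arbitrary: w) auto

lemma mon_finite: "finite (mon d xs)"
 by (induction xs) auto

lemma mon_mono: "c \<le> d ==> mon c xs \<subseteq> mon d xs"
proof (induction xs)
 case (Cons x xs)
 then show ?case unfolding mon.simps by (intro image_mono Sigma_mono) auto
qed simp

lemma mon_one: "set xs \<subseteq> carrier R ==> \<one> \<in> mon d xs"
proof (induction xs)
 case (Cons x xs)
 then show ?case unfolding mon.simps by (intro image_eqI[of _ _ "(0, \<one>)"]) auto
qed simp

lemma mon_gen: "set xs \<subseteq> carrier R ==> x \<in> set xs ==> x \<in> mon 1 xs"
proof (induction xs)
 case (Cons y xs)
 then have c: "y \<in> carrier R" "x \<in> carrier R" "set xs \<subseteq> carrier R" by auto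
 show ?case
 proof (cases "x = y")
  case True
  then show ?thesis using c mon_one[OF c(3)] unfolding mon.simps by (intro image_eqI[of _ _ "(1, \<one>)"]) auto
 next
  case False
  then have "x \<in> mon 1 xs" using Cons by auto
  then show ?thesis using c unfolding mon.simps by (intro image_eqI[of _ _ "(0, x)"]) auto
 qed
qed simp

lemma mon_mult:
 assumes "set xs \<subseteq> carrier R" "v \<in> mon c xs" "w \<in> mon d xs"
 shows "v \<otimes> w \<in> mon (c + d) xs"
 using assms
proof (induction xs arbitrary: v w)
 case (Cons x xs)
 obtain i v' where v: "i \<le> c" "v' \<in> mon c xs" "v = x [^] i \<otimes> v'" using Cons.prems(2) by auto
 obtain j w' where w: "j \<le> d" "w' \<in> mon d xs" "w = x [^] j \<otimes> w'" using Cons.prems(3) by auto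
 have cl: "x \<in> carrier R" "v' \<in> carrier R" "w' \<in> carrier R"
  using Cons.prems(1) mon_closed[OF _ v(2)] mon_closed[OF _ w(2)] by auto
 have "v' \<otimes> w' \<in> mon (c + d) xs" using Cons.IH[OF _ v(2) w(2)] Cons.prems(1) by simp
 moreover have "v \<otimes> w = x [^] (i + j) \<otimes> (v' \<otimes> w')"
  unfolding v(3) w(3) using cl by (simp add: m_ac flip: nat_pow_mult)
 ultimately show ?case unfolding mon.simps using v(1) w(1) by (intro image_eqI[of _ _ "(i + j, v' \<otimes> w')"]) auto
qed simp

lemma mon_split:
 assumes "set xs \<subseteq> carrier R" "0 < (q::nat)" "w \<in> mon d xs"
 shows "\<exists>v \<in> mon (d div q) xs. \<exists>u \<in> mon (q - 1) xs. w = v [^] q \<otimes> u"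
 using assms
proof (induction xs arbitrary: w)
 case (Cons x xs)
 obtain j w' where w: "j \<le> d" "w' \<in> mon d xs" "w = x [^] j \<otimes> w'" using Cons.prems(3) by auto
 obtain v u where vu: "v \<in> mon (d div q) xs" "u \<in> mon (q - 1) xs" "w' = v [^] q \<otimes> u"
  using Cons.IH[OF _ Cons.prems(2) w(2)] Cons.prems(1) by auto
 have cl: "x \<in> carrier R" "v \<in> carrier R" "u \<in> carrier R"
  using Cons.prems(1) mon_closed[OF _ vu(1)] mon_closed[OF _ vu(2)] by auto
 have "x [^] j = (x [^] (j div q)) [^] q \<otimes> x [^] (j mod q)"
  using cl(1) by (simp add: nat_pow_pow nat_pow_mult)
 then have "w = (x [^] (j div q) \<otimes> v) [^] q \<otimes> (x [^] (j mod q) \<otimes> u)"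
  unfolding w(3) vu(3) using cl by (simp add: nat_pow_distrib m_ac)
 moreover have "x [^] (j div q) \<otimes> v \<in> mon (d div q) (x # xs)"
  unfolding mon.simps using vu(1) w(1) by (intro image_eqI[of _ _ "(j div q, v)"]) (auto simp: div_le_mono)
 moreover have "j mod q \<le> q - 1" using mod_less_divisor[OF \<open>0 < q\<close>, of j] by linarith
 then have "x [^] (j mod q) \<otimes> u \<in> mon (q - 1) (x # xs)"
  unfolding mon.simps using vu(2) by (intro image_eqI[of _ _ "(j mod q, u)"]) auto
 ultimately show ?case by blast
qed simp

end

section \<open>Degree filtrations on modules and on the ring\<close>

locale module_gauge = module R M for R (structure) and M (structure) +
 fixes F :: "'a set" and xs :: "'a list"
 assumes F: "subring F R" and xs: "set xs \<subseteq> carrier R"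
begin

lemma FR: "a \<in> F ==> a \<in> carrier R"
 using subringE(1)[OF F] by auto

lemma mon_cl: "w \<in> mon n xs ==> w \<in> carrier R"
 by (rule mon_closed[OF xs])

definition D :: "'c set \<Rightarrow> nat \<Rightarrow> 'c set" where
 "D Y n = span_over M F ((\<lambda>(w, y). w *[M] y) ` (mon n xs \<times> Y))"

lemma D_induct [consumes 2, case_names zero step]:
 assumes "x \<in> D Y n" "Y \<subseteq> carrier M"
  and "P \<zero>\<^bsub>M\<^esub>"
  and "\<And>a w y v. \<lbrakk>a \<in> F; w \<in> mon n xs; y \<in> Y; a \<in> carrier R; w \<in> carrier R; y \<in> carrier M; v \<in> carrier M;
      v \<in> D Y n; P v\<rbrakk> \<Longrightarrow> P ((a \<otimes> w) *[M] y +[M] v)"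
 shows "P x"
proof -
 let ?G = "(\<lambda>(w, y). w *[M] y) ` (mon n xs \<times> Y)"
 have G: "?G \<subseteq> carrier M" using mon_cl assms(2) by auto
 show ?thesis using assms(1) unfolding D_def
 proof induction
  case (step a x v)
  then obtain w y where x: "w \<in> mon n xs" "y \<in> Y" "x = w *[M] y" by auto
  have c: "a \<in> carrier R" "w \<in> carrier R" "y \<in> carrier M" "v \<in> carrier M"
   using FR[OF step(1)] mon_cl[OF x(1)] x(2) assms(2) span_over_closed[OF subringE(1)[OF F] G] step(3) by auto
  have "P ((a \<otimes> w) *[M] y +[M] v)"
   by (rule assms(4)[OF step(1) x(1,2) c _ step.IH]) (use step(3) in \<open>simp add: D_def\<close>)
  then show ?case using c by (simp add: x(3) smult_assoc1)
 qed (rule assms(3))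
qed

context
 fixes Y assumes Y: "Y \<subseteq> carrier M"
begin

lemma D_scalar_closed: "scalar_closed M F (D Y n)"
 unfolding D_def by (rule scalar_closed_span[OF F]) (use mon_cl Y in auto)

lemma D_closed: "x \<in> D Y n ==> x \<in> carrier M"
 and D_zero: "\<zero>\<^bsub>M\<^esub> \<in> D Y n"
 and D_add: "x \<in> D Y n ==> y \<in> D Y n ==> x +[M] y \<in> D Y n"
 and D_smult: "a \<in> F ==> x \<in> D Y n ==> a *[M] x \<in> D Y n"
 using D_scalar_closed[of n] by (auto simp: scalar_closed_def)

lemma D_mono: "m \<le> n ==> D Y m \<subseteq> D Y n"
 unfolding D_def by (intro span_over_mono image_mono Sigma_mono mon_mono) auto

lemma D_base: "w \<in> mon n xs ==> y \<in> Y ==> w *[M] y \<in> D Y n"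
 unfolding D_def using span_over_incl[OF subringE(3)[OF F] subringE(1)[OF F], of "(\<lambda>(w, y). w *[M] y) ` (mon n xs \<times> Y)"]
  mon_cl Y by fastforce

lemma D_gen: "y \<in> Y ==> y \<in> D Y n"
 using D_base[OF mon_one[OF xs], of y n] Y by (simp add: subset_iff)

lemma D_mon:
 assumes u: "u \<in> mon d xs" and x: "x \<in> D Y n"
 shows "u *[M] x \<in> D Y (n + d)"
 using x Y
proof (induction rule: D_induct)
 case zero
 then show ?case using D_zero mon_cl[OF u] by simp
next
 case (step a w y v)
 have "u *[M] ((a \<otimes> w) *[M] y +[M] v) = a *[M] ((w \<otimes> u) *[M] y) +[M] u *[M] v"
  using step mon_cl[OF u] by (simp add: smult_r_distr m_ac flip: smult_assoc1)
 then show ?case using D_add[OF D_smult[OF step(1) D_base[OF mon_mult[OF xs step(2) u] step(3)]] step(9)] by simp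
qed

lemma D_finite_dim: "finite Y ==> \<exists>X. finite X \<and> X \<subseteq> carrier M \<and> D Y n = span_over M F X"
 unfolding D_def using mon_finite mon_cl Y by (intro exI[of _ "(\<lambda>(w, y). w *[M] y) ` (mon n xs \<times> Y)"]) auto

end

lemma D_scale:
 assumes t: "t \<in> carrier R" and Y: "Y \<subseteq> carrier M" and x: "x \<in> D Y n"
 shows "t *[M] x \<in> D ((\<lambda>y. t *[M] y) ` Y) n"
 using x Y
proof (induction rule: D_induct)
 have Y': "(\<lambda>y. t *[M] y) ` Y \<subseteq> carrier M" using Y t by auto
 {
  case zero
  then show ?case using D_zero[OF Y'] t by simp
 next
  case (step a w y v)
  have "t *[M] ((a \<otimes> w) *[M] y +[M] v) = a *[M] (w *[M] (t *[M] y)) +[M] t *[M] v"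
   using step t by (simp add: smult_r_distr m_ac flip: smult_assoc1)
  moreover have "a *[M] (w *[M] (t *[M] y)) \<in> D ((\<lambda>y. t *[M] y) ` Y) n"
   by (intro D_smult[OF Y' step(1)] D_base[OF Y' step(2)] imageI step)
  ultimately show ?case using D_add[OF Y' _ step(9)] by simp
 }
qed

definition Dinf :: "'c set \<Rightarrow> 'c set" where "Dinf Y = (\<Union>n. D Y n)"

lemma Dinf_add:
 assumes Y: "Y \<subseteq> carrier M" and "x \<in> Dinf Y" "y \<in> Dinf Y"
 shows "x +[M] y \<in> Dinf Y"
proof -
 obtain m n where "x \<in> D Y m" "y \<in> D Y n" using assms by (auto simp: Dinf_def)
 then have "x +[M] y \<in> D Y (max m n)"
  using D_mono[OF Y, of m "max m n"] D_mono[OF Y, of n "max m n"] by (intro D_add[OF Y]) auto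
 then show ?thesis by (auto simp: Dinf_def)
qed

lemma Dinf_bounded:
 assumes Y: "Y \<subseteq> carrier M" and "finite Z" "Z \<subseteq> Dinf Y"
 shows "\<exists>n. Z \<subseteq> D Y n"
 using assms(2,3)
proof (induction Z)
 case (insert z Z)
 then obtain m n where "Z \<subseteq> D Y m" "z \<in> D Y n" by (auto simp: Dinf_def)
 then show ?case using D_mono[OF Y, of m "max m n"] D_mono[OF Y, of n "max m n"]
  by (intro exI[of _ "max m n"]) auto
qed simp

end

locale ring_gauge = cring R for R (structure) +
 fixes F :: "'a set" and xs :: "'a list"
 assumes F: "subring F R" and xs: "set xs \<subseteq> carrier R"
begin

lemma self_gauge: "module_gauge R (self_module R) F xs"
 by (intro module_gauge.intro self_module module_gauge_axioms.intro F xs)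

text \<open>The filtration of the ring, and the subring F[xs], arise as the case of the module
  \<open>R\<close> with the single generator 1.\<close>

abbreviation "P \<equiv> \<lambda>n. module_gauge.D R (self_module R) F xs {\<one>} n"
abbreviation "polys \<equiv> module_gauge.Dinf R (self_module R) F xs {\<one>}"

end

locale poly_module = module R M + ring_gauge R F xs for R (structure) and M (structure) and F xs

sublocale poly_module \<subseteq> module_gauge R M F xs
 by (intro module_gauge.intro module_axioms module_gauge_axioms.intro F xs)

context poly_module begin

lemma D_poly:
 assumes Y: "Y \<subseteq> carrier M" and r: "r \<in> P d" and x: "x \<in> D Y n"
 shows "r *[M] x \<in> D Y (n + d)"
proof -
 interpret S: module_gauge R "self_module R" F xs by (rule self_gauge)
 have o: "{\<one>} \<subseteq> carrier (self_module R)" by simp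
 note xc = D_closed[OF Y x]
 show ?thesis using r o
 proof (induction rule: S.D_induct)
  case zero
  then show ?case using D_zero[OF Y] xc by simp
 next
  case (step a w y v)
  have c: "y = \<one>" "a \<in> carrier R" "w \<in> carrier R" "v \<in> carrier R" using step(3-7) by auto
  have eq: "((a \<otimes> w) \<odot>\<^bsub>self_module R\<^esub> y \<oplus>\<^bsub>self_module R\<^esub> v) *[M] x = a *[M] (w *[M] x) +[M] v *[M] x"
   unfolding c(1) using xc c(2-4) by (simp add: smult_l_distr smult_assoc1)
  show ?case unfolding eq by (rule D_add[OF Y D_smult[OF Y step(1) D_mon[OF Y step(2) x]] step(9)])
 qed
qed

lemma Dinf_poly:
 assumes Y: "Y \<subseteq> carrier M" and "r \<in> polys" "x \<in> Dinf Y"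
 shows "r *[M] x \<in> Dinf Y"
proof -
 obtain d n where "r \<in> P d" "x \<in> D Y n"
  using assms(2,3) unfolding Dinf_def module_gauge.Dinf_def[OF self_gauge] by (elim UN_E)
 from D_poly[OF Y this] show ?thesis unfolding Dinf_def by (rule UN_I[OF UNIV_I])
qed

end

context ring_gauge begin

lemma self_poly: "poly_module R (self_module R) F xs"
 by (intro poly_module.intro self_module ring_gauge_axioms)

lemma P_closed: "r \<in> P n ==> r \<in> carrier R"
proof -
 interpret S: module_gauge R "self_module R" F xs by (rule self_gauge)
 show "r \<in> P n ==> r \<in> carrier R" using S.D_closed[of "{\<one>}" r n] by simp
qed

lemma P_mon: "w \<in> mon n xs ==> a \<in> F ==> a \<otimes> w \<in> P n"
proof -
 interpret S: module_gauge R "self_module R" F xs by (rule self_gauge)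
 assume w: "w \<in> mon n xs" and a: "a \<in> F"
 have "w \<odot>\<^bsub>self_module R\<^esub> \<one> \<in> P n" by (rule S.D_base) (use w in auto)
 then have "a \<odot>\<^bsub>self_module R\<^esub> (w \<odot>\<^bsub>self_module R\<^esub> \<one>) \<in> P n" by (rule S.D_smult[OF _ a, rotated]) auto
 then show ?thesis using S.mon_cl[OF w] by simp
qed

lemma polys_closed: "r \<in> polys ==> r \<in> carrier R"
 using P_closed by (auto simp: module_gauge.Dinf_def[OF self_gauge])

lemma P_polys: "r \<in> P n ==> r \<in> polys"
 by (auto simp: module_gauge.Dinf_def[OF self_gauge])

lemma polys_mult: "r \<in> polys ==> s \<in> polys ==> r \<otimes> s \<in> polys"
 using poly_module.Dinf_poly[OF self_poly, of "{\<one>}" r s] by simp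

lemma polys_add: "r \<in> polys ==> s \<in> polys ==> r \<oplus> s \<in> polys"
 using module_gauge.Dinf_add[OF self_gauge, of "{\<one>}" r s] by simp

lemma F_polys: "a \<in> F ==> a \<in> polys"
 using P_mon[OF mon_one[OF xs], of a 0] P_polys[of a 0] subringE(1)[OF F] by (simp add: subset_iff)

lemma gen_polys: "x \<in> set xs ==> x \<in> polys"
 using P_mon[OF mon_gen[OF xs], of x \<one>] P_polys[of x 1] subringE(3)[OF F] xs by (simp add: subset_iff)

lemma polys_minus: "r \<in> polys ==> \<ominus> r \<in> polys"
 using polys_mult[OF F_polys[OF subringE(5)[OF F subringE(3)[OF F]]], of r] polys_closed[of r] by (simp add: l_minus)

lemma polys_pow: "r \<in> polys ==> r [^] (k::nat) \<in> polys"
 by (induction k) (auto intro: polys_mult F_polys[OF subringE(3)[OF F]])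

end

text \<open>Collects what is used of an algebra essentially of finite type over an F-finite field:
  \<open>F\<close> is a field, finite over its p-th powers with generators \<open>L\<close>, and
  each ring element becomes a polynomial after multiplication by a polynomial that is a unit of
  \<open>R\<close>.\<close>

locale frobenius_gauge = noetherian_char R p + ring_gauge R F xs for R (structure) and p and F xs +
 fixes L
 assumes F_inv: "\<And>a. a \<in> F ==> a \<noteq> \<zero> ==> \<exists>b \<in> F. b \<otimes> a = \<one>"
  and L: "finite L" "L \<subseteq> F"
  and F_frob: "\<And>a. a \<in> F ==> a \<in> span_over (frobenius_push p 1 R (self_module R)) F L"
  and denom: "\<And>r. r \<in> carrier R ==> \<exists>s \<in> Units R \<inter> polys. s \<otimes> r \<in> polys"
begin

lemma L_closed: "l \<in> L ==> l \<in> carrier R"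
 using L(2) subringE(1)[OF F] by auto

lemma F_frob_induct [consumes 1, case_names zero step]:
 assumes "a \<in> F" "Q \<zero>"
  and "\<And>b l c. \<lbrakk>b \<in> F; l \<in> L; b \<in> carrier R; l \<in> carrier R; c \<in> carrier R; Q c\<rbrakk> \<Longrightarrow> Q (b [^] p \<otimes> l \<oplus> c)"
 shows "Q a"
proof -
 interpret S: module R "frobenius_push p 1 R (self_module R)"
  by (rule frobenius_push_module[OF self_module])
 have Ls: "L \<subseteq> carrier (frobenius_push p 1 R (self_module R))" using L_closed by auto
 show ?thesis using F_frob[OF assms(1)]
 proof induction
  case zero
  then show ?case using assms(2) by simp
 next
  case (step b l c)
  have "c \<in> carrier R" using S.span_over_closed[OF subringE(1)[OF F] Ls] step(3) by auto
  then show ?case using assms(3)[OF step(1,2) _ L_closed[OF step(2)] _ step.IH] subringE(1)[OF F] step(1) by auto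
 qed
qed

abbreviation "U \<equiv> Units R \<inter> polys"

lemma U_mult: "s \<in> U ==> t \<in> U ==> s \<otimes> t \<in> U"
 using polys_mult by auto

lemma U_one: "\<one> \<in> U"
 using F_polys[OF subringE(3)[OF F]] by auto

text \<open>All of \<open>F\<close> may occur as a coefficient, since coefficients do not contribute
  to the degree; what matters is that the exponents stay below p^e.\<close>

definition "frob_gens e = {a \<otimes> u | a u. a \<in> F \<and> u \<in> mon (p ^ e - 1) xs}"

lemma frob_gens_closed: "frob_gens e \<subseteq> carrier R"
 using mon_closed[OF xs] subringE(1)[OF F] by (auto simp: frob_gens_def)

text \<open>Polynomials are treated monomial by monomial with \<open>mon_split\<close>. A general r
  is (1/s)^(p^e) times the polynomial s^(p^e - 1) (s r).\<close>

lemma frobenius_span: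
 assumes r: "r \<in> carrier R"
 shows "r \<in> span_over (frobenius_push p e R (self_module R)) (carrier R) (frob_gens e)"
proof -
 let ?S = "span_over (frobenius_push p e R (self_module R)) (carrier R) (frob_gens e)"
 interpret S: module R "frobenius_push p e R (self_module R)"
  by (rule frobenius_push_module[OF self_module])
 interpret G: module_gauge R "self_module R" F xs by (rule self_gauge)
 have o: "{\<one>} \<subseteq> carrier (self_module R)" by simp
 have step: "i [^] (p ^ e) \<otimes> b \<in> ?S" if i: "i \<in> carrier R" and b: "b \<in> P d" for i b d
  using b o
 proof (induction rule: G.D_induct)
  case zero
  then show ?case using span_over.zero[of "frobenius_push p e R (self_module R)"] i by simp
 next
  case (step a w y c)
  obtain v u where vu: "v \<in> mon (d div p ^ e) xs" "u \<in> mon (p ^ e - 1) xs" "w = v [^] (p ^ e) \<otimes> u"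
   using mon_split[OF xs _ step(2), of "p ^ e"] by auto
  have cl: "v \<in> carrier R" "u \<in> carrier R" using mon_closed[OF xs] vu by auto
  have "(i \<otimes> v) \<odot>\<^bsub>frobenius_push p e R (self_module R)\<^esub> (a \<otimes> u) \<oplus>\<^bsub>frobenius_push p e R (self_module R)\<^esub> i [^] (p ^ e) \<otimes> c \<in> ?S"
   using i cl vu(2) step by (intro span_over.step) (auto simp: frob_gens_def)
  moreover have "i [^] (p ^ e) \<otimes> ((a \<otimes> w) \<odot>\<^bsub>self_module R\<^esub> y \<oplus>\<^bsub>self_module R\<^esub> c) = (i \<otimes> v) [^] (p ^ e) \<otimes> (a \<otimes> u) \<oplus> i [^] (p ^ e) \<otimes> c"
   using step i cl by (simp add: vu(3) r_distr nat_pow_distrib m_ac)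
  ultimately show ?case by simp
 qed
 obtain s where s: "s \<in> Units R" "s \<in> polys" "s \<otimes> r \<in> polys" using denom[OF r] by auto
 have sc: "s \<in> carrier R" "inv s \<in> carrier R" using s(1) by auto
 obtain q where q: "p ^ e = Suc q" using p_pos by (metis gr0_implies_Suc zero_less_power)
 have "s [^] q \<otimes> (s \<otimes> r) \<in> polys" using polys_mult[OF polys_pow] s by simp
 then obtain d where "s [^] q \<otimes> (s \<otimes> r) \<in> P d" by (auto simp: G.Dinf_def)
 from step[OF sc(2) this] have "(inv s) [^] (p ^ e) \<otimes> (s [^] q \<otimes> (s \<otimes> r)) \<in> ?S" .
 moreover have "(inv s) [^] (p ^ e) \<otimes> (s [^] q \<otimes> (s \<otimes> r)) = ((inv s) \<otimes> s) [^] (p ^ e) \<otimes> r"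
  using sc r by (simp add: q nat_pow_distrib m_ac)
 ultimately show ?thesis using s(1) r by simp
qed

lemma gauge_F_fin: "F_fin"
proof -
 let ?V = "frobenius_push p 1 R (self_module R)"
 interpret S: module R ?V by (rule frobenius_push_module[OF self_module])
 define X where "X = (\<lambda>(l, u). l \<otimes> u) ` (L \<times> mon (p - 1) xs)"
 have X: "finite X" "X \<subseteq> carrier ?V" using L mon_finite L_closed mon_closed[OF xs] by (auto simp: X_def)
 note SS = S.submodule_props[OF S.span_over_submodule[OF X(2)]]
 have "a \<otimes> u \<in> span_over ?V (carrier R) X" if a: "a \<in> F" and u: "u \<in> mon (p - 1) xs" for a u
  using a
 proof (induction rule: F_frob_induct)
  case zero
  then show ?case using SS(2) mon_closed[OF xs u] by simp
 next
  case (step b l c)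
  have "b \<odot>\<^bsub>?V\<^esub> (l \<otimes> u) \<oplus>\<^bsub>?V\<^esub> c \<otimes> u \<in> span_over ?V (carrier R) X"
   using step u by (intro span_over.step) (auto simp: X_def)
  then show ?case using step mon_closed[OF xs u] by (simp add: l_distr m_assoc)
 qed
 then have "frob_gens 1 \<subseteq> span_over ?V (carrier R) X" by (auto simp: frob_gens_def)
 then have "span_over ?V (carrier R) (frob_gens 1) \<subseteq> span_over ?V (carrier R) X"
  using SS(3,4) by (intro S.span_over_least[OF SS(2)]) auto
 then have "carrier ?V \<subseteq> span_over ?V (carrier R) X"
  using frobenius_span[of _ 1] by (auto simp del: One_nat_def)
 then have "span_over ?V (carrier R) X = carrier ?V" using SS(1) by auto
 then have "finitely_generated R ?V" using X unfolding S.finitely_generated_iff by blast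
 then show ?thesis by (simp only: F_fin_def)
qed

end

section \<open>Contraction of degrees\<close>

locale gauged_cartier = cartier R M p \<kappa> + frobenius_gauge R p F xs L
 for R (structure) and M (structure) and p \<kappa> F xs L

sublocale gauged_cartier \<subseteq> poly_module R M F xs
 by (intro poly_module.intro module_axioms ring_gauge_axioms)

context gauged_cartier begin

lemma common_denominator_one:
 assumes Y: "Y \<subseteq> carrier M" and x: "x \<in> span_over M (carrier R) Y"
 shows "\<exists>s \<in> U. s *[M] x \<in> Dinf Y"
 using x
proof induction
 case zero
 then show ?case using U_one D_zero[OF Y, of 0] by (intro bexI[of _ \<one>]) (auto simp: Dinf_def)
next
 case (step a y v)
 then obtain t where t: "t \<in> U" "t *[M] v \<in> Dinf Y" by auto
 obtain s where s: "s \<in> U" "s \<otimes> a \<in> polys" using denom[OF step(1)] by auto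
 have cl: "a \<in> carrier R" "y \<in> carrier M" "v \<in> carrier M" "s \<in> carrier R" "t \<in> carrier R"
  using step Y span_over_closed[OF subset_refl Y] s t by auto
 have "(s \<otimes> t) *[M] (a *[M] y +[M] v) = (t \<otimes> (s \<otimes> a)) *[M] y +[M] s *[M] (t *[M] v)"
  using cl by (simp add: smult_r_distr m_ac flip: smult_assoc1)
 moreover have "y \<in> Dinf Y" using D_gen[OF Y step(2), of 0] by (auto simp: Dinf_def)
 ultimately have "(s \<otimes> t) *[M] (a *[M] y +[M] v) \<in> Dinf Y"
  using s t Dinf_add[OF Y] Dinf_poly[OF Y] polys_mult by simp
 then show ?case using U_mult[OF s(1) t(1)] by auto
qed

lemma common_denominator:
 assumes Y: "Y \<subseteq> carrier M" and "finite Z" "Z \<subseteq> span_over M (carrier R) Y"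
 shows "\<exists>s \<in> U. \<forall>z \<in> Z. s *[M] z \<in> Dinf Y"
 using assms(2,3)
proof (induction Z)
 case (insert z Z)
 then obtain t where t: "t \<in> U" "\<And>z. z \<in> Z ==> t *[M] z \<in> Dinf Y" by auto
 obtain s where s: "s \<in> U" "s *[M] z \<in> Dinf Y" using common_denominator_one[OF Y, of z] insert by auto
 have ZM: "v \<in> carrier M" if "v \<in> insert z Z" for v
  using that insert span_over_closed[OF subset_refl Y] by auto
 have "(s \<otimes> t) *[M] v \<in> Dinf Y" if v: "v \<in> insert z Z" for v
 proof (cases "v = z")
  case True
  have "(s \<otimes> t) *[M] v = t *[M] (s *[M] z)" using s(1) t(1) ZM True by (simp add: Units_closed m_comm flip: smult_assoc1)
  then show ?thesis using Dinf_poly[OF Y _ s(2)] t(1) by simp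
 next
  case False
  have "(s \<otimes> t) *[M] v = s *[M] (t *[M] v)" using s(1) t(1) ZM[OF v] by (simp add: Units_closed smult_assoc1)
  then show ?thesis using Dinf_poly[OF Y _ t(2)] s(1) v False by simp
 qed
 then show ?case using U_mult[OF s(1) t(1)] by auto
qed (use U_one in auto)

text \<open>If w = z^p u and a is a sum of terms b^p l, then \<kappa>(a w y) is the sum of the b z
  \<kappa>(l u y): the factor z of degree at most n div p leaves \<kappa>, and the rest is bounded
  by assumption. The factor \<open>s\<close> is there because the estimate is used first with a
  denominator and then, for rescaled generators, with s = 1.\<close>

lemma kappa_D:
 assumes Y: "Y \<subseteq> carrier M" "Y' \<subseteq> carrier M" and s: "s \<in> carrier R"
  and bound: "\<And>l u y. l \<in> L ==> u \<in> mon (p - 1) xs ==> y \<in> Y ==> s *[M] \<kappa> ((l \<otimes> u) *[M] y) \<in> D Y' c"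
  and x: "x \<in> D Y n"
 shows "s *[M] \<kappa> x \<in> D Y' (n div p + c)"
 using x Y(1)
proof (induction rule: D_induct)
 case zero
 then show ?case using kpow_zero[of 1] D_zero[OF Y(2)] s by simp
next
 case (step a w y v)
 obtain z u where w: "z \<in> mon (n div p) xs" "u \<in> mon (p - 1) xs" "w = z [^] p \<otimes> u"
  using mon_split[OF xs p_pos step(2)] by auto
 have cl: "z \<in> carrier R" "u \<in> carrier R" using mon_cl w by auto
 have "s *[M] \<kappa> ((a \<otimes> w) *[M] y) \<in> D Y' (n div p + c)"
  using step(1)
 proof (induction rule: F_frob_induct)
  case zero
  then show ?case using kpow_zero[of 1] D_zero[OF Y(2)] s step(5,6) by simp
 next
  case (step b l a')
  note c = cl s step(3-5) \<open>y \<in> carrier M\<close> \<open>w \<in> carrier R\<close>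
  have "((b [^] p \<otimes> l \<oplus> a') \<otimes> w) *[M] y = (b \<otimes> z) [^] p *[M] ((l \<otimes> u) *[M] y) +[M] (a' \<otimes> w) *[M] y"
  proof -
   have "(b [^] p \<otimes> l \<oplus> a') \<otimes> w = (b \<otimes> z) [^] p \<otimes> (l \<otimes> u) \<oplus> a' \<otimes> w"
   proof -
    have "b [^] p \<otimes> l \<otimes> w = (b \<otimes> z) [^] p \<otimes> (l \<otimes> u)" using c by (simp add: w(3) nat_pow_distrib m_ac)
    then show ?thesis using c by (simp add: l_distr)
   qed
   then show ?thesis using c by (simp add: smult_l_distr smult_assoc1)
  qed
  then have "\<kappa> (((b [^] p \<otimes> l \<oplus> a') \<otimes> w) *[M] y) = (b \<otimes> z) *[M] \<kappa> ((l \<otimes> u) *[M] y) +[M] \<kappa> ((a' \<otimes> w) *[M] y)"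
   using c by (simp only: \<kappa>_add \<kappa>_smult smult_closed m_closed nat_pow_closed)
  moreover have "s *[M] ((b \<otimes> z) *[M] k) = (b \<otimes> z) *[M] (s *[M] k)" if "k \<in> carrier M" for k
   using c that by (simp add: m_ac flip: smult_assoc1)
  ultimately have "s *[M] \<kappa> (((b [^] p \<otimes> l \<oplus> a') \<otimes> w) *[M] y) =
    (b \<otimes> z) *[M] (s *[M] \<kappa> ((l \<otimes> u) *[M] y)) +[M] s *[M] \<kappa> ((a' \<otimes> w) *[M] y)"
   using c by (simp only: smult_r_distr \<kappa>_closed smult_closed m_closed)
  moreover have "(b \<otimes> z) *[M] (s *[M] \<kappa> ((l \<otimes> u) *[M] y)) \<in> D Y' (n div p + c)"
   using D_poly[OF Y(2) P_mon[OF w(1) step(1)] bound[OF step(2) w(2) \<open>y \<in> Y\<close>]] by (simp add: add.commute)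
  ultimately show ?case using D_add[OF Y(2)] step(6) by simp
 qed
 then show ?case using D_add[OF Y(2) _ step(9)] step s by (simp add: \<kappa>_add smult_r_distr)
qed

text \<open>The finitely many values \<kappa>(l u y) have a common denominator s, so s \<kappa>
  preserves the polynomial module generated by \<open>Y1\<close>. Rescaling the generators absorbs
  s, and \<kappa> itself preserves the new module; the largest degree among the new values is the
  constant c.\<close>

lemma gauge_exists:
 "\<exists>Y c. finite Y \<and> Y \<subseteq> carrier M \<and> span_over M (carrier R) Y = carrier M \<and> (\<forall>n. \<kappa> ` D Y n \<subseteq> D Y (n div p + c))"
proof -
 obtain Y1 where Y1: "finite Y1" "Y1 \<subseteq> carrier M" "span_over M (carrier R) Y1 = carrier M"
  using fg finitely_generated_iff by auto
 let ?u = "mon (p - 1) xs"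
 define Z where "Z = (\<lambda>((l, u), y). \<kappa> ((l \<otimes> u) *[M] y)) ` ((L \<times> ?u) \<times> Y1)"
 have Z: "finite Z" "Z \<subseteq> carrier M"
  using L mon_finite Y1 L_closed mon_cl by (auto simp: Z_def)
 obtain s where s: "s \<in> U" "\<And>z. z \<in> Z ==> s *[M] z \<in> Dinf Y1"
  using common_denominator[OF Y1(2) Z(1)] Z(2) Y1(3) by auto
 have sc: "s \<in> carrier R" "inv s \<in> carrier R" "inv s \<otimes> s = \<one>" using s(1) by auto
 have "finite ((\<lambda>z. s *[M] z) ` Z)" "(\<lambda>z. s *[M] z) ` Z \<subseteq> Dinf Y1" using Z(1) s(2) by auto
 from Dinf_bounded[OF Y1(2) this] obtain c1 where c1: "\<And>z. z \<in> Z ==> s *[M] z \<in> D Y1 c1" by auto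
 have stable: "s *[M] \<kappa> x \<in> Dinf Y1" if x: "x \<in> Dinf Y1" for x
 proof -
  obtain n where n: "x \<in> D Y1 n" using x by (auto simp: Dinf_def)
  have "s *[M] \<kappa> x \<in> D Y1 (n div p + c1)"
   by (rule kappa_D[OF Y1(2,2) sc(1) c1 n]) (force simp: Z_def)
  then show ?thesis by (auto simp: Dinf_def)
 qed
 \<comment> \<open>The exponent 2 is forced. One has \<kappa>(s^(-k) x) = s^(-1) \<kappa>(s^(p-k) x)
   = s^(-2) (s \<kappa>)(s^(p-k) x), so the result always carries s^(-2), and k = 2 reproduces it;
   s^(p-2) is a polynomial because p is at least 2.\<close>
 define i where "i = inv s \<otimes> inv s"
 have ic: "i \<in> carrier R" using sc by (simp add: i_def)
 define Y where "Y = (\<lambda>y. i *[M] y) ` Y1"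
 have Y: "finite Y" "Y \<subseteq> carrier M" using Y1 ic by (auto simp: Y_def)
 have gen: "span_over M (carrier R) Y = carrier M"
 proof
  show "span_over M (carrier R) Y \<subseteq> carrier M" by (rule span_over_closed[OF subset_refl Y(2)])
  note SS = submodule_props[OF span_over_submodule[OF Y(2)]]
  have "a *[M] y \<in> span_over M (carrier R) Y" if a: "a \<in> carrier R" and y: "y \<in> Y1" for a y
  proof -
   have yM: "y \<in> carrier M" using y Y1 by auto
   have "(s \<otimes> s) \<otimes> i = (inv s \<otimes> s) \<otimes> (inv s \<otimes> s)" using sc(1,2) by (simp add: i_def m_ac)
   then have "a *[M] y = (a \<otimes> ((s \<otimes> s) \<otimes> i)) *[M] y" using a sc by simp
   also have "\<dots> = (a \<otimes> (s \<otimes> s)) *[M] (i *[M] y)"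
    using a sc(1) ic yM by (simp add: smult_assoc1)
   also have "\<dots> \<in> span_over M (carrier R) Y"
    using a sc(1) y Y by (intro span_over_base) (auto simp: Y_def)
   finally show ?thesis .
  qed
  then have "span_over M (carrier R) Y1 \<subseteq> span_over M (carrier R) Y"
   using SS(3) by (intro span_over_least[OF SS(2)]) auto
  then show "carrier M \<subseteq> span_over M (carrier R) Y" using Y1(3) by simp
 qed
 define Z' where "Z' = (\<lambda>((l, u), y). \<kappa> ((l \<otimes> u) *[M] y)) ` ((L \<times> ?u) \<times> Y)"
 have "finite Z'" using L mon_finite Y by (auto simp: Z'_def)
 moreover have "Z' \<subseteq> Dinf Y"
 proof
  fix z assume "z \<in> Z'"
  then obtain l u y where z: "l \<in> L" "u \<in> ?u" "y \<in> Y1" "z = \<kappa> ((l \<otimes> u) *[M] (i *[M] y))"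
   by (auto simp: Z'_def Y_def)
  have cl: "l \<in> carrier R" "u \<in> carrier R" "y \<in> carrier M" using z L_closed mon_cl Y1 by auto
  define x where "x = (s [^] (p - 2) \<otimes> (l \<otimes> u)) *[M] y"
  have xM: "x \<in> carrier M" using cl sc by (simp add: x_def)
  have "l \<otimes> u \<in> polys" using P_polys[OF P_mon[OF z(2)]] z(1) L(2) by auto
  then have "s [^] (p - 2) \<otimes> (l \<otimes> u) \<in> polys" using polys_mult polys_pow s(1) by simp
  moreover have "y \<in> Dinf Y1" using D_gen[OF Y1(2) z(3), of 0] by (auto simp: Dinf_def)
  ultimately have "x \<in> Dinf Y1" unfolding x_def by (rule Dinf_poly[OF Y1(2)])
  from stable[OF this] obtain n where "s *[M] \<kappa> x \<in> D Y1 n" by (auto simp: Dinf_def)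
  then have "i *[M] (s *[M] \<kappa> x) \<in> Dinf Y" using D_scale[OF ic Y1(2)] unfolding Dinf_def Y_def by blast
  moreover have "i *[M] (s *[M] \<kappa> x) = z"
  proof -
   have "i \<otimes> s = inv s \<otimes> (inv s \<otimes> s)" using sc(1,2) by (simp add: i_def m_ac)
   then have inv_s: "i \<otimes> s = inv s" using sc by simp
   obtain k where k: "p = k + 2" using p_gt_1 by (metis Suc_leI add.commute le_Suc_ex numeral_2_eq_2 One_nat_def)
   have "inv s [^] p \<otimes> s [^] (p - 2) = (inv s \<otimes> s) [^] k \<otimes> i"
    using sc(1,2) by (simp add: k i_def nat_pow_distrib numeral_2_eq_2 m_ac)
   then have e: "inv s [^] p \<otimes> s [^] (p - 2) = i" using sc ic by simp
   have "i *[M] (s *[M] \<kappa> x) = inv s *[M] \<kappa> x" using sc(1) ic xM inv_s by (simp flip: smult_assoc1)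
   also have "\<dots> = \<kappa> (inv s [^] p *[M] x)" using \<kappa>_smult[OF sc(2) xM] by simp
   also have "inv s [^] p *[M] x = ((inv s [^] p \<otimes> s [^] (p - 2)) \<otimes> (l \<otimes> u)) *[M] y"
    unfolding x_def using sc(1,2) cl by (simp add: m_assoc flip: smult_assoc1)
   also have "\<dots> = (l \<otimes> u) *[M] (i *[M] y)" unfolding e using cl ic by (simp add: m_comm flip: smult_assoc1)
   finally show ?thesis by (simp add: z(4))
  qed
  ultimately show "z \<in> Dinf Y" by simp
 qed
 ultimately have "\<exists>c. Z' \<subseteq> D Y c" by (rule Dinf_bounded[OF Y(2)])
 then obtain c where c: "Z' \<subseteq> D Y c" by auto
 have "\<kappa> x \<in> D Y (n div p + c)" if x: "x \<in> D Y n" for x n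
 proof -
  have "\<one> *[M] \<kappa> ((l \<otimes> u) *[M] y) \<in> D Y c" if "l \<in> L" "u \<in> ?u" "y \<in> Y" for l u y
  proof -
   have "\<kappa> ((l \<otimes> u) *[M] y) \<in> Z'" using that by (force simp: Z'_def)
   then have k: "\<kappa> ((l \<otimes> u) *[M] y) \<in> D Y c" using c by (rule subsetD[rotated])
   then show ?thesis using D_closed[OF Y(2) k] by simp
  qed
  from kappa_D[OF Y(2,2) one_closed this x] show ?thesis using D_closed[OF Y(2) x] by simp
 qed
 then show ?thesis using Y gen by (intro exI[of _ Y] exI[of _ c]) auto
qed

end

locale gauge = gauged_cartier +
 fixes Y c
 assumes Y: "finite Y" "Y \<subseteq> carrier M" "span_over M (carrier R) Y = carrier M"
  and \<kappa>_D: "\<And>x n. x \<in> D Y n ==> \<kappa> x \<in> D Y (n div p + c)"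
begin

text \<open>The additive error c of a single step accumulates to at most 2 c, since (2 c) div p + c
  is at most 2 c; the bound is independent of the number of iterations.\<close>

lemma kpow_D: "x \<in> D Y (k * p ^ e + 2 * c) ==> (\<kappa> ^^ e) x \<in> D Y (k + 2 * c)"
proof (induction e arbitrary: x)
 case (Suc e)
 have "(k * p ^ Suc e + 2 * c) div p = k * p ^ e + 2 * c div p"
 proof -
  have "k * p ^ Suc e + 2 * c = 2 * c + p * (k * p ^ e)" by simp
  then show ?thesis using p_pos by (simp only: div_mult_self2 neq0_conv add.commute)
 qed
 moreover have "2 * c div p \<le> c"
 proof -
  have "2 * c div p \<le> 2 * c div 2" by (rule div_le_mono2) (use p_gt_1 in auto)
  then show ?thesis by simp
 qed
 ultimately have "(k * p ^ Suc e + 2 * c) div p + c \<le> k * p ^ e + 2 * c" by linarith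
 then have "\<kappa> x \<in> D Y (k * p ^ e + 2 * c)" using \<kappa>_D[OF Suc.prems] D_mono[OF Y(2)] by blast
 from Suc.IH[OF this] show ?case by (simp only: funpow_Suc_right o_apply)
qed simp

text \<open>Over \<open>R\<close>, the module F^e_*R is generated in degrees below p^e. Multiplying
  \<open>X\<close> by these generators gives degrees below (k + 1) p^e, which \<kappa>^e divides by
  p^e; so the resulting degree bound does not depend on e.\<close>

lemma kpow_image_span:
 assumes N: "submodule N R M" and X: "X \<subseteq> N" "N \<subseteq> span_over M (carrier R) X" "X \<subseteq> D Y (k * p ^ e)"
 shows "(\<kappa> ^^ e) ` N \<subseteq> span_over M (carrier R) ((\<kappa> ^^ e) ` N \<inter> D Y (k + 1 + 2 * c))" (is "_ \<subseteq> ?S")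
proof -
 note NS = submodule_props[OF N]
 have XM: "X \<subseteq> carrier M" using X NS(1) by auto
 have T: "(\<kappa> ^^ e) ` N \<inter> D Y (k + 1 + 2 * c) \<subseteq> carrier M" using D_closed[OF Y(2)] by auto
 note SS = submodule_props[OF span_over_submodule[OF T]]
 interpret V: module R "frobenius_push p e R (self_module R)"
  by (rule frobenius_push_module[OF self_module])
 have small: "(\<kappa> ^^ e) (w *[M] x) \<in> (\<kappa> ^^ e) ` N \<inter> D Y (k + 1 + 2 * c)"
  if w: "w \<in> frob_gens e" and x: "x \<in> X" for w x
 proof -
  obtain a u where au: "a \<in> F" "u \<in> mon (p ^ e - 1) xs" "w = a \<otimes> u" using w by (auto simp: frob_gens_def)
  have "w *[M] x \<in> D Y (k * p ^ e + (p ^ e - 1))"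
   unfolding au(3) by (rule D_poly[OF Y(2) P_mon[OF au(2,1)]]) (use x X in auto)
  moreover have "k * p ^ e + (p ^ e - 1) \<le> (k + 1) * p ^ e + 2 * c" by simp
  ultimately have "w *[M] x \<in> D Y ((k + 1) * p ^ e + 2 * c)" using D_mono[OF Y(2)] by blast
  moreover have "w *[M] x \<in> N" using NS(4) w x X(1) frob_gens_closed by blast
  ultimately show ?thesis using kpow_D by blast
 qed
 have one: "(\<kappa> ^^ e) (r *[M] x) \<in> ?S" if r: "r \<in> carrier R" and x: "x \<in> X" for r x
  using frobenius_span[OF r, of e]
 proof induction
  case zero
  then show ?case using SS(2) x XM by (simp add: subset_iff)
 next
  case (step a w b)
  have cl: "a \<in> carrier R" "w \<in> carrier R" "b \<in> carrier R" "x \<in> carrier M"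
   using step(1-3) x XM frob_gens_closed V.span_over_closed[OF subset_refl, of "frob_gens e"] by auto
  have "(\<kappa> ^^ e) ((a [^] (p ^ e) \<otimes> w \<oplus> b) *[M] x) = a *[M] (\<kappa> ^^ e) (w *[M] x) +[M] (\<kappa> ^^ e) (b *[M] x)"
   using cl by (simp add: smult_l_distr smult_assoc1 kpow_add kpow_smult)
  moreover have "\<dots> \<in> ?S" by (rule span_over.step[OF step(1) small[OF step(2) x] step.IH])
  ultimately show ?case by simp
 qed
 have "(\<kappa> ^^ e) v \<in> ?S" if "v \<in> span_over M (carrier R) X" for v
  using that
 proof induction
  case zero
  then show ?case using SS(2) by simp
 next
  case (step r x v)
  have "v \<in> carrier M" using span_over_closed[OF subset_refl XM] step(3) by auto
  then show ?case using one[OF step(1,2)] SS(3) step XM by (simp add: kpow_add subset_iff)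
 qed
 then show ?thesis using X(2) by auto
qed

lemma dimension_exists:
 obtains \<delta> :: "'c set \<Rightarrow> nat" and d where
  "\<forall>V. scalar_closed M F V \<and> V \<subseteq> D Y n \<longrightarrow> \<delta> V \<le> d"
  "\<forall>V W. scalar_closed M F V \<and> scalar_closed M F W \<and> V \<subset> W \<and> W \<subseteq> D Y n \<longrightarrow> \<delta> V < \<delta> W"
proof -
 obtain X where X: "finite X" "X \<subseteq> carrier M" "D Y n = span_over M F X"
  using D_finite_dim[OF Y(2,1), of n] by auto
 obtain \<delta> :: "'c set \<Rightarrow> nat" where \<delta>:
  "(\<forall>V. scalar_closed M F V \<and> V \<subseteq> D Y n \<longrightarrow> \<delta> V \<le> card X) \<and>
   (\<forall>V W. scalar_closed M F V \<and> scalar_closed M F W \<and> V \<subset> W \<and> W \<subseteq> D Y n \<longrightarrow> \<delta> V < \<delta> W)"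
  unfolding X(3) using subspace_dimension[OF F F_inv X(1,2)] by (rule exE)
 show thesis by (rule that[of \<delta> "card X"]) (use \<delta> in simp_all)
qed

lemma submodule_scalar_closed:
 assumes N: "submodule N R M"
 shows "scalar_closed M F N"
 unfolding scalar_closed_def
 using submodule_props(1,2)[OF N] submodule_props(3)[OF N] submodule_props(4)[OF N FR] by simp

section \<open>Existence of the least candidate\<close>

definition candidate :: "'c set \<Rightarrow> bool" where
 "candidate N \<longleftrightarrow> kstable N \<and> generically_nil N"

text \<open>The multiplier s passes into \<kappa>^b as s^(p^b), which is a multiple of s and so
  keeps the argument in \<open>N\<close>. This brings different exponents of \<kappa> to a common
  value.\<close>

lemma generically_nil_raise:
 assumes \<eta>: "primeideal \<eta> R" and N: "kstable N" and x: "x \<in> carrier M" and s: "s \<in> carrier R - \<eta>" "s *[M] (\<kappa> ^^ a) x \<in> N"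
 shows "s *[M] (\<kappa> ^^ (b + a)) x \<in> (\<kappa> ^^ b) ` N" "s *[M] (\<kappa> ^^ (b + a)) x \<in> N"
proof -
 have Ns: "submodule N R M" using N by (simp add: kstable_def)
 obtain q where q: "p ^ b = Suc q" using p_pos by (metis gr0_implies_Suc zero_less_power)
 have "s [^] q *[M] (s *[M] (\<kappa> ^^ a) x) \<in> N" using submodule_props(4)[OF Ns _ s(2)] s(1) by simp
 then have n: "s [^] (p ^ b) *[M] (\<kappa> ^^ a) x \<in> N" using s(1) x by (simp add: q smult_assoc1)
 have e: "s *[M] (\<kappa> ^^ (b + a)) x = (\<kappa> ^^ b) (s [^] (p ^ b) *[M] (\<kappa> ^^ a) x)"
  using s(1) x kpow_smult[of s "(\<kappa> ^^ a) x" b] by (simp add: kpow_plus)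
 show "s *[M] (\<kappa> ^^ (b + a)) x \<in> (\<kappa> ^^ b) ` N" unfolding e using n by (rule imageI)
 show "s *[M] (\<kappa> ^^ (b + a)) x \<in> N" unfolding e by (rule kstable_kpow[OF N n])
qed

lemma HS_closed: "x \<in> HS \<eta> ==> x \<in> carrier M"
 by (simp add: local_sections_def)

lemma candidate_image:
 assumes "candidate N"
 shows "candidate ((\<kappa> ^^ e) ` N)"
proof -
 have N: "kstable N" "generically_nil N" "submodule N R M" using assms by (auto simp: candidate_def kstable_def)
 have "\<kappa> ((\<kappa> ^^ e) n) \<in> (\<kappa> ^^ e) ` N" if "n \<in> N" for n
 proof -
  have "\<kappa> ((\<kappa> ^^ e) n) = (\<kappa> ^^ e) (\<kappa> n)" by (rule funpow_swap1)
  then show ?thesis using kstable_kpow[OF N(1) that, of 1] by auto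
 qed
 then have "kstable ((\<kappa> ^^ e) ` N)" using kpow_image_submodule[OF N(3)] by (auto simp: kstable_def)
 moreover have "\<exists>a. \<forall>x \<in> HS \<eta>. \<exists>s \<in> carrier R - \<eta>. s *[M] (\<kappa> ^^ a) x \<in> (\<kappa> ^^ e) ` N" if \<eta>: "associated_prime R M \<eta>" for \<eta>
 proof -
  have P: "primeideal \<eta> R" using \<eta> by (simp add: associated_prime_def)
  obtain a where a: "\<forall>x \<in> HS \<eta>. \<exists>s \<in> carrier R - \<eta>. s *[M] (\<kappa> ^^ a) x \<in> N"
   using N(2) \<eta> unfolding generically_nil_def by blast
  show ?thesis using a generically_nil_raise(1)[OF P N(1) HS_closed, of _ \<eta> _ a e] by (intro exI[of _ "e + a"]) blast
 qed
 ultimately show ?thesis by (simp add: candidate_def generically_nil_def)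
qed

lemma candidate_Int:
 assumes "candidate N" "candidate N'"
 shows "candidate (N \<inter> N')"
proof -
 have N: "kstable N" "generically_nil N" "submodule N R M" and N': "kstable N'" "generically_nil N'" "submodule N' R M"
  using assms by (auto simp: candidate_def kstable_def)
 note A = submodule_props[OF N(3)] and B = submodule_props[OF N'(3)]
 have "submodule (N \<inter> N') R M"
  by (rule submoduleI) (use A(1) in blast, use A(2) B(2) in blast, use A(5) B(5) in blast, use A(3) B(3) in blast, use A(4) B(4) in blast)
 then have "kstable (N \<inter> N')" using N(1) N'(1) by (auto simp: kstable_def)
 moreover have "\<exists>a. \<forall>x \<in> HS \<eta>. \<exists>s \<in> carrier R - \<eta>. s *[M] (\<kappa> ^^ a) x \<in> N \<inter> N'" if \<eta>: "associated_prime R M \<eta>" for \<eta>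
 proof -
  have P: "primeideal \<eta> R" using \<eta> by (simp add: associated_prime_def)
  obtain a b where a: "\<forall>x \<in> HS \<eta>. \<exists>s \<in> carrier R - \<eta>. s *[M] (\<kappa> ^^ a) x \<in> N"
   and b: "\<forall>x \<in> HS \<eta>. \<exists>s \<in> carrier R - \<eta>. s *[M] (\<kappa> ^^ b) x \<in> N'"
   using N(2) N'(2) \<eta> unfolding generically_nil_def by blast
  have "\<exists>s \<in> carrier R - \<eta>. s *[M] (\<kappa> ^^ (b + a)) x \<in> N \<inter> N'" if x: "x \<in> HS \<eta>" for x
  proof -
   obtain s where s: "s \<in> carrier R - \<eta>" "s *[M] (\<kappa> ^^ a) x \<in> N" using a x by auto
   obtain t where t: "t \<in> carrier R - \<eta>" "t *[M] (\<kappa> ^^ b) x \<in> N'" using b x by auto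
   have xM: "x \<in> carrier M" by (rule HS_closed[OF x])
   have 1: "s *[M] (\<kappa> ^^ (b + a)) x \<in> N" by (rule generically_nil_raise(2)[OF P N(1) xM s])
   have 2: "t *[M] (\<kappa> ^^ (b + a)) x \<in> N'"
    using generically_nil_raise(2)[OF P N'(1) xM t, of a] by (simp add: add.commute)
   have "s \<otimes> t \<in> carrier R - \<eta>" using prime_mult_notin[OF P] s(1) t(1) by blast
   moreover have "(s \<otimes> t) *[M] (\<kappa> ^^ (b + a)) x = t *[M] (s *[M] (\<kappa> ^^ (b + a)) x)"
    "(s \<otimes> t) *[M] (\<kappa> ^^ (b + a)) x = s *[M] (t *[M] (\<kappa> ^^ (b + a)) x)"
    using s(1) t(1) xM by (simp_all add: m_comm flip: smult_assoc1)
   ultimately show ?thesis using A(4)[OF _ 1, of t] B(4)[OF _ 2, of s] s(1) t(1) by (metis DiffD1 IntI)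
  qed
  then show ?thesis by blast
 qed
 ultimately show ?thesis by (simp add: candidate_def generically_nil_def)
qed

lemma candidate_carrier: "candidate (carrier M)"
proof -
 have "submodule (carrier M) R M" by (rule submoduleI) auto
 moreover have "\<one> \<in> carrier R - \<eta>" if "associated_prime R M \<eta>" for \<eta>
  using prime_one that by (auto simp: associated_prime_def)
 ultimately show ?thesis
  by (auto simp: candidate_def kstable_def generically_nil_def HS_closed intro!: exI[of _ 0] bexI[of _ \<one>])
qed

text \<open>Among the candidates choose one whose intersection with a fixed finite-dimensional piece of the gauge is
 minimal. A high iterate of \<open>\<kappa>\<close> maps it to a module generated by elements of that piece, which therefore
 lies in every other candidate.\<close>

lemma least_candidate: "\<exists>N. candidate N \<and> (\<forall>N'. candidate N' \<longrightarrow> N \<subseteq> N')"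
proof -
 define E where "E = D Y (1 + 1 + 2 * c)"
 have E: "scalar_closed M F E" unfolding E_def by (rule D_scalar_closed[OF Y(2)])
 obtain \<delta> :: "'c set \<Rightarrow> nat" and d where "\<forall>V. scalar_closed M F V \<and> V \<subseteq> E \<longrightarrow> \<delta> V \<le> d"
  and "\<forall>V W. scalar_closed M F V \<and> scalar_closed M F W \<and> V \<subset> W \<and> W \<subseteq> E \<longrightarrow> \<delta> V < \<delta> W"
  by (rule dimension_exists[of "1 + 1 + 2 * c", folded E_def])
 then have \<delta>: "\<delta> V < \<delta> W" if "scalar_closed M F V" "scalar_closed M F W" "V \<subset> W" "W \<subseteq> E" for V W
  using that by simp
 obtain N0 where "candidate N0 \<and> (\<forall>N. candidate N \<longrightarrow> \<delta> (N0 \<inter> E) \<le> \<delta> (N \<inter> E))"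
  using ex_has_least_nat[of candidate "carrier M" "\<lambda>N. \<delta> (N \<inter> E)", OF candidate_carrier] by (rule exE)
 then have N0: "candidate N0" "\<And>N. candidate N ==> \<delta> (N0 \<inter> E) \<le> \<delta> (N \<inter> E)" by simp_all
 have sc: "scalar_closed M F (N \<inter> E)" if "candidate N" for N
  using that E submodule_scalar_closed by (intro scalar_closed_Int) (auto simp: candidate_def kstable_def)
 have sub: "N0 \<inter> E \<subseteq> N" if N: "candidate N" for N
 proof (rule ccontr)
  assume "\<not> N0 \<inter> E \<subseteq> N"
  then have "N0 \<inter> N \<inter> E \<subset> N0 \<inter> E" by auto
  then have "\<delta> (N0 \<inter> N \<inter> E) < \<delta> (N0 \<inter> E)"
   using candidate_Int[OF N0(1) N] N0(1) by (intro \<delta> sc) auto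
  then show False using N0(2)[OF candidate_Int[OF N0(1) N]] by simp
 qed
 have N0s: "submodule N0 R M" using N0(1) by (simp add: candidate_def kstable_def)
 obtain X where X: "X \<subseteq> N0" "finite X" "N0 = span_over M (carrier R) X"
  using noetherian_span[OF noetherian_ring Y(1,2) N0s] submodule_props(1)[OF N0s] Y(3) by auto
 have XM: "X \<subseteq> carrier M" using X(1) submodule_props(1)[OF N0s] by auto
 obtain s where s: "s \<in> U" "\<And>x. x \<in> X ==> s *[M] x \<in> Dinf Y"
  using common_denominator[OF Y(2) X(2)] Y(3) XM by auto
 define X' where "X' = (\<lambda>x. s *[M] x) ` X"
 have X': "X' \<subseteq> N0" "finite X'" "X' \<subseteq> Dinf Y"
  using X(1,2) s submodule_props(4)[OF N0s, of s] by (auto simp: X'_def Units_closed subset_iff)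
 have X'M: "X' \<subseteq> carrier M" using X'(1) submodule_props(1)[OF N0s] by auto
 have span: "N0 \<subseteq> span_over M (carrier R) X'"
 proof -
  note SS = submodule_props[OF span_over_submodule[OF X'M]]
  have "a *[M] x \<in> span_over M (carrier R) X'" if a: "a \<in> carrier R" and x: "x \<in> X" for a x
  proof -
   have "(a \<otimes> inv s) *[M] (s *[M] x) \<in> span_over M (carrier R) X'"
    using a x s(1) X'M by (intro span_over_base) (auto simp: X'_def)
   moreover have "x \<in> carrier M" using x XM by auto
   then have "(a \<otimes> inv s) *[M] (s *[M] x) = a *[M] x"
    using a s(1) by (simp add: m_assoc Units_closed flip: smult_assoc1)
   ultimately show ?thesis by simp
  qed
  then show ?thesis unfolding X(3) using SS(3) by (intro span_over_least[OF SS(2)]) auto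
 qed
 obtain e where e: "X' \<subseteq> D Y e" using Dinf_bounded[OF Y(2) X'(2,3)] by auto
 \<comment> \<open>One number serves both as degree bound for \<open>X'\<close> and as exponent of
   \<kappa>: a degree of at most e is at most p^e, which is the case k = 1 for which
   \<open>E\<close> was chosen.\<close>
 have "e \<le> 1 * p ^ e" using p_gt_1 by (simp add: less_imp_le)
 then have "X' \<subseteq> D Y (1 * p ^ e)" using e D_mono[OF Y(2)] by blast
 from kpow_image_span[OF N0s X'(1) span this]
 have im: "(\<kappa> ^^ e) ` N0 \<subseteq> span_over M (carrier R) ((\<kappa> ^^ e) ` N0 \<inter> E)" by (simp only: E_def)
 have "(\<kappa> ^^ e) ` N0 \<subseteq> N0" using kstable_kpow N0(1) by (auto simp: candidate_def)
 then have small: "(\<kappa> ^^ e) ` N0 \<inter> E \<subseteq> N0 \<inter> E" by auto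
 have "(\<kappa> ^^ e) ` N0 \<subseteq> N" if N: "candidate N" for N
 proof -
  have "submodule N R M" using N by (simp add: candidate_def kstable_def)
  note NS = submodule_props[OF this]
  have "(\<kappa> ^^ e) ` N0 \<inter> E \<subseteq> N" using small sub[OF N] by auto
  then have "span_over M (carrier R) ((\<kappa> ^^ e) ` N0 \<inter> E) \<subseteq> N"
   using NS(3,4) by (intro span_over_least[OF NS(2)]) auto
  then show ?thesis using im by (rule subset_trans[rotated])
 qed
 then show ?thesis using candidate_image[OF N0(1), of e] by blast
qed

text \<open>Existence of a least candidate gives LEAST its intended meaning. F-regularity then says
  that the least candidate is \<open>M\<close>, so there is no smaller one.\<close>

lemma F_regular_minimal:
 assumes "F_regular p R M \<kappa>" "kstable N" "generically_nil N"
 shows "N = carrier M"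
proof -
 obtain N0 where N0: "candidate N0" "\<And>N'. candidate N' ==> N0 \<subseteq> N'" using least_candidate by auto
 have "test_module p R M \<kappa> \<one> 0 = N0"
  unfolding test_module_def test_condition_iff
  by (rule Least_equality) (use N0 in \<open>auto simp: candidate_def\<close>)
 then have "N0 = carrier M" using assms(1) by (simp add: F_regular_def)
 then show ?thesis using N0(2)[of N] assms submodule_props(1)[of N] by (auto simp: candidate_def kstable_def)
qed

end

locale F_regular_gauge = F_regular_cartier R M p \<kappa> f + gauge R M p \<kappa> F xs L Y c
 for R (structure) and M (structure) and p \<kappa> f F xs L Y c
begin

text \<open>For a unit s the element s f is a polynomial of some degree k, so f^n M is generated in
  degree n k, which is at most k p^e if n \<le> p^e. Thus every \<tau>(l) with l in [0, 1] is
  generated by its intersection with one finite-dimensional piece \<open>E\<close>. As the \<tau>(l)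
  form a chain, the bounded function \<delta> of this intersection tells them apart.\<close>

lemma finite_tau: "finite (tau ` {0..1})"
proof -
 obtain s where s: "s \<in> U" "s \<otimes> f \<in> polys" using denom[OF fR] by auto
 then obtain k where k: "s \<otimes> f \<in> P k" by (auto simp: module_gauge.Dinf_def[OF self_gauge])
 have sc: "s \<in> carrier R" "inv s \<in> carrier R" "inv s \<otimes> s = \<one>" using s(1) by auto
 define E where "E = D Y (k + 1 + 2 * c)"
 have E: "scalar_closed M F E" unfolding E_def by (rule D_scalar_closed[OF Y(2)])
 obtain \<delta> :: "'c set \<Rightarrow> nat" and d where \<delta>b: "\<forall>V. scalar_closed M F V \<and> V \<subseteq> E \<longrightarrow> \<delta> V \<le> d"
  and "\<forall>V W. scalar_closed M F V \<and> scalar_closed M F W \<and> V \<subset> W \<and> W \<subseteq> E \<longrightarrow> \<delta> V < \<delta> W"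
  by (rule dimension_exists[of "k + 1 + 2 * c", folded E_def])
 then have \<delta>: "\<delta> V < \<delta> W" if "scalar_closed M F V" "scalar_closed M F W" "V \<subset> W" "W \<subseteq> E" for V W
  using that by simp
 have pow: "(s \<otimes> f) [^] n *[M] y \<in> D Y (n * k)" if y: "y \<in> Y" for n :: nat and y
 proof (induction n)
  case 0
  have "y \<in> carrier M" using y Y(2) by auto
  then show ?case using D_gen[OF Y(2) y] by simp
 next
  case (Suc n)
  have "y \<in> carrier M" using y Y(2) by auto
  then have "(s \<otimes> f) [^] Suc n *[M] y = (s \<otimes> f) *[M] ((s \<otimes> f) [^] n *[M] y)"
   using sc(1) by (simp only: nat_pow_Suc m_comm nat_pow_closed m_closed fR flip: smult_assoc1)
  then show ?case using D_poly[OF Y(2) k Suc.IH] by (simp add: add.commute)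
 qed
 have gen: "img e n \<subseteq> span_over M (carrier R) (img e n \<inter> E)" if n: "n \<le> p ^ e" for e n
 proof -
  let ?N = "(\<lambda>m. f [^] n *[M] m) ` carrier M"
  let ?X = "(\<lambda>y. (s \<otimes> f) [^] n *[M] y) ` Y"
  have N: "submodule ?N R M" by (rule smult_image_submodule) (auto intro: submoduleI)
  have XN: "?X \<subseteq> ?N"
  proof
   fix x assume "x \<in> ?X"
   then obtain y where y: "y \<in> Y" "x = (s \<otimes> f) [^] n *[M] y" by auto
   have yM: "y \<in> carrier M" using y(1) Y(2) by auto
   have "x = f [^] n *[M] (s [^] n *[M] y)"
    unfolding y(2) using sc(1) yM by (simp add: nat_pow_distrib m_comm flip: smult_assoc1)
   then show "x \<in> ?N" using sc(1) yM by auto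
  qed
  have XM: "?X \<subseteq> carrier M" using Y(2) sc(1) by auto
  note SS = submodule_props[OF span_over_submodule[OF XM]]
  have "f [^] n *[M] v \<in> span_over M (carrier R) ?X" if "v \<in> span_over M (carrier R) Y" for v
   using that
  proof induction
   case zero
   then show ?case using SS(2) by simp
  next
   case (step a y v)
   have cl: "y \<in> carrier M" "v \<in> carrier M" using step Y(2) span_over_closed[OF subset_refl Y(2)] by auto
   have "inv s [^] n \<otimes> (s \<otimes> f) [^] n = (inv s \<otimes> s) [^] n \<otimes> f [^] n"
    using sc(1,2) by (simp add: nat_pow_distrib m_assoc)
   then have "inv s [^] n \<otimes> (s \<otimes> f) [^] n = f [^] n" using sc(3) by simp
   then have "f [^] n *[M] (a *[M] y +[M] v) = (a \<otimes> (inv s [^] n \<otimes> (s \<otimes> f) [^] n)) *[M] y +[M] f [^] n *[M] v"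
    using step(1) cl by (simp add: smult_r_distr m_comm flip: smult_assoc1)
   also have "\<dots> = (a \<otimes> inv s [^] n) *[M] ((s \<otimes> f) [^] n *[M] y) +[M] f [^] n *[M] v"
    using step(1) cl sc(1,2) by (simp add: m_assoc flip: smult_assoc1)
   also have "\<dots> \<in> span_over M (carrier R) ?X"
    using step sc(2) by (intro span_over.step) auto
   finally show ?case .
  qed
  then have NX: "?N \<subseteq> span_over M (carrier R) ?X" unfolding Y(3) by auto
  have "n * k \<le> k * p ^ e" using n by (simp add: mult.commute)
  then have XD: "?X \<subseteq> D Y (k * p ^ e)" using pow[of _ n] D_mono[OF Y(2), of "n * k" "k * p ^ e"] by auto
  have "(\<kappa> ^^ e) ` ?N = img e n" by (auto simp: img_def image_image)
  then show ?thesis using kpow_image_span[OF N XN NX XD] by (simp only: E_def)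
 qed
 have tgen: "tau l \<subseteq> span_over M (carrier R) (tau l \<inter> E)" if l: "l \<in> {0..1}" for l
 proof -
  obtain e where e: "tau l = img e (nat \<lceil>l * real p ^ e\<rceil>)" using tau_eventually[of l] l by auto
  have "l * real p ^ e \<le> 1 * real p ^ e" using l by (intro mult_right_mono) auto
  then have "\<lceil>l * real p ^ e\<rceil> \<le> int (p ^ e)" by (simp add: ceiling_le_iff)
  then have "nat \<lceil>l * real p ^ e\<rceil> \<le> p ^ e" by linarith
  from gen[OF this] show ?thesis by (simp only: e)
 qed
 have sm: "submodule (tau l) R M" if "l \<in> {0..1}" for l using tau_submodule that by auto
 have sc: "scalar_closed M F (tau l \<inter> E)" if "l \<in> {0..1}" for l
  by (rule scalar_closed_Int[OF submodule_scalar_closed[OF sm[OF that]] E])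
 have sub: "tau l \<subseteq> tau m" if l: "l \<in> {0..1}" and m: "m \<in> {0..1}" and lm: "tau l \<inter> E \<subseteq> tau m" for l m
 proof -
  note NS = submodule_props[OF sm[OF m]]
  have "span_over M (carrier R) (tau l \<inter> E) \<subseteq> tau m"
   using NS(3,4) lm by (intro span_over_least[OF NS(2)]) auto
  then show ?thesis using tgen[OF l] by (rule subset_trans[rotated])
 qed
 have le: "tau m = tau l" if l: "l \<in> {0..1}" and m: "m \<in> {0..1}" and eq: "\<delta> (tau l \<inter> E) = \<delta> (tau m \<inter> E)" and lm: "l \<le> m" for l m
 proof -
  have am: "tau m \<subseteq> tau l" by (rule tau_antimono) (use l lm in auto)
  have "\<not> tau m \<inter> E \<subset> tau l \<inter> E" using \<delta>[OF sc[OF m] sc[OF l]] eq by auto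
  then have "tau l \<inter> E \<subseteq> tau m" using am by auto
  from sub[OF l m this] am show ?thesis by auto
 qed
 have "inj_on (\<lambda>T. \<delta> (T \<inter> E)) (tau ` {0..1})"
 proof (rule inj_onI)
  fix A B assume "A \<in> tau ` {0..1}" "B \<in> tau ` {0..1}" and eq: "\<delta> (A \<inter> E) = \<delta> (B \<inter> E)"
  then obtain l m where lm: "l \<in> {0..1}" "m \<in> {0..1}" "A = tau l" "B = tau m" by auto
  show "A = B" using le[OF lm(1,2)] le[OF lm(2,1)] eq lm(3,4) by (cases "l \<le> m") auto
 qed
 moreover have "(\<lambda>T. \<delta> (T \<inter> E)) ` (tau ` {0..1}) \<subseteq> {..d}" using \<delta>b sc by auto
 ultimately show ?thesis using finite_subset finite_imageD by (metis finite_atMost)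
qed

end

section \<open>Binomial coefficients modulo a prime\<close>

lemma prime_dvd_choose_prime_power:
 fixes p :: nat
 assumes p: "Factorial_Ring.prime p" and k: "0 < k" "k < p ^ j"
 shows "p dvd (p ^ j choose k)"
proof (rule ccontr)
 assume "\<not> p dvd (p ^ j choose k)"
 then have "coprime (p ^ j) (p ^ j choose k)" using p by (simp add: prime_imp_coprime)
 moreover have "p ^ j dvd k * (p ^ j choose k)"
  using times_binomial_minus1_eq[OF k(1), of "p ^ j"] by simp
 ultimately have "p ^ j dvd k" by (simp add: coprime_dvd_mult_left_iff)
 then show False using k by (simp add: nat_dvd_not_less)
qed

text \<open>A case of Lucas's theorem. By Vandermonde's identity, raising m by p^j raises the
  binomial by 1 modulo p, because the inner binomials of p^j vanish; the quotient m div p^j also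
  rises by 1.\<close>

lemma choose_prime_power_mod:
 fixes p :: nat
 assumes p: "Factorial_Ring.prime p"
 shows "(m choose p ^ j) mod p = (m div p ^ j) mod p"
proof (induction m rule: less_induct)
 case (less m)
 have q: "0 < p ^ j" using p by (simp add: prime_gt_0_nat)
 show ?case
 proof (cases "m < p ^ j")
  case False
  define x where "x = m - p ^ j"
  have m: "m = x + p ^ j" using False by (simp add: x_def)
  have "(m choose p ^ j) = (\<Sum>k\<le>p ^ j. (x choose (p ^ j - k)) * (p ^ j choose k))"
  proof -
   have "(m choose p ^ j) = (p ^ j + x choose p ^ j)" by (simp add: m add.commute)
   also have "\<dots> = (\<Sum>k\<le>p ^ j. (p ^ j choose k) * (x choose (p ^ j - k)))" by (rule vandermonde[symmetric])
   finally show ?thesis by (simp add: mult.commute)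
  qed
  also have "{..p ^ j} = {0, p ^ j} \<union> {0<..<p ^ j}" using q by auto
  also have "(\<Sum>k\<in>{0, p ^ j} \<union> {0<..<p ^ j}. (x choose (p ^ j - k)) * (p ^ j choose k)) =
    (\<Sum>k\<in>{0, p ^ j}. (x choose (p ^ j - k)) * (p ^ j choose k)) + (\<Sum>k\<in>{0<..<p ^ j}. (x choose (p ^ j - k)) * (p ^ j choose k))"
   by (rule sum.union_disjoint) auto
  also have "(\<Sum>k\<in>{0, p ^ j}. (x choose (p ^ j - k)) * (p ^ j choose k)) = (x choose p ^ j) + 1" using q by simp
  finally have e: "(m choose p ^ j) = (x choose p ^ j) + 1 + (\<Sum>k\<in>{0<..<p ^ j}. (x choose (p ^ j - k)) * (p ^ j choose k))" .
  have "p dvd (\<Sum>k\<in>{0<..<p ^ j}. (x choose (p ^ j - k)) * (p ^ j choose k))"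
   by (intro dvd_sum dvd_mult prime_dvd_choose_prime_power[OF p]) auto
  then have "(m choose p ^ j) mod p = ((x choose p ^ j) + 1) mod p" unfolding e by (auto elim!: dvdE)
  also have "\<dots> = (x div p ^ j + 1) mod p"
   using less.IH[of x] q by (intro mod_add_cong) (simp_all add: m)
  also have "x div p ^ j + 1 = m div p ^ j" using q by (simp add: m)
  finally show ?thesis .
 qed (simp add: binomial_eq_0)
qed

text \<open>Modulo \<open>p\<close>, this is the indicator function of the congruence class of \<open>n\<close> modulo \<open>p\<^sup>e\<close>, by Fermat's
 little theorem.\<close>

primrec projector_wt :: "nat \<Rightarrow> nat \<Rightarrow> nat \<Rightarrow> nat \<Rightarrow> nat" where
 "projector_wt p n 0 m = 1"
| "projector_wt p n (Suc e) m =
   projector_wt p n e m * (1 + (p - 1) * ((m choose p ^ e) + (p - (n div p ^ e) mod p)) ^ (p - 1))"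

lemma digit_mod:
 fixes p :: nat
 assumes "0 < p"
 shows "m mod p ^ Suc e = m mod p ^ e + p ^ e * ((m div p ^ e) mod p)"
 by (metis add.commute mod_mult2_eq power_Suc2)

text \<open>Each factor is 1 - (binomial - digit of n)^(p-1), where \<open>p - 1\<close> and
  \<open>p - c\<close> stand for -1 and -c so that weights remain natural numbers. By
  \<open>choose_prime_power_mod\<close> the binomial is the corresponding digit of m.\<close>

lemma projector_wt_mod:
 fixes p :: nat
 assumes p: "Factorial_Ring.prime p"
 shows "projector_wt p n e m mod p = (if m mod p ^ e = n mod p ^ e then 1 else 0)"
proof (induction e)
 case 0
 then show ?case using prime_gt_1_nat[OF p] by simp
next
 case (Suc e)
 have p1: "1 < p" using p by (rule prime_gt_1_nat)
 define c where "c = (n div p ^ e) mod p"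
 define d where "d = (m div p ^ e) mod p"
 define b where "b = (m choose p ^ e) + (p - c)"
 have c: "c < p" "d < p" using p1 by (simp_all add: c_def d_def)
 have "b mod p = (d + (p - c)) mod p"
  unfolding b_def d_def using choose_prime_power_mod[OF p, of m e] by (intro mod_add_cong) auto
 then have b: "p dvd b \<longleftrightarrow> d = c"
 proof -
  assume e: "b mod p = (d + (p - c)) mod p"
  have "p dvd b \<longleftrightarrow> p dvd d + (p - c)" using e by (simp add: dvd_eq_mod_eq_0)
  also have "\<dots> \<longleftrightarrow> d = c"
  proof
   assume "p dvd d + (p - c)"
   then obtain k where k: "d + (p - c) = p * k" by (elim dvdE)
   have "0 < p * k" "p * k < p * 2" using c k by linarith+
   then have "0 < k" "k < 2" using p1 by (simp_all only: nat_0_less_mult_iff mult_less_cancel1)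
   then have "k = 1" by simp
   then show "d = c" using k c by simp
  qed (use c in simp)
  finally show ?thesis .
 qed
 have f: "(1 + (p - 1) * b ^ (p - 1)) mod p = (if d = c then 1 else 0)"
 proof (cases "d = c")
  case True
  then have "p dvd b ^ (p - 1)" using b p1 by (meson dvd_power dvd_trans zero_less_diff)
  then have "p dvd (p - 1) * b ^ (p - 1)" by simp
  then have "(1 + (p - 1) * b ^ (p - 1)) mod p = 1 mod p" by (metis add.right_neutral dvd_eq_mod_eq_0 mod_add_right_eq)
  then show ?thesis using True p1 by simp
 next
  case False
  then have "[b ^ (p - 1) = 1] (mod p)" using b fermat_theorem[OF p, of b] by simp
  then have "[1 + (p - 1) * b ^ (p - 1) = 1 + (p - 1) * 1] (mod p)" by (intro cong_add cong_mult cong_refl)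
  then show ?thesis using False p1 by (simp add: cong_def)
 qed
 have "m mod p ^ Suc e = n mod p ^ Suc e \<longleftrightarrow> m mod p ^ e = n mod p ^ e \<and> d = c"
 proof
  assume e: "m mod p ^ Suc e = n mod p ^ Suc e"
  have "(m mod p ^ Suc e) mod p ^ e = (n mod p ^ Suc e) mod p ^ e" by (simp only: e)
  then have 1: "m mod p ^ e = n mod p ^ e" by (simp add: mod_mod_cancel)
  have "m mod p ^ e + p ^ e * d = n mod p ^ e + p ^ e * c"
   using e p1 by (simp only: digit_mod[OF less_trans[OF zero_less_one p1]] c_def d_def)
  then have "p ^ e * d = p ^ e * c" using 1 by simp
  then show "m mod p ^ e = n mod p ^ e \<and> d = c" using 1 p1 by simp
 qed (use p1 in \<open>simp only: digit_mod[OF less_trans[OF zero_less_one p1]] c_def d_def simp_thms\<close>)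
 moreover have "projector_wt p n (Suc e) m mod p = (projector_wt p n e m mod p * ((1 + (p - 1) * b ^ (p - 1)) mod p)) mod p"
  by (simp only: projector_wt.simps b_def c_def mod_mult_eq)
 ultimately show ?case unfolding Suc.IH f using p1 by simp
qed

lemma digits_sum:
 fixes p :: nat
 assumes "\<And>j. j < e ==> c j < p"
 shows "(\<Sum>j<e. c j * p ^ j) < p ^ e" "\<And>j. j < e ==> (\<Sum>j<e. c j * p ^ j) div p ^ j mod p = c j"
proof -
 have "(\<Sum>j<e. c j * p ^ j) < p ^ e \<and> (\<forall>j<e. (\<Sum>j<e. c j * p ^ j) div p ^ j mod p = c j)"
  using assms
 proof (induction e)
  case (Suc e)
  let ?s = "\<Sum>j<e. c j * p ^ j"
  have IH: "?s < p ^ e" "\<And>j. j < e ==> ?s div p ^ j mod p = c j" using Suc by auto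
  have ce: "c e < p" using Suc.prems by simp
  then have p0: "0 < p" by simp
  have "?s + c e * p ^ e < p ^ e + c e * p ^ e" using IH(1) by simp
  also have "\<dots> = (c e + 1) * p ^ e" by simp
  also have "\<dots> \<le> p * p ^ e" using ce by (intro mult_right_mono) auto
  finally have 1: "(\<Sum>j<Suc e. c j * p ^ j) < p ^ Suc e" by simp
  have "(\<Sum>j<Suc e. c j * p ^ j) div p ^ j mod p = c j" if j: "j < Suc e" for j
  proof (cases "j = e")
   case True
   then show ?thesis using IH(1) ce p0 by simp
  next
   case False
   then obtain k where k: "e = j + Suc k" using j by (metis less_Suc_eq add_Suc_right less_imp_Suc_add)
   have eq: "(\<Sum>j<Suc e. c j * p ^ j) = ?s + (c e * p ^ Suc k) * p ^ j" by (simp add: k power_add mult_ac)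
   have ne: "p ^ j \<noteq> 0" using p0 by simp
   have "(\<Sum>j<Suc e. c j * p ^ j) div p ^ j = c e * p ^ Suc k + ?s div p ^ j"
    unfolding eq by (rule div_mult_self1[OF ne])
   then have "(\<Sum>j<Suc e. c j * p ^ j) div p ^ j mod p = (c e * p ^ Suc k + ?s div p ^ j) mod p" by (simp only:)
   also have "\<dots> = (?s div p ^ j) mod p"
   proof -
    have "c e * p ^ Suc k = (c e * p ^ k) * p" by simp
    then show ?thesis by (simp only: mod_mult_self3)
   qed
   finally show ?thesis using IH(2)[of j] k by simp
  qed
  then show ?case using 1 by simp
 qed simp
 then show "(\<Sum>j<e. c j * p ^ j) < p ^ e" "\<And>j. j < e ==> (\<Sum>j<e. c j * p ^ j) div p ^ j mod p = c j" by auto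
qed

lemma sum_digits:
 fixes p :: nat
 assumes "0 < p"
 shows "(\<Sum>j<e. (n div p ^ j mod p) * p ^ j) = n mod p ^ e"
proof (induction e)
 case (Suc e)
 then show ?case using digit_mod[OF assms, of n e] by (simp add: mult.commute)
qed simp

section \<open>Groups of homomorphisms\<close>

lemma hom_module_simps:
 "\<zero>\<^bsub>hom_module R V W\<^esub> = (\<lambda>x \<in> carrier V. \<zero>\<^bsub>W\<^esub>)"
 "g \<oplus>\<^bsub>hom_module R V W\<^esub> h = (\<lambda>x \<in> carrier V. g x +[W] h x)"
 "h \<in> carrier (hom_module R V W) \<longleftrightarrow> h \<in> extensional (carrier V) \<and> linear_map R V W h"
 by (simp_all add: hom_module_def)

lemma hom_module_group:
 assumes "module R V" "module R W"
 shows "comm_group (add_monoid (hom_module R V W))"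
  and "h \<in> carrier (hom_module R V W) ==>
   inv\<^bsub>add_monoid (hom_module R V W)\<^esub> h = (\<lambda>x \<in> carrier V. \<ominus>\<^bsub>W\<^esub> h x)"
proof -
 interpret V: module R V by fact
 interpret W: module R W by fact
 let ?H = "hom_module R V W"
 have mem: "h \<in> carrier ?H \<longleftrightarrow> h \<in> extensional (carrier V) \<and> linear_map R V W h" for h
  by (rule hom_module_simps(3))
 have ad: "(\<lambda>x \<in> carrier V. g x +[W] h x) \<in> carrier ?H" if "g \<in> carrier ?H" "h \<in> carrier ?H" for g h
  using that unfolding mem linear_map_def
  by (auto simp: Pi_iff W.smult_r_distr W.M.a_ac V.smult_closed)
 have ng: "(\<lambda>x \<in> carrier V. \<ominus>\<^bsub>W\<^esub> h x) \<in> carrier ?H" if "h \<in> carrier ?H" for h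
  using that unfolding mem linear_map_def
  by (auto simp: Pi_iff W.smult_r_minus W.M.minus_add V.smult_closed)
 have cl: "h x \<in> carrier W" if "h \<in> carrier ?H" "x \<in> carrier V" for h x
  using that unfolding mem linear_map_def by auto
 have ext: "h \<in> extensional (carrier V)" if "h \<in> carrier ?H" for h using that unfolding mem by simp
 have inv: "(\<lambda>x \<in> carrier V. (\<lambda>x \<in> carrier V. \<ominus>\<^bsub>W\<^esub> h x) x +[W] h x) = (\<lambda>x \<in> carrier V. \<zero>\<^bsub>W\<^esub>)" if "h \<in> carrier ?H" for h
  using cl[OF that] by (intro restrict_ext) (simp add: W.M.l_neg)
 show G: "comm_group (add_monoid ?H)"
 proof (rule comm_groupI)
  show "\<one>\<^bsub>add_monoid ?H\<^esub> \<in> carrier (add_monoid ?H)"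
   by (auto simp: hom_module_simps linear_map_def)
  show "x \<otimes>\<^bsub>add_monoid ?H\<^esub> y \<in> carrier (add_monoid ?H)"
   if "x \<in> carrier (add_monoid ?H)" "y \<in> carrier (add_monoid ?H)" for x y
   using that ad by (simp add: hom_module_simps(2))
  show "x \<otimes>\<^bsub>add_monoid ?H\<^esub> y \<otimes>\<^bsub>add_monoid ?H\<^esub> z = x \<otimes>\<^bsub>add_monoid ?H\<^esub> (y \<otimes>\<^bsub>add_monoid ?H\<^esub> z)"
   if "x \<in> carrier (add_monoid ?H)" "y \<in> carrier (add_monoid ?H)" "z \<in> carrier (add_monoid ?H)" for x y z
   using that cl by (simp add: hom_module_simps(1,2)) (intro restrict_ext, simp add: W.M.a_assoc)
  show "x \<otimes>\<^bsub>add_monoid ?H\<^esub> y = y \<otimes>\<^bsub>add_monoid ?H\<^esub> x"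
   if "x \<in> carrier (add_monoid ?H)" "y \<in> carrier (add_monoid ?H)" for x y
   using that cl by (simp add: hom_module_simps(1,2)) (intro restrict_ext, simp add: W.M.a_comm)
  show "\<one>\<^bsub>add_monoid ?H\<^esub> \<otimes>\<^bsub>add_monoid ?H\<^esub> x = x" if "x \<in> carrier (add_monoid ?H)" for x
   by (rule extensionalityI[of _ "carrier V"]) (use that cl ext in \<open>auto simp: hom_module_simps(1,2)\<close>)
  show "\<exists>y \<in> carrier (add_monoid ?H). y \<otimes>\<^bsub>add_monoid ?H\<^esub> x = \<one>\<^bsub>add_monoid ?H\<^esub>" if "x \<in> carrier (add_monoid ?H)" for x
  proof -
   have "x \<in> carrier ?H" using that by simp
   from inv[OF this] ng[OF this] show ?thesis
    by (intro bexI[of _ "\<lambda>xa \<in> carrier V. \<ominus>\<^bsub>W\<^esub> x xa"]) (simp_all add: hom_module_simps(1,2) del: restrict_apply)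
  qed
 qed
 then interpret G: comm_group "add_monoid ?H" .
 show "inv\<^bsub>add_monoid ?H\<^esub> h = (\<lambda>x \<in> carrier V. \<ominus>\<^bsub>W\<^esub> h x)" if h: "h \<in> carrier ?H"
  by (rule G.inv_equality) (use inv[OF h] ng[OF h] h in \<open>auto simp: hom_module_simps(1,2)\<close>)
qed

lemma hom_compose:
 assumes g: "g \<in> carrier (hom_module R V W)" and h: "h \<in> carrier (hom_module R V V)" and V: "module R V"
 shows "compose (carrier V) g h \<in> carrier (hom_module R V W)"
proof -
 interpret V: module R V by fact
 show ?thesis using g h unfolding hom_module_simps(3) linear_map_def
  by (auto simp: compose_def Pi_iff)
qed

lemma end_ring_simps:
 "carrier (end_ring R V) = carrier (hom_module R V V)" "\<one>\<^bsub>end_ring R V\<^esub> = (\<lambda>x \<in> carrier V. x)"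
 "g \<oplus>\<^bsub>end_ring R V\<^esub> h = (\<lambda>x \<in> carrier V. g x +[V] h x)"
 "g \<otimes>\<^bsub>end_ring R V\<^esub> h = compose (carrier V) g h"
 "\<ominus>\<^bsub>end_ring R V\<^esub> h = inv\<^bsub>add_monoid (hom_module R V V)\<^esub> h"
 by (simp_all add: end_ring_def hom_module_simps a_inv_def m_inv_def)

section \<open>Coefficientwise operators\<close>

lemma hom_nat_multiple:
 assumes "h \<in> ring_hom A B" "ring A" "ring B"
 shows "h ([(n::nat)] \<cdot>\<^bsub>A\<^esub> \<one>\<^bsub>A\<^esub>) = [n] \<cdot>\<^bsub>B\<^esub> \<one>\<^bsub>B\<^esub>"
proof -
 interpret h: ring_hom_ring A B h by (rule ring_hom_ringI2[OF assms(2,3,1)])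
 show ?thesis by (induction n) auto
qed

context cring_char begin

lemma add_pow_mod:
 assumes x: "x \<in> carrier R" and "(a::nat) mod p = b mod p"
 shows "[a] \<cdot> x = [b] \<cdot> x"
proof -
 have "[n] \<cdot> x = [(n mod p)] \<cdot> x" for n :: nat
 proof -
  have "[n] \<cdot> x = [(p * (n div p) + n mod p)] \<cdot> x" by simp
  also have "\<dots> = [(p * (n div p))] \<cdot> x \<oplus> [(n mod p)] \<cdot> x" using x by (rule add.nat_pow_mult[symmetric])
  finally show ?thesis using add_pow_p_dvd[OF x, of "p * (n div p)"] x by simp
 qed
 then show ?thesis using assms(2) by metis
qed

lemma UP_cring: "UP_cring R"
 by (simp add: UP_cring_def is_cring)

abbreviation "pmonom \<equiv> up_ring.monom (UP R)"

lemma UP_carrier: "carrier (UP R) = up R"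
 and UP_coeff: "q \<in> up R ==> up_ring.coeff (UP R) q = q"
 and UP_add: "x \<in> up R ==> y \<in> up R ==> x \<oplus>\<^bsub>UP R\<^esub> y = (\<lambda>i. x i \<oplus> y i)"
 and UP_zero: "\<zero>\<^bsub>UP R\<^esub> = (\<lambda>_. \<zero>)"
 and UP_monom: "r \<in> carrier R ==> pmonom r n = (\<lambda>m. if m = n then r else \<zero>)"
 by (auto simp: UP_def)

lemma pmonom_closed: "r \<in> carrier R ==> pmonom r n \<in> up R"
proof -
 interpret U: UP_cring R "UP R" by (rule UP_cring)
 show "r \<in> carrier R ==> pmonom r n \<in> up R" using U.monom_closed[of r n] by (simp only: UP_carrier)
qed

lemma poly_induct [consumes 1, case_names zero add monom]:
 assumes q: "q \<in> up R" and z: "Q \<zero>\<^bsub>UP R\<^esub>"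
  and a: "\<And>x y. x \<in> up R ==> y \<in> up R ==> Q x ==> Q y ==> Q (x \<oplus>\<^bsub>UP R\<^esub> y)"
  and m: "\<And>r n. r \<in> carrier R ==> Q (pmonom r n)"
 shows "Q q"
proof -
 have *: "Q q" if "q \<in> up R" "\<forall>m \<ge> n. q m = \<zero>" for q n
  using that
 proof (induction n arbitrary: q)
  case 0
  then have "q = (\<lambda>_. \<zero>)" by auto
  then show ?case using z by (simp add: UP_zero)
 next
  case (Suc n)
  have qc: "q m \<in> carrier R" for m using Suc.prems(1) by (auto simp: up_def)
  let ?q = "q(n := \<zero>)"
  have "?q m = \<zero>" if "n \<le> m" for m using Suc.prems(2) that by (cases "m = n") auto
  then have z': "\<forall>m \<ge> n. ?q m = \<zero>" by blast
  have "bound \<zero> n ?q" by (rule bound.intro) (use z' in \<open>blast intro: less_imp_le\<close>)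
  then have u: "?q \<in> up R" using qc by (auto simp: up_def)
  have "Q (?q \<oplus>\<^bsub>UP R\<^esub> pmonom (q n) n)" by (rule a[OF u pmonom_closed[OF qc] Suc.IH[OF u z'] m[OF qc]])
  moreover have "?q \<oplus>\<^bsub>UP R\<^esub> pmonom (q n) n = q"
   unfolding UP_add[OF u pmonom_closed[OF qc]] unfolding UP_monom[OF qc] using qc by auto
  ultimately show ?case by (simp only:)
 qed
 obtain n where "bound \<zero> n q" using q by (auto simp: up_def)
 then have "\<forall>m \<ge> Suc n. q m = \<zero>" by (auto simp: bound_def)
 from *[OF q this] show ?thesis .
qed

lemma UP_char: "cring_char (UP R) p"
proof -
 interpret U: UP_cring R "UP R" by (rule UP_cring)
 have "[p] \<cdot>\<^bsub>UP R\<^esub> \<one>\<^bsub>UP R\<^esub> = up_ring.monom (UP R) ([p] \<cdot> \<one>) 0"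
  using hom_nat_multiple[OF U.const_ring_hom ring_axioms U.P.ring_axioms, of p] by simp
 also have "\<dots> = \<zero>\<^bsub>UP R\<^esub>" using p_zero by simp
 finally show ?thesis by (intro cring_char.intro U.P.is_cring cring_char_axioms.intro prime_p)
qed

section \<open>Operators that preserve each exponent of t\<close>

definition coeff_op :: "(nat \<Rightarrow> 'a \<Rightarrow> 'a) \<Rightarrow> (nat \<Rightarrow> 'a) \<Rightarrow> nat \<Rightarrow> 'a" where
 "coeff_op g = (\<lambda>q \<in> up R. \<lambda>m. g m (q m))"

text \<open>The last clause is linearity over p^e-th powers of R[t], tested on (c t^i)^(p^e):
  multiplication by this element shifts exponents by i p^e.\<close>

definition admissible :: "nat \<Rightarrow> (nat \<Rightarrow> 'a \<Rightarrow> 'a) \<Rightarrow> bool" where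
 "admissible e g \<longleftrightarrow> (\<forall>m. \<forall>r \<in> carrier R. g m r \<in> carrier R) \<and>
   (\<forall>m. \<forall>r \<in> carrier R. \<forall>s \<in> carrier R. g m (r \<oplus> s) = g m r \<oplus> g m s) \<and>
   (\<forall>m i. \<forall>c \<in> carrier R. \<forall>r \<in> carrier R. g (m + i * p ^ e) (c [^] (p ^ e) \<otimes> r) = c [^] (p ^ e) \<otimes> g m r)"

lemma admissibleD:
 assumes "admissible e g"
 shows "r \<in> carrier R ==> g m r \<in> carrier R"
  "r \<in> carrier R ==> s \<in> carrier R ==> g m (r \<oplus> s) = g m r \<oplus> g m s"
  "c \<in> carrier R ==> r \<in> carrier R ==> g (m + i * p ^ e) (c [^] (p ^ e) \<otimes> r) = c [^] (p ^ e) \<otimes> g m r"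
  "g m \<zero> = \<zero>"
proof -
 show 1: "r \<in> carrier R ==> g m r \<in> carrier R" for r m using assms by (simp add: admissible_def)
 show 2: "r \<in> carrier R ==> s \<in> carrier R ==> g m (r \<oplus> s) = g m r \<oplus> g m s" for r s using assms by (simp add: admissible_def)
 show "c \<in> carrier R ==> r \<in> carrier R ==> g (m + i * p ^ e) (c [^] (p ^ e) \<otimes> r) = c [^] (p ^ e) \<otimes> g m r"
  using assms by (simp add: admissible_def)
 have "g m \<zero> \<oplus> g m \<zero> = g m \<zero>" using 2[of \<zero> \<zero>] by simp
 then show "g m \<zero> = \<zero>" using 1[of \<zero> m] by (metis add.r_cancel_one zero_closed)
qed

lemma coeff_op_closed:
 assumes g: "admissible e g" and q: "q \<in> up R"
 shows "coeff_op g q \<in> up R"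
proof -
 obtain n where n: "bound \<zero> n q" using q by (auto simp: up_def)
 have "bound \<zero> n (\<lambda>m. g m (q m))" using n admissibleD(4)[OF g] by (auto simp: bound_def)
 moreover have "g m (q m) \<in> carrier R" for m using q admissibleD(1)[OF g] by (auto simp: up_def)
 ultimately show ?thesis using q by (auto simp: coeff_op_def up_def)
qed

lemma coeff_op_monom:
 assumes g: "admissible e g" and r: "r \<in> carrier R"
 shows "coeff_op g (pmonom r n) = pmonom (g n r) n"
 using pmonom_closed[OF r, of n] admissibleD(4)[OF g] admissibleD(1)[OF g r]
 by (auto simp: coeff_op_def UP_monom[OF r] UP_monom)

lemma coeff_op_add:
 assumes g: "admissible e g" and x: "x \<in> up R" and y: "y \<in> up R"
 shows "coeff_op g (x \<oplus>\<^bsub>UP R\<^esub> y) = coeff_op g x \<oplus>\<^bsub>UP R\<^esub> coeff_op g y"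
proof -
 have "x m \<in> carrier R" "y m \<in> carrier R" for m using x y by (auto simp: up_def)
 then show ?thesis
  unfolding UP_add[OF x y] UP_add[OF coeff_op_closed[OF g x] coeff_op_closed[OF g y]]
  using x y up_add_closed[OF x y] admissibleD(2)[OF g] by (simp add: coeff_op_def)
qed

lemma coeff_op_zero: "admissible e g ==> coeff_op g \<zero>\<^bsub>UP R\<^esub> = \<zero>\<^bsub>UP R\<^esub>"
 using admissibleD(4)[of e g] coeff_op_monom[of e g \<zero> 0] by (simp add: UP_monom UP_zero)

abbreviation "push_UP e \<equiv> frobenius_push p e (UP R) (self_module (UP R))"

lemma push_UP_module: "module (UP R) (push_UP e)"
proof -
 interpret UC: cring_char "UP R" p by (rule UP_char)
 show ?thesis by (rule UC.frobenius_push_module[OF UC.self_module])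
qed

lemma diff_ops_carrier: "carrier (diff_ops p e (UP R)) = carrier (hom_module (UP R) (push_UP e) (push_UP e))"
 by (simp add: diff_ops_def end_ring_simps)

text \<open>The p^e-th power of a polynomial is the sum of the p^e-th powers of its terms. Hence
  linearity has to be checked for monomials only, where it is the admissibility condition.\<close>

lemma coeff_op_mem:
 assumes g: "admissible e g"
 shows "coeff_op g \<in> carrier (diff_ops p e (UP R))"
proof -
 interpret U: UP_cring R "UP R" by (rule UP_cring)
 interpret UC: cring_char "UP R" p by (rule UP_char)
 let ?C = "coeff_op g"
 have cl: "?C x \<in> carrier (UP R)" if "x \<in> carrier (UP R)" for x
  using coeff_op_closed[OF g] that by (simp only: UP_carrier)
 have ad: "?C (x \<oplus>\<^bsub>UP R\<^esub> y) = ?C x \<oplus>\<^bsub>UP R\<^esub> ?C y" if "x \<in> carrier (UP R)" "y \<in> carrier (UP R)" for x y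
  using coeff_op_add[OF g] that by (simp only: UP_carrier)
 note z = coeff_op_zero[OF g]
 have mm: "?C (pmonom (c [^] (p ^ e)) (i * p ^ e) \<otimes>\<^bsub>UP R\<^esub> x) = pmonom (c [^] (p ^ e)) (i * p ^ e) \<otimes>\<^bsub>UP R\<^esub> ?C x"
  if c: "c \<in> carrier R" and x: "x \<in> up R" for c i x
  using x
 proof (induction rule: poly_induct)
  case zero
  then show ?case using z c by simp
 next
  case (add x y)
  then have "x \<in> carrier (UP R)" "y \<in> carrier (UP R)" by (simp_all only: UP_carrier)
  then show ?case using add c by (simp add: ad cl U.P.r_distr)
 next
  case (monom r n)
  have "?C (pmonom (c [^] (p ^ e)) (i * p ^ e) \<otimes>\<^bsub>UP R\<^esub> pmonom r n) = ?C (pmonom (c [^] (p ^ e) \<otimes> r) (n + i * p ^ e))"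
   using c monom by (simp only: U.monom_mult[symmetric] nat_pow_closed add.commute)
  also have "\<dots> = pmonom (c [^] (p ^ e) \<otimes> g n r) (i * p ^ e + n)"
   using coeff_op_monom[OF g, of "c [^] (p ^ e) \<otimes> r" "n + i * p ^ e"] admissibleD(3)[OF g c monom, of n i] c monom
   by (simp only: m_closed nat_pow_closed add.commute)
  also have "\<dots> = pmonom (c [^] (p ^ e)) (i * p ^ e) \<otimes>\<^bsub>UP R\<^esub> pmonom (g n r) n"
   using c admissibleD(1)[OF g monom] by (simp only: U.monom_mult nat_pow_closed)
  also have "pmonom (g n r) n = ?C (pmonom r n)" by (rule coeff_op_monom[OF g monom, symmetric])
  finally show ?case .
 qed
 have sm: "?C (a [^]\<^bsub>UP R\<^esub> (p ^ e) \<otimes>\<^bsub>UP R\<^esub> x) = a [^]\<^bsub>UP R\<^esub> (p ^ e) \<otimes>\<^bsub>UP R\<^esub> ?C x" if a: "a \<in> up R" and x: "x \<in> up R" for a x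
  using a
 proof (induction rule: poly_induct)
  case zero
  have "\<zero>\<^bsub>UP R\<^esub> [^]\<^bsub>UP R\<^esub> (p ^ e) = \<zero>\<^bsub>UP R\<^esub>" by (rule UC.frobenius_zero)
  then show ?case using x cl[of x] z by (simp add: UP_carrier[symmetric])
 next
  case (add b c)
  then have bc: "b \<in> carrier (UP R)" "c \<in> carrier (UP R)" "x \<in> carrier (UP R)" using x by (simp_all only: UP_carrier)
  then show ?case using add.IH UC.frobenius_add[OF bc(1,2), of e] by (simp add: ad cl U.P.l_distr)
 next
  case (monom c i)
  show ?case using mm[OF monom x, of i] U.monom_pow[OF monom, of i "p ^ e"] by (simp only:)
 qed
 have "?C \<in> extensional (carrier (UP R))" by (simp add: coeff_op_def UP_carrier)
 then show ?thesis
  unfolding diff_ops_carrier hom_module_simps(3) linear_map_def using cl ad sm by (simp add: UP_carrier)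
qed

lemma coeff_op_eqI:
 "(\<And>m r. r \<in> carrier R ==> g m r = h m r) ==> coeff_op g = coeff_op h"
 unfolding coeff_op_def by (intro restrict_ext ext) (auto simp: up_def)

lemma admissible_comp:
 assumes g: "admissible e g" and h: "admissible e h"
 shows "admissible e (\<lambda>m r. g m (h m r))" "admissible e (\<lambda>m r. g m r \<oplus> h m r)"
  "admissible e (\<lambda>m r. \<ominus> g m r)" "admissible e (\<lambda>m r. r)"
 using admissibleD[OF g] admissibleD[OF h] unfolding admissible_def
 by (simp_all add: r_distr a_ac r_minus minus_add)

lemma operator_ring_ops:
 assumes g: "admissible e g" and h: "admissible e h"
 shows "coeff_op g \<otimes>\<^bsub>diff_ops p e (UP R)\<^esub> coeff_op h = coeff_op (\<lambda>m r. g m (h m r))"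
  "coeff_op g \<oplus>\<^bsub>diff_ops p e (UP R)\<^esub> coeff_op h = coeff_op (\<lambda>m r. g m r \<oplus> h m r)"
  "\<ominus>\<^bsub>diff_ops p e (UP R)\<^esub> coeff_op g = coeff_op (\<lambda>m r. \<ominus> g m r)"
  "\<one>\<^bsub>diff_ops p e (UP R)\<^esub> = coeff_op (\<lambda>m r. r)"
proof -
 interpret U: UP_cring R "UP R" by (rule UP_cring)
 note gc = coeff_op_closed[OF g] and hc = coeff_op_closed[OF h]
 show "coeff_op g \<otimes>\<^bsub>diff_ops p e (UP R)\<^esub> coeff_op h = coeff_op (\<lambda>m r. g m (h m r))"
  unfolding diff_ops_def end_ring_simps frobenius_push_simps self_module_simps UP_carrier compose_def
  unfolding coeff_op_def[of "\<lambda>m r. g m (h m r)"]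
  by (intro restrict_ext) (use hc in \<open>simp add: coeff_op_def\<close>)
 show "coeff_op g \<oplus>\<^bsub>diff_ops p e (UP R)\<^esub> coeff_op h = coeff_op (\<lambda>m r. g m r \<oplus> h m r)"
  unfolding diff_ops_def end_ring_simps frobenius_push_simps self_module_simps UP_carrier
  unfolding coeff_op_def[of "\<lambda>m r. g m r \<oplus> h m r"]
  by (intro restrict_ext) (simp only: UP_add[OF gc hc], simp add: coeff_op_def)
 have mem: "coeff_op g \<in> carrier (hom_module (UP R) (push_UP e) (push_UP e))"
  using coeff_op_mem[OF g] by (simp only: diff_ops_carrier)
 have neg: "\<ominus>\<^bsub>push_UP e\<^esub> y = (\<lambda>i. \<ominus> y i)" if y: "y \<in> up R" for y
 proof -
  have yc: "y i \<in> carrier R" for i using y by (auto simp: up_def)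
  have "(\<lambda>i. \<ominus> y i) \<oplus>\<^bsub>UP R\<^esub> y = \<zero>\<^bsub>UP R\<^esub>"
   unfolding UP_add[OF up_a_inv_closed[OF y] y] UP_zero using yc by (simp add: l_neg)
  then have "\<ominus>\<^bsub>UP R\<^esub> y = (\<lambda>i. \<ominus> y i)"
   using y up_a_inv_closed[OF y] by (intro U.P.minus_equality) (simp_all only: UP_carrier)
  moreover have "\<ominus>\<^bsub>push_UP e\<^esub> y = \<ominus>\<^bsub>UP R\<^esub> y" by (simp add: a_inv_def m_inv_def)
  ultimately show ?thesis by simp
 qed
 have "\<ominus>\<^bsub>diff_ops p e (UP R)\<^esub> coeff_op g = (\<lambda>x \<in> up R. \<ominus>\<^bsub>push_UP e\<^esub> coeff_op g x)"
  unfolding diff_ops_def end_ring_simps(5) hom_module_group(2)[OF push_UP_module push_UP_module mem] by (simp add: UP_carrier)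
 also have "\<dots> = coeff_op (\<lambda>m r. \<ominus> g m r)"
  unfolding coeff_op_def[of "\<lambda>m r. \<ominus> g m r"]
  by (intro restrict_ext) (simp only: neg[OF gc], simp add: coeff_op_def)
 finally show "\<ominus>\<^bsub>diff_ops p e (UP R)\<^esub> coeff_op g = coeff_op (\<lambda>m r. \<ominus> g m r)" .
 show "\<one>\<^bsub>diff_ops p e (UP R)\<^esub> = coeff_op (\<lambda>m r. r)"
  by (simp add: diff_ops_def end_ring_simps coeff_op_def UP_carrier)
qed

lemma coefficientwise_operator:
 assumes D: "D \<in> carrier (diff_ops p e R)"
 shows "admissible e (\<lambda>_. D)" "coefficientwise R D = coeff_op (\<lambda>_. D)"
proof -
 have "linear_map R (frobenius_push p e R (self_module R)) (frobenius_push p e R (self_module R)) D"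
  using D by (simp add: diff_ops_def end_ring_simps hom_module_simps)
 then show "admissible e (\<lambda>_. D)" by (auto simp: linear_map_def admissible_def Pi_iff)
 show "coefficientwise R D = coeff_op (\<lambda>_. D)"
  unfolding coefficientwise_def coeff_op_def UP_carrier by (intro restrict_ext) (simp add: UP_coeff)
qed

section \<open>Weights and the Euler algebra\<close>

definition weight_op :: "(nat \<Rightarrow> nat) \<Rightarrow> (nat \<Rightarrow> 'a) \<Rightarrow> nat \<Rightarrow> 'a" where
 "weight_op w = coeff_op (\<lambda>m r. [(w m)] \<cdot> r)"

definition periodic :: "nat \<Rightarrow> (nat \<Rightarrow> nat) \<Rightarrow> bool" where
 "periodic e w \<longleftrightarrow> (\<forall>m i. w (m + i * p ^ e) mod p = w m mod p)"

lemma admissible_weight: "periodic e w ==> admissible e (\<lambda>m r. [(w m)] \<cdot> r)"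
 unfolding admissible_def periodic_def
proof (intro conjI allI ballI)
 assume w: "\<forall>m i. w (m + i * p ^ e) mod p = w m mod p"
 fix m i c r assume c: "c \<in> carrier R" and r: "r \<in> carrier R"
 have "[(w (m + i * p ^ e))] \<cdot> (c [^] (p ^ e) \<otimes> r) = [(w m)] \<cdot> (c [^] (p ^ e) \<otimes> r)"
  by (rule add_pow_mod) (use w c r in auto)
 then show "[(w (m + i * p ^ e))] \<cdot> (c [^] (p ^ e) \<otimes> r) = c [^] (p ^ e) \<otimes> [(w m)] \<cdot> r"
  using add_pow_rdistr[of "c [^] (p ^ e)" r "w m"] c r by simp
qed (simp_all add: add.nat_pow_distrib)

lemma periodic_choose:
 assumes "j < e"
 shows "periodic e (\<lambda>m. m choose p ^ j)"
proof -
 obtain k where k: "e = j + Suc k" using assms by (metis add_Suc_right less_imp_Suc_add)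
 have "(m + i * p ^ e) div p ^ j mod p = m div p ^ j mod p" for m i
 proof -
  have eq: "m + i * p ^ e = m + (i * p ^ k * p) * p ^ j" by (simp add: k power_add mult_ac)
  have ne: "p ^ j \<noteq> 0" using p_gt_1 by simp
  have "(m + i * p ^ e) div p ^ j = i * p ^ k * p + m div p ^ j" unfolding eq by (rule div_mult_self1[OF ne])
  then show ?thesis by simp
 qed
 then show ?thesis by (simp only: periodic_def choose_prime_power_mod[OF prime_p] simp_thms)
qed

lemma euler_operator:
 "euler_op R a = weight_op (\<lambda>m. m choose a)"
 unfolding euler_op_def weight_op_def coeff_op_def UP_carrier by (intro restrict_ext) (simp add: UP_coeff)

text \<open>The generators have this shape, and admissible families are closed under the ring
  operations. Arbitrary elements of the algebra are handled through this description.\<close>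

lemma euler_algebra_admissible:
 assumes "P \<in> euler_algebra p e R"
 shows "\<exists>g. admissible e g \<and> P = coeff_op g"
 using assms unfolding euler_algebra_def
proof induction
 case one
 have a: "admissible e (\<lambda>m r. r)" by (simp add: admissible_def)
 show ?case using operator_ring_ops(4)[OF a a] a by blast
next
 case (incl h)
 then consider D where "D \<in> carrier (diff_ops p e R)" "h = coefficientwise R D"
  | j where "j < e" "h = euler_op R (p ^ j)" by auto
 then show ?case
 proof cases
  case 1
  then show ?thesis using coefficientwise_operator by blast
 next
  case 2
  then show ?thesis using admissible_weight[OF periodic_choose] unfolding euler_operator weight_op_def by blast
 qed
next
 case (a_inv h)
 then obtain g where g: "admissible e g" "h = coeff_op g" by auto
 show ?case unfolding g(2) operator_ring_ops(3)[OF g(1) g(1)] using admissible_comp(3)[OF g(1) g(1)] by auto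
next
 case (eng_add a b)
 then obtain g h where g: "admissible e g" "a = coeff_op g" "admissible e h" "b = coeff_op h" by auto
 show ?case unfolding g(2,4) operator_ring_ops(2)[OF g(1,3)] using admissible_comp(2)[OF g(1,3)] by auto
next
 case (eng_mult a b)
 then obtain g h where g: "admissible e g" "a = coeff_op g" "admissible e h" "b = coeff_op h" by auto
 show ?case unfolding g(2,4) operator_ring_ops(1)[OF g(1,3)] using admissible_comp(1)[OF g(1,3)] by auto
qed

lemma euler_algebra_mult:
 assumes "P \<in> euler_algebra p e R" "Q \<in> euler_algebra p e R"
 shows "compose (carrier (UP R)) P Q \<in> euler_algebra p e R"
 using generate_ring.eng_mult[OF assms[unfolded euler_algebra_def]]
 by (simp add: euler_algebra_def diff_ops_def end_ring_simps)

lemma coefficientwise_algebra: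
 assumes D: "\<And>r. r \<in> carrier R ==> D r \<in> carrier R"
  "\<And>r s. r \<in> carrier R ==> s \<in> carrier R ==> D (r \<oplus> s) = D r \<oplus> D s"
  "\<And>c r. c \<in> carrier R ==> r \<in> carrier R ==> D (c [^] (p ^ e) \<otimes> r) = c [^] (p ^ e) \<otimes> D r"
 shows "coeff_op (\<lambda>_. D) \<in> euler_algebra p e R" "admissible e (\<lambda>_. D)"
proof -
 have D': "restrict D (carrier R) \<in> carrier (diff_ops p e R)"
  by (auto simp: diff_ops_def end_ring_simps hom_module_simps linear_map_def D)
 have "coefficientwise R (restrict D (carrier R)) \<in> euler_algebra p e R"
  unfolding euler_algebra_def by (intro generate_ring.incl UnI1 imageI D')
 moreover have "coefficientwise R (restrict D (carrier R)) = coeff_op (\<lambda>_. D)"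
  unfolding coefficientwise_operator(2)[OF D'] by (rule coeff_op_eqI) simp
 ultimately show "coeff_op (\<lambda>_. D) \<in> euler_algebra p e R" by simp
 show "admissible e (\<lambda>_. D)" using D by (simp add: admissible_def)
qed

text \<open>Such weights are closed under sums, products and constants. They therefore contain all
  polynomials with natural coefficients in the binomials of the Euler operators, in particular the
  projector.\<close>

definition alg_weight :: "nat \<Rightarrow> (nat \<Rightarrow> nat) \<Rightarrow> bool" where
 "alg_weight e w \<longleftrightarrow> periodic e w \<and> weight_op w \<in> euler_algebra p e R"

lemma alg_weight_add:
 assumes "alg_weight e v" "alg_weight e w"
 shows "alg_weight e (\<lambda>m. v m + w m)"
proof -
 have p: "periodic e v" "periodic e w" using assms by (simp_all add: alg_weight_def)
 have "periodic e (\<lambda>m. v m + w m)" using p unfolding periodic_def by (blast intro: mod_add_cong)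
 moreover have "weight_op (\<lambda>m. v m + w m) = weight_op v \<oplus>\<^bsub>diff_ops p e (UP R)\<^esub> weight_op w"
  unfolding weight_op_def operator_ring_ops(2)[OF admissible_weight[OF p(1)] admissible_weight[OF p(2)]]
  by (rule coeff_op_eqI) (simp add: add.nat_pow_mult)
 ultimately show ?thesis using assms unfolding alg_weight_def euler_algebra_def
  by (auto intro: generate_ring.eng_add)
qed

lemma alg_weight_mult:
 assumes "alg_weight e v" "alg_weight e w"
 shows "alg_weight e (\<lambda>m. v m * w m)"
proof -
 have p: "periodic e v" "periodic e w" using assms by (simp_all add: alg_weight_def)
 have "periodic e (\<lambda>m. v m * w m)" using p unfolding periodic_def by (blast intro: mod_mult_cong)
 moreover have "weight_op (\<lambda>m. v m * w m) = weight_op v \<otimes>\<^bsub>diff_ops p e (UP R)\<^esub> weight_op w"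
  unfolding weight_op_def operator_ring_ops(1)[OF admissible_weight[OF p(1)] admissible_weight[OF p(2)]]
  by (rule coeff_op_eqI) (simp add: add.nat_pow_pow mult.commute)
 ultimately show ?thesis using assms unfolding alg_weight_def euler_algebra_def
  by (auto intro: generate_ring.eng_mult)
qed

lemma alg_weight_const: "alg_weight e (\<lambda>_. k)"
proof (induction k)
 case 0
 have a: "admissible e (\<lambda>m r. r)" by (simp add: admissible_def)
 have one: "coeff_op (\<lambda>m r. r) \<in> euler_algebra p e R"
  unfolding euler_algebra_def operator_ring_ops(4)[OF a a, symmetric] by (rule generate_ring.one)
 have n: "coeff_op (\<lambda>m r. \<ominus> r) \<in> euler_algebra p e R"
  using generate_ring.a_inv[OF one[unfolded euler_algebra_def]] unfolding operator_ring_ops(3)[OF a a] euler_algebra_def .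
 \<comment> \<open>The generated ring starts from 1, so the zero operator is obtained as 1 +
   (-1).\<close>
 have "weight_op (\<lambda>_. 0) = coeff_op (\<lambda>m r. r \<oplus> \<ominus> r)"
  unfolding weight_op_def by (rule coeff_op_eqI) (simp add: r_neg)
 also have "\<dots> \<in> euler_algebra p e R"
  using generate_ring.eng_add[OF one[unfolded euler_algebra_def] n[unfolded euler_algebra_def]]
  unfolding operator_ring_ops(2)[OF a admissible_comp(3)[OF a a]] euler_algebra_def .
 finally show ?case by (simp add: alg_weight_def periodic_def)
next
 case (Suc k)
 have a: "admissible e (\<lambda>m r. r)" by (simp add: admissible_def)
 have "weight_op (\<lambda>_. 1) = coeff_op (\<lambda>m r. r)"
  unfolding weight_op_def by (rule coeff_op_eqI) simp
 then have "alg_weight e (\<lambda>_. 1)"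
  unfolding alg_weight_def euler_algebra_def operator_ring_ops(4)[OF a a, symmetric] periodic_def
  by (simp add: generate_ring.one)
 from alg_weight_add[OF Suc this] show ?case by simp
qed

lemma alg_weight_power: "alg_weight e w ==> alg_weight e (\<lambda>m. w m ^ k)"
proof (induction k)
 case 0
 then show ?case using alg_weight_const[of e 1] by simp
next
 case (Suc k)
 then show ?case using alg_weight_mult[of e w "\<lambda>m. w m ^ k"] by simp
qed

lemma alg_weight_choose: "j < e ==> alg_weight e (\<lambda>m. m choose p ^ j)"
 unfolding alg_weight_def euler_operator[symmetric] euler_algebra_def
 by (auto intro: periodic_choose generate_ring.incl)

lemma alg_weight_projector: "d \<le> e ==> alg_weight e (projector_wt p n d)"
proof (induction d)
 case 0
 then show ?case using alg_weight_const[of e 1] by simp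
next
 case (Suc d)
 then show ?case unfolding projector_wt.simps
  by (intro alg_weight_mult alg_weight_add alg_weight_power alg_weight_const alg_weight_choose) auto
qed

end

section \<open>Eigenspaces of the Euler operators\<close>

locale bernstein = F_regular_cartier +
 fixes e :: nat
 assumes frob: "frob_rank e (\<lambda>r. r)"
begin

abbreviation "G \<equiv> add_monoid (graph_shriek p e R f M)"
abbreviation "Alg \<equiv> euler_algebra p e R"
abbreviation "\<gamma> \<equiv> graph_map R f"
abbreviation "pushM \<equiv> graph_push R f M"
abbreviation act (infixl "\<star>" 70) where "\<psi> \<star> P \<equiv> compose (up R) \<psi> P"

definition phi :: "'c \<Rightarrow> (nat \<Rightarrow> 'a) \<Rightarrow> 'c" where
 "phi m = (\<lambda>s \<in> up R. (\<kappa> ^^ e) (\<gamma> s *[M] m))"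

lemma pre_univ: "UP_pre_univ_prop R R (\<lambda>r. r)"
 by (rule UP_pre_univ_propI) (auto simp: ring_hom_def is_cring)

lemma \<gamma>_hom: "\<gamma> \<in> ring_hom (UP R) R"
 unfolding graph_map_def by (rule UP_pre_univ_prop.eval_ring_hom[OF pre_univ fR])

lemma \<gamma>_monom: "r \<in> carrier R ==> \<gamma> (pmonom r n) = r \<otimes> f [^] n"
 unfolding graph_map_def by (rule UP_pre_univ_prop.eval_monom[OF pre_univ _ fR])

lemma \<gamma>_closed [simp]: "s \<in> up R ==> \<gamma> s \<in> carrier R"
 and \<gamma>_add: "s \<in> up R ==> t \<in> up R ==> \<gamma> (s \<oplus>\<^bsub>UP R\<^esub> t) = \<gamma> s \<oplus> \<gamma> t"
 and \<gamma>_mult: "s \<in> up R ==> t \<in> up R ==> \<gamma> (s \<otimes>\<^bsub>UP R\<^esub> t) = \<gamma> s \<otimes> \<gamma> t"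
 and \<gamma>_one: "\<gamma> \<one>\<^bsub>UP R\<^esub> = \<one>"
 using \<gamma>_hom by (auto simp: ring_hom_def UP_carrier)

lemma pushM_simps: "carrier pushM = carrier M" "\<zero>\<^bsub>pushM\<^esub> = \<zero>\<^bsub>M\<^esub>" "x +[pushM] y = x +[M] y" "s *[pushM] x = \<gamma> s *[M] x"
 "\<ominus>\<^bsub>pushM\<^esub> x = \<ominus>\<^bsub>M\<^esub> x"
 by (simp_all add: graph_push_def restrict_scalars_def a_inv_def m_inv_def)

lemma UP_ring_facts: "cring (UP R)" "s \<in> up R ==> t \<in> up R ==> s \<oplus>\<^bsub>UP R\<^esub> t \<in> up R"
 "s \<in> up R ==> t \<in> up R ==> s \<otimes>\<^bsub>UP R\<^esub> t \<in> up R" "\<zero>\<^bsub>UP R\<^esub> \<in> up R" "s \<in> up R ==> s [^]\<^bsub>UP R\<^esub> (k::nat) \<in> up R"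
proof -
 interpret UC: cring_char "UP R" p by (rule UP_char)
 show "cring (UP R)" by (rule UC.is_cring)
 show "s \<in> up R ==> t \<in> up R ==> s \<oplus>\<^bsub>UP R\<^esub> t \<in> up R" "s \<in> up R ==> t \<in> up R ==> s \<otimes>\<^bsub>UP R\<^esub> t \<in> up R"
  "\<zero>\<^bsub>UP R\<^esub> \<in> up R" "s \<in> up R ==> s [^]\<^bsub>UP R\<^esub> (k::nat) \<in> up R"
  unfolding UP_carrier[symmetric] by simp_all
qed

lemma \<gamma>_pow: "s \<in> up R ==> \<gamma> (s [^]\<^bsub>UP R\<^esub> (k::nat)) = \<gamma> s [^] k"
proof (induction k)
 case 0
 then show ?case by (simp add: nat_pow_def \<gamma>_one)
next
 case (Suc k)
 have "s [^]\<^bsub>UP R\<^esub> Suc k = s [^]\<^bsub>UP R\<^esub> k \<otimes>\<^bsub>UP R\<^esub> s" by (simp add: nat_pow_def)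
 then show ?case using Suc \<gamma>_mult[OF UP_ring_facts(5)[OF Suc.prems, of k] Suc.prems] by simp
qed

lemma pushM_module: "module (UP R) pushM"
proof (intro moduleI abelian_groupI UP_ring_facts(1))
 show "\<exists>y \<in> carrier pushM. y +[pushM] x = \<zero>\<^bsub>pushM\<^esub>" if "x \<in> carrier pushM" for x
  using that by (auto simp: pushM_simps M.l_neg intro!: bexI[of _ "\<ominus>\<^bsub>M\<^esub> x"])
qed (auto simp: pushM_simps UP_carrier M.a_ac \<gamma>_add \<gamma>_mult \<gamma>_one smult_l_distr smult_r_distr smult_assoc1)

lemma shriek_hom: "graph_shriek p e R f M = hom_module (UP R) (push_UP e) pushM"
 by (simp add: graph_shriek_def frobenius_shriek_def)

lemma G_group: "comm_group G"
 unfolding shriek_hom by (rule hom_module_group(1)[OF push_UP_module pushM_module])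

sublocale GG: comm_group G by (rule G_group)


lemma G_simps: "\<one>\<^bsub>G\<^esub> = (\<lambda>x \<in> up R. \<zero>\<^bsub>M\<^esub>)" "g **[G] h = (\<lambda>x \<in> up R. g x +[M] h x)"
 by (simp_all add: shriek_hom hom_module_simps pushM_simps UP_carrier)

lemma G_inv: "h \<in> carrier G ==> inv\<^bsub>G\<^esub> h = (\<lambda>x \<in> up R. \<ominus>\<^bsub>M\<^esub> h x)"
 using hom_module_group(2)[OF push_UP_module pushM_module, of h]
 by (simp add: shriek_hom pushM_simps UP_carrier)

lemma G_mem: "h \<in> carrier G \<longleftrightarrow> h \<in> extensional (up R) \<and> linear_map (UP R) (push_UP e) pushM h"
 by (simp add: shriek_hom hom_module_simps UP_carrier)

lemma G_ext: "h \<in> carrier G ==> h \<in> extensional (up R)"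
 and G_closed: "h \<in> carrier G ==> x \<in> up R ==> h x \<in> carrier M"
 and G_add: "h \<in> carrier G ==> x \<in> up R ==> y \<in> up R ==> h (x \<oplus>\<^bsub>UP R\<^esub> y) = h x +[M] h y"
 unfolding G_mem linear_map_def by (auto simp: pushM_simps UP_carrier)

lemma G_zero: "h \<in> carrier G ==> h \<zero>\<^bsub>UP R\<^esub> = \<zero>\<^bsub>M\<^esub>"
proof -
 assume h: "h \<in> carrier G"
 interpret UC: cring_char "UP R" p by (rule UP_char)
 have "h \<zero>\<^bsub>UP R\<^esub> +[M] h \<zero>\<^bsub>UP R\<^esub> = h \<zero>\<^bsub>UP R\<^esub>"
  using G_add[OF h UP_ring_facts(4) UP_ring_facts(4)] by simp
 then show ?thesis using G_closed[OF h UP_ring_facts(4)] by (metis M.add.r_cancel_one)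
qed

lemma G_eqI:
 assumes g: "g \<in> carrier G" and h: "h \<in> carrier G"
  and eq: "\<And>r n. r \<in> carrier R ==> g (pmonom r n) = h (pmonom r n)"
 shows "g = h"
proof (rule extensionalityI[OF G_ext[OF g] G_ext[OF h]])
 fix x assume "x \<in> up R"
 then show "g x = h x"
 proof (induction rule: poly_induct)
  case zero
  then show ?case by (simp only: G_zero[OF g] G_zero[OF h])
 next
  case (add x y)
  then show ?case by (simp only: G_add[OF g] G_add[OF h])
 qed (rule eq)
qed

lemma phi_mem: "m \<in> carrier M ==> phi m \<in> carrier G"
proof -
 assume m: "m \<in> carrier M"
 interpret UC: cring_char "UP R" p by (rule UP_char)
 show ?thesis
  unfolding G_mem linear_map_def
 proof (intro conjI ballI funcsetI)
  show "phi m \<in> extensional (up R)" by (simp add: phi_def)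
  show "phi m x \<in> carrier pushM" if "x \<in> carrier (push_UP e)" for x
   using that m by (simp add: phi_def pushM_simps UP_carrier)
  show "phi m (x \<oplus>\<^bsub>push_UP e\<^esub> y) = phi m x +[pushM] phi m y" if "x \<in> carrier (push_UP e)" "y \<in> carrier (push_UP e)" for x y
   using that m by (simp add: phi_def pushM_simps UP_carrier \<gamma>_add UP_ring_facts smult_l_distr kpow_add)
  show "phi m (a \<odot>\<^bsub>push_UP e\<^esub> x) = a *[pushM] phi m x" if "a \<in> carrier (UP R)" "x \<in> carrier (push_UP e)" for a x
  proof -
   have ax: "a \<in> up R" "x \<in> up R" using that by (simp_all add: UP_carrier)
   have "(\<kappa> ^^ e) (\<gamma> a [^] (p ^ e) *[M] (\<gamma> x *[M] m)) = \<gamma> a *[M] (\<kappa> ^^ e) (\<gamma> x *[M] m)"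
    using ax m by (intro kpow_smult) auto
   then show ?thesis
    using ax m by (simp add: phi_def pushM_simps UP_carrier UP_ring_facts \<gamma>_mult \<gamma>_pow smult_assoc1)
  qed
 qed
qed

lemma phi_monom: "r \<in> carrier R ==> phi m (pmonom r n) = (\<kappa> ^^ e) ((r \<otimes> f [^] n) *[M] m)"
 using pmonom_closed[of r n] by (simp add: phi_def \<gamma>_monom)

lemma graph_cartier_phi: "graph_cartier e R M \<kappa> f A = phi ` A"
 unfolding graph_cartier_def phi_def UP_carrier by auto

lemma Alg_closed: "P \<in> Alg ==> x \<in> up R ==> P x \<in> up R"
 using euler_algebra_admissible coeff_op_closed by blast


lemma act_mem:
 assumes g: "g \<in> carrier G" and P: "P \<in> Alg"
 shows "g \<star> P \<in> carrier G"
proof -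
 obtain h where h: "admissible e h" "P = coeff_op h" using euler_algebra_admissible[OF P] by auto
 have "P \<in> carrier (hom_module (UP R) (push_UP e) (push_UP e))"
  using coeff_op_mem[OF h(1)] unfolding h(2) diff_ops_carrier .
 moreover have "g \<in> carrier (hom_module (UP R) (push_UP e) pushM)" using g by (simp add: shriek_hom)
 ultimately have "compose (carrier (push_UP e)) g P \<in> carrier (hom_module (UP R) (push_UP e) pushM)"
  using hom_compose[OF _ _ push_UP_module] by blast
 then show ?thesis by (simp add: shriek_hom UP_carrier)
qed

lemma act_assoc: "Q \<in> Alg ==> (g \<star> P) \<star> Q = g \<star> (P \<star> Q)"
 unfolding compose_def by (intro restrict_ext) (simp add: Alg_closed)

lemma act_one: "P \<in> Alg ==> \<one>\<^bsub>G\<^esub> \<star> P = \<one>\<^bsub>G\<^esub>"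
 unfolding compose_def G_simps by (intro restrict_ext) (simp add: Alg_closed)

lemma act_mult: "P \<in> Alg ==> (g **[G] h) \<star> P = (g \<star> P) **[G] (h \<star> P)"
 unfolding compose_def G_simps by (intro restrict_ext) (simp add: Alg_closed)

lemma act_inv: "P \<in> Alg ==> g \<in> carrier G ==> (inv\<^bsub>G\<^esub> g) \<star> P = inv\<^bsub>G\<^esub> (g \<star> P)"
proof -
 assume P: "P \<in> Alg" and g: "g \<in> carrier G"
 show ?thesis unfolding G_inv[OF act_mem[OF g P]] unfolding G_inv[OF g] compose_def
  by (intro restrict_ext) (simp add: Alg_closed[OF P])
qed

section \<open>The submodules generated by the graph maps\<close>

abbreviation "ES A \<equiv> euler_submodule p e R M \<kappa> f A"
abbreviation "fM \<equiv> (\<lambda>m. f *[M] m) ` carrier M"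

lemma ES_generate: "ES A = generate G {phi m \<star> P | m P. m \<in> A \<and> P \<in> Alg}"
 unfolding euler_submodule_def graph_cartier_phi UP_carrier by (rule arg_cong[of _ _ "generate G"]) auto

lemma phi_act_mem: "m \<in> carrier M ==> P \<in> Alg ==> phi m \<star> P \<in> carrier G"
 by (rule act_mem[OF phi_mem])

lemma ES_subgroup: "A \<subseteq> carrier M ==> subgroup (ES A) G"
proof -
 assume A: "A \<subseteq> carrier M"
 have "{phi m \<star> P | m P. m \<in> A \<and> P \<in> Alg} \<subseteq> carrier G" using phi_act_mem A by blast
 then show ?thesis unfolding ES_generate by (rule GG.generate_is_subgroup)
qed

lemma ES_base: "m \<in> A ==> P \<in> Alg ==> phi m \<star> P \<in> ES A"
 unfolding ES_generate by (rule generate.incl) auto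

lemma ES_induct [consumes 2, case_names one base inv mult]:
 assumes "\<psi> \<in> ES A" and A: "A \<subseteq> carrier M"
  and one: "Q \<one>\<^bsub>G\<^esub>" and base: "\<And>m P. m \<in> A ==> P \<in> Alg ==> Q (phi m \<star> P)"
  and inv: "\<And>g. g \<in> carrier G ==> Q g ==> Q (inv\<^bsub>G\<^esub> g)"
  and mult: "\<And>g h. g \<in> carrier G ==> h \<in> carrier G ==> Q g ==> Q h ==> Q (g **[G] h)"
 shows "Q \<psi>"
proof -
 have "\<psi> \<in> carrier G \<and> Q \<psi>"
  using assms(1) unfolding ES_generate
 proof induction
  case one
  show ?case using assms(3) GG.one_closed by blast
 next
  case (incl h)
  then obtain m P where m: "m \<in> A" "P \<in> Alg" "h = phi m \<star> P" by auto
  show ?case unfolding m(3) using phi_act_mem[of m P] base[OF m(1,2)] m(1,2) A by blast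
 next
  case (inv h)
  then obtain m P where m: "m \<in> A" "P \<in> Alg" "h = phi m \<star> P" by auto
  then have "h \<in> carrier G" "Q h" unfolding m(3) using phi_act_mem[of m P] base[OF m(1,2)] A by blast+
  then show ?case using assms(5) GG.inv_closed by blast
 next
  case (eng g h)
  then show ?case using mult GG.m_closed by blast
 qed
 then show ?thesis ..
qed

lemma fM_sub: "fM \<subseteq> carrier M" by auto

lemma ES_act:
 assumes "\<psi> \<in> ES A" and A: "A \<subseteq> carrier M" and P: "P \<in> Alg"
 shows "\<psi> \<star> P \<in> ES A"
 using assms(1,2)
proof (induction rule: ES_induct)
 case one
 then show ?case using act_one[OF P] subgroup.one_closed[OF ES_subgroup[OF A]] by simp
next
 case (base m Q)
 have "Q \<star> P \<in> Alg" using euler_algebra_mult[OF base(2) P] by (simp only: UP_carrier)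
 from ES_base[OF base(1) this] show ?case unfolding act_assoc[OF P] .
next
 case (inv g)
 then show ?case using act_inv[OF P inv(1)] subgroup.m_inv_closed[OF ES_subgroup[OF A]] by simp
next
 case (mult g h)
 then show ?case using act_mult[OF P] subgroup.m_closed[OF ES_subgroup[OF A]] by simp
qed

text \<open>Operators of the algebra preserve the exponent n, and the graph map sends t^n to f^n; a
  generator belonging to f m' thus takes its value at r t^n in \<kappa>^e(f^(n+1) M). This is the
  obstruction by which a coset is later seen to be nonzero.\<close>

lemma ES_monom:
 assumes g: "g \<in> ES fM" and r: "r \<in> carrier R"
 shows "g (pmonom r n) \<in> img e (Suc n)"
proof -
 note IS = submodule_props[OF img_submodule[of e "Suc n"]]
 note x = pmonom_closed[OF r, of n]
 show ?thesis
  using g fM_sub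
 proof (induction rule: ES_induct)
  case one
  then show ?case unfolding G_simps using IS(2) x by simp
 next
  case (base m P)
  obtain h where h: "admissible e h" "P = coeff_op h" using euler_algebra_admissible[OF base(2)] by auto
  obtain m' where m: "m' \<in> carrier M" "m = f *[M] m'" using base(1) by auto
  note hr = admissibleD(1)[OF h(1) r, of n]
  have "(phi m \<star> P) (pmonom r n) = phi m (pmonom (h n r) n)"
   using x by (simp add: compose_def h(2) coeff_op_monom[OF h(1) r])
  also have "\<dots> = (\<kappa> ^^ e) (f [^] Suc n *[M] (h n r *[M] m'))"
   unfolding phi_monom[OF hr] m(2) using hr m(1) by (simp add: m_ac flip: smult_assoc1)
  also have "\<dots> \<in> img e (Suc n)" unfolding img_def using hr m(1) by (intro imageI) auto
  finally show ?case .
 next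
  case (inv g)
  then show ?case using IS(5) x by (simp add: G_inv)
 next
  case (mult g h)
  then show ?case unfolding G_simps using IS(3) x by simp
 qed
qed

section \<open>The projector to one residue class of exponents\<close>

abbreviation "proj n \<equiv> weight_op (projector_wt p n e)"

lemma weight_Alg: "alg_weight e w ==> weight_op w \<in> Alg"
 and weight_admissible: "alg_weight e w ==> admissible e (\<lambda>m r. [(w m)] \<cdot> r)"
 by (simp_all add: alg_weight_def admissible_weight)

lemma proj_weight: "alg_weight e (projector_wt p n e)"
 by (rule alg_weight_projector) simp

lemma proj_scalar:
 assumes n: "n < p ^ e" and y: "y \<in> carrier R"
 shows "[(projector_wt p n e k)] \<cdot> y = (if k mod p ^ e = n then y else \<zero>)"
proof -
 have "projector_wt p n e k mod p = (if k mod p ^ e = n then 1 else 0) mod p"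
  using projector_wt_mod[OF prime_p, of n e k] n p_gt_1 by simp
 from add_pow_mod[OF y this] show ?thesis using y by simp
qed

text \<open>A projected map only sees exponents k congruent to n modulo p^e, and for these f^k is
  f^n times a p^e-th power. This is why the eigenspace of n is governed by f^n alone.\<close>

lemma phi_proj_value:
 assumes n: "n < p ^ e" and g: "admissible e g" and r: "r \<in> carrier R"
 shows "((phi m \<star> proj n) \<star> coeff_op g) (pmonom r k) =
  (\<kappa> ^^ e) (((if k mod p ^ e = n then g k r else \<zero>) \<otimes> f [^] k) *[M] m)"
proof -
 note gr = admissibleD(1)[OF g r, of k]
 note w = weight_admissible[OF proj_weight, of n]
 have "((phi m \<star> proj n) \<star> coeff_op g) (pmonom r k) = phi m (proj n (pmonom (g k r) k))"
  using pmonom_closed[OF r, of k] pmonom_closed[OF gr, of k] by (simp add: compose_def coeff_op_monom[OF g r])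
 also have "proj n (pmonom (g k r) k) = pmonom (if k mod p ^ e = n then g k r else \<zero>) k"
  unfolding weight_op_def coeff_op_monom[OF w gr] proj_scalar[OF n gr] ..
 finally show ?thesis using phi_monom gr by simp
qed

text \<open>If \<open>\<kappa>\<^sup>e(f\<^sup>n M) = \<kappa>\<^sup>e(f\<^bsup>n+1\<^esup> M)\<close>, then a summand \<open>\<xi>(r)\<^bsup>p\<^sup>e\<^esup> x\<close> of the identity of \<open>F\<^sup>e\<^sub>*R\<close> can be used to replace
 \<open>f\<^sup>n x m\<close> by \<open>f\<^bsup>n+1\<^esup> b\<close> under \<open>\<kappa>\<^sup>e\<close>.\<close>

lemma phi_proj_frob_rank:
 assumes n: "n < p ^ e" and eq: "img e n = img e (Suc n)" and g: "frob_rank e g" and m: "m \<in> carrier M"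
 shows "admissible e (\<lambda>_. g) \<and> coeff_op (\<lambda>_. g) \<in> Alg \<and> (phi m \<star> proj n) \<star> coeff_op (\<lambda>_. g) \<in> ES fM"
 using g
proof induction
 case (zero g)
 have A: "coeff_op (\<lambda>_. g) \<in> Alg" "admissible e (\<lambda>_. g)"
  by (rule coefficientwise_algebra; simp add: zero)+
 have mem: "(phi m \<star> proj n) \<star> coeff_op (\<lambda>_. g) \<in> carrier G"
  by (intro act_mem phi_mem m A weight_Alg proj_weight)
 have "(phi m \<star> proj n) \<star> coeff_op (\<lambda>_. g) = \<one>\<^bsub>G\<^esub>"
 proof (rule G_eqI[OF mem GG.one_closed])
  fix r k assume r: "r \<in> carrier R"
  show "((phi m \<star> proj n) \<star> coeff_op (\<lambda>_. g)) (pmonom r k) = \<one>\<^bsub>G\<^esub> (pmonom r k)"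
   unfolding phi_proj_value[OF n A(2) r] G_simps(1) using zero r m pmonom_closed[OF r, of k] by simp
 qed
 then show ?case using A subgroup.one_closed[OF ES_subgroup[OF fM_sub]] by simp
next
 case (step \<xi> x g g')
 note \<xi> = step.hyps(1)[unfolded frob_linear_def] and x = step.hyps(2) and g' = step.hyps(4)
 have \<xi>c: "\<xi> r \<in> carrier R" if "r \<in> carrier R" for r by (rule frob_linear_closed[OF step.hyps(1) that])
 have \<xi>a: "\<xi> (r \<oplus> s) = \<xi> r \<oplus> \<xi> s" if "r \<in> carrier R" "s \<in> carrier R" for r s using \<xi> that by simp
 have \<xi>l: "\<xi> (a [^] (p ^ e) \<otimes> r) = a \<otimes> \<xi> r" if "a \<in> carrier R" "r \<in> carrier R" for a r using \<xi> that by simp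
 from step.IH have ga: "admissible e (\<lambda>_. g)" and gA: "(phi m \<star> proj n) \<star> coeff_op (\<lambda>_. g) \<in> ES fM" by auto
 note gc = admissibleD(1)[OF ga] and gadd = admissibleD(2)[OF ga] and gl = admissibleD(3)[OF ga]
 define q where "q r = \<xi> r [^] (p ^ e)" for r
 have qc: "q r \<in> carrier R" if "r \<in> carrier R" for r using \<xi>c[OF that] by (simp add: q_def)
 have qadd: "q (r \<oplus> s) = q r \<oplus> q s" if "r \<in> carrier R" "s \<in> carrier R" for r s
  using that \<xi>c by (simp add: q_def \<xi>a frobenius_add)
 have ql: "q (c [^] (p ^ e) \<otimes> r) = c [^] (p ^ e) \<otimes> q r" if "c \<in> carrier R" "r \<in> carrier R" for c r
  using that \<xi>c by (simp add: q_def \<xi>l nat_pow_distrib)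
 have qA: "coeff_op (\<lambda>_. q) \<in> Alg" "admissible e (\<lambda>_. q)"
  by (rule coefficientwise_algebra[OF qc qadd ql]; assumption)+
 have g'c: "g' r \<in> carrier R" if r: "r \<in> carrier R" for r using g'[OF r] \<xi>c[OF r] x gc[OF r] by simp
 have g'add: "g' (r \<oplus> s) = g' r \<oplus> g' s" if rs: "r \<in> carrier R" "s \<in> carrier R" for r s
 proof -
  have "g' (r \<oplus> s) = (q r \<oplus> q s) \<otimes> x \<oplus> (g r \<oplus> g s)" using g'[of "r \<oplus> s"] qadd[OF rs] gadd[OF rs] rs by (simp add: q_def)
  also have "\<dots> = (q r \<otimes> x \<oplus> g r) \<oplus> (q s \<otimes> x \<oplus> g s)" using qc rs x gc by (simp add: l_distr R.a_ac)
  finally show ?thesis using g' rs by (simp add: q_def)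
 qed
 have g'l: "g' (c [^] (p ^ e) \<otimes> r) = c [^] (p ^ e) \<otimes> g' r" if cr: "c \<in> carrier R" "r \<in> carrier R" for c r
 proof -
  have "g' (c [^] (p ^ e) \<otimes> r) = (c [^] (p ^ e) \<otimes> q r) \<otimes> x \<oplus> c [^] (p ^ e) \<otimes> g r"
   using g'[of "c [^] (p ^ e) \<otimes> r"] ql[OF cr] gl[OF cr] cr by (simp add: q_def)
  also have "\<dots> = c [^] (p ^ e) \<otimes> (q r \<otimes> x \<oplus> g r)" using qc cr x gc by (simp add: r_distr m_assoc)
  finally show ?thesis using g' cr by (simp add: q_def)
 qed
 have A: "coeff_op (\<lambda>_. g') \<in> Alg" "admissible e (\<lambda>_. g')"
  by (rule coefficientwise_algebra[OF g'c g'add g'l]; assumption)+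
 \<comment> \<open>The equality of images is used here, for the element x m, which does not involve
   the argument r; so b can be chosen once for the whole map.\<close>
 have "(\<kappa> ^^ e) (f [^] n *[M] (x *[M] m)) \<in> img e (Suc n)"
  unfolding eq[symmetric] unfolding img_def using x m by (intro imageI) auto
 then obtain b where b: "b \<in> carrier M" "(\<kappa> ^^ e) (f [^] n *[M] (x *[M] m)) = (\<kappa> ^^ e) (f [^] Suc n *[M] b)"
  unfolding img_def by auto
 have fb: "f *[M] b \<in> fM" "f *[M] b \<in> carrier M" using b by auto
 let ?L = "(phi m \<star> proj n) \<star> coeff_op (\<lambda>_. g')"
 let ?S = "(phi (f *[M] b) \<star> proj n) \<star> coeff_op (\<lambda>_. q)"
 let ?T = "(phi m \<star> proj n) \<star> coeff_op (\<lambda>_. g)"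
 have S: "?S \<in> ES fM" by (intro ES_act ES_base fb fM_sub qA weight_Alg proj_weight)
 have ST: "?S **[G] ?T \<in> ES fM" by (rule subgroup.m_closed[OF ES_subgroup[OF fM_sub] S gA])
 have "?L = ?S **[G] ?T"
 proof (rule G_eqI)
  show "?L \<in> carrier G" by (intro act_mem phi_mem m A weight_Alg proj_weight)
  show "?S **[G] ?T \<in> carrier G" using ST subgroup.subset[OF ES_subgroup[OF fM_sub]] by blast
  fix r k assume r: "r \<in> carrier R"
  have v: "(?S **[G] ?T) (pmonom r k) = ?S (pmonom r k) +[M] ?T (pmonom r k)"
   unfolding G_simps using pmonom_closed[OF r, of k] by simp
  show "?L (pmonom r k) = (?S **[G] ?T) (pmonom r k)"
  proof (cases "k mod p ^ e = n")
   case False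
   then show ?thesis unfolding v phi_proj_value[OF n A(2) r] phi_proj_value[OF n qA(2) r] phi_proj_value[OF n ga r]
    using m fb(2) by simp
  next
   case True
   define i where "i = k div p ^ e"
   have k: "f [^] k = (f [^] i) [^] (p ^ e) \<otimes> f [^] n"
    using True div_mult_mod_eq[of k "p ^ e"] by (simp add: i_def nat_pow_pow nat_pow_mult)
   \<comment> \<open>The p^e-th root of \<xi>(r)^(p^e) (f^i)^(p^e). It leaves \<kappa>^e as a factor
     in both expressions, which then differ only by the replacement of f^n x m by f^(n+1) b.\<close>
   define u where "u = \<xi> r \<otimes> f [^] i"
   have u: "u \<in> carrier R" using \<xi>c[OF r] by (simp add: u_def)
   have qk: "q r \<otimes> f [^] k = u [^] (p ^ e) \<otimes> f [^] n"
    using \<xi>c[OF r] by (simp add: k q_def u_def nat_pow_distrib m_assoc)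
   have 1: "(\<kappa> ^^ e) (((q r \<otimes> x) \<otimes> f [^] k) *[M] m) = u *[M] (\<kappa> ^^ e) (f [^] n *[M] (x *[M] m))"
   proof -
    have "(q r \<otimes> x) \<otimes> f [^] k = (q r \<otimes> f [^] k) \<otimes> x" using qc[OF r] x by (simp add: m_ac)
    then have "((q r \<otimes> x) \<otimes> f [^] k) *[M] m = u [^] (p ^ e) *[M] (f [^] n *[M] (x *[M] m))"
     unfolding qk using u x m by (simp add: smult_assoc1)
    then show ?thesis using kpow_smult[OF u, of "f [^] n *[M] (x *[M] m)" e] x m by simp
   qed
   have 2: "(\<kappa> ^^ e) ((q r \<otimes> f [^] k) *[M] (f *[M] b)) = u *[M] (\<kappa> ^^ e) (f [^] Suc n *[M] b)"
   proof -
    have "(q r \<otimes> f [^] k) *[M] (f *[M] b) = u [^] (p ^ e) *[M] (f [^] Suc n *[M] b)"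
     unfolding qk using u b by (simp add: smult_assoc1)
    then show ?thesis using kpow_smult[OF u, of "f [^] Suc n *[M] b" e] b by simp
   qed
   have "?L (pmonom r k) = (\<kappa> ^^ e) ((((q r \<otimes> x) \<oplus> g r) \<otimes> f [^] k) *[M] m)"
    unfolding phi_proj_value[OF n A(2) r] using True g'[OF r] by (simp add: q_def)
   also have "\<dots> = (\<kappa> ^^ e) (((q r \<otimes> x) \<otimes> f [^] k) *[M] m) +[M] (\<kappa> ^^ e) ((g r \<otimes> f [^] k) *[M] m)"
    using qc[OF r] x gc[OF r] m by (simp add: l_distr smult_l_distr kpow_add)
   also have "\<dots> = ?S (pmonom r k) +[M] ?T (pmonom r k)"
    unfolding 1 b(2) 2[symmetric] phi_proj_value[OF n qA(2) r] phi_proj_value[OF n ga r] using True by simp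
   finally show ?thesis unfolding v .
  qed
 qed
 then show ?case using ST A by simp
qed

lemma identity_act: "g \<in> carrier G ==> g \<star> coeff_op (\<lambda>_ r. r) = g"
 by (rule extensionalityI[of _ "up R"]) (auto simp: compose_def coeff_op_def G_ext)

lemma operator_multiple:
 assumes g: "admissible e g" and r: "r \<in> carrier R"
 shows "g m ([(k::nat)] \<cdot> r) = [k] \<cdot> g m r"
 using admissibleD[OF g] r by (induction k) auto

text \<open>Taking natural multiples commutes with every additive map on coefficients.\<close>

lemma weight_commute:
 assumes w: "alg_weight e w" and P: "P \<in> Alg"
 shows "P \<star> weight_op w = weight_op w \<star> P"
proof -
 obtain g where g: "admissible e g" "P = coeff_op g" using euler_algebra_admissible[OF P] by auto
 have "coeff_op g \<otimes>\<^bsub>diff_ops p e (UP R)\<^esub> weight_op w = weight_op w \<otimes>\<^bsub>diff_ops p e (UP R)\<^esub> coeff_op g"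
  unfolding weight_op_def operator_ring_ops(1)[OF g(1) weight_admissible[OF w]] operator_ring_ops(1)[OF weight_admissible[OF w] g(1)]
  by (rule coeff_op_eqI) (rule operator_multiple[OF g(1)])
 then show ?thesis unfolding g(2) by (simp add: diff_ops_def end_ring_simps UP_carrier)
qed

text \<open>Projectors commute with the algebra, so an operator applied to phi m can be moved behind
  the projector. For phi m itself, \<open>phi_proj_frob_rank\<close> applies to the identity of
  F^e_*R, which has finite rank by \<open>frob\<close>.\<close>

lemma ES_proj:
 assumes n: "n < p ^ e" and eq: "img e n = img e (Suc n)" and \<psi>: "\<psi> \<in> ES (carrier M)"
 shows "\<psi> \<star> proj n \<in> ES fM"
proof -
 note pushM = weight_Alg[OF proj_weight, of n] and SG = ES_subgroup[OF fM_sub]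
 show ?thesis
  using \<psi> subset_refl
 proof (induction rule: ES_induct)
  case one
  then show ?case using act_one[OF pushM] subgroup.one_closed[OF SG] by simp
 next
  case (base m P)
  have "(phi m \<star> proj n) \<star> coeff_op (\<lambda>_ r. r) \<in> ES fM"
   using phi_proj_frob_rank[OF n eq frob base(1)] by simp
  then have "phi m \<star> proj n \<in> ES fM" using identity_act[OF act_mem[OF phi_mem[OF base(1)] pushM]] by simp
  from ES_act[OF this fM_sub base(2)] show ?case
   unfolding act_assoc[OF pushM] act_assoc[OF base(2)] weight_commute[OF proj_weight base(2)] .
 next
  case (inv g)
  then show ?case using act_inv[OF pushM inv(1)] subgroup.m_inv_closed[OF SG] by simp
 next
  case (mult g h)
  then show ?case using act_mult[OF pushM] subgroup.m_closed[OF SG] by simp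
 qed
qed

section \<open>The quotient\<close>

abbreviation "BQ \<equiv> bernstein_quotient p e R M \<kappa> f"
abbreviation coset ("\<lbrakk>_\<rbrakk>") where "\<lbrakk>\<psi>\<rbrakk> \<equiv> ES fM #>\<^bsub>G\<^esub> \<psi>"

lemma N_subgroup: "subgroup (ES fM) G"
 by (rule ES_subgroup[OF fM_sub])

lemma ES_carrier_mem: "\<psi> \<in> ES (carrier M) ==> \<psi> \<in> carrier G"
 by (rule subsetD[OF subgroup.subset[OF ES_subgroup[OF subset_refl]]])

lemma BQ_simps: "carrier BQ = {\<lbrakk>\<psi>\<rbrakk> | \<psi>. \<psi> \<in> ES (carrier M)}" "\<one>\<^bsub>BQ\<^esub> = ES fM" "X \<otimes>\<^bsub>BQ\<^esub> Y = X <#>\<^bsub>G\<^esub> Y"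
proof -
 have U: "(\<Union>a \<in> A. {h a}) = {h a | a. a \<in> A}" for A and h :: "((nat \<Rightarrow> 'a) \<Rightarrow> 'c) \<Rightarrow> ((nat \<Rightarrow> 'a) \<Rightarrow> 'c) set" by auto
 have "carrier BQ = (\<Union>a \<in> ES (carrier M). {\<lbrakk>a\<rbrakk>})"
  unfolding bernstein_quotient_def FactGroup_def RCOSETS_def r_coset_def by simp
 then show "carrier BQ = {\<lbrakk>\<psi>\<rbrakk> | \<psi>. \<psi> \<in> ES (carrier M)}" unfolding U .
 show "\<one>\<^bsub>BQ\<^esub> = ES fM" unfolding bernstein_quotient_def FactGroup_def by simp
 show "X \<otimes>\<^bsub>BQ\<^esub> Y = X <#>\<^bsub>G\<^esub> Y" unfolding bernstein_quotient_def FactGroup_def set_mult_def by simp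
qed

lemma coset_mult: "a \<in> carrier G ==> b \<in> carrier G ==> \<lbrakk>a\<rbrakk> <#>\<^bsub>G\<^esub> \<lbrakk>b\<rbrakk> = \<lbrakk>a **[G] b\<rbrakk>"
 by (rule normal.rcos_sum[OF iffD2[OF GG.normal_iff_subgroup N_subgroup]])

lemma coset_act:
 assumes a: "a \<in> carrier G" and b: "b \<in> carrier G" and P: "P \<in> Alg" and eq: "\<lbrakk>a\<rbrakk> = \<lbrakk>b\<rbrakk>"
 shows "\<lbrakk>a \<star> P\<rbrakk> = \<lbrakk>b \<star> P\<rbrakk>"
proof -
 have "a \<in> \<lbrakk>b\<rbrakk>" using GG.rcos_self[OF a N_subgroup] unfolding eq .
 then obtain h where h: "h \<in> ES fM" "a = h **[G] b" unfolding r_coset_def by auto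
 have "a \<star> P = (h \<star> P) **[G] (b \<star> P)" unfolding h(2) by (rule act_mult[OF P])
 moreover have "(h \<star> P) **[G] (b \<star> P) \<in> \<lbrakk>b \<star> P\<rbrakk>"
  by (rule GG.rcosI[OF ES_act[OF h(1) fM_sub P] subgroup.subset[OF N_subgroup] act_mem[OF b P]])
 ultimately have "a \<star> P \<in> \<lbrakk>b \<star> P\<rbrakk>" by (simp only:)
 from GG.repr_independence[OF this act_mem[OF b P] N_subgroup] show ?thesis by (rule sym)
qed

lemma action_coset:
 assumes a: "a \<in> carrier G" and P: "P \<in> Alg"
 shows "bernstein_action p e R M \<kappa> f P \<lbrakk>a\<rbrakk> = \<lbrakk>a \<star> P\<rbrakk>"
proof -
 have "\<lbrakk>x \<star> P\<rbrakk> = \<lbrakk>a \<star> P\<rbrakk>" if x: "x \<in> \<lbrakk>a\<rbrakk>" for x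
 proof -
  have "\<lbrakk>a\<rbrakk> = \<lbrakk>x\<rbrakk>" by (rule GG.repr_independence[OF x a N_subgroup])
  moreover have "x \<in> carrier G"
   using x GG.r_coset_subset_G[OF subgroup.subset[OF N_subgroup] a] by (rule subsetD[rotated])
  ultimately show ?thesis using coset_act[OF _ a P] by (simp only:)
 qed
 then have "(\<Union>x \<in> \<lbrakk>a\<rbrakk>. \<lbrakk>x \<star> P\<rbrakk>) = (\<Union>x \<in> \<lbrakk>a\<rbrakk>. \<lbrakk>a \<star> P\<rbrakk>)" by (rule SUP_cong[OF refl])
 also have "\<dots> = \<lbrakk>a \<star> P\<rbrakk>" using GG.rcos_self[OF a N_subgroup] by blast
 finally show ?thesis unfolding bernstein_action_def induced_on_cosets_def UP_carrier .
qed

lemma weight_act_monom: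
 assumes w: "alg_weight e w" and r: "r \<in> carrier R"
 shows "(\<psi> \<star> weight_op w) (pmonom r n) = \<psi> (pmonom ([(w n)] \<cdot> r) n)"
 using pmonom_closed[OF r, of n] coeff_op_monom[OF weight_admissible[OF w] r, of n]
 by (simp add: compose_def weight_op_def)

lemma weight_act_add:
 assumes \<psi>: "\<psi> \<in> carrier G" and v: "alg_weight e v" and w: "alg_weight e w"
 shows "\<psi> \<star> weight_op (\<lambda>m. v m + w m) = (\<psi> \<star> weight_op v) **[G] (\<psi> \<star> weight_op w)"
proof (rule G_eqI)
 note vw = alg_weight_add[OF v w]
 show "\<psi> \<star> weight_op (\<lambda>m. v m + w m) \<in> carrier G" by (rule act_mem[OF \<psi> weight_Alg[OF vw]])
 show "(\<psi> \<star> weight_op v) **[G] (\<psi> \<star> weight_op w) \<in> carrier G"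
  by (intro GG.m_closed act_mem \<psi> weight_Alg v w)
 fix r n assume r: "r \<in> carrier R"
 interpret U: UP_cring R "UP R" by (rule UP_cring)
 have c: "[(v n)] \<cdot> r \<in> carrier R" "[(w n)] \<cdot> r \<in> carrier R" using r by simp_all
 have "pmonom ([(v n + w n)] \<cdot> r) n = pmonom ([(v n)] \<cdot> r) n \<oplus>\<^bsub>UP R\<^esub> pmonom ([(w n)] \<cdot> r) n"
  using U.monom_add[OF c] R.add.nat_pow_mult[OF r, of "v n" "w n"] by simp
 then have "\<psi> (pmonom ([(v n + w n)] \<cdot> r) n) = \<psi> (pmonom ([(v n)] \<cdot> r) n) +[M] \<psi> (pmonom ([(w n)] \<cdot> r) n)"
  using G_add[OF \<psi> pmonom_closed[OF c(1)] pmonom_closed[OF c(2)]] by simp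
 moreover have "((\<psi> \<star> weight_op v) **[G] (\<psi> \<star> weight_op w)) (pmonom r n) =
   (\<psi> \<star> weight_op v) (pmonom r n) +[M] (\<psi> \<star> weight_op w) (pmonom r n)"
  unfolding G_simps using pmonom_closed[OF r, of n] by simp
 ultimately show "(\<psi> \<star> weight_op (\<lambda>m. v m + w m)) (pmonom r n) =
   ((\<psi> \<star> weight_op v) **[G] (\<psi> \<star> weight_op w)) (pmonom r n)"
  by (simp only: weight_act_monom[OF vw r] weight_act_monom[OF v r] weight_act_monom[OF w r])
qed

lemma weight_act_mult:
 assumes \<psi>: "\<psi> \<in> carrier G" and v: "alg_weight e v" and w: "alg_weight e w"
 shows "\<psi> \<star> weight_op (\<lambda>m. v m * w m) = (\<psi> \<star> weight_op v) \<star> weight_op w"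
proof (rule G_eqI)
 note vw = alg_weight_mult[OF v w]
 show "\<psi> \<star> weight_op (\<lambda>m. v m * w m) \<in> carrier G" by (rule act_mem[OF \<psi> weight_Alg[OF vw]])
 show "(\<psi> \<star> weight_op v) \<star> weight_op w \<in> carrier G"
  by (intro act_mem \<psi> weight_Alg v w)
 fix r n assume r: "r \<in> carrier R"
 have c: "[(w n)] \<cdot> r \<in> carrier R" using r by simp
 have "[(v n * w n)] \<cdot> r = [(v n)] \<cdot> ([(w n)] \<cdot> r)" using R.add.nat_pow_pow[OF r, of "v n" "w n"] by (simp add: mult.commute)
 then show "(\<psi> \<star> weight_op (\<lambda>m. v m * w m)) (pmonom r n) = ((\<psi> \<star> weight_op v) \<star> weight_op w) (pmonom r n)"
  by (simp only: weight_act_monom[OF vw r] weight_act_monom[OF w r] weight_act_monom[OF v c])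
qed

lemma weight_cong: "(\<And>m. v m mod p = w m mod p) ==> weight_op v = weight_op w"
 unfolding weight_op_def by (rule coeff_op_eqI) (rule add_pow_mod)

lemma weight_act_one:
 assumes \<psi>: "\<psi> \<in> carrier G"
 shows "\<psi> \<star> weight_op (\<lambda>_. 1) = \<psi>"
proof (rule G_eqI[OF act_mem[OF \<psi> weight_Alg[OF alg_weight_const]] \<psi>])
 fix r n assume r: "r \<in> carrier R"
 have "[(1::nat)] \<cdot> r = r" by (rule R.add.nat_pow_eone[OF r])
 then show "(\<psi> \<star> weight_op (\<lambda>_. 1)) (pmonom r n) = \<psi> (pmonom r n)"
  by (simp only: weight_act_monom[OF alg_weight_const r])
qed

lemma weight_act_zero:
 assumes \<psi>: "\<psi> \<in> carrier G"
 shows "\<psi> \<star> weight_op (\<lambda>_. 0) = \<one>\<^bsub>G\<^esub>"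
proof (rule G_eqI[OF act_mem[OF \<psi> weight_Alg[OF alg_weight_const]] GG.one_closed])
 interpret U: UP_cring R "UP R" by (rule UP_cring)
 fix r n assume r: "r \<in> carrier R"
 show "(\<psi> \<star> weight_op (\<lambda>_. 0)) (pmonom r n) = \<one>\<^bsub>G\<^esub> (pmonom r n)"
  unfolding weight_act_monom[OF alg_weight_const r] G_simps(1)
  using G_zero[OF \<psi>] pmonom_closed[OF r, of n] by simp
qed

text \<open>Powers in the multiplicatively written quotient are multiples, that is, actions of
  constant weights. Eigenvalue equations thus become equalities between the actions of two
  weights.\<close>

lemma coset_pow:
 assumes \<psi>: "\<psi> \<in> carrier G"
 shows "\<lbrakk>\<psi>\<rbrakk> [^]\<^bsub>BQ\<^esub> (k::nat) = \<lbrakk>\<psi> \<star> weight_op (\<lambda>_. k)\<rbrakk>"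
proof (induction k)
 case 0
 have "\<lbrakk>\<one>\<^bsub>G\<^esub>\<rbrakk> = ES fM"
  by (rule GG.coset_join2[OF GG.one_closed N_subgroup subgroup.one_closed[OF N_subgroup]])
 then show ?case using BQ_simps(2) by (simp only: weight_act_zero[OF \<psi>]) (simp add: nat_pow_def)
next
 case (Suc k)
 have "\<lbrakk>\<psi>\<rbrakk> [^]\<^bsub>BQ\<^esub> Suc k = \<lbrakk>\<psi> \<star> weight_op (\<lambda>_. k)\<rbrakk> <#>\<^bsub>G\<^esub> \<lbrakk>\<psi>\<rbrakk>"
  unfolding Suc.IH[symmetric] BQ_simps(3)[symmetric] by (simp add: nat_pow_def)
 also have "\<dots> = \<lbrakk>(\<psi> \<star> weight_op (\<lambda>_. k)) **[G] (\<psi> \<star> weight_op (\<lambda>_. 1))\<rbrakk>"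
  unfolding weight_act_one[OF \<psi>] by (rule coset_mult[OF act_mem[OF \<psi> weight_Alg[OF alg_weight_const]] \<psi>])
 also have "\<dots> = \<lbrakk>\<psi> \<star> weight_op (\<lambda>_. k + 1)\<rbrakk>"
  by (simp only: weight_act_add[OF \<psi> alg_weight_const alg_weight_const])
 finally show ?case by simp
qed

text \<open>The weights w that act on this coset like the constant w n are closed under sums,
  products and powers. The assumption puts the binomials among them, hence also the
  projector.\<close>

lemma eigenvector_weight:
 assumes \<psi>: "\<psi> \<in> carrier G"
  and eig: "\<And>j. j < e ==> \<lbrakk>\<psi> \<star> weight_op (\<lambda>m. m choose p ^ j)\<rbrakk> = \<lbrakk>\<psi> \<star> weight_op (\<lambda>_. n choose p ^ j)\<rbrakk>"
 shows "\<lbrakk>\<psi> \<star> proj k\<rbrakk> = \<lbrakk>\<psi> \<star> weight_op (\<lambda>_. projector_wt p k e n)\<rbrakk>"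
proof -
 define E where "E w \<longleftrightarrow> alg_weight e w \<and> \<lbrakk>\<psi> \<star> weight_op w\<rbrakk> = \<lbrakk>\<psi> \<star> weight_op (\<lambda>_. w n)\<rbrakk>" for w
 note C = alg_weight_const and A = act_mem[OF \<psi> weight_Alg]
 have const: "E (\<lambda>_. c)" for c by (simp add: E_def C)
 have add: "E (\<lambda>m. v m + w m)" if "E v" "E w" for v w
 proof -
  have v: "alg_weight e v" "\<lbrakk>\<psi> \<star> weight_op v\<rbrakk> = \<lbrakk>\<psi> \<star> weight_op (\<lambda>_. v n)\<rbrakk>"
   and w: "alg_weight e w" "\<lbrakk>\<psi> \<star> weight_op w\<rbrakk> = \<lbrakk>\<psi> \<star> weight_op (\<lambda>_. w n)\<rbrakk>" using that by (simp_all only: E_def simp_thms)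
  have "\<lbrakk>\<psi> \<star> weight_op (\<lambda>m. v m + w m)\<rbrakk> = \<lbrakk>\<psi> \<star> weight_op (\<lambda>_. v n + w n)\<rbrakk>"
   unfolding weight_act_add[OF \<psi> v(1) w(1)] weight_act_add[OF \<psi> C C]
    coset_mult[OF A[OF v(1)] A[OF w(1)], symmetric] coset_mult[OF A[OF C] A[OF C], symmetric] v(2) w(2) ..
  then show ?thesis using alg_weight_add[OF v(1) w(1)] by (simp only: E_def simp_thms)
 qed
 have mult: "E (\<lambda>m. v m * w m)" if "E v" "E w" for v w
 proof -
  have v: "alg_weight e v" "\<lbrakk>\<psi> \<star> weight_op v\<rbrakk> = \<lbrakk>\<psi> \<star> weight_op (\<lambda>_. v n)\<rbrakk>"
   and w: "alg_weight e w" "\<lbrakk>\<psi> \<star> weight_op w\<rbrakk> = \<lbrakk>\<psi> \<star> weight_op (\<lambda>_. w n)\<rbrakk>" using that by (simp_all only: E_def simp_thms)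
  have "\<lbrakk>\<psi> \<star> weight_op (\<lambda>m. v m * w m)\<rbrakk> = \<lbrakk>(\<psi> \<star> weight_op (\<lambda>_. v n)) \<star> weight_op w\<rbrakk>"
   unfolding weight_act_mult[OF \<psi> v(1) w(1)] by (rule coset_act[OF A[OF v(1)] A[OF C] weight_Alg[OF w(1)] v(2)])
  \<comment> \<open>The relation for w is known for \<psi> itself, not for its multiple by v n; so
    the constant is first moved behind \<open>weight_op w\<close>.\<close>
  also have "(\<psi> \<star> weight_op (\<lambda>_. v n)) \<star> weight_op w = (\<psi> \<star> weight_op w) \<star> weight_op (\<lambda>_. v n)"
   unfolding weight_act_mult[OF \<psi> C w(1), symmetric] weight_act_mult[OF \<psi> w(1) C, symmetric] by (simp only: mult.commute)
  also have "\<lbrakk>\<dots>\<rbrakk> = \<lbrakk>(\<psi> \<star> weight_op (\<lambda>_. w n)) \<star> weight_op (\<lambda>_. v n)\<rbrakk>"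
   by (rule coset_act[OF A[OF w(1)] A[OF C] weight_Alg[OF C] w(2)])
  also have "\<dots> = \<lbrakk>\<psi> \<star> weight_op (\<lambda>_. v n * w n)\<rbrakk>"
   unfolding weight_act_mult[OF \<psi> C C, symmetric] by (simp only: mult.commute)
  finally show ?thesis using alg_weight_mult[OF v(1) w(1)] by (simp only: E_def simp_thms)
 qed
 have power: "E (\<lambda>m. w m ^ l)" if "E w" for w and l :: nat
 proof (induction l)
  case 0
  then show ?case using const[of 1] by simp
 next
  case (Suc l)
  then show ?case using mult[OF that Suc] by (simp only: power_Suc)
 qed
 have choose: "E (\<lambda>m. m choose p ^ j)" if "j < e" for j
  using alg_weight_choose[OF that] eig[OF that] by (simp only: E_def simp_thms)
 have "E (projector_wt p k d)" if "d \<le> e" for d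
  using that
 proof (induction d)
  case 0
  then show ?case using const[of 1] by simp
 next
  case (Suc d)
  then have "E (projector_wt p k d)" "d < e" by auto
  then show ?case unfolding projector_wt.simps by (intro mult add power const choose)
 qed
 then have "E (projector_wt p k e)" by simp
 then show ?thesis by (simp only: E_def simp_thms)
qed

text \<open>If the images agree, an eigenvector for the digits of n coincides with its projection to
  the class of n, which \<open>ES_proj\<close> places in the zero coset. If they differ, a projected
  graph map satisfies the eigenvalue equations even before passing to the quotient, and its value at
  t^n keeps it out of the zero coset.\<close>

lemma bernstein_indices_iff:
 assumes i: "i \<in> {1..e} \<rightarrow>\<^sub>E {..<p}" and n: "n = (\<Sum>j<e. i (Suc j) * p ^ j)"
 shows "i \<in> bernstein_indices p e R M \<kappa> f \<longleftrightarrow> img e n \<noteq> img e (Suc n)"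
proof -
 have ip: "i (Suc j) < p" if "j < e" for j using i that by (auto simp: PiE_def Pi_iff)
 have np: "n < p ^ e" unfolding n using ip by (rule digits_sum(1))
 have dig: "n div p ^ j mod p = i (Suc j)" if "j < e" for j unfolding n using ip that by (rule digits_sum(2))
 have ch: "(n choose p ^ j) mod p = i (Suc j) mod p" if "j < e" for j
  using choose_prime_power_mod[OF prime_p, of n j] dig[OF that] ip[OF that] by simp
 have eig_iff: "\<lbrakk>\<psi>\<rbrakk> \<in> bernstein_eigenspace p e R M \<kappa> f i \<longleftrightarrow>
   (\<forall>j<e. \<lbrakk>\<psi> \<star> weight_op (\<lambda>m. m choose p ^ j)\<rbrakk> = \<lbrakk>\<psi> \<star> weight_op (\<lambda>_. n choose p ^ j)\<rbrakk>)"
  if \<psi>: "\<psi> \<in> ES (carrier M)" for \<psi>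
 proof -
  note \<psi>G = ES_carrier_mem[OF \<psi>]
  have "\<lbrakk>\<psi>\<rbrakk> \<in> carrier BQ" using \<psi> unfolding BQ_simps by blast
  moreover have "(\<forall>j \<in> {1..e}. Q j) \<longleftrightarrow> (\<forall>j<e. Q (Suc j))" for Q
   unfolding image_Suc_lessThan[symmetric] by auto
  ultimately have e1: "\<lbrakk>\<psi>\<rbrakk> \<in> bernstein_eigenspace p e R M \<kappa> f i \<longleftrightarrow>
    (\<forall>j<e. bernstein_action p e R M \<kappa> f (euler_op R (p ^ j)) \<lbrakk>\<psi>\<rbrakk> = \<lbrakk>\<psi>\<rbrakk> [^]\<^bsub>BQ\<^esub> i (Suc j))"
   unfolding bernstein_eigenspace_def mem_Collect_eq by (simp only: simp_thms diff_Suc_1)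
  have e2: "bernstein_action p e R M \<kappa> f (euler_op R (p ^ j)) \<lbrakk>\<psi>\<rbrakk> = \<lbrakk>\<psi> \<star> weight_op (\<lambda>m. m choose p ^ j)\<rbrakk>" if "j < e" for j
   unfolding euler_operator by (rule action_coset[OF \<psi>G weight_Alg[OF alg_weight_choose[OF that]]])
  have e3: "\<lbrakk>\<psi>\<rbrakk> [^]\<^bsub>BQ\<^esub> i (Suc j) = \<lbrakk>\<psi> \<star> weight_op (\<lambda>_. n choose p ^ j)\<rbrakk>" if "j < e" for j
   unfolding coset_pow[OF \<psi>G] using weight_cong[of "\<lambda>_. n choose p ^ j" "\<lambda>_. i (Suc j)"] ch[OF that] by simp
  show ?thesis unfolding e1 by (simp only: e2 e3 cong: imp_cong)
 qed
 have one: "\<lbrakk>\<one>\<^bsub>G\<^esub>\<rbrakk> = ES fM"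
  by (rule GG.coset_join2[OF GG.one_closed N_subgroup subgroup.one_closed[OF N_subgroup]])
 have "bernstein_eigenspace p e R M \<kappa> f i = {ES fM}" if eq: "img e n = img e (Suc n)"
 proof (intro equalityI subsetI)
  fix Y assume Y: "Y \<in> bernstein_eigenspace p e R M \<kappa> f i"
  then have "Y \<in> carrier BQ" unfolding bernstein_eigenspace_def by blast
  then obtain \<psi> where \<psi>: "\<psi> \<in> ES (carrier M)" "Y = \<lbrakk>\<psi>\<rbrakk>" unfolding BQ_simps by blast
  note \<psi>G = ES_carrier_mem[OF \<psi>(1)]
  have "\<lbrakk>\<psi> \<star> proj n\<rbrakk> = \<lbrakk>\<psi> \<star> weight_op (\<lambda>_. projector_wt p n e n)\<rbrakk>"
   using Y unfolding \<psi>(2) eig_iff[OF \<psi>(1)] by (intro eigenvector_weight[OF \<psi>G]) blast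
  also have "weight_op (\<lambda>_. projector_wt p n e n) = weight_op (\<lambda>_. 1)"
   by (rule weight_cong) (use projector_wt_mod[OF prime_p, of n e n] p_gt_1 in simp)
  also have "\<psi> \<star> weight_op (\<lambda>_. 1) = \<psi>" by (rule weight_act_one[OF \<psi>G])
  finally have "Y = \<lbrakk>\<psi> \<star> proj n\<rbrakk>" unfolding \<psi>(2) by (rule sym)
  also have "\<dots> = ES fM"
   by (rule GG.coset_join2[OF act_mem[OF \<psi>G weight_Alg[OF proj_weight]] N_subgroup ES_proj[OF np eq \<psi>(1)]])
  finally show "Y \<in> {ES fM}" by (simp only: singleton_iff)
 next
  fix Y assume "Y \<in> {ES fM}"
  then have Y: "Y = \<lbrakk>\<one>\<^bsub>G\<^esub>\<rbrakk>" unfolding one by (rule singletonD)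
  have "\<one>\<^bsub>G\<^esub> \<in> ES (carrier M)" by (rule subgroup.one_closed[OF ES_subgroup[OF subset_refl]])
  note o = eig_iff[OF this]
  have "\<lbrakk>\<one>\<^bsub>G\<^esub> \<star> weight_op (\<lambda>m. m choose p ^ j)\<rbrakk> = \<lbrakk>\<one>\<^bsub>G\<^esub> \<star> weight_op (\<lambda>_. n choose p ^ j)\<rbrakk>" if "j < e" for j
   unfolding act_one[OF weight_Alg[OF alg_weight_choose[OF that]]] act_one[OF weight_Alg[OF alg_weight_const]] ..
  then show "Y \<in> bernstein_eigenspace p e R M \<kappa> f i" unfolding Y o by blast
 qed
 moreover have "bernstein_eigenspace p e R M \<kappa> f i \<noteq> {ES fM}" if ne: "img e n \<noteq> img e (Suc n)"
 proof -
  have "img e (Suc n) \<subseteq> img e n" by (rule img_antimono) simp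
  then obtain y where y: "y \<in> img e n" "y \<notin> img e (Suc n)" using ne by auto
  then obtain m where m: "m \<in> carrier M" "(\<kappa> ^^ e) (f [^] n *[M] m) \<notin> img e (Suc n)" unfolding img_def by auto
  define \<psi> where "\<psi> = phi m \<star> proj n"
  have \<psi>: "\<psi> \<in> ES (carrier M)" unfolding \<psi>_def by (rule ES_base[OF m(1) weight_Alg[OF proj_weight]])
  note \<psi>G = ES_carrier_mem[OF \<psi>]
  \<comment> \<open>The map \<psi> vanishes on exponents not congruent to n modulo p^e, and on the
    others the binomials with j < e are constant modulo p.\<close>
  have "\<psi> \<star> weight_op (\<lambda>m. m choose p ^ j) = \<psi> \<star> weight_op (\<lambda>_. n choose p ^ j)" if j: "j < e" for j
  proof (rule G_eqI)
   note C = alg_weight_choose[OF j] and K = alg_weight_const[of e "n choose p ^ j"]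
   show "\<psi> \<star> weight_op (\<lambda>m. m choose p ^ j) \<in> carrier G" by (rule act_mem[OF \<psi>G weight_Alg[OF C]])
   show "\<psi> \<star> weight_op (\<lambda>_. n choose p ^ j) \<in> carrier G" by (rule act_mem[OF \<psi>G weight_Alg[OF K]])
   fix r k assume r: "r \<in> carrier R"
   have "[(k choose p ^ j)] \<cdot> r = [(n choose p ^ j)] \<cdot> r" if "k mod p ^ e = n"
   proof (rule add_pow_mod[OF r])
    have "k = n + (k div p ^ e) * p ^ e" using that div_mult_mod_eq[of k "p ^ e"] by simp
    then show "(k choose p ^ j) mod p = (n choose p ^ j) mod p"
     using periodic_choose[OF j] unfolding periodic_def by metis
   qed
   then show "(\<psi> \<star> weight_op (\<lambda>m. m choose p ^ j)) (pmonom r k) = (\<psi> \<star> weight_op (\<lambda>_. n choose p ^ j)) (pmonom r k)"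
    unfolding \<psi>_def weight_op_def[of "\<lambda>m. m choose p ^ j"] weight_op_def[of "\<lambda>_. n choose p ^ j"]
     phi_proj_value[OF np weight_admissible[OF C] r] phi_proj_value[OF np weight_admissible[OF K] r]
    by (cases "k mod p ^ e = n") simp_all
  qed
  then have "\<lbrakk>\<psi>\<rbrakk> \<in> bernstein_eigenspace p e R M \<kappa> f i" unfolding eig_iff[OF \<psi>] by simp
  moreover have "\<lbrakk>\<psi>\<rbrakk> \<noteq> ES fM"
  proof
   assume "\<lbrakk>\<psi>\<rbrakk> = ES fM"
   then have "\<psi> \<in> ES fM" by (rule GG.coset_join1[OF _ \<psi>G N_subgroup])
   then have "\<psi> (pmonom \<one> n) \<in> img e (Suc n)" by (rule ES_monom) simp
   moreover have "\<psi> (pmonom \<one> n) = (\<kappa> ^^ e) (f [^] n *[M] m)"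
   proof -
    have a: "admissible e (\<lambda>_ r. r)" by (simp add: admissible_def)
    have "\<psi> = (phi m \<star> proj n) \<star> coeff_op (\<lambda>_ r. r)"
     using identity_act[OF \<psi>G] unfolding \<psi>_def by (rule sym)
    then have "\<psi> (pmonom \<one> n) = ((phi m \<star> proj n) \<star> coeff_op (\<lambda>_ r. r)) (pmonom \<one> n)" by (rule arg_cong)
    then show ?thesis unfolding phi_proj_value[OF np a one_closed] using np by simp
   qed
   ultimately show False using m(2) by simp
  qed
  ultimately show ?thesis by blast
 qed
 ultimately show ?thesis using i unfolding bernstein_indices_def BQ_simps by blast
qed

end

section \<open>Localizations of algebras of finite type\<close>

lemma (in ring_hom_ring) image_subring: "subring (h ` carrier R) S"
proof (rule S.subringI)
 show "h ` carrier R \<subseteq> carrier S" "\<one>\<^bsub>S\<^esub> \<in> h ` carrier R" by (auto intro!: image_eqI[of _ _ "\<one>\<^bsub>R\<^esub>"])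
 show "\<ominus>\<^bsub>S\<^esub> x \<in> h ` carrier R" if "x \<in> h ` carrier R" for x
  using that by (auto simp flip: hom_a_inv)
 show "x **[S] y \<in> h ` carrier R" if "x \<in> h ` carrier R" "y \<in> h ` carrier R" for x y
  using that by (auto simp flip: hom_mult)
 show "x +[S] y \<in> h ` carrier R" if "x \<in> h ` carrier R" "y \<in> h ` carrier R" for x y
  using that by (auto simp flip: hom_add)
qed

text \<open>Write R as a localization of an algebra B of finite type. Then F is the image of K, the
  list consists of the images of the algebra generators, L is the image of generators of K over its
  p-th powers, and the images of the denominators are the polynomials that are units.\<close>

lemma frobenius_gauge_exists:
 fixes K :: "('k, 'l) ring_scheme" and R :: "('a, 'm) ring_scheme"
 assumes p: "Factorial_Ring.prime p" and K: "field K" "has_char K p" "F_finite p K"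
  and R: "regular_ring R" and eft: "essentially_finite_type K R \<phi>"
 shows "\<exists>F xs L. frobenius_gauge R p F xs L"
proof -
 interpret K: field K by (rule K(1))
 interpret R: cring R using R by (simp add: regular_ring_def)
 obtain B :: "'a ring" and \<psi> S h X where \<phi>: "\<phi> \<in> ring_hom K R" and cB: "cring B" and \<psi>: "\<psi> \<in> ring_hom K B"
  and X: "X \<subseteq> carrier B" "finite X" "generate_ring B (\<psi> ` carrier K \<union> X) = carrier B"
  and S: "submonoid S B" and h: "h \<in> ring_iso (localize_ring B S) R"
  and h\<phi>: "\<And>k. k \<in> carrier K ==> h (rfrac B S (\<psi> k) \<one>\<^bsub>B\<^esub>) = \<phi> k"
  using eft unfolding essentially_finite_type_def finite_type_def by auto
 interpret B: cring B by (rule cB)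
 interpret S: submonoid S B by (rule S)
 interpret \<phi>: ring_hom_ring K R \<phi> by (rule ring_hom_ringI2[OF K.ring_axioms R.ring_axioms \<phi>])
 note ops = B.localize_ring_ops[OF S]
 have Sc: "s \<in> carrier B" if "s \<in> S" for s using that S.subset by auto
 define \<beta> where "\<beta> b = h (rfrac B S b \<one>\<^bsub>B\<^esub>)" for b
 have hm: "h (x \<otimes>\<^bsub>localize_ring B S\<^esub> y) = h x **[R] h y" "h (x \<oplus>\<^bsub>localize_ring B S\<^esub> y) = h x +[R] h y" 
  if "x \<in> carrier (localize_ring B S)" "y \<in> carrier (localize_ring B S)" for x y
  using h that by (auto simp: ring_iso_def ring_hom_def)
 have hc: "h x \<in> carrier R" if "x \<in> carrier (localize_ring B S)" for x
  using h that by (auto simp: ring_iso_def ring_hom_def)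
 have h1: "h \<one>\<^bsub>localize_ring B S\<^esub> = \<one>\<^bsub>R\<^esub>" using h by (auto simp: ring_iso_def ring_hom_def)
 have frac: "rfrac B S b s \<in> carrier (localize_ring B S)" if "b \<in> carrier B" "s \<in> S" for b s
  using that unfolding ops(1) by auto
 have \<beta>: "\<beta> \<in> ring_hom B R"
 proof (rule ring_hom_memI)
  show "\<beta> x \<in> carrier R" if "x \<in> carrier B" for x
   unfolding \<beta>_def using hc[OF frac] that by simp
  show "\<beta> (x **[B] y) = \<beta> x **[R] \<beta> y" if "x \<in> carrier B" "y \<in> carrier B" for x y
  proof -
   have "\<beta> x **[R] \<beta> y = h (rfrac B S x \<one>\<^bsub>B\<^esub> \<otimes>\<^bsub>localize_ring B S\<^esub> rfrac B S y \<one>\<^bsub>B\<^esub>)"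
    unfolding \<beta>_def using that by (simp add: hm(1) frac)
   then show ?thesis unfolding \<beta>_def using that by (simp add: ops(3-5))
  qed
  show "\<beta> (x +[B] y) = \<beta> x +[R] \<beta> y" if "x \<in> carrier B" "y \<in> carrier B" for x y
  proof -
   have "\<beta> x +[R] \<beta> y = h (rfrac B S x \<one>\<^bsub>B\<^esub> \<oplus>\<^bsub>localize_ring B S\<^esub> rfrac B S y \<one>\<^bsub>B\<^esub>)"
    unfolding \<beta>_def using that by (simp add: hm(2) frac)
   then show ?thesis unfolding \<beta>_def using that by (simp add: ops(3-5))
  qed
  show "\<beta> \<one>\<^bsub>B\<^esub> = \<one>\<^bsub>R\<^esub>" unfolding \<beta>_def using h1 by (simp add: ops(3-5))
 qed
 interpret \<beta>: ring_hom_ring B R \<beta> by (rule ring_hom_ringI2[OF B.ring_axioms R.ring_axioms \<beta>])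
 have clear: "\<beta> s **[R] h (rfrac B S b s) = \<beta> b" if b: "b \<in> carrier B" and s: "s \<in> S" for b s
 proof -
  have "\<beta> s **[R] h (rfrac B S b s) = h (rfrac B S s \<one>\<^bsub>B\<^esub> \<otimes>\<^bsub>localize_ring B S\<^esub> rfrac B S b s)"
   unfolding \<beta>_def using b s Sc[OF s] by (simp add: hm(1) frac)
  also have "\<dots> = h (rfrac B S (s **[B] b) (\<one>\<^bsub>B\<^esub> **[B] s))"
   using b s Sc[OF s] by (simp add: ops(5))
  also have "rfrac B S (s **[B] b) (\<one>\<^bsub>B\<^esub> **[B] s) = rfrac B S b \<one>\<^bsub>B\<^esub>"
   by (rule ops(6)) (use b s Sc[OF s] in \<open>auto simp: B.m_ac\<close>)
  finally show ?thesis by (simp add: \<beta>_def)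
 qed
 have unit: "\<beta> s \<in> Units R" if s: "s \<in> S" for s
 proof -
  let ?x = "h (rfrac B S \<one>\<^bsub>B\<^esub> s)"
  have 1: "\<beta> s **[R] ?x = \<one>\<^bsub>R\<^esub>" using clear[OF B.one_closed s] by simp
  have x: "?x \<in> carrier R" by (rule hc[OF frac[OF B.one_closed s]])
  have b: "\<beta> s \<in> carrier R" using Sc[OF s] by simp
  have 2: "?x **[R] \<beta> s = \<one>\<^bsub>R\<^esub>" using 1 R.m_comm[OF b x] by simp
  show ?thesis unfolding Units_def using 1 2 x b by blast
 qed
 define F where "F = \<phi> ` carrier K"
 have F: "subring F R" unfolding F_def by (rule \<phi>.image_subring)
 have \<beta>\<psi>: "\<beta> (\<psi> k) = \<phi> k" if "k \<in> carrier K" for k using h\<phi>[OF that] by (simp add: \<beta>_def)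
 obtain xs where xs: "set xs = \<beta> ` X" using finite_list[OF finite_imageI[OF X(2), of \<beta>]] by (rule exE)
 have xsR: "set xs \<subseteq> carrier R" unfolding xs using X(1) by auto
 interpret G: ring_gauge R F xs by (intro ring_gauge.intro R.is_cring ring_gauge_axioms.intro F xsR)
 have poly: "\<beta> b \<in> G.polys" if "b \<in> carrier B" for b
 proof -
  have H: "\<psi> ` carrier K \<union> X \<subseteq> carrier B" using X(1) ring_hom_closed[OF \<psi>] by auto
  have "b \<in> generate_ring B (\<psi> ` carrier K \<union> X)" using that X(3) by simp
  then have "b \<in> carrier B \<and> \<beta> b \<in> G.polys"
  proof induction
   case one
   then show ?case using G.F_polys[OF subringE(3)[OF F]] by simp
  next
   case (incl b)
   then show ?case
   proof
    assume "b \<in> \<psi> ` carrier K"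
    then show ?thesis using G.F_polys \<beta>\<psi> ring_hom_closed[OF \<psi>] by (auto simp: F_def)
   next
    assume "b \<in> X"
    then show ?thesis using G.gen_polys[of "\<beta> b"] xs X(1) by auto
   qed
  next
   case (a_inv b)
   then show ?case using G.polys_minus by simp
  next
   case (eng_add a b)
   then show ?case using G.polys_add by simp
  next
   case (eng_mult a b)
   then show ?case using G.polys_mult by simp
  qed
  then show ?thesis ..
 qed
 have pK: "[p] \<cdot>\<^bsub>K\<^esub> \<one>\<^bsub>K\<^esub> = \<zero>\<^bsub>K\<^esub>" using K(2) by (simp add: has_char_def)
 then have pR: "[p] \<cdot>\<^bsub>R\<^esub> \<one>\<^bsub>R\<^esub> = \<zero>\<^bsub>R\<^esub>"
  using hom_nat_multiple[OF \<phi> K.ring_axioms R.ring_axioms, of p] by simp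
 interpret KC: cring_char K p by (intro cring_char.intro K.is_cring cring_char_axioms.intro p pK)
 interpret V: module K "frobenius_push p 1 K (self_module K)"
  by (rule KC.frobenius_push_module[OF K.self_module])
 obtain Z where Z: "Z \<subseteq> carrier K" "finite Z" "span_over (frobenius_push p 1 K (self_module K)) (carrier K) Z = carrier K"
  using K(3) unfolding F_finite_def V.finitely_generated_iff by auto
 have noeth: "noetherian_char R p"
  using R by (intro noetherian_char.intro noetherian_cring.intro cring_char.intro cring_char_axioms.intro R.is_cring p pR)
   (simp_all add: regular_ring_def)
 have "frobenius_gauge R p F xs (\<phi> ` Z)"
 proof (intro frobenius_gauge.intro noeth G.ring_gauge_axioms frobenius_gauge_axioms.intro)
  fix a assume "a \<in> F" "a \<noteq> \<zero>\<^bsub>R\<^esub>"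
  then obtain k where k: "k \<in> carrier K" "a = \<phi> k" by (auto simp: F_def)
  then have "k \<noteq> \<zero>\<^bsub>K\<^esub>" using \<open>a \<noteq> \<zero>\<^bsub>R\<^esub>\<close> \<phi>.hom_zero by auto
  with k have u: "k \<in> Units K" using K.field_Units by simp
  have "\<phi> (inv\<^bsub>K\<^esub> k) **[R] \<phi> k = \<phi> (inv\<^bsub>K\<^esub> k **[K] k)"
   using k u by (simp only: \<phi>.hom_mult K.Units_inv_closed)
  also have "\<dots> = \<one>\<^bsub>R\<^esub>" unfolding K.Units_l_inv[OF u] by (rule \<phi>.hom_one)
  finally show "\<exists>b \<in> F. b **[R] a = \<one>\<^bsub>R\<^esub>" using u k by (auto simp: F_def)
 next
  show "finite (\<phi> ` Z)" "\<phi> ` Z \<subseteq> F" using Z by (auto simp: F_def)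
 next
  fix a assume "a \<in> F"
  then obtain k where k: "k \<in> carrier K" "a = \<phi> k" by (auto simp: F_def)
  have "k \<in> span_over (frobenius_push p 1 K (self_module K)) (carrier K) Z" using k Z(3) by simp
  then have "\<phi> k \<in> span_over (frobenius_push p 1 R (self_module R)) F (\<phi> ` Z)"
  proof induction
   case zero
   then show ?case using span_over.zero[of "frobenius_push p 1 R (self_module R)"] by simp
  next
   case (step b l c)
   have c: "c \<in> carrier K" using step(3) Z(3) by simp
   have "\<phi> b \<odot>\<^bsub>frobenius_push p 1 R (self_module R)\<^esub> \<phi> l \<oplus>\<^bsub>frobenius_push p 1 R (self_module R)\<^esub> \<phi> c
     \<in> span_over (frobenius_push p 1 R (self_module R)) F (\<phi> ` Z)"
    using step by (intro span_over.step) (auto simp: F_def)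
   moreover have "l \<in> carrier K" using step(2) Z(1) by auto
   ultimately show ?case using step(1) c by (simp add: \<phi>.hom_nat_pow)
  qed
  then show "a \<in> span_over (frobenius_push p 1 R (self_module R)) F (\<phi> ` Z)" using k by simp
 next
  fix r assume "r \<in> carrier R"
  then obtain x where x: "x \<in> carrier (localize_ring B S)" "r = h x"
   using h by (auto simp: ring_iso_def bij_betw_def)
  then obtain b s where bs: "b \<in> carrier B" "s \<in> S" "x = rfrac B S b s" unfolding ops(1) by auto
  show "\<exists>s \<in> Units R \<inter> G.polys. s **[R] r \<in> G.polys"
   using clear[OF bs(1,2)] unit[OF bs(2)] poly[OF bs(1)] poly[OF Sc[OF bs(2)]] x(2) bs(3)
   by (intro bexI[of _ "\<beta> s"]) auto
 qed
 then show ?thesis by blast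
qed

section \<open>Roots of the Bernstein-Sato polynomial\<close>

text \<open>The intervals of the jump criterion are open on the left and closed on the right,
  exactly like the sets on which the ceiling of l P is constant. So the ceiling minus 1 recovers
  n.\<close>

lemma ceiling_eq_Suc_iff:
 fixes l P :: rat
 assumes "0 < P"
 shows "of_nat n / P < l \<and> l \<le> of_nat (Suc n) / P \<longleftrightarrow> \<lceil>l * P\<rceil> = int n + 1"
 using assms by (simp add: ceiling_eq_iff pos_divide_less_eq pos_le_divide_eq add.commute)

text \<open>The digit i_e carries the largest weight 1/p and i_1 the smallest; over the denominator
  p^e the sum is the number whose lowest digit is i_1.\<close>

lemma digit_fraction:
 fixes i :: "nat \<Rightarrow> nat"
 assumes "0 < p"
 shows "(\<Sum>j = 1..e. of_nat (i j) / of_nat p ^ (e + 1 - j)) = (of_nat (\<Sum>j<e. i (Suc j) * p ^ j) / of_nat p ^ e :: rat)"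
proof -
 have "(\<Sum>j = 1..e. of_nat (i j) / of_nat p ^ (e + 1 - j)) = (\<Sum>j<e. of_nat (i (Suc j)) / of_nat p ^ (e - j) :: rat)"
  unfolding image_Suc_lessThan[symmetric] by (subst sum.reindex) auto
 also have "\<dots> = (\<Sum>j<e. of_nat (i (Suc j)) * of_nat p ^ j / of_nat p ^ e)"
 proof (rule sum.cong[OF refl])
  fix j assume "j \<in> {..<e}"
  then have "e = j + (e - j)" by simp
  then have "(of_nat p :: rat) ^ e = of_nat p ^ j * of_nat p ^ (e - j)" by (metis power_add)
  then show "of_nat (i (Suc j)) / of_nat p ^ (e - j) = (of_nat (i (Suc j)) * of_nat p ^ j / of_nat p ^ e :: rat)"
   using assms by simp
 qed
 finally show ?thesis by (simp add: sum_divide_distrib)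
qed

theorem corollary3p9:
  fixes p :: nat
    and K :: "('k, 'l) ring_scheme"
    and R :: "('a, 'm) ring_scheme"
    and \<phi> :: "'k \<Rightarrow> 'a"
    and M :: "('a, 'b, 'n) module_scheme"
    and \<kappa> :: "'b \<Rightarrow> 'b"
    and f :: 'a
  assumes "Factorial_Ring.prime p"
    and "field K" and "has_char K p" and "F_finite p K"
    and "regular_ring R" and "essentially_finite_type K R \<phi>"
    and "cartier_module p R M \<kappa>" and "F_regular p R M \<kappa>"
    and "regular_element R M f"
  shows "\<exists>e\<^sub>0. \<forall>e \<ge> e\<^sub>0.
    {x :: rat. poly (bernstein_sato p e R M \<kappa> f) x = 0} =
    {(of_int \<lceil>l * of_nat p ^ e\<rceil> - 1) / of_nat p ^ e | l :: rat.
       F_jumping_number p R M \<kappa> f l \<and> 0 < l \<and> l \<le> 1}"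
proof -
 obtain F xs L where g: "frobenius_gauge R p F xs L"
  using frobenius_gauge_exists[OF assms(1-6)] by auto
 interpret FG: frobenius_gauge R p F xs L by (rule g)
 have lin: "linear_map R (frobenius_push p 1 R M) M \<kappa>" and mod: "module R M" and fgM: "finitely_generated R M"
  using assms(7) by (simp_all add: cartier_module_def)
 have C: "cartier R M p \<kappa>"
  using lin by (intro cartier.intro cartier_axioms.intro mod FG.noetherian_char_axioms fgM) (auto simp: linear_map_def)
 have GC: "gauged_cartier R M p \<kappa> F xs L" by (intro gauged_cartier.intro C g)
 obtain Y c where Y: "finite Y" "Y \<subseteq> carrier M" "span_over M (carrier R) Y = carrier M"
   "\<forall>n. \<kappa> ` module_gauge.D R M F xs Y n \<subseteq> module_gauge.D R M F xs Y (n div p + c)"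
  using gauged_cartier.gauge_exists[OF GC] by (elim exE conjE)
 have GA: "gauge R M p \<kappa> F xs L Y c"
  using Y(4) by (intro gauge.intro GC gauge_axioms.intro Y(1-3)) auto
 have FC: "F_regular_cartier R M p \<kappa> f"
  by (intro F_regular_cartier.intro C F_regular_cartier_axioms.intro gauge.F_regular_minimal[OF GA assms(8)] assms(9))
 interpret FRG: F_regular_gauge R M p \<kappa> f F xs L Y c by (intro F_regular_gauge.intro FC GA)
 have "{x :: rat. poly (bernstein_sato p e R M \<kappa> f) x = 0} =
  {(of_int \<lceil>l * of_nat p ^ e\<rceil> - 1) / of_nat p ^ e | l :: rat. F_jumping_number p R M \<kappa> f l \<and> 0 < l \<and> l \<le> 1}"
  (is "?A = ?B") for e
 proof -
  interpret B: bernstein R M p \<kappa> f e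
   by (intro bernstein.intro FC bernstein_axioms.intro FG.regular_frob_rank[OF assms(5) FG.gauge_F_fin])
  let ?I = "bernstein_indices p e R M \<kappa> f"
  let ?n = "\<lambda>i :: nat \<Rightarrow> nat. \<Sum>j<e. i (Suc j) * p ^ j"
  have p0: "0 < p" by (rule FG.p_pos)
  have P: "0 < (of_nat p :: rat) ^ e" using p0 by (intro zero_less_power) (simp only: of_nat_0_less_iff)
  have "finite ?I"
   by (rule finite_subset[of _ "{1..e} \<rightarrow>\<^sub>E {..<p}"]) (auto simp: bernstein_indices_def intro: finite_PiE)
  then have roots: "poly (bernstein_sato p e R M \<kappa> f) x = 0 \<longleftrightarrow> (\<exists>i \<in> ?I. x = of_nat (?n i) / of_nat p ^ e)" for x
   unfolding bernstein_sato_def poly_prod digit_fraction[OF p0] by (auto simp: prod_zero_iff)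
  show ?thesis
  proof (intro equalityI subsetI)
   fix x assume "x \<in> ?A"
   then obtain i where i: "i \<in> ?I" "x = of_nat (?n i) / of_nat p ^ e" using roots by auto
   have iE: "i \<in> {1..e} \<rightarrow>\<^sub>E {..<p}" using i(1) by (simp add: bernstein_indices_def)
   then have n: "?n i < p ^ e" by (intro digits_sum(1)) (auto simp: PiE_def Pi_iff)
   have "FRG.img e (?n i) \<noteq> FRG.img e (Suc (?n i))" using B.bernstein_indices_iff[OF iE refl] i(1) by simp
   then obtain l where l: "F_jumping_number p R M \<kappa> f l" "of_nat (?n i) / of_nat p ^ e < l"
     "l \<le> of_nat (Suc (?n i)) / of_nat p ^ e" "\<lceil>l * of_nat p ^ e\<rceil> = int (?n i) + 1"
    unfolding FRG.img_neq_iff_jumping_number[OF FRG.finite_tau n] using ceiling_eq_Suc_iff[OF P, of "?n i"] by blast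
   have "of_nat (Suc (?n i)) \<le> (of_nat (p ^ e) :: rat)" using n by (simp only: of_nat_le_iff Suc_le_eq)
   then have "of_nat (Suc (?n i)) / of_nat p ^ e \<le> (1 :: rat)" using P by (simp only: pos_divide_le_eq mult_1 of_nat_power)
   then have "l \<le> 1" using l(3) by (rule order_trans[rotated])
   moreover have "0 < l" using l(1) by (simp add: F_jumping_number_def)
   moreover have "x = (of_int \<lceil>l * of_nat p ^ e\<rceil> - 1) / of_nat p ^ e" unfolding l(4) i(2) by simp
   ultimately show "x \<in> ?B" using l(1) by blast
  next
   fix x assume "x \<in> ?B"
   then obtain l where l: "F_jumping_number p R M \<kappa> f l" "0 < l" "l \<le> 1"
     "x = (of_int \<lceil>l * of_nat p ^ e\<rceil> - 1) / of_nat p ^ e" by auto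
   \<comment> \<open>Since l p^e is positive, its ceiling is at least 1 and the conversion to a
     natural number is faithful.\<close>
   define n where "n = nat (\<lceil>l * of_nat p ^ e\<rceil> - 1)"
   have "0 < l * of_nat p ^ e" using l(2) P by (rule mult_pos_pos)
   then have "0 < \<lceil>l * of_nat p ^ e\<rceil>" by (simp only: zero_less_ceiling)
   then have c: "\<lceil>l * of_nat p ^ e\<rceil> = int n + 1" by (simp add: n_def)
   have "l * of_nat p ^ e \<le> 1 * of_nat p ^ e" using l(3) P by (intro mult_right_mono) auto
   then have "l * of_nat p ^ e \<le> of_int (int (p ^ e))" by simp
   then have "\<lceil>l * of_nat p ^ e\<rceil> \<le> int (p ^ e)" by (simp only: ceiling_le_iff)
   then have n: "n < p ^ e" using c by linarith
   have ne: "FRG.img e n \<noteq> FRG.img e (Suc n)"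
    unfolding FRG.img_neq_iff_jumping_number[OF FRG.finite_tau n] using ceiling_eq_Suc_iff[OF P, of n l] c l(1) by blast
   define i where "i = (\<lambda>j \<in> {1..e}. n div p ^ (j - 1) mod p)"
   have iE: "i \<in> {1..e} \<rightarrow>\<^sub>E {..<p}" using p0 by (simp add: i_def)
   have "?n i = (\<Sum>j<e. (n div p ^ j mod p) * p ^ j)" by (rule sum.cong[OF refl]) (simp add: i_def)
   also have "\<dots> = n" using sum_digits[OF p0, of n e] n by simp
   finally have ni: "?n i = n" .
   have "i \<in> ?I" using B.bernstein_indices_iff[OF iE ni[symmetric]] ne by simp
   moreover have "x = of_nat (?n i) / of_nat p ^ e" unfolding l(4) c ni by simp
   ultimately show "x \<in> ?A" using roots by auto
  qed
 qed
 \<comment> \<open>The equality of the two sets has been shown for every \<open>e\<close>, hence the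
   witness 0.\<close>
 then show ?thesis by (intro exI[of _ 0]) simp
qed

end
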